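(* Let $b,c_2,\rho\in L^\infty(Q)$ and let $d_1,d_2,c_1$ be measurable on $Q$. Assume there is a constant $K>0$ such that for all $(x,t)\in Q$ $$|d_1(x,t)|\leq K\sqrt{a(x)},\quad |c_1(x,t)|\leq K\sqrt{a(x)},\quad |a_x(x)|\leq K\sqrt{a(x)},\quad |d_2(x,t)|\leq K a(x).$$ There exists a constant $\lambda_0>0$ such that for each $\lambda>\lambda_0$ there are constants $s_0(\lambda)>0$ and $C>0$ such that, with $\varphi(t)=e^{\lambda t}$, $$\begin{aligned} &\int_{Q}\left(\frac{1}{a(x)}| u_{t}|^2+ a(x)| u_{xx}|^2+ s\lambda \varphi | u_{x}|^2+ \frac{s^2\lambda^2\varphi^2}{a(x)}| u|^2\right)e^{2s\varphi}\,dx\,dt\\ &+\int_{Q}\frac{1}{s\varphi}\left(a(x)| (am)_{xx}|^2+a(x)| m_{t}|^2 \right)e^{2s\varphi}\,dx\, dt+\int_{Q} \lambda | (am)_{x}|^2 e^{2s\varphi}\, dx\, dt+\int_{Q} s\lambda^2 \varphi\, a(x)| m|^2 e^{2s\varphi}\, dx\,dt\\ &\leq C \int_{Q}s\varphi\frac{1}{a(x)}| F|^2e^{2s\varphi}\, dx\,dt+C \int_{Q}a(x)| G|^2e^{2s\varphi}\, dx\,dt \\ &\quad+ Cs\left( s\lambda\varphi(T)\| u(\cdot,T)\|_{\frac{1}{a}}^2+\| u(\cdot,T)\|_{1,\frac{1}{a}}^2 \right)e^{2s\varphi(T)} +Cs\left( s\lambda\| u(\cdot,0)\|_{\frac{1}{a}}^2+\|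 u(\cdot,0)\|_{1,\frac{1}{a}}^2\right)e^{2s}\\ &\quad +C \left(s\lambda \varphi(T)\| m(\cdot,T)\|_{a}^2+\| m(\cdot,T)\|_{1,a}^2\right)e^{2s\varphi(T)}+C\left( s\lambda \| m(\cdot,0)\|_{a}^2 +\| m(\cdot,0)\|_{1,a}^2\right)e^{2s} \end{aligned}$$ for all $s\geq s_0(\lambda)$ and all pairs $(u,m)$ with $u\in H^1(0,T;L^2_{\frac1a}(0,1))\cap L^2(0,T;H^2_{\frac1a}(0,1))$ and $m\in H^1(0,T;L^2_a(0,1))\cap L^2(0,T;H_{2,a}(0,1))$ satisfying the linearized mean-field game system $$\begin{cases} u_t+a(x)u_{xx}+d_1(x,t)u_x=d_2(x,t)m+F & \text{in }Q,\\ m_t-(a(x)m)_{xx}+c_1(x,t)m_x=b(x,t)m+c_2(x,t)u_x+\rho(x,t)u_{xx}+G & \text{in }Q,\\ u=am=0 & \text{on }\Sigma,\\ m(\cdot,0)=m_0,\quad u(\cdot,T)=h & \text{in }(0,1). \end{cases}$$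
   Context: Let $T>0$, $Q=(0,1)\times(0,T)$, $\Sigma=\{0,1\}\times(0,T)$. The coefficient $a$ satisfies $a\in C([0,1])\cap C^1(0,1)$, $a(x)>0$ for $x\in(0,1)$ and $a(0)=a(1)=0$. All functions are real-valued. The constants $\lambda_0,s_0(\lambda),C$ do not depend on $u,m,F,G,m_0,h$, and $C$ does not depend on $s$. Weighted spaces: $L^2_{\frac1a}(0,1)=\{u\in L^2(0,1): \|u\|_{\frac1a}<\infty\}$ with $\|u\|_{\frac1a}^2=\int_0^1 \frac{u^2}{a}\,dx$; $H^1_{\frac1a}(0,1)=L^2_{\frac1a}(0,1)\cap H^1_0(0,1)$ with $\|u\|_{1,\frac1a}^2=\|u\|_{\frac1a}^2+\|u_x\|_{L^2(0,1)}^2$; $H^2_{\frac1a}(0,1)=\{u\in H^1_{\frac1a}(0,1): a u_{xx}\in L^2_{\frac1a}(0,1)\}$ with $\|u\|_{2,\frac1a}^2=\|u\|_{1,\frac1a}^2+\int_0^1 a\,u_{xx}^2\,dx$. $L^2_a(0,1)=\{u \text{ measurable}: \|u\|_a<\infty\}$ with $\|u\|_a^2=\int_0^1 a u^2\,dx$; $H_{1,a}(0,1)=\{u\in L^2_a(0,1): \int_0^1|(au)_x|^2dx<\infty,\ (au)(0)=(au)(1)=0\}$ with $\|u\|_{1,a}^2=\|u\|_a^2+\int_0^1|(au)_x|^2dx$; $H_{2,a}(0,1)=\{u\in H_{1,a}(0,1): (au)_{xx}\in L^2_a(0,1)\}$ with $\|u\|_{2,a}^2=\|u\|_{1,a}^2+\int_0^1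 a|(au)_{xx}|^2dx$. *)

theory Defs
  imports "HOL-Analysis.Analysis"
begin

text \<open>
  Functions on \<open>(0,1)\<close> and on \<open>Q\<close> are total functions whose values outside the respective open
  set are irrelevant; elements of the function spaces are Lebesgue measurable representatives.
  Squared norms take values in the extended nonnegative reals.
\<close>

abbreviation Omega :: "real set" where
  "Omega \<equiv> {0<..<1}"

abbreviation Q :: "real \<Rightarrow> (real \<times> real) set" where
  "Q T \<equiv> {0<..<1} \<times> {0<..<T}"

definition L_infty :: "real \<Rightarrow> (real \<times> real \<Rightarrow> real) set" where
  "L_infty T = {f \<in> borel_measurable (lebesgue_on (Q T)).
     \<exists>M. AE z in lebesgue_on (Q T). \<bar>f z\<bar> \<le> M}"


section \<open>Weak derivatives in one variable\<close>

definition test_fun :: "real set \<Rightarrow> (real \<Rightarrow> real) \<Rightarrow> bool" where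
  "test_fun S \<phi> \<longleftrightarrow> (\<forall>n. (deriv ^^ n) \<phi> differentiable_on UNIV) \<and>
     (\<exists>K. compact K \<and> K \<subseteq> S \<and> (\<forall>x. x \<notin> K \<longrightarrow> \<phi> x = 0))"

definition locally_integrable :: "real set \<Rightarrow> (real \<Rightarrow> real) \<Rightarrow> bool" where
  "locally_integrable S f \<longleftrightarrow> (\<forall>K. compact K \<and> K \<subseteq> S \<longrightarrow> f absolutely_integrable_on K)"

definition has_weak_deriv :: "real set \<Rightarrow> (real \<Rightarrow> real) \<Rightarrow> (real \<Rightarrow> real) \<Rightarrow> bool" where
  "has_weak_deriv S f g \<longleftrightarrow> locally_integrable S f \<and> locally_integrable S g \<and>
     (\<forall>\<phi>. test_fun S \<phi> \<longrightarrow>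
        (LINT x|lebesgue_on S. f x * deriv \<phi> x) = - (LINT x|lebesgue_on S. g x * \<phi> x))"

text \<open>Some version of the weak derivative on \<open>(0,1)\<close>; all versions agree almost everywhere.\<close>

definition weak_deriv :: "(real \<Rightarrow> real) \<Rightarrow> real \<Rightarrow> real" where
  "weak_deriv f = (SOME g. has_weak_deriv Omega f g)"


section \<open>Weighted spaces on \<open>(0,1)\<close>\<close>

definition L2 :: "(real \<Rightarrow> real) set" where
  "L2 = {f \<in> borel_measurable (lebesgue_on Omega).
     (\<integral>\<^sup>+x. ennreal ((f x)\<^sup>2) \<partial>lebesgue_on Omega) < \<infinity>}"

text \<open>\<open>H\<^sup>1\<^sub>0(0,1)\<close> is the closure of the test functions in \<open>H\<^sup>1(0,1)\<close>.\<close>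

definition H1_0 :: "(real \<Rightarrow> real) set" where
  "H1_0 = {f \<in> L2. \<exists>g \<in> L2. has_weak_deriv Omega f g \<and>
     (\<exists>\<phi> :: nat \<Rightarrow> real \<Rightarrow> real. (\<forall>n. test_fun Omega (\<phi> n)) \<and>
        (\<lambda>n. \<integral>\<^sup>+x. ennreal ((\<phi> n x - f x)\<^sup>2) \<partial>lebesgue_on Omega) \<longlonglongrightarrow> 0 \<and>
        (\<lambda>n. \<integral>\<^sup>+x. ennreal ((deriv (\<phi> n) x - g x)\<^sup>2) \<partial>lebesgue_on Omega) \<longlonglongrightarrow> 0)}"

text \<open>Vanishing at \<open>0\<close> and \<open>1\<close> is a statement about the representative continuous on \<open>[0,1]\<close>.\<close>

definition vanishes_at_ends :: "(real \<Rightarrow> real) \<Rightarrow> bool" where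
  "vanishes_at_ends f \<longleftrightarrow> (\<exists>v. continuous_on {0..1} v \<and>
     (AE x in lebesgue_on Omega. v x = f x) \<and> v 0 = 0 \<and> v 1 = 0)"

text \<open>
  The suffixes \<open>_inv\<close> and \<open>_wt\<close> stand for the weights \<open>1/a\<close> and \<open>a\<close>. Norms of first and second
  order are extended by \<open>\<infinity>\<close> outside the space.
\<close>

definition nsq_inv :: "(real \<Rightarrow> real) \<Rightarrow> (real \<Rightarrow> real) \<Rightarrow> ennreal" where
  "nsq_inv a u = (\<integral>\<^sup>+x. ennreal ((u x)\<^sup>2 / a x) \<partial>lebesgue_on Omega)"

definition L2_inv :: "(real \<Rightarrow> real) \<Rightarrow> (real \<Rightarrow> real) set" where
  "L2_inv a = {u \<in> L2. nsq_inv a u < \<infinity>}"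

definition H1_inv :: "(real \<Rightarrow> real) \<Rightarrow> (real \<Rightarrow> real) set" where
  "H1_inv a = L2_inv a \<inter> H1_0"

definition nsq1_inv :: "(real \<Rightarrow> real) \<Rightarrow> (real \<Rightarrow> real) \<Rightarrow> ennreal" where
  "nsq1_inv a u = (if u \<in> H1_inv a
     then nsq_inv a u + (\<integral>\<^sup>+x. ennreal ((weak_deriv u x)\<^sup>2) \<partial>lebesgue_on Omega) else \<infinity>)"

definition H2_inv :: "(real \<Rightarrow> real) \<Rightarrow> (real \<Rightarrow> real) set" where
  "H2_inv a = {u \<in> H1_inv a. \<exists>ux uxx. has_weak_deriv Omega u ux \<and> has_weak_deriv Omega ux uxx \<and>
     (\<lambda>x. a x * uxx x) \<in> L2_inv a}"

definition nsq2_inv :: "(real \<Rightarrow> real) \<Rightarrow> (real \<Rightarrow> real) \<Rightarrow> ennreal" where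
  "nsq2_inv a u = (if u \<in> H2_inv a
     then nsq1_inv a u +
       (\<integral>\<^sup>+x. ennreal (a x * (weak_deriv (weak_deriv u) x)\<^sup>2) \<partial>lebesgue_on Omega) else \<infinity>)"

definition nsq_wt :: "(real \<Rightarrow> real) \<Rightarrow> (real \<Rightarrow> real) \<Rightarrow> ennreal" where
  "nsq_wt a u = (\<integral>\<^sup>+x. ennreal (a x * (u x)\<^sup>2) \<partial>lebesgue_on Omega)"

definition L2_wt :: "(real \<Rightarrow> real) \<Rightarrow> (real \<Rightarrow> real) set" where
  "L2_wt a = {u \<in> borel_measurable (lebesgue_on Omega). nsq_wt a u < \<infinity>}"

definition H1_wt :: "(real \<Rightarrow> real) \<Rightarrow> (real \<Rightarrow> real) set" where
  "H1_wt a = {u \<in> L2_wt a. (\<exists>w \<in> L2. has_weak_deriv Omega (\<lambda>x. a x * u x) w) \<and>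
     vanishes_at_ends (\<lambda>x. a x * u x)}"

definition nsq1_wt :: "(real \<Rightarrow> real) \<Rightarrow> (real \<Rightarrow> real) \<Rightarrow> ennreal" where
  "nsq1_wt a u = (if u \<in> H1_wt a
     then nsq_wt a u +
       (\<integral>\<^sup>+x. ennreal ((weak_deriv (\<lambda>x. a x * u x) x)\<^sup>2) \<partial>lebesgue_on Omega) else \<infinity>)"

definition H2_wt :: "(real \<Rightarrow> real) \<Rightarrow> (real \<Rightarrow> real) set" where
  "H2_wt a = {u \<in> H1_wt a. \<exists>w z. has_weak_deriv Omega (\<lambda>x. a x * u x) w \<and>
     has_weak_deriv Omega w z \<and> z \<in> L2_wt a}"

definition nsq2_wt :: "(real \<Rightarrow> real) \<Rightarrow> (real \<Rightarrow> real) \<Rightarrow> ennreal" where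
  "nsq2_wt a u = (if u \<in> H2_wt a
     then nsq1_wt a u +
       (\<integral>\<^sup>+x. ennreal (a x * (weak_deriv (weak_deriv (\<lambda>x. a x * u x)) x)\<^sup>2) \<partial>lebesgue_on Omega)
     else \<infinity>)"


section \<open>Bochner spaces on \<open>(0,T)\<close>\<close>

text \<open>
  A function \<open>u\<close> on \<open>Q\<close> is identified with \<open>t \<mapsto> u(\<cdot>,t)\<close>. Here \<open>X\<close> is a space of functions on
  \<open>(0,1)\<close> with squared norm \<open>N\<close>; strong measurability is almost everywhere approximation by
  functions of \<open>t\<close> taking finitely many values in \<open>X\<close>.
\<close>

definition strongly_measurable ::
  "real \<Rightarrow> (real \<Rightarrow> real) set \<Rightarrow> ((real \<Rightarrow> real) \<Rightarrow> ennreal) \<Rightarrow> (real \<times> real \<Rightarrow> real) \<Rightarrow> bool" where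
  "strongly_measurable T X N u \<longleftrightarrow> (\<exists>S :: nat \<Rightarrow> real \<Rightarrow> real \<Rightarrow> real.
     (\<forall>n. finite (S n ` {0<..<T}) \<and> S n ` {0<..<T} \<subseteq> X \<and>
        (\<forall>v. {t \<in> {0<..<T}. S n t = v} \<in> sets lebesgue)) \<and>
     (AE t in lebesgue_on {0<..<T}. (\<lambda>n. N (\<lambda>x. S n t x - u (x, t))) \<longlonglongrightarrow> 0))"

text \<open>
  Joint measurability only selects a representative: the slices of a strongly measurable function
  can be modified on null sets so that it holds, and it is needed to integrate over \<open>Q\<close>.
\<close>

definition Bochner_L2 ::
  "real \<Rightarrow> (real \<Rightarrow> real) set \<Rightarrow> ((real \<Rightarrow> real) \<Rightarrow> ennreal) \<Rightarrow> (real \<times> real \<Rightarrow> real) set" where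
  "Bochner_L2 T X N = {u \<in> borel_measurable (lebesgue_on (Q T)).
     strongly_measurable T X N u \<and>
     (AE t in lebesgue_on {0<..<T}. (\<lambda>x. u (x, t)) \<in> X) \<and>
     (\<integral>\<^sup>+t. N (\<lambda>x. u (x, t)) \<partial>lebesgue_on {0<..<T}) < \<infinity>}"

text \<open>
  The \<open>X\<close>-valued identity \<open>\<integral> \<phi>'(t) u(t) dt = - \<integral> \<phi>(t) v(t) dt\<close>, evaluated at almost every \<open>x\<close>: for
  the weighted \<open>L\<^sup>2\<close> spaces, Bochner integrals are computed pointwise almost everywhere.
\<close>

definition has_time_deriv :: "real \<Rightarrow> (real \<times> real \<Rightarrow> real) \<Rightarrow> (real \<times> real \<Rightarrow> real) \<Rightarrow> bool" where
  "has_time_deriv T u v \<longleftrightarrow> (\<forall>\<phi>. test_fun {0<..<T} \<phi> \<longrightarrow>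
     (AE x in lebesgue_on Omega.
        (LINT t|lebesgue_on {0<..<T}. u (x, t) * deriv \<phi> t) =
        - (LINT t|lebesgue_on {0<..<T}. v (x, t) * \<phi> t)))"

definition Bochner_H1 ::
  "real \<Rightarrow> (real \<Rightarrow> real) set \<Rightarrow> ((real \<Rightarrow> real) \<Rightarrow> ennreal) \<Rightarrow> (real \<times> real \<Rightarrow> real) set" where
  "Bochner_H1 T X N = {u \<in> Bochner_L2 T X N. \<exists>v \<in> Bochner_L2 T X N. has_time_deriv T u v}"

text \<open>
  \<open>v\<close> is the value \<open>u(\<cdot>,\<tau>)\<close> of the representative of \<open>u\<close> in \<open>C([0,T];X)\<close>; for \<open>u\<close> in
  \<open>H\<^sup>1(0,T;X)\<close> it exists and is unique up to null sets.
\<close>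

definition has_time_value ::
  "real \<Rightarrow> (real \<Rightarrow> real) set \<Rightarrow> ((real \<Rightarrow> real) \<Rightarrow> ennreal) \<Rightarrow>
   (real \<times> real \<Rightarrow> real) \<Rightarrow> real \<Rightarrow> (real \<Rightarrow> real) \<Rightarrow> bool" where
  "has_time_value T X N u \<tau> v \<longleftrightarrow> (\<exists>U :: real \<Rightarrow> real \<Rightarrow> real.
     (\<forall>t\<in>{0..T}. U t \<in> X) \<and>
     (\<forall>t\<^sub>0\<in>{0..T}. ((\<lambda>t. N (\<lambda>x. U t x - U t\<^sub>0 x)) \<longlongrightarrow> 0) (at t\<^sub>0 within {0..T})) \<and>
     (AE t in lebesgue_on {0<..<T}. AE x in lebesgue_on Omega. U t x = u (x, t)) \<and>
     (AE x in lebesgue_on Omega. v x = U \<tau> x))"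

text \<open>Jointly measurable versions of the weak derivative in \<open>x\<close>.\<close>

definition has_space_deriv :: "real \<Rightarrow> (real \<times> real \<Rightarrow> real) \<Rightarrow> (real \<times> real \<Rightarrow> real) \<Rightarrow> bool" where
  "has_space_deriv T f g \<longleftrightarrow> g \<in> borel_measurable (lebesgue_on (Q T)) \<and>
     (AE t in lebesgue_on {0<..<T}. has_weak_deriv Omega (\<lambda>x. f (x, t)) (\<lambda>x. g (x, t)))"

end

theory Submission imports Defs "HOL-Computational_Algebra.Polynomial"
begin

text \<open>
  For \<open>z = a m\<close> the second equation, multiplied by \<open>a\<close>, reads \<open>z\<^sub>t - a z\<^sub>x\<^sub>x = \<dots>\<close>, so the system couples a
  backward and a forward evolution equation in \<open>L\<^sup>2(dx/a)\<close> for the symmetric operator \<open>v \<mapsto> a v\<^sub>x\<^sub>x\<close>,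
  whose quadratic form is \<open>-\<integral> v\<^sub>x\<^sup>2 dx\<close>. The weight depends on time only. Hence, when the square of an
  equation is expanded against it, the cross terms are time derivatives of \<open>\<integral> v\<^sup>2 dx/a\<close> and of
  \<open>\<integral> v\<^sub>x\<^sup>2 dx\<close>; integrating by parts in time produces the bulk terms with their powers of \<open>s\<close> and
  \<open>\<lambda>\<close>, and boundary terms at \<open>0\<close> and \<open>T\<close>. By the bounds on the coefficients every coupling term is
  dominated pointwise by \<open>\<surd>a \<bar>u\<^sub>x\<bar>\<close>, \<open>\<surd>a \<bar>(a m)\<^sub>x\<bar>\<close>, \<open>a \<bar>m\<bar>\<close> and \<open>a \<bar>u\<^sub>x\<^sub>x\<bar>\<close>, and is absorbed for large \<open>\<lambda>\<close>.

  The integration by parts in time for \<open>\<integral> v\<^sub>x\<^sup>2 dx\<close> is only needed as an inequality. Convexity of this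
  functional bounds its difference quotients from one side by \<open>\<integral> v\<^sub>x\<^sub>x (v(t + k) - v(t)) dx\<close>, and
  letting \<open>k \<rightarrow> 0\<close> requires neither a time derivative of \<open>v\<^sub>x\<close> nor its continuity in time.
\<close>

section \<open>Smooth cut-off functions\<close>

text \<open>The identity behind \<open>has_time_deriv\<close> holds for each test function off a
  null set of x that depends on it. A statement for almost every x can therefore use only countably
  many test functions, and these must be explicit: smoothed trapezoids with rational parameters.
  Their limits yield the lemma of du Bois-Reymond, which for almost every x makes z(x, .) absolutely
  continuous, with values at every time, 0 and T included. In space the obstacle is the degeneracy:
  only a u_xx^2 is integrable, so u_x may have no limit at 0 and 1. The boundary products in Green's
  identity are made to vanish along suitable sequences. The powers of phi = e^(lam t) are forced by
  signs. Differentiating phi^n e^(2 s phi) gives a surplus n lam, which on the gradient has the good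
  sign in the backward equation and the bad one in the forward equation. Hence the first is weighted
  by s phi e^(2 s phi), the weight of F, and the second by e^(2 s phi); its gradient term comes from
  testing with z itself. Thresholds: lam above 6000 k^4, where k bounds all couplings, and s >=
  1.\<close>

definition flat_exp :: "real poly \<Rightarrow> real \<Rightarrow> real" where
  "flat_exp P t = (if t > 0 then poly P (1 / t) * exp (- 1 / t) else 0)"

lemma poly_over_exp_tendsto_0: "((\<lambda>s. poly P s * exp (- s)) \<longlongrightarrow> (0::real)) at_top"
proof -
  have "((\<lambda>s. \<Sum>i\<le>degree P. coeff P i * (s ^ i / exp s)) \<longlongrightarrow> (\<Sum>i\<le>degree P. coeff P i * 0)) at_top"
    by (intro tendsto_intros tendsto_power_div_exp_0)
  moreover have "(\<lambda>s. \<Sum>i\<le>degree P. coeff P i * (s ^ i / exp s)) = (\<lambda>s. poly P s * exp (- s))"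
    by (auto simp: poly_altdef sum_distrib_right exp_minus divide_inverse mult.assoc)
  ultimately show ?thesis by simp
qed

lemma flat_exp_tendsto_0: "(flat_exp P \<longlongrightarrow> 0) (at 0)"
proof -
  have "((\<lambda>t. poly P (inverse t) * exp (- inverse t)) \<longlongrightarrow> 0) (at_right 0)"
    by (rule filterlim_compose[OF poly_over_exp_tendsto_0 filterlim_inverse_at_top_right])
  then have "(flat_exp P \<longlongrightarrow> 0) (at_right 0)"
    by (rule Lim_transform_eventually)
      (auto simp: eventually_at_right_field flat_exp_def inverse_eq_divide intro!: exI[of _ 1])
  moreover have "(flat_exp P \<longlongrightarrow> 0) (at_left 0)"
    by (rule Lim_transform_eventually[of "\<lambda>_. 0"])
      (auto simp: eventually_at_left_field flat_exp_def intro!: exI[of _ "-1"])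
  ultimately show ?thesis
    by (simp add: filterlim_split_at)
qed

text \<open>With y = 1/t, the derivative of P(y) e^(-y) in t is y^2 (P - P')(y) e^(-y). The
  polynomial changes but the shape does not.\<close>

definition flat_exp_deriv :: "real poly \<Rightarrow> real poly" where
  "flat_exp_deriv P = monom 1 2 * (P - pderiv P)"

lemma has_real_derivative_flat_exp:
  "(flat_exp P has_real_derivative flat_exp (flat_exp_deriv P) x) (at x)"
proof -
  consider "x > 0" | "x < 0" | "x = 0" by linarith
  then show ?thesis
  proof cases
    case 1
    have "((\<lambda>t. poly P (1 / t) * exp (- 1 / t)) has_real_derivative flat_exp (flat_exp_deriv P) x) (at x)"
      using 1 by (auto intro!: derivative_eq_intros DERIV_chain2[OF poly_DERIV]
          simp: flat_exp_def flat_exp_deriv_def poly_monom power2_eq_square field_simps)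
    then show ?thesis
      by (rule has_field_derivative_transform_within[where d = x])
        (use 1 in \<open>auto simp: flat_exp_def dist_real_def\<close>)
  next
    case 2
    have "((\<lambda>t. 0) has_real_derivative flat_exp (flat_exp_deriv P) x) (at x)"
      using 2 by (auto simp: flat_exp_def)
    then show ?thesis
      by (rule has_field_derivative_transform_within[where d = "- x"])
        (use 2 in \<open>auto simp: flat_exp_def dist_real_def\<close>)
  next
    case 3
    \<comment> \<open>Dividing by h only multiplies the polynomial by one more power of 1/h, so the
      difference quotient at 0 is again a flat function and tends to 0.\<close>
    have "(\<lambda>h. (flat_exp P (0 + h) - flat_exp P 0) / h) = flat_exp (monom 1 1 * P)"
      by (rule ext) (auto simp: flat_exp_def poly_monom field_simps)
    then show ?thesis
      using flat_exp_tendsto_0[of "monom 1 1 * P"] 3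
      by (simp add: DERIV_def flat_exp_def)
  qed
qed

text \<open>Smoothness in \<open>test_fun\<close> means that every iterated derivative is
  differentiable. A class stable under differentiation supplies this by induction, without a formula
  for the n-th derivative.\<close>

lemma smooth_of_closed_under_deriv:
  fixes f :: "real \<Rightarrow> real"
  assumes closed: "\<And>f. f \<in> C \<Longrightarrow> \<exists>g\<in>C. \<forall>x. (f has_real_derivative g x) (at x)"
    and f: "f \<in> C"
  shows "(deriv ^^ n) f differentiable_on UNIV"
proof -
  have in_C: "deriv f \<in> C" if "f \<in> C" for f
  proof -
    obtain g where g: "g \<in> C" "\<forall>x. (f has_real_derivative g x) (at x)"
      using closed \<open>f \<in> C\<close> by blast
    then have "deriv f = g" by (auto intro!: ext DERIV_imp_deriv)
    then show ?thesis using g by simp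
  qed
  have "(deriv ^^ n) f \<in> C"
    by (induction n) (auto simp: f in_C)
  then obtain g where "\<forall>x. ((deriv ^^ n) f has_real_derivative g x) (at x)"
    using closed by blast
  then show ?thesis
    by (auto simp: differentiable_on_def real_differentiable_def)
qed

text \<open>One factor is flat at its left end p, the other at its right end q. The product rule
  turns one such product into a sum of two, so closure under sums is exactly what stability under
  differentiation requires.\<close>

inductive_set bump_class :: "(real \<Rightarrow> real) set" where
  prod: "(\<lambda>t. flat_exp P (n * (t - p)) * flat_exp R (n * (q - t))) \<in> bump_class"
| add: "f \<in> bump_class \<Longrightarrow> g \<in> bump_class \<Longrightarrow> (\<lambda>t. f t + g t) \<in> bump_class"

lemma flat_exp_smult: "flat_exp (smult c P) t = c * flat_exp P t"
  by (simp add: flat_exp_def)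

lemma flat_exp_const: "flat_exp [:c:] t = c * flat_exp 1 t"
  by (simp add: flat_exp_def)

lemma bump_class_closed:
  "f \<in> bump_class \<Longrightarrow> \<exists>g\<in>bump_class. \<forall>x. (f has_real_derivative g x) (at x)"
proof (induction rule: bump_class.induct)
  case (prod P n p R q)
  let ?g = "\<lambda>t. flat_exp (smult n (flat_exp_deriv P)) (n * (t - p)) * flat_exp R (n * (q - t)) +
      flat_exp P (n * (t - p)) * flat_exp (smult (- n) (flat_exp_deriv R)) (n * (q - t))"
  have "?g \<in> bump_class"
    by (intro bump_class.add bump_class.prod)
  moreover have "((\<lambda>t. flat_exp P (n * (t - p)) * flat_exp R (n * (q - t))) has_real_derivative ?g x) (at x)" for x
    by (auto intro!: derivative_eq_intros DERIV_chain2[OF has_real_derivative_flat_exp]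
        simp: flat_exp_smult simp del: smult_minus_left)
  ultimately show ?case
    by (intro bexI[of _ ?g] allI)
next
  case (add f g)
  then obtain f' g' where "f' \<in> bump_class" "\<forall>x. (f has_real_derivative f' x) (at x)"
    "g' \<in> bump_class" "\<forall>x. (g has_real_derivative g' x) (at x)" by blast
  then show ?case
    by (intro bexI[of _ "\<lambda>t. f' t + g' t"]) (auto intro: bump_class.add derivative_intros)
qed

text \<open>For n to infinity this approaches the indicator of the interval from p to p + r, staying
  between 0 and 1. The parameter n sharpens the edges without moving the support.\<close>

definition bump :: "real \<Rightarrow> real \<Rightarrow> real \<Rightarrow> real \<Rightarrow> real" where
  "bump n p r t = flat_exp 1 (n * (t - p)) * flat_exp 1 (n * (p + r - t))"

lemma bump_nonneg: "0 \<le> bump n p r t"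
  by (simp add: bump_def flat_exp_def)

lemma bump_le_1: "bump n p r t \<le> 1"
  unfolding bump_def by (rule mult_le_one) (auto simp: flat_exp_def)

lemma bump_eq_0: "n > 0 \<Longrightarrow> t \<notin> {p<..<p+r} \<Longrightarrow> bump n p r t = 0"
  by (auto simp: bump_def flat_exp_def zero_less_mult_iff)

lemma bump_shift: "bump n (p + d) r t = bump n p r (t - d)"
  by (simp add: bump_def algebra_simps)

lemma has_real_derivative_bump_ex: "\<exists>g. \<forall>x. (bump n p r has_real_derivative g x) (at x)"
proof -
  have "bump n p r \<in> bump_class"
    unfolding bump_def[abs_def] by (rule bump_class.prod)
  then show ?thesis using bump_class_closed by blast
qed

lemma continuous_on_bump: "continuous_on S (bump n p r)"
  using has_real_derivative_bump_ex[of n p r]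
  by (meson DERIV_isCont continuous_at_imp_continuous_on)

lemma bump_borel [measurable]: "bump n p r \<in> borel_measurable borel"
  using continuous_on_bump borel_measurable_continuous_onI by blast

definition ramp :: "real \<Rightarrow> real \<Rightarrow> real \<Rightarrow> real \<Rightarrow> real" where
  "ramp n p r t = integral {p..t} (bump n p r)"

lemma has_real_derivative_ramp:
  assumes "n > 0"
  shows "(ramp n p r has_real_derivative bump n p r x) (at x)"
proof -
  obtain F where "\<forall>x::real. - \<infinity> < ereal x \<longrightarrow> ereal x < \<infinity> \<longrightarrow> (F has_vector_derivative bump n p r x) (at x)"
    using einterval_antiderivative[of "-\<infinity>" \<infinity> "bump n p r"]
      continuous_on_bump[of UNIV n p r] by (auto simp: continuous_on_eq_continuous_at)
  then have F: "(F has_real_derivative bump n p r x) (at x)" for x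
    by (simp add: has_real_derivative_iff_has_vector_derivative)
  have "ramp n p r t = F t - F p" for t
  \<comment> \<open>For t < p the interval {p..t} is empty and \<open>ramp\<close> is 0 by
    convention. The antiderivative agrees there because the bump vanishes left of p, so F is
    constant.\<close>
  proof (cases "t < p")
    case True
    obtain z where "F p - F t = (p - t) * bump n p r z" "t < z" "z < p"
      using MVT2[OF True, of F "bump n p r"] F by blast
    then have "F p = F t" using bump_eq_0[OF assms, of z p r] by auto
    then show ?thesis using True by (simp add: ramp_def)
  next
    case False
    have "(bump n p r has_integral (F t - F p)) {p..t}"
      using False F by (intro fundamental_theorem_of_calculus)
        (auto simp: has_real_derivative_iff_has_vector_derivative[symmetric] has_field_derivative_at_within)
    then show ?thesis by (simp add: ramp_def integral_unique)
  qed
  then have "ramp n p r = (\<lambda>t. F t - F p)" by auto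
  then show ?thesis using F by (auto intro!: derivative_eq_intros)
qed

text \<open>A smoothed trapezoid: it climbs on [p, p + r], stays level up to p + d and descends on
  [p + d, p + d + r]. Its derivative is a difference of two bumps, so testing with it compares local
  means of a function near p and near p + d.\<close>

definition hump :: "real \<Rightarrow> real \<Rightarrow> real \<Rightarrow> real \<Rightarrow> real \<Rightarrow> real" where
  "hump n p d r t = ramp n p r t - ramp n p r (t - d)"

lemma has_real_derivative_hump:
  assumes "n > 0"
  shows "(hump n p d r has_real_derivative bump n p r x - bump n (p + d) r x) (at x)"
  unfolding hump_def[abs_def] bump_shift
  by (auto intro!: derivative_eq_intros has_real_derivative_ramp assms
      DERIV_chain2[OF has_real_derivative_ramp])

lemma deriv_hump:
  "n > 0 \<Longrightarrow> deriv (hump n p d r) = (\<lambda>x. bump n p r x - bump n (p + d) r x)"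
  by (auto intro!: ext DERIV_imp_deriv has_real_derivative_hump)

lemma ramp_eq_0: "t \<le> p \<Longrightarrow> ramp n p r t = 0"
  by (cases "t = p") (auto simp: ramp_def)

lemma ramp_mono: "n > 0 \<Longrightarrow> t \<le> t' \<Longrightarrow> ramp n p r t \<le> ramp n p r t'"
  by (rule DERIV_nonneg_imp_nondecreasing[of t t' "ramp n p r"])
    (auto intro: has_real_derivative_ramp bump_nonneg exI)

lemma ramp_const:
  assumes "n > 0" "p + r \<le> t" "r \<ge> 0"
  shows "ramp n p r t = ramp n p r (p + r)"
proof (cases "t = p + r")
  case False
  with assms have "p + r < t" by simp
  then obtain z where "ramp n p r t - ramp n p r (p + r) = (t - (p + r)) * bump n p r z" "p + r < z" "z < t"
    using MVT2[of "p + r" t "ramp n p r" "bump n p r"] has_real_derivative_ramp[OF assms(1)] by blast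
  then show ?thesis using bump_eq_0[OF assms(1), of z p r] by auto
qed simp

lemma ramp_bounds:
  assumes "n > 0" "r \<ge> 0"
  shows "0 \<le> ramp n p r t" "ramp n p r t \<le> r"
proof -
  show "0 \<le> ramp n p r t"
    using ramp_mono[OF assms(1), of p t p r] ramp_eq_0[of t p n r] ramp_eq_0[of p p n r] by fastforce
  have "ramp n p r t \<le> ramp n p r (p + r)"
    using ramp_mono[OF assms(1), of t "p+r" p r] ramp_const[OF assms(1) _ assms(2), of p t] by fastforce
  also have "\<dots> \<le> integral {p..p+r} (\<lambda>_. 1)"
    unfolding ramp_def by (intro integral_le integrable_continuous_interval continuous_on_bump bump_le_1)
      (auto intro: bump_le_1)
  also have "\<dots> = r" using assms by simp
  finally show "ramp n p r t \<le> r" .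
qed

lemma hump_bound: "n > 0 \<Longrightarrow> r \<ge> 0 \<Longrightarrow> \<bar>hump n p d r t\<bar> \<le> r"
  using ramp_bounds[of n r p t] ramp_bounds[of n r p "t - d"] by (auto simp: hump_def)

lemma hump_eq_0: "n > 0 \<Longrightarrow> r \<ge> 0 \<Longrightarrow> d \<ge> 0 \<Longrightarrow> t \<notin> {p..p+d+r} \<Longrightarrow> hump n p d r t = 0"
  using ramp_const[of n p r t] ramp_const[of n p r "t - d"] ramp_eq_0[of t p n r] ramp_eq_0[of "t - d" p n r]
  by (auto simp: hump_def not_le)

lemma test_fun_hump:
  assumes "n > 0" "r \<ge> 0" "d \<ge> 0" "{p..p+d+r} \<subseteq> S"
  shows "test_fun S (hump n p d r)"
  unfolding test_fun_def
proof (intro conjI allI)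
  fix k :: nat
  show "(deriv ^^ k) (hump n p d r) differentiable_on UNIV"
  \<comment> \<open>The hump is a primitive and not itself in \<open>bump_class\<close>; only its
    derivative is. Order zero is therefore treated apart.\<close>
  proof (cases k)
    case 0
    then show ?thesis
      using has_real_derivative_hump[OF assms(1), of p d r]
      by (simp add: differentiable_on_def real_differentiable_def) blast
  next
    case (Suc j)
    have "bump n p r \<in> bump_class"
      unfolding bump_def[abs_def] by (rule bump_class.prod)
    \<comment> \<open>\<open>bump_class\<close> has no closure under negation, so the minus sign is
      carried by the constant polynomial -1.\<close>
    moreover have "(\<lambda>t. flat_exp ([:-1:]) (n * (t - (p + d))) * flat_exp 1 (n * (p + d + r - t))) \<in> bump_class"
      by (rule bump_class.prod)
    ultimately have "(\<lambda>x. bump n p r x + flat_exp ([:-1:]) (n * (x - (p + d))) * flat_exp 1 (n * (p + d + r - x))) \<in> bump_class"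
      by (rule bump_class.add)
    then have "deriv (hump n p d r) \<in> bump_class"
      unfolding deriv_hump[OF assms(1)] by (simp add: flat_exp_const bump_def[of n "p + d"])
    then have "(deriv ^^ j) (deriv (hump n p d r)) differentiable_on UNIV"
      by (rule smooth_of_closed_under_deriv[rotated]) (rule bump_class_closed)
    then show ?thesis by (simp add: Suc funpow_swap1)
  qed
next
  show "\<exists>K. compact K \<and> K \<subseteq> S \<and> (\<forall>x. x \<notin> K \<longrightarrow> hump n p d r x = 0)"
    using assms hump_eq_0 by (intro exI[of _ "{p..p+d+r}"]) auto
qed

section \<open>Limits of the cut-off functions as the edges sharpen\<close>

lemma flat_exp_1_tendsto:
  assumes "filterlim X at_top F"
  shows "((\<lambda>n. flat_exp 1 (X n)) \<longlongrightarrow> 1) F"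
proof -
  have "((\<lambda>n. exp (- inverse (X n))) \<longlongrightarrow> exp (- 0)) F"
    by (intro tendsto_intros tendsto_inverse_0_at_top assms)
  moreover have "eventually (\<lambda>n. exp (- inverse (X n)) = flat_exp 1 (X n)) F"
    using eventually_compose_filterlim[OF eventually_gt_at_top[of 0] assms]
    by eventually_elim (simp add: flat_exp_def inverse_eq_divide)
  ultimately show ?thesis by (auto intro: Lim_transform_eventually)
qed

lemma flat_exp_1_scaled_tendsto:
  assumes "y \<longlonglongrightarrow> l" "l \<noteq> 0"
  shows "(\<lambda>k. flat_exp 1 (real (Suc k) * y k)) \<longlonglongrightarrow> (if l > 0 then 1 else 0)"
proof (cases "l > 0")
  case True
  have "filterlim (\<lambda>k. real (Suc k) * y k) at_top sequentially"
    using filterlim_tendsto_pos_mult_at_top[OF assms(1) True, of "\<lambda>k. real (Suc k)"]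
      filterlim_compose[OF filterlim_real_sequentially filterlim_Suc] by (simp add: mult.commute)
  then show ?thesis using True flat_exp_1_tendsto by auto
next
  case False
  with assms have "eventually (\<lambda>k. y k < 0) sequentially"
    using order_tendstoD(2)[OF assms(1), of 0] by auto
  then have "eventually (\<lambda>k. 0 = flat_exp 1 (real (Suc k) * y k)) sequentially"
    by eventually_elim (auto simp: flat_exp_def zero_less_mult_iff)
  then show ?thesis using False by (auto intro: Lim_transform_eventually)
qed

text \<open>The left end may move with k. This lets rational parameters approximate arbitrary real
  end points while the edges sharpen.\<close>

lemma bump_tendsto:
  assumes "P \<longlonglongrightarrow> p" "t \<noteq> p" "t \<noteq> p + r"
  shows "(\<lambda>k. bump (real (Suc k)) (P k) r t) \<longlonglongrightarrow> indicator {p<..<p+r} t"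
proof -
  have "(\<lambda>k. bump (real (Suc k)) (P k) r t) \<longlonglongrightarrow> (if t - p > 0 then 1 else 0) * (if p + r - t > 0 then 1 else 0)"
    unfolding bump_def
    by (intro tendsto_mult flat_exp_1_scaled_tendsto tendsto_intros assms) (use assms in auto)
  then show ?thesis by (simp add: indicator_def split: if_splits)
qed

lemma ramp_tendsto:
  assumes "P \<longlonglongrightarrow> p" "r \<ge> 0"
  shows "(\<lambda>k. ramp (real (Suc k)) (P k) r t) \<longlonglongrightarrow> max 0 (min (t - p) r)"
proof -
  obtain b where "\<bar>P k\<bar> \<le> b" for k
    using convergent_imp_Bseq[OF convergentI[OF assms(1)]] by (auto simp: Bseq_def)
  then have B: "P k \<ge> - b" for k
    by (metis abs_le_D2 minus_le_iff)
  \<comment> \<open>\<open>L\<close> lies to the left of p, of t and of all P k, so that every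
    integral runs over the same interval and dominated convergence applies.\<close>
  define L where "L = min (- b) (min p t)"
  have *: "ramp (real (Suc k)) (P k) r t = integral {L..t} (bump (real (Suc k)) (P k) r)" for k
  proof (cases "P k \<le> t")
    case True
    have "integral {L..P k} (bump (real (Suc k)) (P k) r) = integral {L..P k} (\<lambda>_. 0)"
      by (rule integral_cong) (auto intro!: bump_eq_0)
    moreover have "integral {L..P k} (bump (real (Suc k)) (P k) r) + integral {P k..t} (bump (real (Suc k)) (P k) r)
      = integral {L..t} (bump (real (Suc k)) (P k) r)"
      using B[of k] True by (intro Henstock_Kurzweil_Integration.integral_combine integrable_continuous_interval continuous_on_bump) (auto simp: L_def)
    ultimately show ?thesis by (simp add: ramp_def)
  next
    case False
    have "integral {L..t} (bump (real (Suc k)) (P k) r) = integral {L..t} (\<lambda>_. 0)"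
      by (rule integral_cong) (use False in \<open>auto intro!: bump_eq_0\<close>)
    then show ?thesis using False by (simp add: ramp_def)
  qed
  have "(\<lambda>k. integral\<^sup>L lebesgue (\<lambda>u. indicator {L..t} u * bump (real (Suc k)) (P k) r u))
     \<longlonglongrightarrow> integral\<^sup>L lebesgue (\<lambda>u. indicator {L..t} u * indicator {p<..<p+r} u)"
  proof (rule integral_dominated_convergence[where w = "indicator {L..t}"])
    show "AE x in lebesgue. (\<lambda>k. indicator {L..t} x * bump (real (Suc k)) (P k) r x)
        \<longlonglongrightarrow> indicator {L..t} x * indicator {p<..<p + r} x"
    proof (rule AE_I'[of "{p, p + r}"])
      show "{p, p + r} \<in> null_sets lebesgue"
        by (auto simp: negligible_iff_null_sets[symmetric])
      show "{x \<in> space lebesgue. \<not> (\<lambda>k. indicator {L..t} x * bump (real (Suc k)) (P k) r x)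
        \<longlonglongrightarrow> indicator {L..t} x * indicator {p<..<p + r} x} \<subseteq> {p, p + r}"
        using bump_tendsto[OF assms(1), of _ r] by (auto intro!: tendsto_mult)
    qed
    show "integrable lebesgue (indicat_real {L..t})"
      by (intro integrable_real_indicator) (auto simp: emeasure_lborel_Icc_eq)
    show "AE x in lebesgue. norm (indicator {L..t} x * bump (real (Suc k)) (P k) r x) \<le> indicator {L..t} x" for k
      by (simp add: indicator_def abs_le_iff bump_le_1 order_trans[OF _ bump_nonneg])
  qed (intro borel_measurable_times borel_measurable_indicator measurable_completion; simp)+
  moreover have "integral\<^sup>L lebesgue (\<lambda>u. indicator {L..t} u * bump (real (Suc k)) (P k) r u)
      = integral {L..t} (bump (real (Suc k)) (P k) r)" for k
    using set_lebesgue_integral_eq_integral(2)[of "{L..t}" "bump (real (Suc k)) (P k) r"]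
      absolutely_integrable_continuous_real[OF continuous_on_bump]
    by (auto simp: set_lebesgue_integral_def)
  moreover have "integral\<^sup>L lebesgue (\<lambda>u. indicator {L..t} u * indicator {p<..<p+r} u) = max 0 (min (t - p) r)"
  proof -
    have "(\<lambda>u. indicator {L..t} u * indicator {p<..<p+r} u :: real) = indicator ({L..t} \<inter> {p<..<p+r})"
      by (auto simp: indicator_def)
    moreover have "measure lebesgue ({L..t} \<inter> {p<..<p+r}) = max 0 (min (t - p) r)"
    proof (cases "t < p + r")
      case True
      then have "{L..t} \<inter> {p<..<p+r} = {p<..t}" by (auto simp: L_def)
      then show ?thesis using True by (cases "p \<le> t") (auto simp: max_def)
    next
      case False
      then have "{L..t} \<inter> {p<..<p+r} = {p<..<p+r}" by (auto simp: L_def)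
      then show ?thesis using False assms(2) by (auto simp: max_def)
    qed
    ultimately show ?thesis by simp
  qed
  ultimately show ?thesis using * by simp
qed

lemma hump_tendsto:
  assumes "P \<longlonglongrightarrow> p" "D \<longlonglongrightarrow> d" "r \<ge> 0"
  shows "(\<lambda>k. hump (real (Suc k)) (P k) (D k) r t) \<longlonglongrightarrow> max 0 (min (t - p) r) - max 0 (min (t - p - d) r)"
proof -
  have shift: "ramp n p r (t - d) = ramp n (p + d) r t" if "n > 0" for n p d
  proof -
    have "((\<lambda>x. ramp n p r (x - d) - ramp n (p + d) r x) has_real_derivative 0) (at x)" for x
      by (auto intro!: derivative_eq_intros has_real_derivative_ramp \<open>n > 0\<close>
          DERIV_chain2[OF has_real_derivative_ramp] simp: bump_shift)
    then have "ramp n p r (t - d) - ramp n (p + d) r t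
        = ramp n p r (min p t - \<bar>d\<bar> - d) - ramp n (p + d) r (min p t - \<bar>d\<bar>)"
      using DERIV_isconst_all by blast
    then show ?thesis by (simp add: ramp_eq_0)
  qed
  have "(\<lambda>k. ramp (real (Suc k)) (P k) r t - ramp (real (Suc k)) (P k + D k) r t)
     \<longlonglongrightarrow> max 0 (min (t - p) r) - max 0 (min (t - (p + d)) r)"
    by (intro tendsto_diff ramp_tendsto tendsto_add assms)
  then show ?thesis by (simp add: hump_def shift algebra_simps)
qed

section \<open>Primitives of locally integrable functions\<close>

text \<open>The Lebesgue differentiation theorem, localised: f is cut off to a countable exhaustion
  of the open interval by compact ones, and the exceptional sets are united. Averages to the right
  are the ones that humps produce.\<close>

lemma AE_right_average:
  fixes f :: "real \<Rightarrow> real"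
  assumes "\<And>p q. \<alpha> < p \<Longrightarrow> q < \<beta> \<Longrightarrow> set_integrable lebesgue {p..q} f"
  obtains N where "negligible N" "\<And>x. x \<in> {\<alpha><..<\<beta>} \<Longrightarrow> x \<notin> N \<Longrightarrow>
     ((\<lambda>h. (LINT r:{x..x+h}|lebesgue. f r) / h) \<longlongrightarrow> f x) (at_right 0)"
proof -
  define P where "P n = \<alpha> + 1 / real (Suc n)" for n
  define R where "R n = \<beta> - 1 / real (Suc n)" for n
  define F where "F n x = indicator {P n..R n} x *\<^sub>R f x" for n x
  have "set_integrable lebesgue {P n..R n} f" for n
    by (intro assms) (auto simp: P_def R_def)
  then have int: "integrable lebesgue (F n)" for n
    unfolding set_integrable_def F_def .
  have "\<exists>N. negligible N \<and> (\<forall>x e. x \<notin> N \<longrightarrow> 0 < e \<longrightarrow>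
      (\<exists>d>0. \<forall>h. 0 < h \<and> h < d \<longrightarrow> norm (integral (cbox x (x + h *\<^sub>R One)) (F n) /\<^sub>R h ^ DIM(real) - F n x) < e))" for n
  proof -
    have "F n integrable_on cbox a b" for a b
      using integrable_on_lebesgue[OF int[of n]] by (rule integrable_on_subcbox) simp
    from integrable_ccontinuous_explicit[OF this] show ?thesis by metis
  qed
  then obtain N where N: "\<And>n. negligible (N n)" and
    lim: "\<And>n x e. x \<notin> N n \<Longrightarrow> 0 < e \<Longrightarrow>
      \<exists>d>0. \<forall>h. 0 < h \<and> h < d \<longrightarrow> norm (integral {x..x + h} (F n) / h - F n x) < e"
    by (simp add: divide_inverse mult.commute) metis
  show thesis
  proof (rule that[of "\<Union>n. N n"])
    show "negligible (\<Union>n. N n)"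
      using N by (intro negligible_countable_Union) auto
    fix x assume x: "x \<in> {\<alpha><..<\<beta>}" "x \<notin> (\<Union>n. N n)"
    define \<delta> where "\<delta> = min (x - \<alpha>) (\<beta> - x) / 2"
    have \<delta>: "\<delta> > 0" using x by (auto simp: \<delta>_def)
    then obtain n where n: "1 / real (Suc n) < \<delta>"
      using nat_approx_posE by metis
    have in_PR: "y \<in> {P n..R n}" if "x \<le> y" "y \<le> x + \<delta>" for y
    proof -
      have "\<delta> \<le> (x - \<alpha>) / 2" "\<delta> \<le> (\<beta> - x) / 2" by (auto simp: \<delta>_def)
      then have "\<alpha> + 1 / real (Suc n) \<le> y" "y \<le> \<beta> - 1 / real (Suc n)"
        using that n by argo+
      then show ?thesis by (simp add: P_def R_def)
    qed
    show "((\<lambda>h. (LINT r:{x..x+h}|lebesgue. f r) / h) \<longlongrightarrow> f x) (at_right 0)"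
    proof (rule tendstoI)
      fix e :: real assume "e > 0"
      then obtain d where d: "d > 0" "\<And>h. 0 < h \<Longrightarrow> h < d \<Longrightarrow> norm (integral {x..x + h} (F n) / h - F n x) < e"
        using lim[of x n e] x by blast
      have "dist ((LINT r:{x..x+h}|lebesgue. f r) / h) (f x) < e" if "0 < h" "h < min d \<delta>" for h
      proof -
        have "set_integrable lebesgue {x..x+h} f"
          using that x \<delta> by (intro assms) (auto simp: \<delta>_def min_def split: if_splits)
        then have "(LINT r:{x..x+h}|lebesgue. f r) = integral {x..x+h} f"
          by (rule set_lebesgue_integral_eq_integral)
        also have "\<dots> = integral {x..x+h} (F n)"
          by (rule integral_cong) (use in_PR that in \<open>auto simp: F_def\<close>)
        finally show ?thesis
          using d(2)[of h] that in_PR[of x] \<delta> by (simp add: F_def dist_real_def)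
      qed
      then show "\<forall>\<^sub>F h in at_right 0. dist ((LINT r:{x..x+h}|lebesgue. f r) / h) (f x) < e"
        using d(1) \<delta> by (auto simp: eventually_at_right_field intro!: exI[of _ "min d \<delta>"])
    qed
  qed
qed

text \<open>Two limits are taken. First the edges sharpen and rational parameters tend to s and t -
  s: the tested identity then relates the integrals of f over [s, s + r] and [t, t + r] to the
  integral of g against a trapezoid. Then r tends to 0 after division by r: the averages converge at
  points where f has right averages, and the trapezoid becomes the indicator of (s, t). Restricting
  \<open>test\<close> to countably many functions allows a common null set in the application to
  time derivatives.\<close>

lemma du_bois_reymond:
  fixes f g :: "real \<Rightarrow> real"
  assumes f: "\<And>p q. \<alpha> < p \<Longrightarrow> q < \<beta> \<Longrightarrow> set_integrable lebesgue {p..q} f"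
    and g: "\<And>p q. \<alpha> < p \<Longrightarrow> q < \<beta> \<Longrightarrow> set_integrable lebesgue {p..q} g"
    and test: "\<And>n p d j. p \<in> \<rat> \<Longrightarrow> d \<in> \<rat> \<Longrightarrow> \<alpha> < p \<Longrightarrow> 0 < d \<Longrightarrow> p + d + 1 / real (Suc j) < \<beta> \<Longrightarrow>
      (LINT x|lebesgue_on {\<alpha><..<\<beta>}. f x * deriv (hump (real (Suc n)) p d (1 / real (Suc j))) x) =
      - (LINT x|lebesgue_on {\<alpha><..<\<beta>}. g x * hump (real (Suc n)) p d (1 / real (Suc j)) x)"
  obtains N where "negligible N"
    "\<And>s t. s \<notin> N \<Longrightarrow> t \<notin> N \<Longrightarrow> \<alpha> < s \<Longrightarrow> s < t \<Longrightarrow> t < \<beta> \<Longrightarrow> f t - f s = (LINT r:{s..t}|lebesgue. g r)"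
proof -
  obtain N where N: "negligible N" and avg: "\<And>x. x \<in> {\<alpha><..<\<beta>} \<Longrightarrow> x \<notin> N \<Longrightarrow>
     ((\<lambda>h. (LINT r:{x..x+h}|lebesgue. f r) / h) \<longlongrightarrow> f x) (at_right 0)"
    using AE_right_average[OF f] by blast
  show thesis
  proof (rule that[OF N])
    fix s t assume st: "s \<notin> N" "t \<notin> N" "\<alpha> < s" "s < t" "t < \<beta>"
    define d where "d = t - s"
    define c where "c = (t + \<beta>) / 2"
    define F where "F x = indicator {s..c} x * f x" for x
    define G where "G x = indicator {s..c} x * g x" for x
    have c: "t < c" "c < \<beta>" using st by (auto simp: c_def)
    have F: "integrable lebesgue F" and G: "integrable lebesgue G"
      using f[of s c] g[of s c] st c by (auto simp: F_def[abs_def] G_def[abs_def] set_integrable_def)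
    \<comment> \<open>The pointwise limit of the humps: the trapezoid of height at most r with
      corners s, s + r, s + d and s + d + r.\<close>
    define th where "th r x = max 0 (min (x - s) r) - max 0 (min (x - s - d) r)" for r x
    obtain j0 where j0: "1 / real (Suc j0) < (\<beta> - t) / 4"
      using nat_approx_posE[of "(\<beta> - t) / 4"] st by auto
    have step: "(LINT x:{s..s+r}|lebesgue. f x) - (LINT x:{t..t+r}|lebesgue. f x) = - (LINT x|lebesgue. G x * th r x)"
      if r: "r = 1 / real (Suc j)" and rlt: "r < (\<beta> - t) / 4" for r j
    proof -
      \<comment> \<open>The two rational approximations overshoot by less than an eighth each and r
        is below a quarter of \<open>\<beta> - t\<close>, so all supports stay to the left of the
        midpoint c.\<close>
      define \<delta> where "\<delta> = (\<beta> - t) / 8"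
      have \<delta>: "\<delta> > 0" using st by (simp add: \<delta>_def)
      have "r > 0" using r by simp
      \<comment> \<open>Rational approximations are taken from above, so that the supports begin to
        the right of s.\<close>
      have "\<exists>q\<in>\<rat>. y < q \<and> q < y + \<delta> / real (Suc k)" for y k
        using Rats_dense_in_real[of y "y + \<delta> / real (Suc k)"] \<delta> by auto
      then obtain q where q: "\<And>y k. q y k \<in> \<rat>" "\<And>y k. y < q y k" "\<And>y k. q y k < y + \<delta> / real (Suc k)"
        by metis
      have lim0: "(\<lambda>k. \<delta> / real (Suc k)) \<longlonglongrightarrow> 0"
        using tendsto_mult[OF tendsto_const[of \<delta>] LIMSEQ_inverse_real_of_nat] by (simp add: divide_inverse)
      have qlim: "q y \<longlonglongrightarrow> y" for y
      proof (rule tendsto_sandwich[of "\<lambda>_. y" _ _ "\<lambda>k. y + \<delta> / real (Suc k)"])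
        show "(\<lambda>k. y + \<delta> / real (Suc k)) \<longlonglongrightarrow> y" using tendsto_add[OF tendsto_const[of y] lim0] by simp
      qed (use q in \<open>auto intro!: always_eventually less_imp_le\<close>)
      have q\<delta>: "q y k < y + \<delta>" for y k
      proof -
        have "\<delta> / real (Suc k) \<le> \<delta> / 1" using \<delta> by (intro divide_left_mono) auto
        then show ?thesis using q(3)[of y k] by linarith
      qed
      have inI: "s < q s k" "q s k + q d k + r < c" "q s k + q d k < c" "q d k > 0" for k
        using q(2)[of s k] q\<delta>[of s k] q\<delta>[of d k] q(2)[of d k] st rlt \<open>r > 0\<close>
        by (auto simp: d_def \<delta>_def c_def field_simps)
      define n where "n k = real (Suc k)" for k
      have n: "n k > 0" for k by (simp add: n_def)
      let ?b = "\<lambda>k x. bump (n k) (q s k) r x - bump (n k) (q s k + q d k) r x"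
      let ?h = "\<lambda>k. hump (n k) (q s k) (q d k) r"
      have "(LINT x|lebesgue. F x * ?b k x) = - (LINT x|lebesgue. G x * ?h k x)" for k
      proof -
        have \<alpha>q: "\<alpha> < q s k" using inI(1)[of k] st by linarith
        have "(LINT x|lebesgue_on {\<alpha><..<\<beta>}. f x * deriv (?h k) x) =
          - (LINT x|lebesgue_on {\<alpha><..<\<beta>}. g x * ?h k x)"
          unfolding r n_def by (rule test) (use \<alpha>q q inI[of k] c in \<open>auto simp: r\<close>)
        moreover have "(LINT x|lebesgue_on {\<alpha><..<\<beta>}. f x * deriv (?h k) x) = (LINT x|lebesgue. F x * ?b k x)"
        proof -
          have "indicator {\<alpha><..<\<beta>} x *\<^sub>R (f x * deriv (?h k) x) = F x * ?b k x" for x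
          proof (cases "x \<in> {s..c}")
            case True
            then show ?thesis using c st by (simp add: F_def deriv_hump[OF n] indicator_def)
          next
            case False
            then have "?b k x = 0"
              using bump_eq_0[OF n, of x "q s k" r k] bump_eq_0[OF n, of x "q s k + q d k" r k] inI[of k] by auto
            then show ?thesis by (simp add: deriv_hump[OF n])
          qed
          then show ?thesis by (simp add: integral_restrict_space)
        qed
        moreover have "(LINT x|lebesgue_on {\<alpha><..<\<beta>}. g x * ?h k x) = (LINT x|lebesgue. G x * ?h k x)"
        proof -
          have *: "indicator {\<alpha><..<\<beta>} x *\<^sub>R (g x * ?h k x) = G x * ?h k x" for x
          proof (cases "x \<in> {s..c}")
            case True
            then show ?thesis using c st by (simp add: G_def indicator_def)
          next
            case False
            then have "?h k x = 0"
              using hump_eq_0[OF n, of r "q d k" x "q s k" k] inI[of k] \<open>r > 0\<close> by auto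
            then show ?thesis by simp
          qed
          show ?thesis by (subst integral_restrict_space) (simp, simp only: *)
        qed
        ultimately show ?thesis by simp
      qed
      moreover have "(\<lambda>k. LINT x|lebesgue. F x * ?b k x) \<longlonglongrightarrow>
          (LINT x|lebesgue. F x * (indicator {s<..<s+r} x - indicator {t<..<t+r} x))"
      proof (rule integral_dominated_convergence[where w = "\<lambda>x. \<bar>F x\<bar>"])
        show "AE x in lebesgue. (\<lambda>k. F x * ?b k x) \<longlonglongrightarrow> F x * (indicator {s<..<s+r} x - indicator {t<..<t+r} x)"
        proof (rule AE_I'[of "{s, s + r, t, t + r}"])
          show "{s, s + r, t, t + r} \<in> null_sets lebesgue"
            by (auto simp: negligible_iff_null_sets[symmetric])
          have "(\<lambda>k. q s k + q d k) \<longlonglongrightarrow> t"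
            using tendsto_add[OF qlim[of s] qlim[of d]] by (simp add: d_def)
          then show "{x \<in> space lebesgue. \<not> (\<lambda>k. F x * ?b k x) \<longlonglongrightarrow> F x * (indicator {s<..<s+r} x - indicator {t<..<t+r} x)}
             \<subseteq> {s, s + r, t, t + r}"
            unfolding n_def using bump_tendsto[OF qlim[of s], of _ r] bump_tendsto[of "\<lambda>k. q s k + q d k" t _ r]
            by (auto intro!: tendsto_mult tendsto_diff)
        qed
        show "AE x in lebesgue. norm (F x * ?b k x) \<le> \<bar>F x\<bar>" for k
        proof (intro always_eventually allI)
          fix x
          have "\<bar>?b k x\<bar> \<le> 1"
            using bump_nonneg bump_le_1 by (smt (verit, best))
          then show "norm (F x * ?b k x) \<le> \<bar>F x\<bar>"
            by (simp add: abs_mult mult_left_le)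
        qed
        show "(\<lambda>x. F x * (indicator {s<..<s + r} x - indicator {t<..<t + r} x)) \<in> borel_measurable lebesgue"
          using F by (intro borel_measurable_times borel_measurable_diff borel_measurable_indicator) auto
        show "(\<lambda>x. F x * ?b k x) \<in> borel_measurable lebesgue" for k
          by (rule borel_measurable_times[OF borel_measurable_integrable[OF F]], rule measurable_completion, simp)
      qed (use F in auto)
      moreover have "(\<lambda>k. LINT x|lebesgue. G x * ?h k x) \<longlonglongrightarrow> (LINT x|lebesgue. G x * th r x)"
      proof (rule integral_dominated_convergence[where w = "\<lambda>x. \<bar>G x\<bar> * r"])
        show "AE x in lebesgue. (\<lambda>k. G x * ?h k x) \<longlonglongrightarrow> G x * th r x"
          unfolding n_def th_def using \<open>r > 0\<close>
          by (intro always_eventually allI tendsto_mult tendsto_const hump_tendsto qlim) simp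
        show "AE x in lebesgue. norm (G x * ?h k x) \<le> \<bar>G x\<bar> * r" for k
          using hump_bound[OF n, of r k] \<open>r > 0\<close>
          by (intro always_eventually allI) (simp add: abs_mult mult_left_mono)
        show "(\<lambda>x. G x * th r x) \<in> borel_measurable lebesgue"
          unfolding th_def by (rule borel_measurable_times[OF borel_measurable_integrable[OF G]], rule measurable_completion, simp)
        have "?h k \<in> borel_measurable borel" for k
          using has_real_derivative_hump[OF n] by (intro borel_measurable_continuous_onI)
            (meson DERIV_isCont continuous_at_imp_continuous_on)
        then show "(\<lambda>x. G x * ?h k x) \<in> borel_measurable lebesgue" for k
          by (intro borel_measurable_times[OF borel_measurable_integrable[OF G]] measurable_completion) simp
      qed (use G in auto)
      ultimately have eq: "(LINT x|lebesgue. F x * (indicator {s<..<s+r} x - indicator {t<..<t+r} x)) = - (LINT x|lebesgue. G x * th r x)"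
        by (simp add: LIMSEQ_unique tendsto_minus_cancel_left)
      have part: "integrable lebesgue (\<lambda>x. F x * indicator {y<..<y+r} x)"
        "(LINT x|lebesgue. F x * indicator {y<..<y+r} x) = (LINT x:{y..y+r}|lebesgue. f x)"
        if y: "y \<in> {s, t}" for y
      proof -
        show "integrable lebesgue (\<lambda>x. F x * indicator {y<..<y+r} x)"
          using integrable_mult_indicator[OF _ F, of "{y<..<y+r}"] by (simp add: mult.commute)
        have sub: "s \<le> y" "y + r \<le> c" using y st c rlt \<open>r > 0\<close> by (auto simp: c_def)
        have "AE x in lebesgue. F x * indicator {y<..<y+r} x = indicator {y..y+r} x *\<^sub>R f x"
        proof (rule AE_I'[of "{y, y + r}"])
          show "{y, y + r} \<in> null_sets lebesgue"
            by (auto simp: negligible_iff_null_sets[symmetric])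
          show "{x \<in> space lebesgue. F x * indicator {y<..<y+r} x \<noteq> indicator {y..y+r} x *\<^sub>R f x} \<subseteq> {y, y + r}"
            using sub by (auto simp: F_def indicator_def)
        qed
        then show "(LINT x|lebesgue. F x * indicator {y<..<y+r} x) = (LINT x:{y..y+r}|lebesgue. f x)"
          unfolding set_lebesgue_integral_def
        proof (rule integral_cong_AE[rotated -1])
          show "(\<lambda>x. F x * indicator {y<..<y+r} x) \<in> borel_measurable lebesgue"
            using F by (intro borel_measurable_times borel_measurable_indicator) auto
          have "set_integrable lebesgue {y..y+r} f"
            using y st c rlt by (intro f) (auto simp: c_def)
          then show "(\<lambda>x. indicator {y..y + r} x *\<^sub>R f x) \<in> borel_measurable lebesgue"
            by (auto simp: set_integrable_def)
        qed
      qed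
      show ?thesis using eq part[of s] part[of t] by (simp add: right_diff_distrib)
    qed
    define r where "r j = 1 / real (Suc (j + j0))" for j
    have r: "r j > 0" "r j < (\<beta> - t) / 4" for j
    proof -
      have "r j \<le> 1 / real (Suc j0)" unfolding r_def by (intro divide_left_mono) auto
      then show "r j < (\<beta> - t) / 4" using j0 by simp
    qed (simp add: r_def)
    have "r \<longlonglongrightarrow> 0"
      using LIMSEQ_ignore_initial_segment[OF LIMSEQ_inverse_real_of_nat, of j0]
      by (simp add: r_def[abs_def] divide_inverse)
    then have rlim: "filterlim r (at_right 0) sequentially"
      using r(1) by (auto simp: filterlim_at less_imp_neq[symmetric] intro!: always_eventually)
    have "(\<lambda>j. (LINT x:{s..s+r j}|lebesgue. f x) / r j - (LINT x:{t..t+r j}|lebesgue. f x) / r j) \<longlonglongrightarrow> f s - f t"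
      using st by (intro tendsto_diff filterlim_compose[OF avg rlim]) auto
    \<comment> \<open>After division by r the trapezoid takes values in [0, 1] and equals the
      indicator of (s, t) at every x other than s and t as soon as r is smaller than the distance
      from x to both.\<close>
    moreover have "(\<lambda>j. LINT x|lebesgue. G x * (th (r j) x / r j)) \<longlonglongrightarrow> (LINT x|lebesgue. G x * indicator {s<..<t} x)"
    proof (rule integral_dominated_convergence[where w = "\<lambda>x. \<bar>G x\<bar>"])
      show "AE x in lebesgue. (\<lambda>j. G x * (th (r j) x / r j)) \<longlonglongrightarrow> G x * indicator {s<..<t} x"
      proof (rule AE_I'[of "{s, t}"])
        show "{s, t} \<in> null_sets lebesgue"
          by (auto simp: negligible_iff_null_sets[symmetric])
        have "(\<lambda>j. th (r j) x / r j) \<longlonglongrightarrow> indicator {s<..<t} x" if "x \<noteq> s" "x \<noteq> t" for x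
        proof -
          define m where "m = min \<bar>x - s\<bar> \<bar>x - t\<bar>"
          have "m > 0" using that by (simp add: m_def)
          with \<open>r \<longlonglongrightarrow> 0\<close> have "\<forall>\<^sub>F j in sequentially. r j < m"
            by (rule order_tendstoD(2))
          then have "\<forall>\<^sub>F j in sequentially. indicator {s<..<t} x = th (r j) x / r j"
          proof eventually_elim
            case (elim j)
            then show ?case using r(1)[of j] st that
              by (auto simp: th_def m_def d_def indicator_def min_def max_def abs_if split: if_splits)
          qed
          then show ?thesis by (rule Lim_transform_eventually[OF tendsto_const])
        qed
        then have "(\<lambda>j. G x * (th (r j) x / r j)) \<longlonglongrightarrow> G x * indicator {s<..<t} x" if "x \<noteq> s" "x \<noteq> t" for x
          using that by (intro tendsto_mult[OF tendsto_const]) auto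
        then show "{x \<in> space lebesgue. \<not> (\<lambda>j. G x * (th (r j) x / r j)) \<longlonglongrightarrow> G x * indicator {s<..<t} x} \<subseteq> {s, t}"
          by blast
      qed
      show "AE x in lebesgue. norm (G x * (th (r j) x / r j)) \<le> \<bar>G x\<bar>" for j
      proof (intro always_eventually allI)
        fix x
        have "\<bar>th (r j) x\<bar> \<le> r j" using r(1)[of j] by (auto simp: th_def)
        then have "\<bar>th (r j) x / r j\<bar> \<le> 1" using r(1)[of j] by simp
        then show "norm (G x * (th (r j) x / r j)) \<le> \<bar>G x\<bar>"
          unfolding real_norm_def abs_mult by (rule mult_left_le) simp
      qed
      show "(\<lambda>x. G x * (th (r j) x / r j)) \<in> borel_measurable lebesgue" for j
        unfolding th_def by (rule borel_measurable_times[OF borel_measurable_integrable[OF G]], rule measurable_completion, simp)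
      show "(\<lambda>x. G x * indicator {s<..<t} x) \<in> borel_measurable lebesgue"
        using G by (intro borel_measurable_times borel_measurable_indicator) auto
    qed (use G in auto)
    moreover have "(LINT x:{s..s+r j}|lebesgue. f x) / r j - (LINT x:{t..t+r j}|lebesgue. f x) / r j
        = - (LINT x|lebesgue. G x * (th (r j) x / r j))" for j
    proof -
      have "(LINT x|lebesgue. G x * (th (r j) x / r j)) = (LINT x|lebesgue. G x * th (r j) x) / r j"
        by (simp add: field_simps flip: integral_divide_zero)
      moreover have "(LINT x:{s..s+r j}|lebesgue. f x) - (LINT x:{t..t+r j}|lebesgue. f x)
          = - (LINT x|lebesgue. G x * th (r j) x)"
        by (rule step[OF _ r(2)]) (simp only: r_def)
      ultimately show ?thesis
        by (metis diff_divide_distrib minus_divide_left)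
    qed
    ultimately have "f s - f t = - (LINT x|lebesgue. G x * indicator {s<..<t} x)"
      by (simp add: LIMSEQ_unique tendsto_minus_cancel_left)
    also have "(LINT x|lebesgue. G x * indicator {s<..<t} x) = (LINT x:{s..t}|lebesgue. g x)"
      unfolding set_lebesgue_integral_def
    proof (rule integral_cong_AE)
      show "AE x in lebesgue. G x * indicator {s<..<t} x = indicator {s..t} x *\<^sub>R g x"
      proof (rule AE_I'[of "{s, t}"])
        show "{s, t} \<in> null_sets lebesgue"
          by (auto simp: negligible_iff_null_sets[symmetric])
      qed (use c in \<open>auto simp: G_def indicator_def\<close>)
      show "(\<lambda>x. G x * indicator {s<..<t} x) \<in> borel_measurable lebesgue"
        using G by (intro borel_measurable_times borel_measurable_indicator) auto
      have "set_integrable lebesgue {s..t} g" using st by (intro g) auto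
      then show "(\<lambda>x. indicator {s..t} x *\<^sub>R g x) \<in> borel_measurable lebesgue"
        by (auto simp: set_integrable_def)
    qed
    finally show "f t - f s = (LINT r:{s..t}|lebesgue. g r)" by simp
  qed
qed

text \<open>Absolute continuity in integrated form. For an open interval S only local integrability
  of f is implied; for S = {0..1} integrability up to the end points is included.\<close>

definition primitive_on :: "real set \<Rightarrow> (real \<Rightarrow> real) \<Rightarrow> (real \<Rightarrow> real) \<Rightarrow> bool" where
  "primitive_on S F f \<longleftrightarrow> (\<forall>s\<in>S. \<forall>t\<in>S. s \<le> t \<longrightarrow>
     set_integrable lebesgue {s..t} f \<and> F t - F s = (LINT r:{s..t}|lebesgue. f r))"

lemma primitive_onD:
  assumes "primitive_on S F f" "s \<in> S" "t \<in> S" "s \<le> t"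
  shows "set_integrable lebesgue {s..t} f" "F t - F s = (LINT r:{s..t}|lebesgue. f r)"
  using assms by (auto simp: primitive_on_def)

lemma primitive_on_subset: "primitive_on S F f \<Longrightarrow> R \<subseteq> S \<Longrightarrow> primitive_on R F f"
  unfolding primitive_on_def by blast

lemma set_integral_Icc_combine:
  fixes f :: "real \<Rightarrow> real"
  assumes "set_integrable lebesgue {a..c} f" "a \<le> b" "b \<le> c"
  shows "(LINT x:{a..b}|lebesgue. f x) + (LINT x:{b..c}|lebesgue. f x) = (LINT x:{a..c}|lebesgue. f x)"
proof -
  have "set_integrable lebesgue {a..b} f" "set_integrable lebesgue {b..c} f"
    using assms by (auto intro: set_integrable_subset)
  then show ?thesis
    using assms Henstock_Kurzweil_Integration.integral_combine[of a b c f]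
      set_lebesgue_integral_eq_integral[of "{a..b}" f] set_lebesgue_integral_eq_integral[of "{b..c}" f]
      set_lebesgue_integral_eq_integral[of "{a..c}" f] by simp
qed

text \<open>A base point c outside the null set is fixed and g is integrated from it, with the sign
  reversed to the left of c. The increments then agree with those of f off the null set.\<close>

lemma primitive_on_exists:
  fixes f g :: "real \<Rightarrow> real"
  assumes "\<alpha> < \<beta>" and g: "\<And>p q. \<alpha> < p \<Longrightarrow> q < \<beta> \<Longrightarrow> set_integrable lebesgue {p..q} g"
    and N: "negligible N"
    "\<And>s t. s \<notin> N \<Longrightarrow> t \<notin> N \<Longrightarrow> \<alpha> < s \<Longrightarrow> s < t \<Longrightarrow> t < \<beta> \<Longrightarrow> f t - f s = (LINT r:{s..t}|lebesgue. g r)"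
  obtains F where "primitive_on {\<alpha><..<\<beta>} F g" "\<And>x. x \<in> {\<alpha><..<\<beta>} \<Longrightarrow> x \<notin> N \<Longrightarrow> F x = f x"
proof -
  have "\<not> {\<alpha><..<\<beta>} \<subseteq> N"
    using N(1) negligible_subset[of N "{\<alpha><..<\<beta>}"] open_not_negligible[of "{\<alpha><..<\<beta>}"] assms(1) by auto
  then obtain c where c: "c \<notin> N" "\<alpha> < c" "c < \<beta>"
    by (meson greaterThanLessThan_iff subsetI)
  define F where "F t = f c + (if c \<le> t then (LINT r:{c..t}|lebesgue. g r) else - (LINT r:{t..c}|lebesgue. g r))" for t
  have null: "(LINT r:{c..c}|lebesgue. g r) = 0"
    unfolding set_lebesgue_integral_def
    by (rule integral_eq_zero_AE, rule AE_mp[OF AE_completion[OF AE_lborel_singleton[of c]]]) auto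
  show thesis
  proof (rule that[of F])
    show "primitive_on {\<alpha><..<\<beta>} F g"
      unfolding primitive_on_def
    proof (intro ballI impI conjI)
      fix s t assume st: "s \<in> {\<alpha><..<\<beta>}" "t \<in> {\<alpha><..<\<beta>}" "s \<le> t"
      then show "set_integrable lebesgue {s..t} g" by (intro g) auto
      consider "c \<le> s" | "s < c" "c \<le> t" | "t < c" by linarith
      then show "F t - F s = (LINT r:{s..t}|lebesgue. g r)"
      proof cases
        case 1
        then show ?thesis using st c set_integral_Icc_combine[OF g, of c t s] by (auto simp: F_def)
      next
        case 2
        then show ?thesis using st c set_integral_Icc_combine[OF g, of s t c] by (auto simp: F_def)
      next
        case 3
        then show ?thesis using st c set_integral_Icc_combine[OF g, of s c t] by (auto simp: F_def)
      qed
    qed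
    fix x assume x: "x \<in> {\<alpha><..<\<beta>}" "x \<notin> N"
    then show "F x = f x"
      using N(2)[of x c] N(2)[of c x] c null by (cases x c rule: linorder_cases) (auto simp: F_def)
  qed
qed

text \<open>This representative carries every pointwise statement made later about weakly
  differentiable functions: end values, integration by parts and uniqueness of the
  derivative.\<close>

lemma has_weak_deriv_primitive:
  assumes "has_weak_deriv {\<alpha><..<\<beta>} f g" "\<alpha> < \<beta>"
  obtains F where "primitive_on {\<alpha><..<\<beta>} F g" "AE x in lebesgue. x \<in> {\<alpha><..<\<beta>} \<longrightarrow> F x = f x"
proof -
  have f: "\<And>p q. \<alpha> < p \<Longrightarrow> q < \<beta> \<Longrightarrow> set_integrable lebesgue {p..q} f"
    and g: "\<And>p q. \<alpha> < p \<Longrightarrow> q < \<beta> \<Longrightarrow> set_integrable lebesgue {p..q} g"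
  proof -
    fix p q assume "\<alpha> < p" "q < \<beta>"
    then have "compact {p..q}" "{p..q} \<subseteq> {\<alpha><..<\<beta>}" by auto
    then show "set_integrable lebesgue {p..q} f" "set_integrable lebesgue {p..q} g"
      using assms(1) unfolding has_weak_deriv_def locally_integrable_def by blast+
  qed
  have test: "(LINT x|lebesgue_on {\<alpha><..<\<beta>}. f x * deriv (hump (real (Suc n)) p d (1 / real (Suc j))) x) =
      - (LINT x|lebesgue_on {\<alpha><..<\<beta>}. g x * hump (real (Suc n)) p d (1 / real (Suc j)) x)"
    if "\<alpha> < p" "0 < d" "p + d + 1 / real (Suc j) < \<beta>" for n p d j
  proof -
    have "test_fun {\<alpha><..<\<beta>} (hump (real (Suc n)) p d (1 / real (Suc j)))"
      by (rule test_fun_hump) (use that in auto)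
    then show ?thesis using assms(1) by (simp add: has_weak_deriv_def)
  qed
  obtain N where N: "negligible N"
    "\<And>s t. s \<notin> N \<Longrightarrow> t \<notin> N \<Longrightarrow> \<alpha> < s \<Longrightarrow> s < t \<Longrightarrow> t < \<beta> \<Longrightarrow> f t - f s = (LINT r:{s..t}|lebesgue. g r)"
    using du_bois_reymond[OF f g test] by blast
  obtain F where F: "primitive_on {\<alpha><..<\<beta>} F g" "\<And>x. x \<in> {\<alpha><..<\<beta>} \<Longrightarrow> x \<notin> N \<Longrightarrow> F x = f x"
    using primitive_on_exists[OF assms(2) g N] by blast
  have "AE x in lebesgue. x \<in> {\<alpha><..<\<beta>} \<longrightarrow> F x = f x"
    by (rule AE_I'[of N]) (use N(1) F(2) in \<open>auto simp: negligible_iff_null_sets\<close>)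
  with F(1) show thesis using that by blast
qed

section \<open>Continuity, one-sided derivatives and uniqueness of primitives\<close>

lemma primitive_on_continuous:
  assumes "primitive_on {c..d} F f"
  shows "continuous_on {c..d} F"
proof (cases "c \<le> d")
  case True
  have F: "F x = F c + integral {c..x} f" if "x \<in> {c..d}" for x
    using primitive_onD[OF assms, of c x] that set_lebesgue_integral_eq_integral[of "{c..x}" f] by auto
  have "f integrable_on {c..d}"
    using primitive_onD[OF assms, of c d] True set_lebesgue_integral_eq_integral[of "{c..d}" f] by auto
  then have "continuous_on {c..d} (\<lambda>x. F c + integral {c..x} f)"
    by (intro continuous_intros indefinite_integral_continuous_1)
  then show ?thesis
    by (rule continuous_on_eq) (rule F[symmetric])
qed simp

lemma primitive_on_open_continuous:
  assumes "primitive_on {\<alpha><..<\<beta>} F f"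
  shows "continuous_on {\<alpha><..<\<beta>} F"
proof (intro continuous_at_imp_continuous_on ballI)
  fix x assume x: "x \<in> {\<alpha><..<\<beta>}"
  define c d where "c = (\<alpha> + x) / 2" and "d = (x + \<beta>) / 2"
  have "continuous_on {c..d} F"
    by (rule primitive_on_continuous[OF primitive_on_subset[OF assms]]) (use x in \<open>auto simp: c_def d_def\<close>)
  moreover have "x \<in> interior {c..d}" using x by (auto simp: c_def d_def)
  ultimately show "isCont F x" by (rule continuous_on_interior)
qed

lemma primitive_on_AE_right_deriv:
  assumes "primitive_on {\<alpha><..<\<beta>} F f"
  shows "AE x in lebesgue. x \<in> {\<alpha><..<\<beta>} \<longrightarrow> ((\<lambda>h. (F (x + h) - F x) / h) \<longlongrightarrow> f x) (at_right 0)"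
proof -
  have int: "set_integrable lebesgue {p..q} f" if "\<alpha> < p" "q < \<beta>" for p q
  proof (cases "p \<le> q")
    case True
    then show ?thesis using primitive_onD(1)[OF assms, of p q] that by auto
  next
    case False
    then have "{p..q} = {}" by auto
    then show ?thesis by (simp add: set_integrable_def)
  qed
  obtain N where N: "negligible N" "\<And>x. x \<in> {\<alpha><..<\<beta>} \<Longrightarrow> x \<notin> N \<Longrightarrow>
     ((\<lambda>h. (LINT r:{x..x+h}|lebesgue. f r) / h) \<longlongrightarrow> f x) (at_right 0)"
    using AE_right_average[OF int] by blast
  have "((\<lambda>h. (F (x + h) - F x) / h) \<longlongrightarrow> f x) (at_right 0)" if x: "x \<in> {\<alpha><..<\<beta>}" "x \<notin> N" for x
  proof (rule Lim_transform_eventually[OF N(2)[OF x]])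
    have "(LINT r:{x..x+h}|lebesgue. f r) / h = (F (x + h) - F x) / h" if "0 < h" "h < \<beta> - x" for h
      using primitive_onD(2)[OF assms, of x "x + h"] x that by auto
    then show "\<forall>\<^sub>F h in at_right 0. (LINT r:{x..x+h}|lebesgue. f r) / h = (F (x + h) - F x) / h"
      using x by (auto simp: eventually_at_right_field intro!: exI[of _ "\<beta> - x"])
  qed
  then show ?thesis
    using N(1) by (intro AE_I'[of N]) (auto simp: negligible_iff_null_sets)
qed

text \<open>Two continuous functions that agree almost everywhere agree, because a nonempty open set
  is not null. The densities are then recovered almost everywhere as right derivatives.\<close>

lemma primitive_on_unique:
  assumes "primitive_on {\<alpha><..<\<beta>} F f" "primitive_on {\<alpha><..<\<beta>} G g"
    and "AE x in lebesgue. x \<in> {\<alpha><..<\<beta>} \<longrightarrow> F x = G x"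
  shows "AE x in lebesgue. x \<in> {\<alpha><..<\<beta>} \<longrightarrow> f x = g x" "\<And>x. x \<in> {\<alpha><..<\<beta>} \<Longrightarrow> F x = G x"
proof -
  show eq: "F x = G x" if x: "x \<in> {\<alpha><..<\<beta>}" for x
  proof -
    have "{x \<in> {\<alpha><..<\<beta>}. F x - G x \<noteq> 0} = {}"
    proof (rule ccontr)
      assume "{x \<in> {\<alpha><..<\<beta>}. F x - G x \<noteq> 0} \<noteq> {}"
      moreover have "open {x \<in> {\<alpha><..<\<beta>}. F x - G x \<noteq> 0}"
      proof -
        have "continuous_on {\<alpha><..<\<beta>} (\<lambda>x. F x - G x)"
          using assms(1,2) by (intro continuous_intros primitive_on_open_continuous)
        from continuous_open_preimage[OF this open_greaterThanLessThan, of "- {0}"]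
        have "open ({\<alpha><..<\<beta>} \<inter> (\<lambda>x. F x - G x) -` (- {0}))" by auto
        then show ?thesis by (simp add: vimage_def Int_def)
      qed
      ultimately have "\<not> negligible {x \<in> {\<alpha><..<\<beta>}. F x - G x \<noteq> 0}"
        using open_not_negligible by blast
      moreover have "negligible {x \<in> {\<alpha><..<\<beta>}. F x - G x \<noteq> 0}"
        using assms(3) by (auto simp: eventually_ae_filter negligible_iff_null_sets[symmetric] elim!: negligible_subset)
      ultimately show False by simp
    qed
    then show ?thesis using x by auto
  qed
  show "AE x in lebesgue. x \<in> {\<alpha><..<\<beta>} \<longrightarrow> f x = g x"
    using primitive_on_AE_right_deriv[OF assms(1)] primitive_on_AE_right_deriv[OF assms(2)]
  proof eventually_elim
    case (elim x)
    show ?case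
    proof
      assume x: "x \<in> {\<alpha><..<\<beta>}"
      have "\<forall>\<^sub>F h in at_right 0. (F (x + h) - F x) / h = (G (x + h) - G x) / h"
        unfolding eventually_at_right_field using x eq by (intro exI[of _ "\<beta> - x"]) auto
      with elim x have "((\<lambda>h. (G (x + h) - G x) / h) \<longlongrightarrow> f x) (at_right 0)"
        by (blast intro: Lim_transform_eventually)
      with elim x show "f x = g x" by (intro tendsto_unique[of "at_right 0"]) auto
    qed
  qed
qed

lemma has_weak_deriv_unique:
  assumes "has_weak_deriv {\<alpha><..<\<beta>} f g" "has_weak_deriv {\<alpha><..<\<beta>} f g'" "\<alpha> < \<beta>"
  shows "AE x in lebesgue. x \<in> {\<alpha><..<\<beta>} \<longrightarrow> g x = g' x"
proof -
  obtain F where F: "primitive_on {\<alpha><..<\<beta>} F g" "AE x in lebesgue. x \<in> {\<alpha><..<\<beta>} \<longrightarrow> F x = f x"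
    using has_weak_deriv_primitive[OF assms(1,3)] by blast
  obtain F' where F': "primitive_on {\<alpha><..<\<beta>} F' g'" "AE x in lebesgue. x \<in> {\<alpha><..<\<beta>} \<longrightarrow> F' x = f x"
    using has_weak_deriv_primitive[OF assms(2,3)] by blast
  show ?thesis
    by (rule primitive_on_unique(1)[OF F(1) F'(1)]) (use F(2) F'(2) in eventually_elim, auto)
qed

text \<open>Fubini's theorem is applied on the product of Borel measures, so a density that is
  measurable for the completed measure is first exchanged for a Borel one.\<close>

lemma set_integrable_lborel_version:
  fixes f :: "real \<Rightarrow> real"
  assumes "set_integrable lebesgue A f"
  obtains f' where "integrable lborel f'" "AE x in lebesgue. indicator A x * f x = f' x"
proof -
  have f: "integrable lebesgue (\<lambda>x. indicator A x * f x)"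
    using assms by (simp add: set_integrable_def)
  then obtain f' where f': "f' \<in> borel_measurable lborel" "AE x in lborel. indicator A x * f x = f' x"
    using completion_ex_borel_measurable_real[of "\<lambda>x. indicator A x * f x" lborel] by auto
  then have ae: "AE x in lebesgue. indicator A x * f x = f' x" by (simp add: AE_completion)
  have "integrable lebesgue f'"
    using f by (rule integrable_cong_AE_imp) (use f' ae in \<open>auto intro: measurable_completion\<close>)
  then have "integrable lborel f'" using f' by (simp add: integrable_completion)
  then show thesis using ae by (rule that)
qed

lemma integral_pair_snd:
  fixes h :: "real \<times> real \<Rightarrow> real"
  assumes "integrable (lborel \<Otimes>\<^sub>M lborel) h"
  shows "integral\<^sup>L (lborel \<Otimes>\<^sub>M lborel) h = (\<integral>y. (\<integral>x. h (x, y) \<partial>lborel) \<partial>lborel)"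
  using lborel_pair.integral_snd[of "\<lambda>x y. h (x, y)"] assms by simp

text \<open>Fubini's theorem for \<open>f(x) g(y)\<close> on the two triangles of \<open>[c,d]\<^sup>2\<close>.\<close>

lemma primitive_on_by_parts:
  assumes F: "primitive_on {c..d} F f" and G: "primitive_on {c..d} G g" and cd: "c \<le> d"
  shows "F d * G d - F c * G c = (LINT x:{c..d}|lebesgue. f x * G x) + (LINT x:{c..d}|lebesgue. F x * g x)"
    and "set_integrable lebesgue {c..d} (\<lambda>x. f x * G x)"
    and "set_integrable lebesgue {c..d} (\<lambda>x. F x * g x)"
proof -
  have prod: "set_integrable lebesgue {c..d} (\<lambda>x. f x * G x)"
    if "primitive_on {c..d} F f" "primitive_on {c..d} G g" for F f G g
  proof -
    have "continuous_on {c..d} G" using that(2) by (rule primitive_on_continuous)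
    then have G: "G \<in> borel_measurable (lebesgue_on {c..d})" "bounded (G ` {c..d})"
      by (auto intro!: continuous_imp_measurable_on_sets_lebesgue compact_imp_bounded compact_continuous_image)
    have "(\<lambda>x. G x * f x) absolutely_integrable_on {c..d}"
      using primitive_onD(1)[OF that(1), of c d] cd
      by (intro absolutely_integrable_bounded_measurable_product_real G) auto
    then show ?thesis by (simp add: mult.commute)
  qed
  show i1: "set_integrable lebesgue {c..d} (\<lambda>x. f x * G x)" using F G by (rule prod)
  show i2: "set_integrable lebesgue {c..d} (\<lambda>x. F x * g x)" using prod[OF G F] by (simp add: mult.commute)
  obtain f' where f': "integrable lborel f'" "AE x in lebesgue. indicator {c..d} x * f x = f' x"
    using set_integrable_lborel_version primitive_onD(1)[OF F, of c d] cd by auto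
  obtain g' where g': "integrable lborel g'" "AE x in lebesgue. indicator {c..d} x * g x = g' x"
    using set_integrable_lborel_version primitive_onD(1)[OF G, of c d] cd by auto
  have [measurable]: "f' \<in> borel_measurable borel" "g' \<in> borel_measurable borel"
    using f' g' by auto
  \<comment> \<open>The diagonal belongs to only one of the two triangles, so both the closed and
    the open half line occur. They give the same increment because points are null.\<close>
  have inc: "(\<integral>y. indicator {..x} y * h' y \<partial>lborel) = H x - H c" "(\<integral>y. indicator {..<x} y * h' y \<partial>lborel) = H x - H c"
    if H: "primitive_on {c..d} H h" and h': "integrable lborel h'" "AE x in lebesgue. indicator {c..d} x * h x = h' x"
      and x: "x \<in> {c..d}" for H h h' x
  proof -
    have *: "(\<integral>y. indicator A y * h' y \<partial>lborel) = H x - H c" if A: "A = {..x} \<or> A = {..<x}" for A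
    proof -
      have [measurable]: "A \<in> sets borel" using A by auto
      have hm: "(\<lambda>y. indicator A y * h' y) \<in> borel_measurable lborel"
        using h'(1) by measurable
      have "AE y in lebesgue. y \<noteq> x"
        using AE_completion[OF AE_lborel_singleton[of x]] .
      then have "AE y in lebesgue. indicator {c..x} y *\<^sub>R h y = indicator A y * h' y"
        using h'(2)
      proof eventually_elim
        case (elim y)
        then show ?case using x A by (auto simp: indicator_def split: if_splits)
      qed
      then have "(LINT y:{c..x}|lebesgue. h y) = (\<integral>y. indicator A y * h' y \<partial>lebesgue)"
        unfolding set_lebesgue_integral_def
        by (rule integral_cong_AE[rotated -1])
          (use primitive_onD(1)[OF H, of c x] x hm in \<open>auto simp: set_integrable_def intro: measurable_completion\<close>)
      also have "\<dots> = (\<integral>y. indicator A y * h' y \<partial>lborel)"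
        using hm by (rule integral_completion)
      finally show ?thesis using primitive_onD(2)[OF H, of c x] x by simp
    qed
    show "(\<integral>y. indicator {..x} y * h' y \<partial>lborel) = H x - H c" "(\<integral>y. indicator {..<x} y * h' y \<partial>lborel) = H x - H c"
      using *[of "{..x}"] *[of "{..<x}"] by auto
  qed
  have fg: "integrable (lborel \<Otimes>\<^sub>M lborel) (\<lambda>(x, y). f' x * g' y)"
    using f'(1) g'(1)
    by (intro lborel_pair.Fubini_integrable) (auto simp: abs_mult)
  have zero: "AE x in lborel. x \<notin> {c..d} \<longrightarrow> f' x = 0 \<and> g' x = 0"
  proof -
    have "AE x in lebesgue. x \<notin> {c..d} \<longrightarrow> f' x = 0 \<and> g' x = 0"
      using f'(2) g'(2) by eventually_elim (auto simp: indicator_def)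
    then show ?thesis by (simp add: AE_completion_iff)
  qed
  have total: "(\<integral>y. h' y \<partial>lborel) = H d - H c"
    if H: "primitive_on {c..d} H h" and h': "integrable lborel h'" "AE x in lebesgue. indicator {c..d} x * h x = h' x" for H h h'
  proof -
    have "AE x in lborel. h' x = indicator {..d} x * h' x"
    proof -
      have "AE x in lebesgue. h' x = indicator {..d} x * h' x"
        using h'(2) by eventually_elim (auto simp: indicator_def split: if_splits)
      then show ?thesis by (simp add: AE_completion_iff)
    qed
    then have "(\<integral>y. h' y \<partial>lborel) = (\<integral>y. indicator {..d} y * h' y \<partial>lborel)"
      using h'(1) by (intro integral_cong_AE) auto
    then show ?thesis using inc(1)[OF H h', of d] cd by simp
  qed
  let ?A = "\<lambda>z::real \<times> real. indicator {z. snd z \<le> fst z} z *\<^sub>R (case z of (x, y) \<Rightarrow> f' x * g' y)"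
  let ?B = "\<lambda>z::real \<times> real. indicator {z. fst z < snd z} z *\<^sub>R (case z of (x, y) \<Rightarrow> f' x * g' y)"
  have [measurable]: "{z :: real \<times> real. snd z \<le> fst z} \<in> sets (borel \<Otimes>\<^sub>M borel)"
    "{z :: real \<times> real. fst z < snd z} \<in> sets (borel \<Otimes>\<^sub>M borel)"
    unfolding borel_prod
    by (intro borel_closed borel_open closed_Collect_le open_Collect_less continuous_intros)+
  have A: "integrable (lborel \<Otimes>\<^sub>M lborel) ?A" and B: "integrable (lborel \<Otimes>\<^sub>M lborel) ?B"
    by (rule integrable_mult_indicator[OF _ fg]; simp)+
  have "(F d - F c) * (G d - G c) = (\<integral>x. f' x \<partial>lborel) * (\<integral>y. g' y \<partial>lborel)"
    by (simp add: total[OF F f'] total[OF G g'])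
  also have "\<dots> = (\<integral>x. (\<integral>y. f' x * g' y \<partial>lborel) \<partial>lborel)" by simp
  also have "\<dots> = (\<integral>z. (case z of (x, y) \<Rightarrow> f' x * g' y) \<partial>(lborel \<Otimes>\<^sub>M lborel))"
    using lborel_pair.integral_fst'[OF fg] by simp
  also have "\<dots> = (\<integral>z. ?A z + ?B z \<partial>(lborel \<Otimes>\<^sub>M lborel))"
    by (intro Bochner_Integration.integral_cong refl) (auto simp: indicator_def not_le)
  also have "\<dots> = (\<integral>z. ?A z \<partial>(lborel \<Otimes>\<^sub>M lborel)) + (\<integral>z. ?B z \<partial>(lborel \<Otimes>\<^sub>M lborel))"
    using A B by (rule Bochner_Integration.integral_add)
  also have "(\<integral>z. ?A z \<partial>(lborel \<Otimes>\<^sub>M lborel)) = (\<integral>x. (\<integral>y. ?A (x, y) \<partial>lborel) \<partial>lborel)"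
    using lborel_pair.integral_fst'[OF A] by simp
  also have "\<dots> = (\<integral>x. f' x * (\<integral>y. indicator {..x} y * g' y \<partial>lborel) \<partial>lborel)"
  proof (intro Bochner_Integration.integral_cong refl)
    fix x
    have "(\<integral>y. ?A (x, y) \<partial>lborel) = (\<integral>y. f' x * (indicator {..x} y * g' y) \<partial>lborel)"
      by (intro Bochner_Integration.integral_cong refl) (auto simp: indicator_def)
    then show "(\<integral>y. ?A (x, y) \<partial>lborel) = f' x * (\<integral>y. indicator {..x} y * g' y \<partial>lborel)" by simp
  qed
  also have "\<dots> = (LINT x:{c..d}|lebesgue. f x * (G x - G c))"
  proof -
    have m: "(\<lambda>x. f' x * (\<integral>y. indicator {..x} y * g' y \<partial>lborel)) \<in> borel_measurable lborel"
    proof -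
      have "(\<lambda>(x, y). indicator {z. snd z \<le> fst z} (x, y) * g' y) \<in> borel_measurable (lborel \<Otimes>\<^sub>M lborel)"
        by measurable
      from lborel.borel_measurable_lebesgue_integral[OF this]
      have "(\<lambda>x. \<integral>y. indicator {z. snd z \<le> fst z} (x, y) * g' y \<partial>lborel) \<in> borel_measurable lborel" by simp
      then have "(\<lambda>x. \<integral>y. indicator {..x} y * g' y \<partial>lborel) \<in> borel_measurable lborel" by (simp add: indicator_def)
      then show ?thesis by measurable
    qed
    have "AE x in lebesgue. indicator {c..d} x *\<^sub>R (f x * (G x - G c)) = f' x * (\<integral>y. indicator {..x} y * g' y \<partial>lborel)"
      using f'(2)
    proof eventually_elim
      case (elim x)
      then show ?case using inc(1)[OF G g', of x] by (auto simp: indicator_def split: if_splits)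
    qed
    moreover have "set_integrable lebesgue {c..d} (\<lambda>x. f x * (G x - G c))"
      using i1 primitive_onD(1)[OF F, of c d] cd by (simp add: right_diff_distrib)
    ultimately show ?thesis
      unfolding set_lebesgue_integral_def set_integrable_def
      using m by (subst integral_completion[symmetric], simp)
        (rule integral_cong_AE[symmetric], auto intro: measurable_completion)
  qed
  also have "(\<integral>z. ?B z \<partial>(lborel \<Otimes>\<^sub>M lborel)) = (\<integral>y. (\<integral>x. ?B (x, y) \<partial>lborel) \<partial>lborel)"
    using B by (rule integral_pair_snd)
  also have "\<dots> = (\<integral>y. (\<integral>x. indicator {..<y} x * f' x \<partial>lborel) * g' y \<partial>lborel)"
  proof (intro Bochner_Integration.integral_cong refl)
    fix y
    have "(\<integral>x. ?B (x, y) \<partial>lborel) = (\<integral>x. (indicator {..<y} x * f' x) * g' y \<partial>lborel)"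
      by (intro Bochner_Integration.integral_cong refl) (auto simp: indicator_def)
    then show "(\<integral>x. ?B (x, y) \<partial>lborel) = (\<integral>x. indicator {..<y} x * f' x \<partial>lborel) * g' y" by simp
  qed
  also have "\<dots> = (LINT x:{c..d}|lebesgue. (F x - F c) * g x)"
  proof -
    have m: "(\<lambda>x. (\<integral>y. indicator {..<x} y * f' y \<partial>lborel) * g' x) \<in> borel_measurable lborel"
    proof -
      have [measurable]: "{z :: real \<times> real. snd z < fst z} \<in> sets (borel \<Otimes>\<^sub>M borel)"
        unfolding borel_prod by (intro borel_open open_Collect_less continuous_intros)
      have "(\<lambda>(x, y). indicator {z. snd z < fst z} (x, y) * f' y) \<in> borel_measurable (lborel \<Otimes>\<^sub>M lborel)"
        by measurable
      from lborel.borel_measurable_lebesgue_integral[OF this]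
      have "(\<lambda>x. \<integral>y. indicator {z. snd z < fst z} (x, y) * f' y \<partial>lborel) \<in> borel_measurable lborel" by simp
      then have "(\<lambda>x. \<integral>y. indicator {..<x} y * f' y \<partial>lborel) \<in> borel_measurable lborel" by (simp add: indicator_def)
      then show ?thesis by measurable
    qed
    have "AE x in lebesgue. indicator {c..d} x *\<^sub>R ((F x - F c) * g x) = (\<integral>y. indicator {..<x} y * f' y \<partial>lborel) * g' x"
      using g'(2)
    proof eventually_elim
      case (elim x)
      then show ?case using inc(2)[OF F f', of x] by (auto simp: indicator_def split: if_splits)
    qed
    moreover have "set_integrable lebesgue {c..d} (\<lambda>x. (F x - F c) * g x)"
      using i2 primitive_onD(1)[OF G, of c d] cd by (simp add: left_diff_distrib)
    ultimately show ?thesis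
      unfolding set_lebesgue_integral_def set_integrable_def
      using m by (subst integral_completion[symmetric], simp)
        (rule integral_cong_AE[symmetric], auto intro: measurable_completion)
  qed
  finally have "(F d - F c) * (G d - G c) =
      (LINT x:{c..d}|lebesgue. f x * (G x - G c)) + (LINT x:{c..d}|lebesgue. (F x - F c) * g x)" .
  also have "(LINT x:{c..d}|lebesgue. f x * (G x - G c)) = (LINT x:{c..d}|lebesgue. f x * G x) - (F d - F c) * G c"
    using i1 primitive_onD[OF F, of c d] cd by (simp add: right_diff_distrib set_integral_diff)
  also have "(LINT x:{c..d}|lebesgue. (F x - F c) * g x) = (LINT x:{c..d}|lebesgue. F x * g x) - F c * (G d - G c)"
    using i2 primitive_onD[OF G, of c d] cd by (simp add: left_diff_distrib set_integral_diff)
  finally show "F d * G d - F c * G c = (LINT x:{c..d}|lebesgue. f x * G x) + (LINT x:{c..d}|lebesgue. F x * g x)"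
    by (simp add: algebra_simps)
qed

section \<open>Square integrable functions and Steklov means\<close>

lemma integrable_mult_L2:
  fixes f g :: "'a \<Rightarrow> real"
  assumes [measurable]: "f \<in> borel_measurable M" "g \<in> borel_measurable M"
    and f: "integrable M (\<lambda>x. (f x)\<^sup>2)" and g: "integrable M (\<lambda>x. (g x)\<^sup>2)"
  shows "integrable M (\<lambda>x. f x * g x)"
proof (rule Bochner_Integration.integrable_bound)
  show "integrable M (\<lambda>x. (f x)\<^sup>2 + (g x)\<^sup>2)" using f g by simp
  have "\<bar>a * b\<bar> \<le> a\<^sup>2 + b\<^sup>2" for a b :: real
    using sum_squares_bound[of "\<bar>a\<bar>" "\<bar>b\<bar>"] mult_nonneg_nonneg[of "\<bar>a\<bar>" "\<bar>b\<bar>"]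
    unfolding abs_mult power2_abs mult.assoc by linarith
  then show "AE x in M. norm (f x * g x) \<le> norm ((f x)\<^sup>2 + (g x)\<^sup>2)" by auto
qed auto

lemma integrable_add_sq:
  fixes f g :: "'a \<Rightarrow> real"
  assumes "f \<in> borel_measurable M" "g \<in> borel_measurable M"
    and "integrable M (\<lambda>x. (f x)\<^sup>2)" and "integrable M (\<lambda>x. (g x)\<^sup>2)"
  shows "integrable M (\<lambda>x. (f x + g x)\<^sup>2)" "integrable M (\<lambda>x. (f x - g x)\<^sup>2)"
  using assms integrable_mult_L2[OF assms] by (auto simp: power2_sum power2_diff mult.assoc)

text \<open>Young's inequality with a free parameter d, which takes the place of the Cauchy-Schwarz
  inequality below. The factor 1/2 is given away.\<close>

lemma integral_mult_L2_le:
  fixes f g :: "'a \<Rightarrow> real"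
  assumes "f \<in> borel_measurable M" "g \<in> borel_measurable M"
    and f: "integrable M (\<lambda>x. (f x)\<^sup>2)" and g: "integrable M (\<lambda>x. (g x)\<^sup>2)" and d: "d > 0"
  shows "\<bar>\<integral>x. f x * g x \<partial>M\<bar> \<le> d * (\<integral>x. (f x)\<^sup>2 \<partial>M) + (\<integral>x. (g x)\<^sup>2 \<partial>M) / d"
proof -
  have "\<bar>a * b\<bar> \<le> d * a\<^sup>2 + b\<^sup>2 / d" for a b
  proof -
    have "0 \<le> (d * \<bar>a\<bar> - \<bar>b\<bar>)\<^sup>2" by simp
    then have "2 * d * (\<bar>a\<bar> * \<bar>b\<bar>) \<le> d\<^sup>2 * a\<^sup>2 + b\<^sup>2"
      by (simp add: power2_diff power_mult_distrib algebra_simps)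
    moreover have "d * (\<bar>a\<bar> * \<bar>b\<bar>) \<le> 2 * d * (\<bar>a\<bar> * \<bar>b\<bar>)" using d by simp
    ultimately have "d * (\<bar>a\<bar> * \<bar>b\<bar>) \<le> d\<^sup>2 * a\<^sup>2 + b\<^sup>2" by linarith
    then show ?thesis using d by (simp add: abs_mult field_simps power2_eq_square)
  qed
  then have "(\<integral>x. norm (f x * g x) \<partial>M) \<le> (\<integral>x. d * (f x)\<^sup>2 + (g x)\<^sup>2 / d \<partial>M)"
    using integrable_mult_L2[OF assms(1-4)] f g by (intro integral_mono) auto
  then have "norm (\<integral>x. f x * g x \<partial>M) \<le> (\<integral>x. d * (f x)\<^sup>2 + (g x)\<^sup>2 / d \<partial>M)"
    by (rule order_trans[OF integral_norm_bound])
  then show ?thesis using f g by simp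
qed

text \<open>If g is the time derivative of z, this forward mean is the difference quotient of z with
  step 1/n. That is how it enters the energy inequality.\<close>

definition steklov :: "real \<Rightarrow> ('a \<times> real \<Rightarrow> real) \<Rightarrow> 'a \<times> real \<Rightarrow> real" where
  "steklov n g z = n * (\<integral>r. indicator {snd z..snd z + 1 / n} r * g (fst z, r) \<partial>lborel)"

lemma steklov_measurable [measurable]:
  assumes [measurable]: "g \<in> borel_measurable (M \<Otimes>\<^sub>M lborel)"
  shows "steklov n g \<in> borel_measurable (M \<Otimes>\<^sub>M lborel)"
proof -
  have [measurable]: "Measurable.pred (((M \<Otimes>\<^sub>M lborel)) \<Otimes>\<^sub>M lborel) (\<lambda>w::('a \<times> real) \<times> real. snd w \<in> {snd (fst w)..snd (fst w) + 1 / n})"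
    unfolding atLeastAtMost_iff by measurable
  have "(\<lambda>(z, r). indicator {snd z..snd z + 1 / n} r * g (fst z, r)) \<in> borel_measurable ((M \<Otimes>\<^sub>M lborel) \<Otimes>\<^sub>M lborel)"
    unfolding split_beta' indicator_def by measurable
  from lborel.borel_measurable_lebesgue_integral[OF this] show ?thesis
    unfolding steklov_def by measurable
qed

lemma steklov_sq_le:
  assumes [measurable]: "(\<lambda>r. g (x, r)) \<in> borel_measurable lborel" and n: "n > 0"
  shows "ennreal ((steklov n g (x, t))\<^sup>2) \<le> ennreal n * (\<integral>\<^sup>+r. indicator {t..t+1/n} r * ennreal ((g (x, r))\<^sup>2) \<partial>lborel)"
proof -
  let ?I = "\<integral>r. indicator {t..t + 1 / n} r * g (x, r) \<partial>lborel"
  have "ennreal \<bar>?I\<bar> \<le> (\<integral>\<^sup>+r. indicator {t..t+1/n} r * ennreal \<bar>g (x, r)\<bar> \<partial>lborel)" (is "_ \<le> ?J")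
  proof (cases "integrable lborel (\<lambda>r. indicator {t..t + 1 / n} r * g (x, r))")
    case True
    have "ennreal \<bar>?I\<bar> \<le> (\<integral>\<^sup>+r. ennreal (norm (indicator {t..t + 1 / n} r * g (x, r))) \<partial>lborel)"
      using integral_norm_bound_ennreal[OF True] by simp
    also have "\<dots> = ?J" by (intro nn_integral_cong) (auto simp: indicator_def)
    finally show ?thesis .
  next
    \<comment> \<open>A function that is not integrable has Bochner integral 0, so the bound is
      trivial.\<close>
    case False
    then show ?thesis by (simp add: not_integrable_integral_eq)
  qed
  then have "(ennreal \<bar>?I\<bar>)\<^sup>2 \<le> ?J\<^sup>2" by (rule power_mono) simp
  \<comment> \<open>An indicator equals its square. Splitting off one copy leaves the length 1/n of
    the interval as one factor of the Cauchy-Schwarz inequality.\<close>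
  also have "\<dots> = (\<integral>\<^sup>+r. indicator {t..t+1/n} r * (indicator {t..t+1/n} r * ennreal \<bar>g (x, r)\<bar>) \<partial>lborel)\<^sup>2"
    by (intro arg_cong[where f = "\<lambda>x. x\<^sup>2"] nn_integral_cong) (auto simp: indicator_def)
  also have "\<dots> \<le> (\<integral>\<^sup>+r. (indicator {t..t+1/n} r)\<^sup>2 \<partial>lborel) * (\<integral>\<^sup>+r. (indicator {t..t+1/n} r * ennreal \<bar>g (x, r)\<bar>)\<^sup>2 \<partial>lborel)"
    by (intro Cauchy_Schwarz_nn_integral) measurable
  also have "(\<integral>\<^sup>+r. (indicator {t..t+1/n} r)\<^sup>2 \<partial>lborel) = (\<integral>\<^sup>+r. indicator {t..t+1/n} r \<partial>lborel)"
    by (intro nn_integral_cong) (auto simp: indicator_def)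
  also have "\<dots> = ennreal (1 / n)" using n by simp
  also have "(\<integral>\<^sup>+r. (indicator {t..t+1/n} r * ennreal \<bar>g (x, r)\<bar>)\<^sup>2 \<partial>lborel) =
    (\<integral>\<^sup>+r. indicator {t..t+1/n} r * ennreal ((g (x, r))\<^sup>2) \<partial>lborel)" (is "_ = ?K")
    by (intro nn_integral_cong) (auto simp: indicator_def ennreal_power)
  finally have *: "ennreal (?I\<^sup>2) \<le> ennreal (1 / n) * ?K" by (simp add: ennreal_power)
  have "ennreal ((steklov n g (x, t))\<^sup>2) = ennreal (n\<^sup>2) * ennreal (?I\<^sup>2)"
    using n by (simp add: steklov_def power_mult_distrib ennreal_mult')
  also have "\<dots> \<le> ennreal (n\<^sup>2) * (ennreal (1 / n) * ?K)"
    by (intro mult_left_mono *) simp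
  also have "\<dots> = ennreal n * ?K"
    using n by (simp add: mult.assoc[symmetric] ennreal_mult'[symmetric] power2_eq_square)
  finally show ?thesis .
qed

text \<open>Averaging contracts the L^2 norm: after exchanging the integrals, each r is reached
  exactly by the t in [r - 1/n, r], a set of length 1/n that cancels the factor n.\<close>

lemma steklov_nn_integral_le:
  assumes M: "sigma_finite_measure M" and [measurable]: "g \<in> borel_measurable (M \<Otimes>\<^sub>M lborel)" and n: "n > 0"
  shows "(\<integral>\<^sup>+z. ennreal ((steklov n g z)\<^sup>2) \<partial>(M \<Otimes>\<^sub>M lborel)) \<le> (\<integral>\<^sup>+z. ennreal ((g z)\<^sup>2) \<partial>(M \<Otimes>\<^sub>M lborel))"
proof -
  have "(\<integral>\<^sup>+z. ennreal ((steklov n g z)\<^sup>2) \<partial>(M \<Otimes>\<^sub>M lborel)) = (\<integral>\<^sup>+x. \<integral>\<^sup>+t. ennreal ((steklov n g (x, t))\<^sup>2) \<partial>lborel \<partial>M)"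
    by (subst lborel.nn_integral_fst[symmetric]) simp_all
  also have "\<dots> \<le> (\<integral>\<^sup>+x. \<integral>\<^sup>+t. ennreal n * (\<integral>\<^sup>+r. indicator {t..t+1/n} r * ennreal ((g (x, r))\<^sup>2) \<partial>lborel) \<partial>lborel \<partial>M)"
    by (intro nn_integral_mono steklov_sq_le n) simp
  also have "\<dots> = (\<integral>\<^sup>+x. \<integral>\<^sup>+r. ennreal ((g (x, r))\<^sup>2) \<partial>lborel \<partial>M)"
  proof (rule nn_integral_cong)
    fix x assume x: "x \<in> space M"
    have [measurable]: "(\<lambda>r. g (x, r)) \<in> borel_measurable lborel" using x by simp
    have [measurable]: "Measurable.pred (lborel \<Otimes>\<^sub>M lborel) (\<lambda>w::real \<times> real. snd w \<in> {fst w..fst w + 1 / n})"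
      "Measurable.pred (lborel \<Otimes>\<^sub>M lborel) (\<lambda>w::real \<times> real. fst w \<in> {snd w..snd w + 1 / n})"
      unfolding atLeastAtMost_iff by measurable
    have ind: "case_prod (\<lambda>t r. indicator {t..t+1/n} r * ennreal ((g (x, r))\<^sup>2)) \<in> borel_measurable (lborel \<Otimes>\<^sub>M lborel)"
      unfolding split_beta' indicator_def by measurable
    have "(\<integral>\<^sup>+t. ennreal n * (\<integral>\<^sup>+r. indicator {t..t+1/n} r * ennreal ((g (x, r))\<^sup>2) \<partial>lborel) \<partial>lborel)
        = ennreal n * (\<integral>\<^sup>+t. (\<integral>\<^sup>+r. indicator {t..t+1/n} r * ennreal ((g (x, r))\<^sup>2) \<partial>lborel) \<partial>lborel)"
      by (intro nn_integral_cmult lborel.borel_measurable_nn_integral ind)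
    also have "(\<integral>\<^sup>+t. (\<integral>\<^sup>+r. indicator {t..t+1/n} r * ennreal ((g (x, r))\<^sup>2) \<partial>lborel) \<partial>lborel)
        = (\<integral>\<^sup>+r. (\<integral>\<^sup>+t. indicator {t..t+1/n} r * ennreal ((g (x, r))\<^sup>2) \<partial>lborel) \<partial>lborel)"
      by (rule lborel_pair.Fubini'[OF ind, symmetric])
    also have "\<dots> = (\<integral>\<^sup>+r. ennreal ((g (x, r))\<^sup>2) * ennreal (1 / n) \<partial>lborel)"
    proof (rule nn_integral_cong)
      fix r
      have "(\<integral>\<^sup>+t. indicator {t..t+1/n} r * ennreal ((g (x, r))\<^sup>2) \<partial>lborel)
         = (\<integral>\<^sup>+t. ennreal ((g (x, r))\<^sup>2) * indicator {r-1/n..r} t \<partial>lborel)"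
        by (intro nn_integral_cong) (auto simp: indicator_def)
      also have "\<dots> = ennreal ((g (x, r))\<^sup>2) * ennreal (1 / n)"
        using n by (simp add: nn_integral_cmult_indicator)
      finally show "(\<integral>\<^sup>+t. indicator {t..t+1/n} r * ennreal ((g (x, r))\<^sup>2) \<partial>lborel) = ennreal ((g (x, r))\<^sup>2) * ennreal (1 / n)" .
    qed
    also have "\<dots> = (\<integral>\<^sup>+r. ennreal ((g (x, r))\<^sup>2) \<partial>lborel) * ennreal (1 / n)"
      by (rule nn_integral_multc) measurable
    also have "ennreal n * \<dots> = (\<integral>\<^sup>+r. ennreal ((g (x, r))\<^sup>2) \<partial>lborel)"
      using n by (simp add: mult.left_commute[of "ennreal n"] ennreal_mult'[symmetric])
    finally show "(\<integral>\<^sup>+t. ennreal n * (\<integral>\<^sup>+r. indicator {t..t+1/n} r * ennreal ((g (x, r))\<^sup>2) \<partial>lborel) \<partial>lborel)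
       = (\<integral>\<^sup>+r. ennreal ((g (x, r))\<^sup>2) \<partial>lborel)" .
  qed
  also have "\<dots> = (\<integral>\<^sup>+z. ennreal ((g z)\<^sup>2) \<partial>(M \<Otimes>\<^sub>M lborel))"
    by (subst lborel.nn_integral_fst[symmetric]) simp_all
  finally show ?thesis .
qed

lemma steklov_AE_tendsto_slice:
  fixes g :: "real \<Rightarrow> real"
  assumes [measurable]: "g \<in> borel_measurable lborel" and fin: "(\<integral>\<^sup>+r. ennreal ((g r)\<^sup>2) \<partial>lborel) < \<infinity>"
  shows "AE t in lborel. (\<lambda>n. real (Suc n) * (\<integral>r. indicator {t..t + 1 / real (Suc n)} r * g r \<partial>lborel)) \<longlonglongrightarrow> g t"
proof -
  have sq: "integrable lborel (\<lambda>r. (g r)\<^sup>2)"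
    using fin by (intro integrableI_bounded) auto
  have int: "set_integrable lborel {p..q} g" for p q
  proof -
    have "integrable lborel (indicat_real {p..q})"
      by (intro integrable_real_indicator) (auto simp: emeasure_lborel_Icc_eq)
    moreover have "(\<lambda>r. (indicat_real {p..q} r)\<^sup>2) = indicat_real {p..q}"
      by (auto simp: indicator_def)
    ultimately show ?thesis
      unfolding set_integrable_def using sq by (simp add: integrable_mult_L2)
  qed
  then have int': "set_integrable lebesgue {p..q} g" for p q
    unfolding set_integrable_def by (subst integrable_completion) (auto simp: set_integrable_def)
  have "AE t in lborel. t \<in> {- real m<..<real m} \<longrightarrow> ((\<lambda>h. (LINT r:{t..t+h}|lebesgue. g r) / h) \<longlongrightarrow> g t) (at_right 0)" for m
  proof -
    obtain N where N: "negligible N" "\<And>x. x \<in> {- real m<..<real m} \<Longrightarrow> x \<notin> N \<Longrightarrow>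
     ((\<lambda>h. (LINT r:{x..x+h}|lebesgue. g r) / h) \<longlongrightarrow> g x) (at_right 0)"
      using AE_right_average[OF int'] by blast
    have "AE t in lebesgue. t \<in> {- real m<..<real m} \<longrightarrow> ((\<lambda>h. (LINT r:{t..t+h}|lebesgue. g r) / h) \<longlongrightarrow> g t) (at_right 0)"
      using N by (intro AE_I'[of N]) (auto simp: negligible_iff_null_sets)
    then show ?thesis by (simp only: AE_completion_iff)
  qed
  then have "AE t in lborel. \<forall>m. t \<in> {- real m<..<real m} \<longrightarrow> ((\<lambda>h. (LINT r:{t..t+h}|lebesgue. g r) / h) \<longlongrightarrow> g t) (at_right 0)"
    by (simp only: AE_all_countable simp_thms)
  then show ?thesis
  proof eventually_elim
    case (elim t)
    obtain m where "\<bar>t\<bar> < real m" using reals_Archimedean2 by blast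
    then have "((\<lambda>h. (LINT r:{t..t+h}|lebesgue. g r) / h) \<longlongrightarrow> g t) (at_right 0)"
      using elim by (auto simp: abs_less_iff)
    moreover have "filterlim (\<lambda>n. 1 / real (Suc n)) (at_right 0) sequentially"
      using LIMSEQ_inverse_real_of_nat by (auto simp: filterlim_at inverse_eq_divide)
    ultimately have "(\<lambda>n. (LINT r:{t..t+1 / real (Suc n)}|lebesgue. g r) / (1 / real (Suc n))) \<longlonglongrightarrow> g t"
      by (rule filterlim_compose)
    moreover have "(LINT r:{t..t+1 / real (Suc n)}|lebesgue. g r) / (1 / real (Suc n)) =
        real (Suc n) * (\<integral>r. indicator {t..t + 1 / real (Suc n)} r * g r \<partial>lborel)" for n
      by (simp add: set_lebesgue_integral_def integral_completion mult.commute)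
    ultimately show ?case by (simp add: mult.commute)
  qed
qed

lemma steklov_AE_tendsto:
  assumes M: "sigma_finite_measure M" and [measurable]: "g \<in> borel_measurable (M \<Otimes>\<^sub>M lborel)"
    and fin: "integrable (M \<Otimes>\<^sub>M lborel) (\<lambda>z. (g z)\<^sup>2)"
  shows "AE z in M \<Otimes>\<^sub>M lborel. (\<lambda>n. steklov (real (Suc n)) g z) \<longlonglongrightarrow> g z"
proof -
  interpret sigma_finite_measure M by fact
  interpret P: pair_sigma_finite M "lborel :: real measure" ..
  show ?thesis
  proof (rule P.AE_pair_measure)
    show "{z \<in> space (M \<Otimes>\<^sub>M lborel). (\<lambda>n. steklov (real (Suc n)) g z) \<longlonglongrightarrow> g z} \<in> sets (M \<Otimes>\<^sub>M lborel)"
      by measurable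
    have "(\<integral>\<^sup>+x. \<integral>\<^sup>+r. ennreal ((g (x, r))\<^sup>2) \<partial>lborel \<partial>M) < \<infinity>"
      using fin by (subst lborel.nn_integral_fst) (auto simp: integrable_iff_bounded)
    then have "AE x in M. (\<integral>\<^sup>+r. ennreal ((g (x, r))\<^sup>2) \<partial>lborel) \<noteq> \<infinity>"
      by (intro nn_integral_PInf_AE lborel.borel_measurable_nn_integral) auto
    then show "AE x in M. AE t in lborel. (\<lambda>n. steklov (real (Suc n)) g (x, t)) \<longlonglongrightarrow> g (x, t)"
      using AE_space
    proof eventually_elim
      case x: (elim x)
      then have "AE t in lborel. (\<lambda>n. real (Suc n) * (\<integral>r. indicator {t..t + 1 / real (Suc n)} r * g (x, r) \<partial>lborel)) \<longlonglongrightarrow> g (x, t)"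
        by (intro steklov_AE_tendsto_slice) (auto simp: less_top[symmetric])
      then show ?case
        by (simp add: steklov_def)
    qed
  qed
qed

lemma steklov_L2:
  assumes M: "sigma_finite_measure M" and [measurable]: "g \<in> borel_measurable (M \<Otimes>\<^sub>M lborel)"
    and fin: "integrable (M \<Otimes>\<^sub>M lborel) (\<lambda>z. (g z)\<^sup>2)" and n: "n > 0"
  shows "integrable (M \<Otimes>\<^sub>M lborel) (\<lambda>z. (steklov n g z)\<^sup>2)"
    "(\<integral>z. (steklov n g z)\<^sup>2 \<partial>(M \<Otimes>\<^sub>M lborel)) \<le> (\<integral>z. (g z)\<^sup>2 \<partial>(M \<Otimes>\<^sub>M lborel))"
proof -
  have le: "(\<integral>\<^sup>+z. ennreal ((steklov n g z)\<^sup>2) \<partial>(M \<Otimes>\<^sub>M lborel)) \<le> (\<integral>\<^sup>+z. ennreal ((g z)\<^sup>2) \<partial>(M \<Otimes>\<^sub>M lborel))"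
    by (rule steklov_nn_integral_le[OF M _ n]) simp
  also have g: "\<dots> = ennreal (\<integral>z. (g z)\<^sup>2 \<partial>(M \<Otimes>\<^sub>M lborel))"
    using fin by (intro nn_integral_eq_integral) auto
  finally have *: "(\<integral>\<^sup>+z. ennreal ((steklov n g z)\<^sup>2) \<partial>(M \<Otimes>\<^sub>M lborel)) \<le> ennreal (\<integral>z. (g z)\<^sup>2 \<partial>(M \<Otimes>\<^sub>M lborel))" .
  show i: "integrable (M \<Otimes>\<^sub>M lborel) (\<lambda>z. (steklov n g z)\<^sup>2)"
    by (rule integrableI_bounded) (use * in \<open>auto intro: le_less_trans\<close>)
  then have "(\<integral>\<^sup>+z. ennreal ((steklov n g z)\<^sup>2) \<partial>(M \<Otimes>\<^sub>M lborel)) = ennreal (\<integral>z. (steklov n g z)\<^sup>2 \<partial>(M \<Otimes>\<^sub>M lborel))"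
    by (intro nn_integral_eq_integral) auto
  then show "(\<integral>z. (steklov n g z)\<^sup>2 \<partial>(M \<Otimes>\<^sub>M lborel)) \<le> (\<integral>z. (g z)\<^sup>2 \<partial>(M \<Otimes>\<^sub>M lborel))"
    using * by (simp add: ennreal_le_iff)
qed

text \<open>
  The parallelogram law turns almost everywhere convergence without loss of norm into convergence
  in \<open>L\<^sup>2\<close>.
\<close>

lemma L2_tendsto_of_AE_tendsto:
  fixes S :: "nat \<Rightarrow> 'a \<Rightarrow> real"
  assumes [measurable]: "\<And>n. S n \<in> borel_measurable N" "g \<in> borel_measurable N"
    and S: "\<And>n. integrable N (\<lambda>z. (S n z)\<^sup>2)" and g: "integrable N (\<lambda>z. (g z)\<^sup>2)"
    and le: "\<And>n. (\<integral>z. (S n z)\<^sup>2 \<partial>N) \<le> (\<integral>z. (g z)\<^sup>2 \<partial>N)"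
    and lim: "AE z in N. (\<lambda>n. S n z) \<longlonglongrightarrow> g z"
  shows "(\<lambda>n. \<integral>z. (S n z - g z)\<^sup>2 \<partial>N) \<longlonglongrightarrow> 0"
proof -
  define G where "G = (\<integral>z. (g z)\<^sup>2 \<partial>N)"
  define c where "c n = (\<integral>z. (S n z + g z)\<^sup>2 \<partial>N)" for n
  have G0: "G \<ge> 0" by (simp add: G_def)
  have ip: "integrable N (\<lambda>z. (S n z + g z)\<^sup>2)" "integrable N (\<lambda>z. (S n z - g z)\<^sup>2)" for n
    using integrable_add_sq[OF _ _ S g] by auto
  have "AE z in N. ennreal (4 * (g z)\<^sup>2) = liminf (\<lambda>n. ennreal ((S n z + g z)\<^sup>2))"
    using lim
  proof eventually_elim
    case (elim z)
    then have "(\<lambda>n. ennreal ((S n z + g z)\<^sup>2)) \<longlonglongrightarrow> ennreal ((g z + g z)\<^sup>2)"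
      by (intro tendsto_ennrealI tendsto_intros)
    then show ?case
      by (simp add: lim_imp_Liminf power2_eq_square algebra_simps)
  qed
  then have "(\<integral>\<^sup>+z. ennreal (4 * (g z)\<^sup>2) \<partial>N) = (\<integral>\<^sup>+z. liminf (\<lambda>n. ennreal ((S n z + g z)\<^sup>2)) \<partial>N)"
    by (rule nn_integral_cong_AE)
  also have "\<dots> \<le> liminf (\<lambda>n. \<integral>\<^sup>+z. ennreal ((S n z + g z)\<^sup>2) \<partial>N)"
    by (intro nn_integral_liminf) measurable
  also have "(\<lambda>n. \<integral>\<^sup>+z. ennreal ((S n z + g z)\<^sup>2) \<partial>N) = (\<lambda>n. ennreal (c n))"
    unfolding c_def using ip by (intro ext nn_integral_eq_integral) auto
  also have "(\<integral>\<^sup>+z. ennreal (4 * (g z)\<^sup>2) \<partial>N) = ennreal (4 * G)"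
    unfolding G_def using g by (subst nn_integral_eq_integral) auto
  finally have liminf: "ennreal (4 * G) \<le> liminf (\<lambda>n. ennreal (c n))" .
  have diff: "(\<integral>z. (S n z - g z)\<^sup>2 \<partial>N) \<le> 4 * G - c n" for n
  proof -
    have "(\<integral>z. (S n z - g z)\<^sup>2 \<partial>N) + c n = (\<integral>z. (S n z - g z)\<^sup>2 + (S n z + g z)\<^sup>2 \<partial>N)"
      unfolding c_def using ip by simp
    also have "\<dots> = (\<integral>z. 2 * (S n z)\<^sup>2 + 2 * (g z)\<^sup>2 \<partial>N)"
      by (intro Bochner_Integration.integral_cong refl) (simp add: power2_eq_square algebra_simps)
    also have "\<dots> \<le> 4 * G" using le[of n] S g by (simp add: G_def)
    finally show ?thesis by simp
  qed
  show ?thesis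
  proof (rule LIMSEQ_I)
    fix e :: real assume e: "e > 0"
    have "\<forall>\<^sub>F n in sequentially. 4 * G - e < c n"
    proof (cases "4 * G - e < 0")
      case True
      have "0 \<le> c n" for n by (simp add: c_def)
      then show ?thesis using True by (intro always_eventually allI) (rule less_le_trans)
    next
      case False
      then have "ennreal (4 * G - e) < ennreal (4 * G)" using e G0 by (simp add: ennreal_less_iff)
      also note liminf
      finally have "\<forall>\<^sub>F n in sequentially. ennreal (4 * G - e) < ennreal (c n)" by (rule less_LiminfD)
      then show ?thesis by eventually_elim (use False in \<open>auto simp: ennreal_less_iff\<close>)
    qed
    then have "\<forall>\<^sub>F n in sequentially. norm ((\<integral>z. (S n z - g z)\<^sup>2 \<partial>N) - 0) < e"
    proof eventually_elim
      case (elim n)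
      then show ?case using diff[of n] by simp
    qed
    then show "\<exists>no. \<forall>n\<ge>no. norm ((\<integral>z. (S n z - g z)\<^sup>2 \<partial>N) - 0) < e"
      by (simp add: eventually_sequentially)
  qed
qed

lemma L2_tendsto_integral_mult:
  fixes S :: "nat \<Rightarrow> 'a \<Rightarrow> real"
  assumes meas[measurable]: "\<And>n. S n \<in> borel_measurable N" "g \<in> borel_measurable N" "p \<in> borel_measurable N"
    and S: "\<And>n. integrable N (\<lambda>z. (S n z)\<^sup>2)" and g: "integrable N (\<lambda>z. (g z)\<^sup>2)" and p: "integrable N (\<lambda>z. (p z)\<^sup>2)"
    and lim: "(\<lambda>n. \<integral>z. (S n z - g z)\<^sup>2 \<partial>N) \<longlonglongrightarrow> 0"
  shows "(\<lambda>n. \<integral>z. p z * S n z \<partial>N) \<longlonglongrightarrow> (\<integral>z. p z * g z \<partial>N)"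
proof (rule LIMSEQ_I)
  fix e :: real assume e: "e > 0"
  define P where "P = (\<integral>z. (p z)\<^sup>2 \<partial>N) + 1"
  have P: "P > 0" "(\<integral>z. (p z)\<^sup>2 \<partial>N) < P" by (auto simp: P_def intro: add_nonneg_pos)
  \<comment> \<open>This d makes the p-part of Young's inequality at most e/2; the other part is
    below e/2 once the squared error is below d e / 2.\<close>
  define d where "d = e / (2 * P)"
  have d: "d > 0" using e P by (simp add: d_def)
  have "\<forall>\<^sub>F n in sequentially. (\<integral>z. (S n z - g z)\<^sup>2 \<partial>N) < d * e / 2"
    using order_tendstoD(2)[OF lim, of "d * e / 2"] d e by simp
  then have "\<forall>\<^sub>F n in sequentially. norm ((\<integral>z. p z * S n z \<partial>N) - (\<integral>z. p z * g z \<partial>N)) < e"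
  proof eventually_elim
    case (elim n)
    have "(\<integral>z. (S n z - g z)\<^sup>2 \<partial>N) / d < e / 2" using elim d by (simp add: field_simps)
    moreover have "d * (\<integral>z. (p z)\<^sup>2 \<partial>N) \<le> e / 2"
      using mult_left_mono[of "\<integral>z. (p z)\<^sup>2 \<partial>N" P d] P d by (simp add: d_def)
    moreover have "\<bar>\<integral>z. p z * (S n z - g z) \<partial>N\<bar> \<le> d * (\<integral>z. (p z)\<^sup>2 \<partial>N) + (\<integral>z. (S n z - g z)\<^sup>2 \<partial>N) / d"
      using integrable_add_sq[OF meas(1,2) S g] p d by (intro integral_mult_L2_le) auto
    moreover have "(\<integral>z. p z * (S n z - g z) \<partial>N) = (\<integral>z. p z * S n z \<partial>N) - (\<integral>z. p z * g z \<partial>N)"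
      using integrable_mult_L2[OF meas(3,1) p S] integrable_mult_L2[OF meas(3,2) p g]
      by (simp add: right_diff_distrib)
    ultimately show ?case unfolding real_norm_def by linarith
  qed
  then show "\<exists>no. \<forall>n\<ge>no. norm ((\<integral>z. p z * S n z \<partial>N) - (\<integral>z. p z * g z \<partial>N)) < e"
    by (simp add: eventually_sequentially)
qed

lemma steklov_tendsto:
  assumes M: "sigma_finite_measure M" and [measurable]: "g \<in> borel_measurable (M \<Otimes>\<^sub>M lborel)" "p \<in> borel_measurable (M \<Otimes>\<^sub>M lborel)"
    and g: "integrable (M \<Otimes>\<^sub>M lborel) (\<lambda>z. (g z)\<^sup>2)" and p: "integrable (M \<Otimes>\<^sub>M lborel) (\<lambda>z. (p z)\<^sup>2)"
  shows "(\<lambda>n. \<integral>z. p z * steklov (real (Suc n)) g z \<partial>(M \<Otimes>\<^sub>M lborel)) \<longlonglongrightarrow> (\<integral>z. p z * g z \<partial>(M \<Otimes>\<^sub>M lborel))"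
  by (intro L2_tendsto_integral_mult L2_tendsto_of_AE_tendsto steklov_L2 steklov_AE_tendsto assms steklov_measurable) auto

section \<open>The abstract energy inequality\<close>

lemma pair_lborel_integral_snd:
  fixes h :: "'a \<times> real \<Rightarrow> real"
  assumes "sigma_finite_measure M" "integrable (M \<Otimes>\<^sub>M lborel) h"
  shows "integral\<^sup>L (M \<Otimes>\<^sub>M lborel) h = (\<integral>t. (\<integral>x. h (x, t) \<partial>M) \<partial>lborel)"
    and "integrable lborel (\<lambda>t. \<integral>x. h (x, t) \<partial>M)"
proof -
  interpret sigma_finite_measure M by fact
  interpret P: pair_sigma_finite M "lborel :: real measure" ..
  show "integral\<^sup>L (M \<Otimes>\<^sub>M lborel) h = (\<integral>t. (\<integral>x. h (x, t) \<partial>M) \<partial>lborel)"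
    using P.integral_snd[of "\<lambda>x t. h (x, t)"] assms(2) by simp
  show "integrable lborel (\<lambda>t. \<integral>x. h (x, t) \<partial>M)"
    using P.integrable_snd[of "\<lambda>x t. h (x, t)"] assms(2) by simp
qed

text \<open>
  The hypothesis \<open>conv\<close> is the inequality \<open>\<beta>(v) - \<beta>(u) \<ge> 2 \<langle>v - u, p\<rangle>\<close> for a convex quadratic
  functional with gradient \<open>2 p\<close>, at \<open>v = u(t + k)\<close>; only the gradient at the earlier time enters,
  so nothing but the value of \<open>\<beta>\<close> is needed beyond \<open>T\<close>.
\<close>

lemma energy_forward:
  fixes zt p :: "'a \<times> real \<Rightarrow> real" and \<beta> \<eta> \<eta>' :: "real \<Rightarrow> real"
  assumes M: "sigma_finite_measure M" and T: "T > 0"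
    and [measurable]: "zt \<in> borel_measurable (M \<Otimes>\<^sub>M lborel)" "p \<in> borel_measurable (M \<Otimes>\<^sub>M lborel)"
    and zt: "integrable (M \<Otimes>\<^sub>M lborel) (\<lambda>z. (zt z)\<^sup>2)" and p: "integrable (M \<Otimes>\<^sub>M lborel) (\<lambda>z. (p z)\<^sup>2)"
    and supp: "\<And>x t. t \<notin> {0<..<T} \<Longrightarrow> p (x, t) = 0"
    and [measurable]: "\<beta> \<in> borel_measurable borel"
    and \<beta>: "\<And>t. \<beta> t \<ge> 0" "integrable lborel (\<lambda>t. indicator {0<..<T} t * \<beta> t)" "\<And>t. t \<ge> T \<Longrightarrow> \<beta> t = \<beta>\<^sub>T"
    and conv: "\<And>k. k > 0 \<Longrightarrow> AE t in lborel. t \<in> {0<..<T} \<longrightarrow>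
      2 * (\<integral>x. p (x, t) * (\<integral>r. indicator {t..t+k} r * zt (x, r) \<partial>lborel) \<partial>M) \<le> \<beta> (t + k) - \<beta> t"
    and \<eta>: "\<And>t. (\<eta> has_real_derivative \<eta>' t) (at t)" "continuous_on UNIV \<eta>'" "\<And>t. \<eta> t \<ge> 0"
  shows "2 * (\<integral>z. \<eta> (snd z) * p z * zt z \<partial>(M \<Otimes>\<^sub>M lborel)) + (\<integral>t. indicator {0<..<T} t * (\<eta>' t * \<beta> t) \<partial>lborel) \<le> \<eta> T * \<beta>\<^sub>T"
proof -
  interpret sigma_finite_measure M by fact
  interpret P: pair_sigma_finite M "lborel :: real measure" ..
  let ?N = "M \<Otimes>\<^sub>M (lborel :: real measure)"
  have \<eta>c: "continuous_on UNIV \<eta>" using \<eta>(1) by (meson DERIV_isCont continuous_at_imp_continuous_on)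
  have [measurable]: "\<eta> \<in> borel_measurable borel" "\<eta>' \<in> borel_measurable borel"
    using \<eta>c \<eta>(2) by (auto intro: borel_measurable_continuous_onI)
  have "bounded (\<eta> ` {-1..T})" "bounded (\<eta>' ` {-1..T})"
    using \<eta>c \<eta>(2) by (auto intro!: compact_imp_bounded compact_continuous_image intro: continuous_on_subset)
  then obtain B C where B: "\<And>t. t \<in> {-1..T} \<Longrightarrow> \<bar>\<eta> t\<bar> \<le> B" and C: "\<And>t. t \<in> {-1..T} \<Longrightarrow> \<bar>\<eta>' t\<bar> \<le> C"
    unfolding bounded_iff by fastforce
  have B0: "B \<ge> 0" using B[of 0] T by auto
  have \<eta>\<beta>: "\<bar>\<eta> s\<bar> * \<beta> t \<le> B * \<beta> t" if "s \<in> {-1..T}" for s t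
    using B[OF that] \<beta>(1) by (intro mult_right_mono) auto
  have C0: "C \<ge> 0" using C[of 0] T by auto
  have lip: "\<bar>\<eta> t - \<eta> s\<bar> \<le> C * (t - s)" if "s \<le> t" "-1 \<le> s" "t \<le> T" for s t
  proof (cases "s = t")
    case False
    with that have "s < t" by simp
    from MVT2[OF this, of \<eta> \<eta>'] \<eta>(1)
    obtain z where "s < z" "z < t" "\<eta> t - \<eta> s = (t - s) * \<eta>' z" by blast
    then show ?thesis using C[of z] that by (simp add: abs_mult mult.commute mult_right_mono)
  qed simp
  have \<beta>T: "\<beta>\<^sub>T \<ge> 0" using \<beta>(1)[of T] \<beta>(3)[of T] by simp
  define pe where "pe z = \<eta> (snd z) * p z" for z
  have pe_m [measurable]: "pe \<in> borel_measurable ?N"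
    unfolding pe_def by measurable
  have pe: "integrable ?N (\<lambda>z. (pe z)\<^sup>2)"
  proof (rule Bochner_Integration.integrable_bound)
    show "integrable ?N (\<lambda>z. B\<^sup>2 * (p z)\<^sup>2)" using p by simp
    show "AE z in ?N. norm ((pe z)\<^sup>2) \<le> norm (B\<^sup>2 * (p z)\<^sup>2)"
    proof (intro always_eventually allI)
      fix z :: "'a \<times> real"
      show "norm ((pe z)\<^sup>2) \<le> norm (B\<^sup>2 * (p z)\<^sup>2)"
      proof (cases "snd z \<in> {0<..<T}")
        case True
        then have "(\<eta> (snd z))\<^sup>2 \<le> B\<^sup>2" using B[of "snd z"] by (intro abs_le_square_iff[THEN iffD1]) auto
        then show ?thesis by (simp add: pe_def power_mult_distrib mult_right_mono)
      next
        case False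
        then have "p z = 0" using supp[of "snd z" "fst z"] by simp
        then show ?thesis by (simp add: pe_def)
      qed
    qed
  qed measurable
  define I where "I n = (\<integral>z. pe z * steklov (real (Suc n)) zt z \<partial>?N)" for n
  have I_lim: "I \<longlonglongrightarrow> (\<integral>z. pe z * zt z \<partial>?N)"
    unfolding I_def by (rule steklov_tendsto[OF M _ _ zt pe]) simp_all
  \<comment> \<open>Minus the backward difference quotient of the weight, which appears when the
    time shift is moved from \<open>\<beta>\<close> to \<open>\<eta>\<close>. It is set to 0 on the
    first step, where the leftover term is nonpositive and is dropped; this is why no boundary term
    at 0 remains.\<close>
  define D where "D n t = (if t > 1 / real (Suc n) then real (Suc n) * (\<eta> (t - 1 / real (Suc n)) - \<eta> t) else 0)" for n t
  have D_m [measurable]: "D n \<in> borel_measurable borel" for n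
    unfolding D_def by measurable
  have D_bound: "\<bar>D n t\<bar> \<le> C" if "t \<in> {0<..<T}" for n t
  proof (cases "t > 1 / real (Suc n)")
    case True
    then have "\<bar>\<eta> t - \<eta> (t - 1 / real (Suc n))\<bar> \<le> C * (1 / real (Suc n))"
      using lip[of "t - 1 / real (Suc n)" t] that by auto
    then have "real (Suc n) * \<bar>\<eta> t - \<eta> (t - 1 / real (Suc n))\<bar> \<le> real (Suc n) * (C * (1 / real (Suc n)))"
      by (intro mult_left_mono) auto
    then show ?thesis using True by (simp add: D_def abs_mult abs_minus_commute)
  qed (use C0 in \<open>simp add: D_def\<close>)
  have k_lim: "(\<lambda>n. 1 / real (Suc n)) \<longlonglongrightarrow> 0"
    using LIMSEQ_inverse_real_of_nat by (simp add: inverse_eq_divide)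
  have D_lim: "(\<lambda>n. D n t) \<longlonglongrightarrow> - \<eta>' t" if "t > 0" for t
  proof -
    have "((\<lambda>h. (\<eta> (t + h) - \<eta> t) / h) \<longlongrightarrow> \<eta>' t) (at 0)" using \<eta>(1)[of t] by (simp add: DERIV_def)
    moreover have "filterlim (\<lambda>n. - (1 / real (Suc n))) (at 0) sequentially"
      using tendsto_minus[OF k_lim] by (auto simp: filterlim_at)
    ultimately have "(\<lambda>n. (\<eta> (t + - (1 / real (Suc n))) - \<eta> t) / - (1 / real (Suc n))) \<longlonglongrightarrow> \<eta>' t"
      by (rule filterlim_compose)
    then have "(\<lambda>n. - ((\<eta> (t + - (1 / real (Suc n))) - \<eta> t) / - (1 / real (Suc n)))) \<longlonglongrightarrow> - \<eta>' t"
      by (rule tendsto_minus)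
    moreover have "\<forall>\<^sub>F n in sequentially. - ((\<eta> (t + - (1 / real (Suc n))) - \<eta> t) / - (1 / real (Suc n))) = D n t"
      using order_tendstoD(2)[OF k_lim that] by eventually_elim (simp add: D_def mult.commute)
    ultimately show ?thesis by (rule Lim_transform_eventually)
  qed
  have J_norm: "norm (indicator {0<..<T} t * \<beta> t * D n t) \<le> C * (indicator {0<..<T} t * \<beta> t)" for n t
  proof (cases "t \<in> {0<..<T}")
    case True
    then have "\<beta> t * \<bar>D n t\<bar> \<le> \<beta> t * C" using D_bound \<beta>(1) by (intro mult_left_mono) auto
    then show ?thesis using True \<beta>(1)[of t] by (simp add: abs_mult mult.commute)
  qed simp
  define J where "J n = (\<integral>t. indicator {0<..<T} t * \<beta> t * D n t \<partial>lborel)" for n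
  have J_int: "integrable lborel (\<lambda>t. indicator {0<..<T} t * \<beta> t * D n t)" for n
  proof (rule Bochner_Integration.integrable_bound)
    show "integrable lborel (\<lambda>t. C * (indicator {0<..<T} t * \<beta> t))" using \<beta>(2) by simp
    show "AE t in lborel. norm (indicator {0<..<T} t * \<beta> t * D n t) \<le> norm (C * (indicator {0<..<T} t * \<beta> t))"
      by (intro always_eventually allI order_trans[OF J_norm]) (simp only: real_norm_def abs_ge_self)
  qed measurable
  have J_lim: "J \<longlonglongrightarrow> (\<integral>t. indicator {0<..<T} t * \<beta> t * (- \<eta>' t) \<partial>lborel)"
    unfolding J_def
  proof (rule integral_dominated_convergence[where w = "\<lambda>t. C * (indicator {0<..<T} t * \<beta> t)"])
    show "AE t in lborel. (\<lambda>n. indicator {0<..<T} t * \<beta> t * D n t) \<longlonglongrightarrow> indicator {0<..<T} t * \<beta> t * (- \<eta>' t)"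
    proof (intro always_eventually allI)
      fix t
      show "(\<lambda>n. indicator {0<..<T} t * \<beta> t * D n t) \<longlonglongrightarrow> indicator {0<..<T} t * \<beta> t * (- \<eta>' t)"
        using tendsto_mult[OF tendsto_const D_lim[of t]] by (cases "t \<in> {0<..<T}") auto
    qed
    show "AE t in lborel. norm (indicator {0<..<T} t * \<beta> t * D n t) \<le> C * (indicator {0<..<T} t * \<beta> t)" for n
      using J_norm by (intro always_eventually allI)
    show "integrable lborel (\<lambda>t. C * (indicator {0<..<T} t * \<beta> t))" using \<beta>(2) by simp
  qed measurable
  have main: "2 * I n \<le> J n + (\<eta> T + C * (1 / real (Suc n))) * \<beta>\<^sub>T" if kT: "1 / real (Suc n) < min 1 T" for n
  proof -
    define k where "k = 1 / real (Suc n)"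
    have k: "0 < k" "k < T" "k < 1" "real (Suc n) * k = 1" using kT by (auto simp: k_def)
    have St_int: "integrable ?N (\<lambda>z. pe z * steklov (real (Suc n)) zt z)"
      by (rule integrable_mult_L2) (use pe steklov_L2[OF M _ zt, of "real (Suc n)"] in auto)
    let ?R = "\<lambda>t. indicator {0<..<T} t * (\<eta> t * (real (Suc n) * (\<beta> (t + k) - \<beta> t)))"
    let ?X = "\<lambda>t. indicator {0<..<T} t * (\<eta> t * \<beta> (t + k))"
    let ?Y = "\<lambda>t. indicator {0<..<T} t * (\<eta> t * \<beta> t)"
    let ?Z = "\<lambda>t. indicator {k<..<T+k} t * (\<eta> (t - k) * \<beta> t)"
    have Y: "integrable lborel ?Y"
    proof (rule Bochner_Integration.integrable_bound)
      show "integrable lborel (\<lambda>t. B * (indicator {0<..<T} t * \<beta> t))" using \<beta>(2) by simp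
      show "AE t in lborel. norm (?Y t) \<le> norm (B * (indicator {0<..<T} t * \<beta> t))"
        using \<eta>\<beta> B0 \<beta>(1) by (intro always_eventually allI) (auto simp: indicator_def abs_mult)
    qed measurable
    have Tk: "integrable lborel (\<lambda>t. indicator {T..<T+k} t * c)" for c :: real
      using k by (intro integrable_mult_left integrable_real_indicator) auto
    have Z: "integrable lborel ?Z"
    proof (rule Bochner_Integration.integrable_bound)
      show "integrable lborel (\<lambda>t. B * (indicator {0<..<T} t * \<beta> t) + indicator {T..<T+k} t * (B * \<beta>\<^sub>T))"
        using \<beta>(2) Tk by simp
      show "AE t in lborel. norm (?Z t) \<le> norm (B * (indicator {0<..<T} t * \<beta> t) + indicator {T..<T+k} t * (B * \<beta>\<^sub>T))"
      proof (intro always_eventually allI)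
        fix t
        consider "t \<le> k" | "k < t" "t < T" | "T \<le> t" "t < T + k" | "T + k \<le> t" by linarith
        then show "norm (?Z t) \<le> norm (B * (indicator {0<..<T} t * \<beta> t) + indicator {T..<T+k} t * (B * \<beta>\<^sub>T))"
        proof cases
          case 2
          then show ?thesis using \<eta>\<beta>[of "t - k" t] k B0 \<beta>(1)[of t] by (simp add: abs_mult)
        next
          case 3
          then show ?thesis using \<eta>\<beta>[of "t - k" t] k B0 \<beta>T \<beta>(3)[of t] by (simp add: abs_mult)
        qed auto
      qed
    qed measurable
    \<comment> \<open>Summation by parts in discrete form: translating by k moves the shift from
      \<open>\<beta>\<close> to \<open>\<eta>\<close>.\<close>
    have XZ: "?X t = ?Z (k + 1 * t)" for t
      by (auto simp: indicator_def add.commute)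
    have X: "integrable lborel ?X"
      unfolding XZ using Z by (rule lborel_integrable_real_affine) simp
    have intX: "(\<integral>t. ?X t \<partial>lborel) = (\<integral>t. ?Z t \<partial>lborel)"
      unfolding XZ using lborel_integral_real_affine[of 1 ?Z k] by simp
    have R_eq: "?R t = real (Suc n) * (?X t - ?Y t)" for t by (simp add: algebra_simps)
    have R: "integrable lborel ?R"
      unfolding R_eq using X Y by simp
    have "2 * I n = 2 * (\<integral>t. (\<integral>x. pe (x, t) * steklov (real (Suc n)) zt (x, t) \<partial>M) \<partial>lborel)"
      unfolding I_def using pair_lborel_integral_snd(1)[OF M St_int] by simp
    also have "\<dots> = (\<integral>t. 2 * (\<integral>x. pe (x, t) * steklov (real (Suc n)) zt (x, t) \<partial>M) \<partial>lborel)" by simp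
    also have "\<dots> \<le> (\<integral>t. ?R t \<partial>lborel)"
    proof (rule integral_mono_AE)
      show "integrable lborel (\<lambda>t. 2 * (\<integral>x. pe (x, t) * steklov (real (Suc n)) zt (x, t) \<partial>M))"
        using pair_lborel_integral_snd(2)[OF M St_int] by simp
      show "AE t in lborel. 2 * (\<integral>x. pe (x, t) * steklov (real (Suc n)) zt (x, t) \<partial>M) \<le> ?R t"
        using conv[OF k(1)]
      proof eventually_elim
        case (elim t)
        show ?case
        proof (cases "t \<in> {0<..<T}")
          case True
          have "2 * (\<integral>x. pe (x, t) * steklov (real (Suc n)) zt (x, t) \<partial>M)
             = \<eta> t * real (Suc n) * (2 * (\<integral>x. p (x, t) * (\<integral>r. indicator {t..t+k} r * zt (x, r) \<partial>lborel) \<partial>M))"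
            by (simp add: pe_def steklov_def k_def algebra_simps flip: integral_mult_right_zero)
          also have "\<dots> \<le> \<eta> t * real (Suc n) * (\<beta> (t + k) - \<beta> t)"
            using elim True \<eta>(3) by (intro mult_left_mono) auto
          finally show ?thesis using True by (simp add: mult.assoc)
        next
          case False
          then show ?thesis by (simp add: pe_def supp)
        qed
      qed
    qed (rule R)
    also have "\<dots> = real (Suc n) * ((\<integral>t. ?Z t \<partial>lborel) - (\<integral>t. ?Y t \<partial>lborel))"
      unfolding R_eq using X Y intX by simp
    also have "\<dots> = (\<integral>t. real (Suc n) * (?Z t - ?Y t) \<partial>lborel)" using Z Y by simp
    \<comment> \<open>Three ranges of t: on (0, k] the term has a favourable sign, on (k, T) it is
      \<open>\<beta> D\<close>, and on [T, T + k) the function \<open>\<beta>\<close> is constant.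
      The last range has length k, which cancels the factor n + 1 and leaves the boundary term at
      T.\<close>
    also have "\<dots> \<le> (\<integral>t. indicator {0<..<T} t * \<beta> t * D n t + indicator {T..<T+k} t * (real (Suc n) * ((\<eta> T + C * k) * \<beta>\<^sub>T)) \<partial>lborel)"
    proof (rule integral_mono)
      show "integrable lborel (\<lambda>t. real (Suc n) * (?Z t - ?Y t))" using Z Y by simp
      show "integrable lborel (\<lambda>t. indicator {0<..<T} t * \<beta> t * D n t + indicator {T..<T+k} t * (real (Suc n) * ((\<eta> T + C * k) * \<beta>\<^sub>T)))"
        using J_int Tk by simp
      fix t
      consider "t \<le> 0" | "0 < t" "t \<le> k" | "k < t" "t < T" | "T \<le> t" "t < T + k" | "T + k \<le> t" by linarith
      then show "real (Suc n) * (?Z t - ?Y t) \<le> indicator {0<..<T} t * \<beta> t * D n t + indicator {T..<T+k} t * (real (Suc n) * ((\<eta> T + C * k) * \<beta>\<^sub>T))"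
      proof cases
        case 2
        then show ?thesis using k \<eta>(3)[of t] \<beta>(1)[of t] by (simp add: D_def k_def[symmetric] indicator_def mult_nonneg_nonneg del: of_nat_Suc)
      next
        case 3
        then show ?thesis using k by (simp add: D_def k_def[symmetric] indicator_def algebra_simps del: of_nat_Suc)
      next
        case 4
        have "\<eta> (t - k) \<le> \<eta> T + C * k"
          using lip[of "t - k" T] 4 k C0 mult_left_mono[of "T - (t - k)" k C] by (auto simp: abs_le_iff)
        then have "real (Suc n) * (\<eta> (t - k) * \<beta>\<^sub>T) \<le> real (Suc n) * ((\<eta> T + C * k) * \<beta>\<^sub>T)"
          using \<beta>T by (intro mult_left_mono mult_right_mono) auto
        then show ?thesis using 4 k \<beta>(3)[of t] by (simp add: indicator_def del: of_nat_Suc)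
      qed (use k in \<open>auto simp: indicator_def\<close>)
    qed
    also have "\<dots> = J n + k * (real (Suc n) * ((\<eta> T + C * k) * \<beta>\<^sub>T))"
      unfolding J_def using J_int Tk k by simp
    also have "k * (real (Suc n) * ((\<eta> T + C * k) * \<beta>\<^sub>T)) = (\<eta> T + C * k) * \<beta>\<^sub>T"
      using k(4) by (metis mult.assoc mult.commute mult.left_neutral)
    finally show ?thesis by (simp add: k_def)
  qed
  have "2 * (\<integral>z. pe z * zt z \<partial>?N) \<le> (\<integral>t. indicator {0<..<T} t * \<beta> t * (- \<eta>' t) \<partial>lborel) + (\<eta> T + C * 0) * \<beta>\<^sub>T"
  proof (rule tendsto_le[OF sequentially_bot])
    show "(\<lambda>n. J n + (\<eta> T + C * (1 / real (Suc n))) * \<beta>\<^sub>T) \<longlonglongrightarrow> (\<integral>t. indicator {0<..<T} t * \<beta> t * (- \<eta>' t) \<partial>lborel) + (\<eta> T + C * 0) * \<beta>\<^sub>T"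
      by (intro tendsto_intros J_lim k_lim)
    show "(\<lambda>n. 2 * I n) \<longlonglongrightarrow> 2 * (\<integral>z. pe z * zt z \<partial>?N)" by (intro tendsto_intros I_lim)
    show "\<forall>\<^sub>F n in sequentially. 2 * I n \<le> J n + (\<eta> T + C * (1 / real (Suc n))) * \<beta>\<^sub>T"
      by (rule eventually_mono[OF order_tendstoD(2)[OF k_lim, of "min 1 T"] main]) (use T in auto)
  qed
  moreover have "(\<integral>t. indicator {0<..<T} t * \<beta> t * (- \<eta>' t) \<partial>lborel) = - (\<integral>t. indicator {0<..<T} t * (\<eta>' t * \<beta> t) \<partial>lborel)"
    by (simp add: mult_ac flip: Bochner_Integration.integral_minus)
  ultimately show ?thesis by (simp add: pe_def)
qed

lemma lborel_reflect: "distr lborel borel (\<lambda>t. c - t) = (lborel :: real measure)"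
  using lborel_real_affine[of "-1" c] by (simp add: density_1)

lemma pair_lborel_reflect:
  assumes M: "sigma_finite_measure M"
  shows "distr (M \<Otimes>\<^sub>M lborel) (M \<Otimes>\<^sub>M lborel) (\<lambda>(x, t). (x, c - t)) = M \<Otimes>\<^sub>M (lborel :: real measure)"
proof -
  have "distr (M \<Otimes>\<^sub>M lborel) (M \<Otimes>\<^sub>M borel) (\<lambda>(x, t). (x, c - t)) = distr M M (\<lambda>x. x) \<Otimes>\<^sub>M distr lborel borel (\<lambda>t::real. c - t)"
    by (rule pair_measure_distr[symmetric]) (simp_all add: lborel_reflect lborel.sigma_finite_measure_axioms)
  also have "\<dots> = M \<Otimes>\<^sub>M lborel" by (simp add: lborel_reflect)
  also have "distr (M \<Otimes>\<^sub>M lborel) (M \<Otimes>\<^sub>M borel) (\<lambda>(x, t). (x, c - t)) = distr (M \<Otimes>\<^sub>M lborel) (M \<Otimes>\<^sub>M lborel) (\<lambda>(x, t). (x, c - t))"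
    by (intro distr_cong sets_pair_measure_cong) auto
  finally show ?thesis .
qed

text \<open>The forward inequality after the reflection t -> T - t. The time derivative and the
  derivative of the weight change sign, and the boundary term moves from T to 0.\<close>

lemma energy_backward:
  fixes zt p :: "'a \<times> real \<Rightarrow> real" and \<beta> \<eta> \<eta>' :: "real \<Rightarrow> real"
  assumes M: "sigma_finite_measure M" and T: "T > 0"
    and [measurable]: "zt \<in> borel_measurable (M \<Otimes>\<^sub>M lborel)" "p \<in> borel_measurable (M \<Otimes>\<^sub>M lborel)"
    and zt: "integrable (M \<Otimes>\<^sub>M lborel) (\<lambda>z. (zt z)\<^sup>2)" and p: "integrable (M \<Otimes>\<^sub>M lborel) (\<lambda>z. (p z)\<^sup>2)"
    and supp: "\<And>x t. t \<notin> {0<..<T} \<Longrightarrow> p (x, t) = 0"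
    and [measurable]: "\<beta> \<in> borel_measurable borel"
    and \<beta>: "\<And>t. \<beta> t \<ge> 0" "integrable lborel (\<lambda>t. indicator {0<..<T} t * \<beta> t)" "\<And>t. t \<le> 0 \<Longrightarrow> \<beta> t = \<beta>\<^sub>0"
    and conv: "\<And>k. k > 0 \<Longrightarrow> AE t in lborel. t \<in> {0<..<T} \<longrightarrow>
      - 2 * (\<integral>x. p (x, t) * (\<integral>r. indicator {t-k..t} r * zt (x, r) \<partial>lborel) \<partial>M) \<le> \<beta> (t - k) - \<beta> t"
    and \<eta>: "\<And>t. (\<eta> has_real_derivative \<eta>' t) (at t)" "continuous_on UNIV \<eta>'" "\<And>t. \<eta> t \<ge> 0"
  shows "- 2 * (\<integral>z. \<eta> (snd z) * p z * zt z \<partial>(M \<Otimes>\<^sub>M lborel)) - (\<integral>t. indicator {0<..<T} t * (\<eta>' t * \<beta> t) \<partial>lborel) \<le> \<eta> 0 * \<beta>\<^sub>0"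
proof -
  interpret sigma_finite_measure M by fact
  interpret P: pair_sigma_finite M "lborel :: real measure" ..
  let ?N = "M \<Otimes>\<^sub>M (lborel :: real measure)"
  let ?\<sigma> = "\<lambda>(x, t). (x, T - t) :: 'a \<times> real"
  have \<sigma>: "?\<sigma> \<in> measurable ?N ?N" by measurable
  have N_int: "integrable ?N (\<lambda>z. h (?\<sigma> z))" "(\<integral>z. h (?\<sigma> z) \<partial>?N) = (\<integral>z. h z \<partial>?N)"
    if "integrable ?N h" for h :: "'a \<times> real \<Rightarrow> real"
  proof -
    have "integrable (distr ?N ?N ?\<sigma>) h" using that pair_lborel_reflect[OF M, of T] by simp
    then show "integrable ?N (\<lambda>z. h (?\<sigma> z))" by (rule integrable_distr[OF \<sigma>])
    show "(\<integral>z. h (?\<sigma> z) \<partial>?N) = (\<integral>z. h z \<partial>?N)"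
      using integral_distr[OF \<sigma>, of h] that pair_lborel_reflect[OF M, of T] by simp
  qed
  have \<eta>c: "continuous_on UNIV \<eta>" using \<eta>(1) by (meson DERIV_isCont continuous_at_imp_continuous_on)
  have [measurable]: "\<eta> \<in> borel_measurable borel" "\<eta>' \<in> borel_measurable borel"
    using \<eta>c \<eta>(2) by (auto intro: borel_measurable_continuous_onI)
  have "2 * (\<integral>z. \<eta> (T - snd z) * p (?\<sigma> z) * (- zt (?\<sigma> z)) \<partial>?N)
     + (\<integral>t. indicator {0<..<T} t * (- \<eta>' (T - t) * \<beta> (T - t)) \<partial>lborel) \<le> \<eta> (T - T) * \<beta>\<^sub>0"
  proof (rule energy_forward[where \<beta> = "\<lambda>t. \<beta> (T - t)" and \<eta> = "\<lambda>t. \<eta> (T - t)" and M = M and zt = "\<lambda>z. - zt (?\<sigma> z)" and p = "\<lambda>z. p (?\<sigma> z)"])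
    show "integrable ?N (\<lambda>z. (- zt (?\<sigma> z))\<^sup>2)" "integrable ?N (\<lambda>z. (p (?\<sigma> z))\<^sup>2)"
      using N_int(1)[OF zt] N_int(1)[OF p] by simp_all
    have "integrable lborel (\<lambda>t. indicator {0<..<T} (T + -1 * t) * \<beta> (T + -1 * t))"
      using \<beta>(2) by (rule lborel_integrable_real_affine) simp
    moreover have "indicator {0<..<T} (T + -1 * t) = (indicator {0<..<T} t :: real)" for t
      by (auto simp: indicator_def)
    ultimately show "integrable lborel (\<lambda>t. indicator {0<..<T} t * \<beta> (T - t))" by simp
    show "((\<lambda>t. \<eta> (T - t)) has_real_derivative - \<eta>' (T - t)) (at t)" for t
    proof -
      have "((\<lambda>t. T - t) has_real_derivative -1) (at t)" by (auto intro!: derivative_eq_intros)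
      from DERIV_chain2[OF \<eta>(1) this] show ?thesis by simp
    qed
    show "continuous_on UNIV (\<lambda>t. - \<eta>' (T - t))"
      by (intro continuous_intros continuous_on_compose2[OF \<eta>(2)]) auto
    fix k :: real assume k: "k > 0"
    let ?Pr = "\<lambda>t. t \<in> {0<..<T} \<longrightarrow> - 2 * (\<integral>x. p (x, t) * (\<integral>r. indicator {t-k..t} r * zt (x, r) \<partial>lborel) \<partial>M) \<le> \<beta> (t - k) - \<beta> t"
    have "AE t in lborel. ?Pr (T - t)"
    proof -
      have "AE t in distr lborel borel (\<lambda>t. T - t). ?Pr t"
        unfolding lborel_reflect by (rule conv[OF k])
      then show ?thesis by (rule AE_distrD[rotated]) simp
    qed
    then show "AE t in lborel. t \<in> {0<..<T} \<longrightarrow>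
        2 * (\<integral>x. p (?\<sigma> (x, t)) * (\<integral>r. indicator {t..t + k} r * - zt (?\<sigma> (x, r)) \<partial>lborel) \<partial>M) \<le> \<beta> (T - (t + k)) - \<beta> (T - t)"
    proof eventually_elim
      case (elim t)
      have eq: "(\<integral>r. indicator {t..t + k} r * zt (x, T - r) \<partial>lborel) = (\<integral>r. indicator {T-t-k..T-t} r * zt (x, r) \<partial>lborel)" for x
      proof -
        have "(\<integral>r. indicator {T-t-k..T-t} r * zt (x, r) \<partial>lborel) = (\<integral>r. indicator {T-t-k..T-t} (T + -1 * r) * zt (x, T + -1 * r) \<partial>lborel)"
          by (subst lborel_integral_real_affine[where c = "-1" and t = T]) simp_all
        also have "\<dots> = (\<integral>r. indicator {t..t + k} r * zt (x, T - r) \<partial>lborel)"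
          by (intro Bochner_Integration.integral_cong refl) (auto simp: indicator_def)
        finally show ?thesis ..
      qed
      have Tt: "T - (t + k) = T - t - k" by simp
      have neg: "(\<integral>x. p (?\<sigma> (x, t)) * (\<integral>r. indicator {t..t + k} r * - zt (?\<sigma> (x, r)) \<partial>lborel) \<partial>M)
          = - (\<integral>x. p (x, T - t) * (\<integral>r. indicator {T-t-k..T-t} r * zt (x, r) \<partial>lborel) \<partial>M)"
        by (simp add: eq)
      show ?case
      proof
        assume "t \<in> {0<..<T}"
        then have "T - t \<in> {0<..<T}" by simp
        note mp[OF elim this]
        then show "2 * (\<integral>x. p (?\<sigma> (x, t)) * (\<integral>r. indicator {t..t + k} r * - zt (?\<sigma> (x, r)) \<partial>lborel) \<partial>M) \<le> \<beta> (T - (t + k)) - \<beta> (T - t)"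
          unfolding neg Tt by (simp only: mult_minus_left mult_minus_right)
      qed
    qed
  next
    show "(\<lambda>z. - zt (?\<sigma> z)) \<in> borel_measurable ?N"
      by (rule borel_measurable_uminus[OF measurable_compose[OF \<sigma>]]) (rule assms)
    show "(\<lambda>z. p (?\<sigma> z)) \<in> borel_measurable ?N"
      by (rule measurable_compose[OF \<sigma>]) (rule assms)
    show "(\<lambda>t. \<beta> (T - t)) \<in> borel_measurable borel"
      by measurable
    show "p (?\<sigma> (x, t)) = 0" if "t \<notin> {0<..<T}" for x t
    proof -
      have "T - t \<notin> {0<..<T}" using that by auto
      then show ?thesis using supp by simp
    qed
    show "\<beta> (T - t) \<ge> 0" "\<eta> (T - t) \<ge> 0" for t by (rule \<beta>(1), rule \<eta>(3))
    show "\<beta> (T - t) = \<beta>\<^sub>0" if "t \<ge> T" for t using that by (intro \<beta>(3)) simp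
  qed (rule M T)+
  moreover have "(\<integral>z. \<eta> (T - snd z) * p (?\<sigma> z) * (- zt (?\<sigma> z)) \<partial>?N) = - (\<integral>z. \<eta> (snd z) * p z * zt z \<partial>?N)"
  proof -
    have "(\<integral>z. \<eta> (T - snd z) * p (?\<sigma> z) * (- zt (?\<sigma> z)) \<partial>?N) = - (\<integral>z. (\<lambda>z. \<eta> (snd z) * p z * zt z) (?\<sigma> z) \<partial>?N)"
      by (subst Bochner_Integration.integral_minus[symmetric], intro Bochner_Integration.integral_cong refl) (simp add: split_beta')
    also have "(\<integral>z. (\<lambda>z. \<eta> (snd z) * p z * zt z) (?\<sigma> z) \<partial>?N) = (\<integral>z. \<eta> (snd z) * p z * zt z \<partial>distr ?N ?N ?\<sigma>)"
      by (rule integral_distr[symmetric, OF \<sigma>]) measurable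
    also have "distr ?N ?N ?\<sigma> = ?N" by (rule pair_lborel_reflect[OF M])
    finally show ?thesis .
  qed
  moreover have "(\<integral>t. indicator {0<..<T} t * (- \<eta>' (T - t) * \<beta> (T - t)) \<partial>lborel) = - (\<integral>t. indicator {0<..<T} t * (\<eta>' t * \<beta> t) \<partial>lborel)"
  proof -
    have "(\<integral>t. indicator {0<..<T} t * (\<eta>' t * \<beta> t) \<partial>lborel) = (\<integral>t. indicator {0<..<T} (T + -1 * t) * (\<eta>' (T + -1 * t) * \<beta> (T + -1 * t)) \<partial>lborel)"
      by (subst lborel_integral_real_affine[where c = "-1" and t = T]) simp_all
    also have "\<dots> = (\<integral>t. indicator {0<..<T} t * (\<eta>' (T - t) * \<beta> (T - t)) \<partial>lborel)"
      by (intro Bochner_Integration.integral_cong refl) (auto simp: indicator_def)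
    finally show ?thesis by simp
  qed
  ultimately show ?thesis by simp
qed

section \<open>Green's identity on the unit interval\<close>

lemma L2_set_integrable:
  fixes f :: "real \<Rightarrow> real"
  assumes "set_integrable lebesgue A (\<lambda>x. (f x)\<^sup>2)" "set_borel_measurable lebesgue A f"
    and A: "A \<in> lmeasurable"
  shows "set_integrable lebesgue A f"
proof -
  let ?i = "indicat_real A"
  have "integrable lebesgue ?i" using A by (intro integrable_real_indicator) (auto simp: fmeasurable_def)
  moreover have "(\<lambda>x. (?i x)\<^sup>2) = ?i" "(\<lambda>x. (?i x * f x)\<^sup>2) = (\<lambda>x. ?i x * (f x)\<^sup>2)"
    by (auto simp: indicator_def)
  ultimately have "integrable lebesgue (\<lambda>x. ?i x * (?i x * f x))"
    using assms by (intro integrable_mult_L2) (auto simp: set_integrable_def set_borel_measurable_def)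
  moreover have "(\<lambda>x. ?i x * (?i x * f x)) = (\<lambda>x. ?i x *\<^sub>R f x)"
    by (auto simp: indicator_def)
  ultimately show ?thesis by (simp add: set_integrable_def)
qed

text \<open>An integrable function cannot stay above c/x near 0, since 1/x is not integrable there.
  In quantitative form: the integral over [d, 2d] tends to 0, which forces x G(x) to be small at
  some point of that interval.\<close>

lemma exists_small_near_0:
  fixes G :: "real \<Rightarrow> real"
  assumes G: "set_integrable lebesgue {0<..<1} G" and nonneg: "\<And>x. G x \<ge> 0"
  obtains X Y where "\<And>n. X n \<in> {0<..<1/2}" "X \<longlonglongrightarrow> 0" "\<And>n. X n * G (X n) \<le> Y n" "Y \<longlonglongrightarrow> 0"
proof -
  \<comment> \<open>The offset keeps 2 \<open>\<delta>\<close> below 1/2, so that points found near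
    0 and, after reflection, near 1 remain separated.\<close>
  define \<delta> where "\<delta> n = 1 / real (Suc (n + 4))" for n
  have \<delta>: "\<delta> n > 0" "2 * \<delta> n < 1/2" for n by (auto simp: \<delta>_def field_simps)
  define J where "J n = (LINT x:{\<delta> n..2 * \<delta> n}|lebesgue. G x)" for n
  have sub: "set_integrable lebesgue {\<delta> n..2 * \<delta> n} G" for n
    by (rule set_integrable_subset[OF G]) (use \<delta>[of n] in auto)
  have \<delta>_lim: "\<delta> \<longlonglongrightarrow> 0"
    unfolding \<delta>_def using LIMSEQ_ignore_initial_segment[OF LIMSEQ_inverse_real_of_nat, of 4] by (simp add: inverse_eq_divide)
  have "(\<lambda>n. LINT x|lebesgue. indicator {\<delta> n..2 * \<delta> n} x *\<^sub>R G x) \<longlonglongrightarrow> (LINT x::real|lebesgue. (0 :: real))"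
  proof (rule integral_dominated_convergence[where w = "\<lambda>x. \<bar>indicator {0<..<1} x *\<^sub>R G x\<bar>"])
    show "AE x in lebesgue. (\<lambda>n. indicator {\<delta> n..2 * \<delta> n} x *\<^sub>R G x) \<longlonglongrightarrow> 0"
    proof (intro always_eventually allI)
      fix x :: real
      show "(\<lambda>n. indicator {\<delta> n..2 * \<delta> n} x *\<^sub>R G x) \<longlonglongrightarrow> 0"
      proof (cases "x > 0")
        case True
        have "(\<lambda>n. 2 * \<delta> n) \<longlonglongrightarrow> 2 * 0" by (intro tendsto_intros \<delta>_lim)
        then have "\<forall>\<^sub>F n in sequentially. 2 * \<delta> n < x" using True by (intro order_tendstoD) auto
        then have "\<forall>\<^sub>F n in sequentially. 0 = indicator {\<delta> n..2 * \<delta> n} x *\<^sub>R G x"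
          by eventually_elim auto
        then show ?thesis by (rule Lim_transform_eventually[OF tendsto_const])
      next
        case False
        then have "x \<notin> {\<delta> n..2 * \<delta> n}" for n using \<delta>[of n] by auto
        then show ?thesis by simp
      qed
    qed
    show "AE x in lebesgue. norm (indicator {\<delta> n..2 * \<delta> n} x *\<^sub>R G x) \<le> \<bar>indicator {0<..<1} x *\<^sub>R G x\<bar>" for n
      using \<delta>[of n] by (intro always_eventually allI) (auto simp: indicator_def)
    show "(\<lambda>x. indicator {\<delta> n..2 * \<delta> n} x *\<^sub>R G x) \<in> borel_measurable lebesgue" for n
      using sub[of n] by (simp add: set_integrable_def)
  qed (use G in \<open>auto simp: set_integrable_def\<close>)
  then have J: "J \<longlonglongrightarrow> 0" by (simp add: J_def[abs_def] set_lebesgue_integral_def)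
  have "\<exists>x\<in>{\<delta> n..2 * \<delta> n}. x * G x \<le> 2 * J n + \<delta> n" for n
  proof (rule ccontr)
    assume "\<not> ?thesis"
    then have gt: "2 * J n + \<delta> n < x * G x" if "x \<in> {\<delta> n..2 * \<delta> n}" for x using that by force
    \<comment> \<open>If x G(x) exceeded 2 J + \<open>\<delta>\<close> on the whole interval, then G
      >= K there because x <= 2 \<open>\<delta>\<close>, and the integral would be at least K
      \<open>\<delta>\<close> = J + \<open>\<delta>\<close>/2. The added \<open>\<delta>\<close>
      makes this a contradiction even when J = 0.\<close>
    define K where "K = (2 * J n + \<delta> n) / (2 * \<delta> n)"
    have lower: "K \<le> G x" if x: "x \<in> {\<delta> n..2 * \<delta> n}" for x
    proof -
      have "x * G x \<le> 2 * \<delta> n * G x" using x nonneg by (intro mult_right_mono) auto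
      then show ?thesis using gt[OF x] \<delta>[of n] by (simp add: K_def field_simps)
    qed
    have "K * \<delta> n = (LINT x:{\<delta> n..2 * \<delta> n}|lebesgue. K)"
      using \<delta>[of n] by (subst set_integral_const) (auto simp: emeasure_lborel_Icc_eq)
    also have "\<dots> \<le> J n"
      unfolding J_def
    proof (rule set_integral_mono)
      show "set_integrable lebesgue {\<delta> n..2 * \<delta> n} (\<lambda>x. K)"
        unfolding set_integrable_def by (intro integrable_scaleR_left integrable_real_indicator) (auto simp: emeasure_lborel_Icc_eq)
    qed (use sub lower in auto)
    finally show False
      using \<delta>[of n] mult_pos_pos[OF \<delta>(1)[of n] \<delta>(1)[of n]] by (simp add: K_def field_simps)
  qed
  then obtain X where X: "\<And>n. X n \<in> {\<delta> n..2 * \<delta> n}" "\<And>n. X n * G (X n) \<le> 2 * J n + \<delta> n" by metis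
  show thesis
  proof (rule that[of X "\<lambda>n. 2 * J n + \<delta> n"])
    show "X n \<in> {0<..<1/2}" for n using X(1)[of n] \<delta>[of n] by auto
    show "X \<longlonglongrightarrow> 0"
    proof (rule tendsto_sandwich[OF _ _ \<delta>_lim])
      show "(\<lambda>n. 2 * \<delta> n) \<longlonglongrightarrow> 0" using tendsto_mult[OF tendsto_const \<delta>_lim, of 2] by simp
    qed (use X(1) in auto)
    show "(\<lambda>n. 2 * J n + \<delta> n) \<longlonglongrightarrow> 0"
      using tendsto_add[OF tendsto_mult[OF tendsto_const J, of 2] \<delta>_lim] by simp
  qed (rule X)
qed

lemma set_integrable_reflect01:
  fixes G :: "real \<Rightarrow> real"
  assumes "set_integrable lebesgue {0<..<1} G"
  shows "set_integrable lebesgue {0<..<1} (\<lambda>x. G (1 - x))"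
proof -
  have "integrable lebesgue (\<lambda>x. indicator {0<..<1} (1 + -1 * x) *\<^sub>R G (1 + -1 * x))"
    using assms unfolding set_integrable_def by (rule lebesgue_integrable_real_affine) simp
  moreover have "indicator {0<..<1} (1 + -1 * x) = (indicator {0<..<1} x :: real)" for x :: real
    by (auto simp: indicator_def)
  ultimately show ?thesis by (simp add: set_integrable_def)
qed

text \<open>Young's inequality for w times the indicator of [s, t]. The free parameter d serves two
  purposes: Hoelder continuity, and uniform convergence of test functions.\<close>

lemma primitive_on_growth:
  fixes w :: "real \<Rightarrow> real"
  assumes W: "primitive_on S W w" "s \<in> S" "t \<in> S" "s \<le> t" "{s..t} \<subseteq> A"
    and sq: "set_integrable lebesgue A (\<lambda>x. (w x)\<^sup>2)" and d: "d > 0"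
  shows "\<bar>W t - W s\<bar> \<le> d * (LINT x:A|lebesgue. (w x)\<^sup>2) + (t - s) / d"
proof -
  let ?i = "indicat_real {s..t}"
  have isq: "(\<lambda>x. (?i x)\<^sup>2) = ?i" "(\<lambda>x. (?i x * w x)\<^sup>2) = (\<lambda>x. ?i x * (w x)\<^sup>2)" by (auto simp: indicator_def)
  have w1: "integrable lebesgue (\<lambda>x. ?i x * w x)" using primitive_onD(1)[OF W(1-4)] by (simp add: set_integrable_def)
  have sub: "set_integrable lebesgue {s..t} (\<lambda>x. (w x)\<^sup>2)" by (rule set_integrable_subset[OF sq]) (use W in auto)
  have "(LINT x|lebesgue. (?i x * w x)\<^sup>2) \<le> (LINT x:A|lebesgue. (w x)\<^sup>2)"
    unfolding isq set_lebesgue_integral_def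
    using sub sq W(5) by (intro integral_mono) (auto simp: set_integrable_def indicator_def)
  then have "d * (LINT x|lebesgue. (?i x * w x)\<^sup>2) \<le> d * (LINT x:A|lebesgue. (w x)\<^sup>2)"
    using d by (intro mult_left_mono) auto
  moreover have "?i \<in> borel_measurable lebesgue" by (intro borel_measurable_indicator) auto
  then have "\<bar>LINT x|lebesgue. (?i x * w x) * ?i x\<bar> \<le> d * (LINT x|lebesgue. (?i x * w x)\<^sup>2) + (LINT x|lebesgue. (?i x)\<^sup>2) / d"
    using W(4) w1 sub d
    by (intro integral_mult_L2_le) (auto simp: isq set_integrable_def emeasure_lborel_Icc_eq intro!: integrable_real_indicator)
  moreover have "(LINT x|lebesgue. (?i x)\<^sup>2) = t - s"
    using W(4) by (simp add: isq)
  moreover have "(LINT x|lebesgue. (?i x * w x) * ?i x) = W t - W s"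
    using primitive_onD(2)[OF W(1-4)]
    by (auto simp: set_lebesgue_integral_def indicator_def intro!: Bochner_Integration.integral_cong)
  ultimately show ?thesis by simp
qed

text \<open>The choice d = sqrt (t - s) gives Hoelder continuity of exponent 1/2, with a constant
  that is not optimal.\<close>

lemma primitive_on_sq_growth:
  fixes w :: "real \<Rightarrow> real"
  assumes W: "primitive_on S W w" "s \<in> S" "t \<in> S" "s < t" "{s..t} \<subseteq> A"
    and sq: "set_integrable lebesgue A (\<lambda>x. (w x)\<^sup>2)"
  shows "(W t - W s)\<^sup>2 \<le> (t - s) * ((LINT x:A|lebesgue. (w x)\<^sup>2) + 1)\<^sup>2"
proof -
  define c where "c = (LINT x:A|lebesgue. (w x)\<^sup>2)"
  have "\<bar>W t - W s\<bar> \<le> sqrt (t - s) * c + (t - s) / sqrt (t - s)"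
    unfolding c_def by (rule primitive_on_growth[OF W(1-3) _ W(5) sq]) (use W(4) in auto)
  also have "\<dots> = sqrt (t - s) * (c + 1)" using W(4) by (simp add: real_div_sqrt distrib_left)
  finally have "(W t - W s)\<^sup>2 \<le> (sqrt (t - s) * (c + 1))\<^sup>2"
    by (metis abs_le_square_iff abs_of_nonneg order_trans abs_ge_self abs_ge_zero)
  then show ?thesis using W(4) by (simp add: c_def power_mult_distrib)
qed

text \<open>V may be unbounded at the end points. Since W vanishes there like the square root of the
  distance, (W V)^2 is at most a constant times the distance times V^2. Square integrability of V
  makes this small along a sequence tending to 0 and another tending to 1. Integration by parts
  between these points and dominated convergence finish the proof.\<close>

lemma green_identity:
  assumes W: "primitive_on {0..1} W w" "W 0 = 0" "W 1 = 0"
    and w: "set_integrable lebesgue {0<..<1} (\<lambda>x. (w x)\<^sup>2)"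
    and V: "primitive_on {0<..<1} V v" and V2: "set_integrable lebesgue {0<..<1} (\<lambda>x. (V x)\<^sup>2)"
    and wV: "set_integrable lebesgue {0<..<1} (\<lambda>x. w x * V x)"
    and Wv: "set_integrable lebesgue {0<..<1} (\<lambda>x. W x * v x)"
  shows "(LINT x:{0<..<1}|lebesgue. w x * V x) = - (LINT x:{0<..<1}|lebesgue. W x * v x)"
proof -
  define c where "c = (LINT x:{0..1}|lebesgue. (w x)\<^sup>2) + 1"
  have w01: "set_integrable lebesgue {0..1} (\<lambda>x. (w x)\<^sup>2)"
  proof -
    have n01: "negligible {x \<in> {0<..<1} - {0..1}. (w x)\<^sup>2 \<noteq> 0}" "negligible {x \<in> {0..1} - {0<..<1}. (w x)\<^sup>2 \<noteq> 0}"
      by (rule negligible_subset[of "{0, 1}"]; force)+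
    show ?thesis using absolutely_integrable_spike_set_eq[OF n01] w by simp
  qed
  have near0: "(W x * V x)\<^sup>2 \<le> c\<^sup>2 * (x * (V x)\<^sup>2)" if "x \<in> {0<..<1}" for x
  proof -
    have "(W x - W 0)\<^sup>2 \<le> (x - 0) * c\<^sup>2"
      unfolding c_def by (rule primitive_on_sq_growth[OF W(1) _ _ _ _ w01]) (use that in auto)
    then have "(W x)\<^sup>2 * (V x)\<^sup>2 \<le> x * c\<^sup>2 * (V x)\<^sup>2" using W(2) by (intro mult_right_mono) auto
    then show ?thesis by (simp add: power_mult_distrib mult_ac)
  qed
  have near1: "(W x * V x)\<^sup>2 \<le> c\<^sup>2 * ((1 - x) * (V x)\<^sup>2)" if "x \<in> {0<..<1}" for x
  proof -
    have "(W 1 - W x)\<^sup>2 \<le> (1 - x) * c\<^sup>2"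
      unfolding c_def by (rule primitive_on_sq_growth[OF W(1) _ _ _ _ w01]) (use that in auto)
    then have "(W x)\<^sup>2 * (V x)\<^sup>2 \<le> (1 - x) * c\<^sup>2 * (V x)\<^sup>2" using W(3) by (intro mult_right_mono) auto
    then show ?thesis by (simp add: power_mult_distrib mult_ac)
  qed
  have sq0: "z \<longlonglongrightarrow> 0" if "\<And>n. (z n)\<^sup>2 \<le> c\<^sup>2 * y n" "y \<longlonglongrightarrow> 0" for z y :: "nat \<Rightarrow> real"
  proof -
    have "(\<lambda>n. c\<^sup>2 * y n) \<longlonglongrightarrow> c\<^sup>2 * 0" by (intro tendsto_intros that)
    then have "(\<lambda>n. (z n)\<^sup>2) \<longlonglongrightarrow> 0"
      by (intro tendsto_sandwich[OF _ _ tendsto_const[of 0], of "\<lambda>n. (z n)\<^sup>2" _ "\<lambda>n. c\<^sup>2 * y n"]) (use that(1) in auto)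
    from tendsto_real_sqrt[OF this] show ?thesis by (simp add: tendsto_rabs_zero_iff)
  qed
  obtain X Y where X: "\<And>n. X n \<in> {0<..<1/2}" "X \<longlonglongrightarrow> 0" "\<And>n. X n * (V (X n))\<^sup>2 \<le> Y n" "Y \<longlonglongrightarrow> 0"
    using exists_small_near_0[OF V2] by auto
  obtain X' Y' where X': "\<And>n. X' n \<in> {0<..<1/2}" "X' \<longlonglongrightarrow> 0" "\<And>n. X' n * (V (1 - X' n))\<^sup>2 \<le> Y' n" "Y' \<longlonglongrightarrow> 0"
    using exists_small_near_0[OF set_integrable_reflect01[OF V2]] by auto
  define Z where "Z n = 1 - X' n" for n
  have XZ: "0 < X n" "X n < Z n" "Z n < 1" for n using X(1)[of n] X'(1)[of n] by (auto simp: Z_def)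
  have Z_lim: "Z \<longlonglongrightarrow> 1" unfolding Z_def using tendsto_diff[OF tendsto_const X'(2), of 1] by simp
  have WX: "(\<lambda>n. W (X n) * V (X n)) \<longlonglongrightarrow> 0"
  proof (rule sq0[OF _ X(4)])
    show "(W (X n) * V (X n))\<^sup>2 \<le> c\<^sup>2 * Y n" for n
      using near0[of "X n"] mult_left_mono[OF X(3)[of n], of "c\<^sup>2"] XZ[of n] by simp
  qed
  have WZ: "(\<lambda>n. W (Z n) * V (Z n)) \<longlonglongrightarrow> 0"
  proof (rule sq0[OF _ X'(4)])
    show "(W (Z n) * V (Z n))\<^sup>2 \<le> c\<^sup>2 * Y' n" for n
      using near1[of "Z n"] mult_left_mono[OF X'(3)[of n], of "c\<^sup>2"] XZ[of n] by (simp add: Z_def)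
  qed
  let ?g = "\<lambda>x. w x * V x + W x * v x"
  have g: "set_integrable lebesgue {0<..<1} ?g" using wV Wv by (rule set_integral_add)
  have sub: "set_integrable lebesgue {X n..Z n} ?g" for n
    by (rule set_integrable_subset[OF g]) (use XZ[of n] in auto)
  have "(\<lambda>n. LINT x|lebesgue. indicator {X n..Z n} x *\<^sub>R ?g x) \<longlonglongrightarrow> (LINT x|lebesgue. indicator {0<..<1} x *\<^sub>R ?g x)"
  proof (rule integral_dominated_convergence[where w = "\<lambda>x. \<bar>indicator {0<..<1} x *\<^sub>R ?g x\<bar>"])
    show "AE x in lebesgue. (\<lambda>n. indicator {X n..Z n} x *\<^sub>R ?g x) \<longlonglongrightarrow> indicator {0<..<1} x *\<^sub>R ?g x"
    proof (intro always_eventually allI)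
      fix x :: real
      have "\<forall>\<^sub>F n in sequentially. indicator {0<..<1} x *\<^sub>R ?g x = indicator {X n..Z n} x *\<^sub>R ?g x"
      proof (cases "x \<in> {0<..<1}")
        case True
        then have "\<forall>\<^sub>F n in sequentially. X n < x" "\<forall>\<^sub>F n in sequentially. x < Z n"
          using order_tendstoD(2)[OF X(2)] order_tendstoD(1)[OF Z_lim] by auto
        then show ?thesis by eventually_elim (use True in auto)
      next
        case False
        have "x \<notin> {X n..Z n}" for n using False XZ[of n] by auto
        then show ?thesis using False by simp
      qed
      then show "(\<lambda>n. indicator {X n..Z n} x *\<^sub>R ?g x) \<longlonglongrightarrow> indicator {0<..<1} x *\<^sub>R ?g x"
        by (rule Lim_transform_eventually[OF tendsto_const])
    qed
    show "AE x in lebesgue. norm (indicator {X n..Z n} x *\<^sub>R ?g x) \<le> \<bar>indicator {0<..<1} x *\<^sub>R ?g x\<bar>" for n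
      using XZ[of n] by (intro always_eventually allI) (auto simp: indicator_def)
    show "(\<lambda>x. indicator {X n..Z n} x *\<^sub>R ?g x) \<in> borel_measurable lebesgue" for n
      using sub[of n] by (simp add: set_integrable_def)
    show "integrable lebesgue (\<lambda>x. \<bar>indicator {0<..<1} x *\<^sub>R ?g x\<bar>)" "(\<lambda>x. indicator {0<..<1} x *\<^sub>R ?g x) \<in> borel_measurable lebesgue"
      using g unfolding set_integrable_def by (rule integrable_abs, rule borel_measurable_integrable)
  qed
  moreover have "(LINT x|lebesgue. indicator {X n..Z n} x *\<^sub>R ?g x) = W (Z n) * V (Z n) - W (X n) * V (X n)" for n
  proof -
    have p: "primitive_on {X n..Z n} W w" "primitive_on {X n..Z n} V v"
      using primitive_on_subset[OF W(1)] primitive_on_subset[OF V] XZ[of n] by (auto simp: subset_eq)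
    note bp = primitive_on_by_parts[OF p less_imp_le[OF XZ(2)]]
    then show ?thesis using set_integral_add(2)[OF bp(2,3)] by (simp add: set_lebesgue_integral_def)
  qed
  moreover have "(\<lambda>n. W (Z n) * V (Z n) - W (X n) * V (X n)) \<longlonglongrightarrow> 0 - 0"
    by (intro tendsto_diff WX WZ)
  ultimately have "(LINT x:{0<..<1}|lebesgue. ?g x) = 0"
    unfolding set_lebesgue_integral_def by (simp add: LIMSEQ_unique)
  then show ?thesis using set_integral_add(2)[OF wV Wv] by simp
qed

text \<open>Membership in H^1_0 with a given version w of the derivative. The formulation by a
  primitive on the closed interval is the common ground of \<open>H1_0\<close>, a closure of test
  functions, and \<open>vanishes_at_ends\<close>, a condition on the continuous
  representative.\<close>

definition H10 :: "(real \<Rightarrow> real) \<Rightarrow> (real \<Rightarrow> real) \<Rightarrow> bool" where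
  "H10 v w \<longleftrightarrow> set_integrable lebesgue Omega (\<lambda>x. (w x)\<^sup>2) \<and>
     (\<exists>W. primitive_on {0..1} W w \<and> W 0 = 0 \<and> W 1 = 0 \<and> (AE x in lebesgue. x \<in> Omega \<longrightarrow> W x = v x))"

lemma primitive_on_diff:
  assumes "primitive_on S F f" "primitive_on S G g"
  shows "primitive_on S (\<lambda>x. F x - G x) (\<lambda>x. f x - g x)"
  unfolding primitive_on_def
proof (intro ballI impI)
  fix s t assume st: "s \<in> S" "t \<in> S" "s \<le> t"
  show "set_integrable lebesgue {s..t} (\<lambda>x. f x - g x) \<and> F t - G t - (F s - G s) = (LINT r:{s..t}|lebesgue. f r - g r)"
    using set_integral_diff[OF primitive_onD(1)[OF assms(1) st] primitive_onD(1)[OF assms(2) st]]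
      primitive_onD(2)[OF assms(1) st] primitive_onD(2)[OF assms(2) st] by simp
qed

lemma set_integrable_iff_lebesgue_on:
  fixes f :: "real \<Rightarrow> real"
  shows "A \<in> sets lebesgue \<Longrightarrow> set_integrable lebesgue A f \<longleftrightarrow> integrable (lebesgue_on A) f"
  by (simp add: set_integrable_def integrable_restrict_space)

lemma set_integral_iff_lebesgue_on:
  fixes f :: "real \<Rightarrow> real"
  shows "A \<in> sets lebesgue \<Longrightarrow> (LINT x:A|lebesgue. f x) = (LINT x|lebesgue_on A. f x)"
  by (simp add: set_lebesgue_integral_def integral_restrict_space)

lemma Omega_lebesgue [simp]: "Omega \<in> sets lebesgue" "Omega \<in> lmeasurable"
  by auto

section \<open>Functions vanishing at the end points and their Dirichlet form\<close>

lemma locally_integrable_measurable: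
  assumes "locally_integrable Omega f"
  shows "f \<in> borel_measurable (lebesgue_on Omega)"
proof -
  define A where "A n = {1 / real (Suc (Suc n))..1 - 1 / real (Suc (Suc n))}" for n
  have "A n \<subseteq> Omega" "compact (A n)" for n
  proof -
    define e where "e = 1 / real (Suc (Suc n))"
    have "0 < e" by (simp add: e_def)
    then have "{e..1 - e} \<subseteq> Omega" by auto
    then show "A n \<subseteq> Omega" by (simp only: A_def e_def)
  qed (simp add: A_def)
  then have "integrable lebesgue (\<lambda>x. indicator (A n) x *\<^sub>R f x)" for n
    using assms unfolding locally_integrable_def set_integrable_def by blast
  then have "(\<lambda>x. indicator (A n) x * f x) \<in> borel_measurable lebesgue" for n
    using borel_measurable_integrable by fastforce
  moreover have "(\<lambda>n. indicator (A n) x * f x) \<longlonglongrightarrow> indicator Omega x * f x" for x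
  proof (cases "x \<in> Omega")
    case True
    have "(\<lambda>n. 1 / real (Suc (Suc n))) \<longlonglongrightarrow> 0"
      using LIMSEQ_ignore_initial_segment[OF LIMSEQ_inverse_real_of_nat, of 1] by (simp add: inverse_eq_divide)
    then have "\<forall>\<^sub>F n in sequentially. 1 / real (Suc (Suc n)) < min x (1 - x)"
      using True by (intro order_tendstoD(2)) auto
    then have "\<forall>\<^sub>F n in sequentially. indicator Omega x * f x = indicator (A n) x * f x"
      by eventually_elim (use True in \<open>auto simp: A_def\<close>)
    then show ?thesis by (rule Lim_transform_eventually[OF tendsto_const])
  next
    case False
    then have "x \<notin> A n" for n using \<open>A n \<subseteq> Omega\<close> by blast
    then show ?thesis using False by simp
  qed
  ultimately have "(\<lambda>x. indicator Omega x * f x) \<in> borel_measurable lebesgue"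
    by (rule borel_measurable_LIMSEQ_real[rotated])
  then show ?thesis
    by (simp add: borel_measurable_restrict_space_iff)
qed

lemma set_integrable_Omega_Icc:
  fixes f :: "real \<Rightarrow> real"
  shows "set_integrable lebesgue {0..1} f \<longleftrightarrow> set_integrable lebesgue Omega f"
    "(LINT x:{0..1}|lebesgue. f x) = (LINT x:Omega|lebesgue. f x)"
proof -
  have n01: "negligible {x \<in> {0..1} - Omega. f x \<noteq> 0}" "negligible {x \<in> Omega - {0..1}. f x \<noteq> 0}" for f :: "real \<Rightarrow> real"
    by (rule negligible_subset[of "{0, 1}"]; force)+
  show i: "set_integrable lebesgue {0..1} f \<longleftrightarrow> set_integrable lebesgue Omega f"
    by (rule absolutely_integrable_spike_set_eq[OF n01])
  show "(LINT x:{0..1}|lebesgue. f x) = (LINT x:Omega|lebesgue. f x)"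
  proof (cases "set_integrable lebesgue {0..1} f")
    case True
    have "AE x in lebesgue. indicator {0..1} x *\<^sub>R f x = indicator Omega x *\<^sub>R f x"
    proof (rule AE_I'[of "{0, 1}"])
      show "{0, 1} \<in> null_sets lebesgue" by (auto simp: negligible_iff_null_sets[symmetric])
    qed (auto simp: indicator_def)
    then show ?thesis
      unfolding set_lebesgue_integral_def
      using True i by (intro integral_cong_AE) (auto simp: set_integrable_def dest: borel_measurable_integrable)
  next
    case False
    then have "\<not> integrable lebesgue (\<lambda>x. indicator {0..1} x *\<^sub>R f x)" "\<not> integrable lebesgue (\<lambda>x. indicator Omega x *\<^sub>R f x)"
      using i by (auto simp: set_integrable_def)
    then show ?thesis by (simp add: set_lebesgue_integral_def not_integrable_integral_eq)
  qed
qed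

lemma L2_Omega_integrable:
  fixes f :: "real \<Rightarrow> real"
  assumes "f \<in> borel_measurable (lebesgue_on Omega)" "set_integrable lebesgue Omega (\<lambda>x. (f x)\<^sup>2)"
  shows "set_integrable lebesgue {0..1} f"
  unfolding set_integrable_Omega_Icc(1)
  by (rule L2_set_integrable[OF assms(2)])
    (use assms(1) in \<open>auto simp: set_borel_measurable_def borel_measurable_restrict_space_iff\<close>)

lemma primitive_on_indefinite:
  fixes g :: "real \<Rightarrow> real"
  assumes "set_integrable lebesgue {a..b} g"
  shows "primitive_on {a..b} (\<lambda>x. LINT r:{a..x}|lebesgue. g r) g"
  unfolding primitive_on_def
proof (intro ballI impI conjI)
  fix s t assume st: "s \<in> {a..b}" "t \<in> {a..b}" "s \<le> t"
  show "set_integrable lebesgue {s..t} g" by (rule set_integrable_subset[OF assms]) (use st in auto)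
  have "set_integrable lebesgue {a..t} g" by (rule set_integrable_subset[OF assms]) (use st in auto)
  from set_integral_Icc_combine[OF this, of s] st
  show "(LINT r:{a..t}|lebesgue. g r) - (LINT r:{a..s}|lebesgue. g r) = (LINT r:{s..t}|lebesgue. g r)" by auto
qed

text \<open>As w is square integrable on a bounded interval, its primitive from 0 extends
  continuously to [0, 1]. It differs from the given continuous representative by a constant on the
  open interval, hence on the closure, so that representative is itself a primitive of w.\<close>

lemma H10I:
  assumes wd: "has_weak_deriv Omega v w" and van: "vanishes_at_ends v"
    and sq: "set_integrable lebesgue Omega (\<lambda>x. (w x)\<^sup>2)"
  shows "H10 v w"
proof -
  obtain v' where v': "continuous_on {0..1} v'" "AE x in lebesgue_on Omega. v' x = v x" "v' 0 = 0" "v' 1 = 0"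
    using van by (auto simp: vanishes_at_ends_def)
  have v'_ae: "AE x in lebesgue. x \<in> Omega \<longrightarrow> v' x = v x"
    using v'(2) by (simp add: AE_restrict_space_iff)
  have w: "set_integrable lebesgue {0..1} w"
    using wd sq by (intro L2_Omega_integrable locally_integrable_measurable) (auto simp: has_weak_deriv_def)
  define P where "P x = (LINT r:{0..x}|lebesgue. w r)" for x
  have P: "primitive_on {0..1} P w" unfolding P_def by (rule primitive_on_indefinite[OF w])
  obtain F where F: "primitive_on Omega F w" "AE x in lebesgue. x \<in> Omega \<longrightarrow> F x = v x"
    using has_weak_deriv_primitive[OF wd] by auto
  have PF: "P x - F x = P (1/2) - F (1/2)" if "x \<in> Omega" for x
  proof (cases "x \<le> 1/2")
    case True
    then show ?thesis using primitive_onD(2)[OF P, of x "1/2"] primitive_onD(2)[OF F(1), of x "1/2"] that by auto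
  next
    case False
    then show ?thesis using primitive_onD(2)[OF P, of "1/2" x] primitive_onD(2)[OF F(1), of "1/2" x] that by auto
  qed
  define c where "c = P (1/2) - F (1/2)"
  have "{x \<in> Omega. v' x - (P x - c) \<noteq> 0} = {}"
  proof (rule ccontr)
    assume "{x \<in> Omega. v' x - (P x - c) \<noteq> 0} \<noteq> {}"
    moreover have "open {x \<in> Omega. v' x - (P x - c) \<noteq> 0}"
    proof -
      have "continuous_on Omega (\<lambda>x. v' x - (P x - c))"
        using v'(1) primitive_on_continuous[OF P]
        by (intro continuous_intros) (auto intro: continuous_on_subset)
      from continuous_open_preimage[OF this open_greaterThanLessThan, of "- {0}"]
      have "open (Omega \<inter> (\<lambda>x. v' x - (P x - c)) -` (- {0}))" by auto
      then show ?thesis by (simp add: vimage_def Int_def)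
    qed
    ultimately have "\<not> negligible {x \<in> Omega. v' x - (P x - c) \<noteq> 0}"
      using open_not_negligible by blast
    moreover have "AE x in lebesgue. x \<in> Omega \<longrightarrow> v' x = P x - c"
      using v'_ae F(2)
    proof eventually_elim
      case (elim x)
      then show ?case using PF[of x] unfolding c_def by argo
    qed
    then have "negligible {x \<in> Omega. v' x - (P x - c) \<noteq> 0}"
      by (auto simp: eventually_ae_filter negligible_iff_null_sets[symmetric] elim!: negligible_subset)
    ultimately show False by simp
  qed
  then have eq: "v' x - P x = - c" if "x \<in> Omega" for x using that by auto
  have "v' x - P x = - c" if "x \<in> {0..1}" for x
  proof (rule continuous_constant_on_closure[of Omega "\<lambda>x. v' x - P x"])
    show "continuous_on (closure Omega) (\<lambda>x. v' x - P x)"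
      using v'(1) primitive_on_continuous[OF P] by (auto intro: continuous_intros)
  qed (use eq that in auto)
  then have vP: "v' x = P x - c" if "x \<in> {0..1}" for x using that by force
  have "primitive_on {0..1} v' w"
    using P vP by (auto simp: primitive_on_def)
  then show ?thesis
    unfolding H10_def using sq v' v'_ae by auto
qed

lemma set_integral_cong_AE_Omega:
  fixes f g :: "real \<Rightarrow> real"
  assumes "AE x in lebesgue. x \<in> Omega \<longrightarrow> f x = g x" "set_integrable lebesgue Omega f"
  shows "set_integrable lebesgue Omega g" "(LINT x:Omega|lebesgue. f x) = (LINT x:Omega|lebesgue. g x)"
proof -
  have ae: "AE x in lebesgue. indicator Omega x *\<^sub>R f x = indicator Omega x *\<^sub>R g x"
    using assms(1) by eventually_elim (simp add: indicator_def)
  have m: "(\<lambda>x. indicator Omega x *\<^sub>R g x) \<in> borel_measurable lebesgue"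
    by (rule borel_measurable_AE[OF borel_measurable_integrable ae])
      (use assms(2) in \<open>simp add: set_integrable_def\<close>)
  show "set_integrable lebesgue Omega g"
    using assms(2) unfolding set_integrable_def by (rule integrable_cong_AE_imp[OF _ m ae])
  show "(LINT x:Omega|lebesgue. f x) = (LINT x:Omega|lebesgue. g x)"
    unfolding set_lebesgue_integral_def
    using assms(2) m ae by (intro integral_cong_AE) (auto simp: set_integrable_def dest: borel_measurable_integrable)
qed

lemma H10_diff:
  assumes v: "H10 v vx" and u: "H10 u ux"
  shows "H10 (\<lambda>x. v x - u x) (\<lambda>x. vx x - ux x)"
proof -
  obtain V where V: "primitive_on {0..1} V vx" "V 0 = 0" "V 1 = 0" "AE x in lebesgue. x \<in> Omega \<longrightarrow> V x = v x"
    and vx: "set_integrable lebesgue Omega (\<lambda>x. (vx x)\<^sup>2)" using v by (auto simp: H10_def)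
  obtain U where U: "primitive_on {0..1} U ux" "U 0 = 0" "U 1 = 0" "AE x in lebesgue. x \<in> Omega \<longrightarrow> U x = u x"
    and ux: "set_integrable lebesgue Omega (\<lambda>x. (ux x)\<^sup>2)" using u by (auto simp: H10_def)
  have "primitive_on {0..1} (\<lambda>x. V x - U x) (\<lambda>x. vx x - ux x)" by (rule primitive_on_diff[OF V(1) U(1)])
  moreover have "AE x in lebesgue. x \<in> Omega \<longrightarrow> V x - U x = v x - u x"
    using V(4) U(4) by eventually_elim auto
  moreover have "set_integrable lebesgue Omega vx" "set_integrable lebesgue Omega ux"
    using primitive_onD(1)[OF V(1), of 0 1] primitive_onD(1)[OF U(1), of 0 1]
    by (simp_all flip: set_integrable_Omega_Icc(1))
  then have "set_integrable lebesgue Omega (\<lambda>x. (vx x - ux x)\<^sup>2)"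
    using vx ux by (simp add: set_integrable_iff_lebesgue_on integrable_add_sq(2))
  ultimately show ?thesis
    unfolding H10_def using V U by (auto intro!: exI[of _ "\<lambda>x. V x - U x"])
qed

text \<open>In the product v u_xx the weights 1/a and a cancel, so it is integrable although u_xx is
  controlled only with the degenerate weight.\<close>

lemma H10_green:
  assumes a: "\<And>x. x \<in> Omega \<Longrightarrow> a x > 0"
    and v: "H10 v vx" and uxx: "has_weak_deriv Omega ux uxx"
    and vv: "set_integrable lebesgue Omega (\<lambda>x. (v x)\<^sup>2 / a x)"
    and ux: "set_integrable lebesgue Omega (\<lambda>x. (ux x)\<^sup>2)"
    and pp: "set_integrable lebesgue Omega (\<lambda>x. a x * (uxx x)\<^sup>2)"
  shows "set_integrable lebesgue Omega (\<lambda>x. vx x * ux x)"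
    and "(LINT x:Omega|lebesgue. vx x * ux x) = - (LINT x:Omega|lebesgue. v x * uxx x)"
proof -
  obtain W where W: "primitive_on {0..1} W vx" "W 0 = 0" "W 1 = 0" and W_ae: "AE x in lebesgue. x \<in> Omega \<longrightarrow> W x = v x"
    and vx: "set_integrable lebesgue Omega (\<lambda>x. (vx x)\<^sup>2)" using v by (auto simp: H10_def)
  obtain G where G: "primitive_on Omega G uxx" "AE x in lebesgue. x \<in> Omega \<longrightarrow> G x = ux x"
    using has_weak_deriv_primitive[OF uxx] by auto
  have meas: "vx \<in> borel_measurable (lebesgue_on Omega)" "ux \<in> borel_measurable (lebesgue_on Omega)"
    "uxx \<in> borel_measurable (lebesgue_on Omega)"
  proof -
    have "set_integrable lebesgue Omega vx"
      using primitive_onD(1)[OF W(1), of 0 1] by (simp flip: set_integrable_Omega_Icc(1))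
    then show "vx \<in> borel_measurable (lebesgue_on Omega)" by (simp add: set_integrable_iff_lebesgue_on)
  qed (use uxx in \<open>auto intro: locally_integrable_measurable simp: has_weak_deriv_def\<close>)
  have W_meas: "W \<in> borel_measurable (lebesgue_on Omega)"
    by (rule continuous_imp_measurable_on_sets_lebesgue)
      (auto intro: continuous_on_subset[OF primitive_on_continuous[OF W(1)]])
  have W2: "integrable (lebesgue_on Omega) (\<lambda>x. (v x)\<^sup>2 / a x + a x * (uxx x)\<^sup>2)"
    using vv pp by (intro Bochner_Integration.integrable_add) (simp_all add: set_integrable_iff_lebesgue_on)
  have Wuxx: "set_integrable lebesgue Omega (\<lambda>x. W x * uxx x)"
    unfolding set_integrable_iff_lebesgue_on[OF Omega_lebesgue(1)]
  proof (rule Bochner_Integration.integrable_bound[OF W2])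
    show "(\<lambda>x. W x * uxx x) \<in> borel_measurable (lebesgue_on Omega)" using W_meas meas by simp
    have "AE x in lebesgue_on Omega. W x = v x" using W_ae by (simp add: AE_restrict_space_iff)
    moreover have "AE x in lebesgue_on Omega. x \<in> Omega" by (rule AE_I2) simp
    ultimately show "AE x in lebesgue_on Omega. norm (W x * uxx x) \<le> norm ((v x)\<^sup>2 / a x + a x * (uxx x)\<^sup>2)"
    proof eventually_elim
      case (elim x)
      have A: "a x > 0" using elim a by auto
      let ?s = "sqrt (a x)"
      have s: "?s > 0" "?s * ?s = a x" using A by auto
      have "2 * (\<bar>v x\<bar> / ?s) * (?s * \<bar>uxx x\<bar>) \<le> (\<bar>v x\<bar> / ?s)\<^sup>2 + (?s * \<bar>uxx x\<bar>)\<^sup>2"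
        by (rule sum_squares_bound)
      also have "\<dots> = (v x)\<^sup>2 / a x + a x * (uxx x)\<^sup>2" using A by (simp add: power_divide power_mult_distrib)
      also have "2 * (\<bar>v x\<bar> / ?s) * (?s * \<bar>uxx x\<bar>) = 2 * \<bar>W x * uxx x\<bar>" using s elim by (simp add: abs_mult)
      finally have 1: "2 * \<bar>W x * uxx x\<bar> \<le> (v x)\<^sup>2 / a x + a x * (uxx x)\<^sup>2" .
      have "\<bar>W x * uxx x\<bar> \<le> 2 * \<bar>W x * uxx x\<bar>" by simp
      with 1 show ?case unfolding real_norm_def by linarith
    qed
  qed
  show wux: "set_integrable lebesgue Omega (\<lambda>x. vx x * ux x)"
    using meas vx ux by (simp add: set_integrable_iff_lebesgue_on integrable_mult_L2)
  have G2: "set_integrable lebesgue Omega (\<lambda>x. (G x)\<^sup>2)"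
    by (rule set_integral_cong_AE_Omega(1)[OF _ ux]) (use G(2) in eventually_elim, auto)
  have ae_wG: "AE x in lebesgue. x \<in> Omega \<longrightarrow> vx x * ux x = vx x * G x"
    using G(2) by eventually_elim auto
  note wG = set_integral_cong_AE_Omega[OF ae_wG wux]
  have green: "(LINT x:Omega|lebesgue. vx x * G x) = - (LINT x:Omega|lebesgue. W x * uxx x)"
    by (rule green_identity[OF W vx G(1) G2 wG(1) Wuxx])
  have "AE x in lebesgue. x \<in> Omega \<longrightarrow> W x * uxx x = v x * uxx x"
    using W_ae by eventually_elim auto
  from set_integral_cong_AE_Omega(2)[OF this Wuxx] green wG(2)
  show "(LINT x:Omega|lebesgue. vx x * ux x) = - (LINT x:Omega|lebesgue. v x * uxx x)" by simp
qed

text \<open>Pointwise 2 (v_x - u_x) u_x <= v_x^2 - u_x^2, and Green's identity moves the derivative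
  from v - u to u_x. Only the earlier function u needs a second derivative.\<close>

lemma H10_convexity:
  assumes a: "\<And>x. x \<in> Omega \<Longrightarrow> a x > 0"
    and v: "H10 v vx" and u: "H10 u ux" and uxx: "has_weak_deriv Omega ux uxx"
    and vu: "set_integrable lebesgue Omega (\<lambda>x. (v x - u x)\<^sup>2 / a x)"
    and pp: "set_integrable lebesgue Omega (\<lambda>x. a x * (uxx x)\<^sup>2)"
  shows "2 * (LINT x:Omega|lebesgue. (v x - u x) * (- uxx x)) \<le> (LINT x:Omega|lebesgue. (vx x)\<^sup>2) - (LINT x:Omega|lebesgue. (ux x)\<^sup>2)"
proof -
  have vx: "set_integrable lebesgue Omega (\<lambda>x. (vx x)\<^sup>2)" and ux: "set_integrable lebesgue Omega (\<lambda>x. (ux x)\<^sup>2)"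
    using v u by (auto simp: H10_def)
  note gr = H10_green[OF a H10_diff[OF v u] uxx vu ux pp]
  have "(LINT x:Omega|lebesgue. (v x - u x) * (- uxx x)) = (LINT x:Omega|lebesgue. (vx x - ux x) * ux x)"
    using gr(2) by (simp add: set_lebesgue_integral_def)
  then have "2 * (LINT x:Omega|lebesgue. (v x - u x) * (- uxx x)) = (LINT x|lebesgue_on Omega. 2 * ((vx x - ux x) * ux x))"
    by (simp add: set_integral_iff_lebesgue_on)
  also have "\<dots> \<le> (LINT x|lebesgue_on Omega. (vx x)\<^sup>2 - (ux x)\<^sup>2)"
  proof (rule integral_mono)
    show "integrable (lebesgue_on Omega) (\<lambda>x. 2 * ((vx x - ux x) * ux x))" using gr(1) by (simp add: set_integrable_iff_lebesgue_on)
    show "integrable (lebesgue_on Omega) (\<lambda>x. (vx x)\<^sup>2 - (ux x)\<^sup>2)" using vx ux by (simp add: set_integrable_iff_lebesgue_on)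
    fix x
    show "2 * ((vx x - ux x) * ux x) \<le> (vx x)\<^sup>2 - (ux x)\<^sup>2"
      using zero_le_power2[of "vx x - ux x"] by (simp add: power2_eq_square algebra_simps)
  qed
  also have "\<dots> = (LINT x:Omega|lebesgue. (vx x)\<^sup>2) - (LINT x:Omega|lebesgue. (ux x)\<^sup>2)"
    using vx ux by (simp add: set_integrable_iff_lebesgue_on set_integral_iff_lebesgue_on)
  finally show ?thesis .
qed

section \<open>Boundary values of limits of test functions\<close>

lemma test_fun_deriv:
  assumes "test_fun S \<phi>"
  shows "(\<phi> has_real_derivative deriv \<phi> x) (at x)" "continuous_on UNIV (deriv \<phi>)"
proof -
  have "(deriv ^^ 0) \<phi> differentiable_on UNIV" "(deriv ^^ 1) \<phi> differentiable_on UNIV"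
    using assms by (auto simp only: test_fun_def)
  then have d: "\<phi> differentiable_on UNIV" "deriv \<phi> differentiable_on UNIV" by simp_all
  then show "(\<phi> has_real_derivative deriv \<phi> x) (at x)"
    by (simp add: differentiable_on_def DERIV_deriv_iff_real_differentiable)
  show "continuous_on UNIV (deriv \<phi>)" using d(2) by (rule differentiable_imp_continuous_on)
qed

lemma test_fun_primitive:
  assumes "test_fun S \<phi>"
  shows "primitive_on UNIV \<phi> (deriv \<phi>)"
  unfolding primitive_on_def
proof (intro ballI impI conjI)
  fix s t :: real assume st: "s \<le> t"
  show i: "set_integrable lebesgue {s..t} (deriv \<phi>)"
    by (intro absolutely_integrable_continuous_real continuous_on_subset[OF test_fun_deriv(2)[OF assms]]) simp
  have "(deriv \<phi> has_integral \<phi> t - \<phi> s) {s..t}"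
    using st test_fun_deriv(1)[OF assms] by (intro fundamental_theorem_of_calculus)
      (auto simp: has_real_derivative_iff_has_vector_derivative[symmetric] has_field_derivative_at_within)
  then show "\<phi> t - \<phi> s = (LINT r:{s..t}|lebesgue. deriv \<phi> r)"
    using set_lebesgue_integral_eq_integral(2)[OF i] by (simp add: integral_unique)
qed

text \<open>
  Convergence of the derivatives in \<open>L\<^sup>2\<close> makes the approximating test functions converge uniformly,
  so the boundary values survive.
\<close>

lemma H1_0_vanishes:
  assumes "f \<in> H1_0"
  shows "vanishes_at_ends f"
proof -
  obtain g \<phi> where fL: "f \<in> L2" and g: "g \<in> L2" and \<phi>: "\<And>n. test_fun Omega (\<phi> n)"
    and l1: "(\<lambda>n. \<integral>\<^sup>+x. ennreal ((\<phi> n x - f x)\<^sup>2) \<partial>lebesgue_on Omega) \<longlonglongrightarrow> 0"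
    and l2: "(\<lambda>n. \<integral>\<^sup>+x. ennreal ((deriv (\<phi> n) x - g x)\<^sup>2) \<partial>lebesgue_on Omega) \<longlonglongrightarrow> 0"
    using assms by (auto simp: H1_0_def)
  have gm: "g \<in> borel_measurable (lebesgue_on Omega)" and fm: "f \<in> borel_measurable (lebesgue_on Omega)"
    using g fL by (auto simp: L2_def)
  have g2: "integrable (lebesgue_on Omega) (\<lambda>x. (g x)\<^sup>2)"
    using g gm by (intro integrableI_bounded) (auto simp: L2_def)
  have g1: "set_integrable lebesgue {0..1} g"
    using gm g2 by (intro L2_Omega_integrable) (simp_all add: set_integrable_iff_lebesgue_on)
  define W where "W x = (LINT r:{0..x}|lebesgue. g r)" for x
  have W: "primitive_on {0..1} W g" unfolding W_def by (rule primitive_on_indefinite[OF g1])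
  have W0: "W 0 = 0"
    unfolding W_def set_lebesgue_integral_def
    by (rule integral_eq_zero_AE, rule AE_mp[OF AE_completion[OF AE_lborel_singleton[of 0]]]) auto
  have \<phi>0: "\<phi> n 0 = 0" "\<phi> n 1 = 0" for n
  proof -
    obtain K where "K \<subseteq> Omega" "\<And>x. x \<notin> K \<Longrightarrow> \<phi> n x = 0" using \<phi>[of n] by (auto simp: test_fun_def)
    then show "\<phi> n 0 = 0" "\<phi> n 1 = 0" by (metis greaterThanLessThan_iff less_irrefl subsetD)+
  qed
  define e where "e n = (LINT x|lebesgue_on Omega. (deriv (\<phi> n) x - g x)\<^sup>2)" for n
  have dm: "deriv (\<phi> n) \<in> borel_measurable (lebesgue_on Omega)" for n
    by (rule continuous_imp_measurable_on_sets_lebesgue)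
      (auto intro: continuous_on_subset[OF test_fun_deriv(2)[OF \<phi>]])
  have d2: "integrable (lebesgue_on Omega) (\<lambda>x. (deriv (\<phi> n) x)\<^sup>2)" for n
  proof -
    have "set_integrable lebesgue {0..1} (\<lambda>x. (deriv (\<phi> n) x)\<^sup>2)"
      by (intro absolutely_integrable_continuous_real continuous_intros continuous_on_subset[OF test_fun_deriv(2)[OF \<phi>]]) simp
    then show ?thesis by (simp add: set_integrable_Omega_Icc(1) set_integrable_iff_lebesgue_on)
  qed
  have diff2: "integrable (lebesgue_on Omega) (\<lambda>x. (deriv (\<phi> n) x - g x)\<^sup>2)" for n
    by (rule integrable_add_sq(2)[OF dm gm d2 g2])
  have "(\<integral>\<^sup>+x. ennreal ((deriv (\<phi> n) x - g x)\<^sup>2) \<partial>lebesgue_on Omega) = ennreal (e n)" for n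
    unfolding e_def by (rule nn_integral_eq_integral[OF diff2]) simp
  with l2 have "(\<lambda>n. ennreal (e n)) \<longlonglongrightarrow> ennreal 0" by simp
  then have e: "e \<longlonglongrightarrow> 0" by (rule tendsto_ennrealD) (auto simp: e_def)
  have e0: "e n \<ge> 0" for n by (simp add: e_def)
  \<comment> \<open>The summand 1/(n + 1) keeps \<open>E n\<close> positive, so that 1 / sqrt (E n)
    is admissible as the parameter of the growth bound.\<close>
  define E where "E n = e n + 1 / real (Suc n)" for n
  have E: "E n > 0" "e n \<le> E n" for n using e0[of n] by (auto simp: E_def intro: add_nonneg_pos)
  have "E \<longlonglongrightarrow> 0 + 0"
    unfolding E_def using LIMSEQ_inverse_real_of_nat by (intro tendsto_add e) (simp add: inverse_eq_divide)
  then have "(\<lambda>n. sqrt (E n)) \<longlonglongrightarrow> sqrt 0" by (intro tendsto_real_sqrt) simp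
  then have sE: "(\<lambda>n. 2 * sqrt (E n)) \<longlonglongrightarrow> 0" using tendsto_mult[OF tendsto_const, of _ _ _ 2] by fastforce
  have unif: "\<bar>\<phi> n x - W x\<bar> \<le> 2 * sqrt (E n)" if x: "x \<in> {0..1}" for n x
  proof -
    have p: "primitive_on {0..1} (\<lambda>x. \<phi> n x - W x) (\<lambda>x. deriv (\<phi> n) x - g x)"
      by (intro primitive_on_diff W primitive_on_subset[OF test_fun_primitive[OF \<phi>]]) simp
    have "\<bar>(\<phi> n x - W x) - (\<phi> n 0 - W 0)\<bar> \<le> (1 / sqrt (E n)) * (LINT x:{0..1}|lebesgue. (deriv (\<phi> n) x - g x)\<^sup>2) + (x - 0) / (1 / sqrt (E n))"
    proof (rule primitive_on_growth[OF p])
      show "set_integrable lebesgue {0..1} (\<lambda>x. (deriv (\<phi> n) x - g x)\<^sup>2)"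
        using diff2 by (simp add: set_integrable_Omega_Icc(1) set_integrable_iff_lebesgue_on)
    qed (use x E[of n] in auto)
    also have "(LINT x:{0..1}|lebesgue. (deriv (\<phi> n) x - g x)\<^sup>2) = e n"
      by (simp add: e_def set_integrable_Omega_Icc(2) set_integral_iff_lebesgue_on)
    also have "(1 / sqrt (E n)) * e n + (x - 0) / (1 / sqrt (E n)) \<le> (1 / sqrt (E n)) * E n + 1 / (1 / sqrt (E n))"
      using E[of n] x by (intro add_mono mult_left_mono divide_right_mono) auto
    also have "\<dots> = 2 * sqrt (E n)" using E[of n] by (simp add: real_div_sqrt)
    finally show ?thesis by (simp add: \<phi>0 W0)
  qed
  have W1: "W 1 = 0"
  proof -
    have "(\<lambda>n. \<bar>W 1\<bar>) \<longlonglongrightarrow> 0"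
      by (rule tendsto_sandwich[OF _ _ tendsto_const[of 0] sE]) (use unif[of 1] \<phi>0 in auto)
    then show ?thesis by (simp add: LIMSEQ_const_iff)
  qed
  have Wm: "W \<in> borel_measurable (lebesgue_on Omega)"
    by (rule continuous_imp_measurable_on_sets_lebesgue)
      (auto intro: continuous_on_subset[OF primitive_on_continuous[OF W]])
  have pm: "\<phi> n \<in> borel_measurable (lebesgue_on Omega)" for n
    by (rule continuous_imp_measurable_on_sets_lebesgue)
      (auto intro!: continuous_at_imp_continuous_on DERIV_isCont[OF test_fun_deriv(1)[OF \<phi>]])
  \<comment> \<open>The test functions converge to W uniformly and to f in L^2, so both limits agree
    almost everywhere.\<close>
  have "(\<integral>\<^sup>+x. ennreal ((W x - f x)\<^sup>2) \<partial>lebesgue_on Omega) \<le> 0"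
  proof (rule tendsto_lowerbound)
    show "(\<lambda>n. 2 * (\<integral>\<^sup>+x. ennreal ((\<phi> n x - f x)\<^sup>2) \<partial>lebesgue_on Omega) + ennreal (2 * (2 * sqrt (E n))\<^sup>2)) \<longlonglongrightarrow> 0"
    proof -
      have "(\<lambda>n. ennreal (2 * (2 * sqrt (E n))\<^sup>2)) \<longlonglongrightarrow> ennreal (2 * 0\<^sup>2)"
        by (intro tendsto_ennrealI tendsto_intros sE)
      moreover have "(\<lambda>n. 2 * (\<integral>\<^sup>+x. ennreal ((\<phi> n x - f x)\<^sup>2) \<partial>lebesgue_on Omega)) \<longlonglongrightarrow> 2 * 0"
        by (intro ennreal_tendsto_cmult l1) simp
      ultimately show ?thesis using tendsto_add by fastforce
    qed
    show "\<forall>\<^sub>F n in sequentially. (\<integral>\<^sup>+x. ennreal ((W x - f x)\<^sup>2) \<partial>lebesgue_on Omega)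
      \<le> 2 * (\<integral>\<^sup>+x. ennreal ((\<phi> n x - f x)\<^sup>2) \<partial>lebesgue_on Omega) + ennreal (2 * (2 * sqrt (E n))\<^sup>2)"
    proof (intro always_eventually allI)
      fix n
      have "(\<integral>\<^sup>+x. ennreal ((W x - f x)\<^sup>2) \<partial>lebesgue_on Omega) \<le> (\<integral>\<^sup>+x. 2 * ennreal ((\<phi> n x - f x)\<^sup>2) + ennreal (2 * (2 * sqrt (E n))\<^sup>2) \<partial>lebesgue_on Omega)"
      proof (rule nn_integral_mono)
        fix x assume "x \<in> space (lebesgue_on Omega)"
        then have x: "x \<in> {0..1}" by auto
        have "(W x - f x)\<^sup>2 \<le> 2 * (\<phi> n x - f x)\<^sup>2 + 2 * (\<phi> n x - W x)\<^sup>2"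
          using zero_le_power2[of "\<phi> n x - f x + (\<phi> n x - W x)"] by (simp add: power2_eq_square algebra_simps)
        also have "(\<phi> n x - W x)\<^sup>2 \<le> (2 * sqrt (E n))\<^sup>2"
          using unif[OF x, of n] by (metis abs_le_square_iff abs_ge_self order_trans)
        finally have "ennreal ((W x - f x)\<^sup>2) \<le> ennreal (2 * (\<phi> n x - f x)\<^sup>2 + 2 * (2 * sqrt (E n))\<^sup>2)"
          by (intro ennreal_leI) simp
        then show "ennreal ((W x - f x)\<^sup>2) \<le> 2 * ennreal ((\<phi> n x - f x)\<^sup>2) + ennreal (2 * (2 * sqrt (E n))\<^sup>2)"
          by (simp add: ennreal_plus ennreal_mult')
      qed
      also have "\<dots> = 2 * (\<integral>\<^sup>+x. ennreal ((\<phi> n x - f x)\<^sup>2) \<partial>lebesgue_on Omega) + ennreal (2 * (2 * sqrt (E n))\<^sup>2)"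
        using pm[of n] fm by (simp add: nn_integral_add nn_integral_cmult emeasure_restrict_space)
      finally show "(\<integral>\<^sup>+x. ennreal ((W x - f x)\<^sup>2) \<partial>lebesgue_on Omega)
      \<le> 2 * (\<integral>\<^sup>+x. ennreal ((\<phi> n x - f x)\<^sup>2) \<partial>lebesgue_on Omega) + ennreal (2 * (2 * sqrt (E n))\<^sup>2)" .
    qed
  qed simp
  then have "AE x in lebesgue_on Omega. ennreal ((W x - f x)\<^sup>2) = 0"
    using Wm fm by (subst nn_integral_0_iff_AE[symmetric]) auto
  then have "AE x in lebesgue_on Omega. W x = f x" by eventually_elim auto
  then show ?thesis
    unfolding vanishes_at_ends_def using primitive_on_continuous[OF W] W0 W1 by blast
qed

section \<open>Carleman estimates in a weighted \<open>L\<^sup>2\<close> space\<close>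

locale time_cylinder =
  fixes M :: "'a measure" and T :: real
  assumes sigma_finite: "sigma_finite_measure M" and T: "T > 0"
begin

definition "N = M \<Otimes>\<^sub>M (lborel :: real measure)"

text \<open>Functions are extended by 0 outside (0, T). Time integrals then run over the whole line,
  where translations, reflections and forward means are available.\<close>

definition L2T :: "('a \<times> real \<Rightarrow> real) \<Rightarrow> bool" where
  "L2T g \<longleftrightarrow> g \<in> borel_measurable N \<and> integrable N (\<lambda>z. (g z)\<^sup>2) \<and> (\<forall>x t. t \<notin> {0<..<T} \<longrightarrow> g (x, t) = 0)"

lemma snd_measurable [measurable]: "snd \<in> measurable N borel"
  by (simp add: N_def)

lemma L2T_integrable:
  assumes g: "L2T g" and h: "L2T h" and \<eta>: "continuous_on UNIV \<eta>"
  shows "integrable N (\<lambda>z. \<eta> (snd z) * (g z * h z))"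
proof -
  have "bounded (\<eta> ` {0..T})"
    using \<eta> by (auto intro!: compact_imp_bounded compact_continuous_image intro: continuous_on_subset)
  then obtain B where B: "\<And>t. t \<in> {0..T} \<Longrightarrow> \<bar>\<eta> t\<bar> \<le> B"
    unfolding bounded_iff by fastforce
  have [measurable]: "\<eta> \<in> borel_measurable borel" "g \<in> borel_measurable N" "h \<in> borel_measurable N"
    using \<eta> g h by (auto simp: L2T_def intro: borel_measurable_continuous_onI)
  have gh: "integrable N (\<lambda>z. g z * h z)" using g h by (auto simp: L2T_def intro: integrable_mult_L2)
  show ?thesis
  proof (rule Bochner_Integration.integrable_bound)
    show "integrable N (\<lambda>z. B * (g z * h z))" using gh by simp
    show "AE z in N. norm (\<eta> (snd z) * (g z * h z)) \<le> norm (B * (g z * h z))"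
    proof (intro always_eventually allI)
      fix z
      show "norm (\<eta> (snd z) * (g z * h z)) \<le> norm (B * (g z * h z))"
      proof (cases "snd z \<in> {0<..<T}")
        case True
        then have "\<bar>\<eta> (snd z)\<bar> \<le> \<bar>B\<bar>" using B[of "snd z"] by force
        then show ?thesis unfolding real_norm_def abs_mult by (rule mult_right_mono) simp
      next
        case False
        then have "g z = 0" using g by (cases z) (simp add: L2T_def)
        then show ?thesis by simp
      qed
    qed
  qed measurable
qed

lemma L2T_add: "L2T g \<Longrightarrow> L2T h \<Longrightarrow> L2T (\<lambda>z. g z + h z)"
  unfolding L2T_def by (auto intro: integrable_add_sq)

lemma L2T_diff: "L2T g \<Longrightarrow> L2T h \<Longrightarrow> L2T (\<lambda>z. g z - h z)"
  unfolding L2T_def by (auto intro: integrable_add_sq)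

lemma L2T_mult_cont:
  assumes g: "L2T g" and \<eta>: "continuous_on UNIV \<eta>"
  shows "L2T (\<lambda>z. \<eta> (snd z) * g z)"
proof -
  have [measurable]: "\<eta> \<in> borel_measurable borel" "g \<in> borel_measurable N"
    using \<eta> g by (auto simp: L2T_def intro: borel_measurable_continuous_onI)
  have "integrable N (\<lambda>z. (\<eta> (snd z))\<^sup>2 * (g z * g z))"
    using g by (rule L2T_integrable[where \<eta> = "\<lambda>t. (\<eta> t)\<^sup>2"]) (use \<eta> g in \<open>auto intro: continuous_intros\<close>)
  then show ?thesis
    using g unfolding L2T_def by (auto simp: power2_eq_square mult_ac)
qed

definition is_weight :: "(real \<Rightarrow> real) \<Rightarrow> (real \<Rightarrow> real) \<Rightarrow> bool" where
  "is_weight \<eta> \<eta>' \<longleftrightarrow> (\<forall>t. (\<eta> has_real_derivative \<eta>' t) (at t)) \<and> continuous_on UNIV \<eta>' \<and> (\<forall>t. \<eta> t \<ge> 0)"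

definition form :: "(real \<Rightarrow> real) \<Rightarrow> ('a \<times> real \<Rightarrow> real) \<Rightarrow> ('a \<times> real \<Rightarrow> real) \<Rightarrow> real" where
  "form \<eta> g h = (\<integral>z. \<eta> (snd z) * (g z * h z) \<partial>N)"

end

text \<open>The weights phi^n e^(2 s phi) with phi = e^(lam t). A derivative returns n lam times the
  same weight plus 2 s lam times the next one, so the family is closed and all bulk terms of the
  estimate arise from such derivatives.\<close>

definition carl :: "real \<Rightarrow> real \<Rightarrow> nat \<Rightarrow> real \<Rightarrow> real" where
  "carl lam s n t = exp (lam * t) ^ n * exp (2 * s * exp (lam * t))"

lemma carl_pos: "carl lam s n t > 0" by (simp add: carl_def)

lemma carl_Suc: "carl lam s (Suc n) t = exp (lam * t) * carl lam s n t" by (simp add: carl_def)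

lemma carl_deriv:
  "(carl lam s n has_real_derivative real n * lam * carl lam s n t + 2 * s * lam * carl lam s (Suc n) t) (at t)"
proof -
  have "((\<lambda>t. exp (real n * (lam * t)) * exp (2 * s * exp (lam * t))) has_real_derivative
      real n * lam * carl lam s n t + 2 * s * lam * carl lam s (Suc n) t) (at t)"
    by (auto intro!: derivative_eq_intros simp: carl_def exp_of_nat_mult[symmetric] algebra_simps)
  moreover have "(\<lambda>t. exp (real n * (lam * t)) * exp (2 * s * exp (lam * t))) = carl lam s n"
    by (auto simp: carl_def exp_of_nat_mult)
  ultimately show ?thesis by simp
qed

lemma carl_cont: "continuous_on S (carl lam s n)"
  unfolding carl_def by (intro continuous_intros)

context time_cylinder
begin

lemma is_weight_carl:
  assumes "c \<ge> 0"
  shows "is_weight (\<lambda>t. c * carl lam s n t) (\<lambda>t. c * (real n * lam * carl lam s n t + 2 * s * lam * carl lam s (Suc n) t))"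
  unfolding is_weight_def
  by (intro conjI allI continuous_intros carl_cont DERIV_cmult carl_deriv)
    (simp add: assms less_imp_le[OF carl_pos])

end

locale carleman = time_cylinder +
  fixes lam s :: real
  assumes lam: "lam \<ge> 1" and s: "s \<ge> 1"
begin

definition J :: "nat \<Rightarrow> ('a \<times> real \<Rightarrow> real) \<Rightarrow> ('a \<times> real \<Rightarrow> real) \<Rightarrow> real" where
  "J n g h = form (carl lam s n) g h"

text \<open>The member of the family with exponent -1, which the natural index of
  \<open>carl\<close> does not reach.\<close>

definition Jm :: "('a \<times> real \<Rightarrow> real) \<Rightarrow> real" where
  "Jm g = form (\<lambda>t. exp (- lam * t) * carl lam s 0 t) g g"

lemma int_J [intro]: "L2T g \<Longrightarrow> L2T h \<Longrightarrow> integrable N (\<lambda>z. carl lam s n (snd z) * (g z * h z))"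
  by (intro L2T_integrable carl_cont)

lemma int_J_minus: "L2T g \<Longrightarrow> integrable N (\<lambda>z. exp (- lam * snd z) * carl lam s 0 (snd z) * (g z * g z))"
  by (rule L2T_integrable[where \<eta> = "\<lambda>t. exp (- lam * t) * carl lam s 0 t"]) (auto intro!: continuous_intros carl_cont)

lemma J_nonneg: "J n g g \<ge> 0"
  unfolding J_def form_def by (intro integral_nonneg_AE always_eventually allI) (simp add: less_imp_le[OF carl_pos])

lemma J_sym: "J n g h = J n h g"
  by (simp add: J_def form_def mult.commute)

lemma form_scaled_carl: "form (\<lambda>t. c * carl lam s n t) g h = c * J n g h"
  by (simp add: J_def form_def mult.assoc)

lemma form_carl_deriv:
  assumes "L2T g" "L2T h"
  shows "form (\<lambda>t. c * (real n * lam * carl lam s n t + 2 * s * lam * carl lam s (Suc n) t)) g h =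
    c * (real n * lam * J n g h + 2 * s * lam * J (Suc n) g h)"
proof -
  have "form (\<lambda>t. c * (real n * lam * carl lam s n t + 2 * s * lam * carl lam s (Suc n) t)) g h =
    (\<integral>z. c * (real n * lam * (carl lam s n (snd z) * (g z * h z)) + 2 * s * lam * (carl lam s (Suc n) (snd z) * (g z * h z))) \<partial>N)"
    unfolding form_def by (intro Bochner_Integration.integral_cong refl) (simp add: algebra_simps)
  also have "\<dots> = c * (real n * lam * J n g h + 2 * s * lam * J (Suc n) g h)"
    using int_J[OF assms] by (simp add: J_def form_def)
  finally show ?thesis .
qed

lemma s_exp_ge_1: "t \<ge> 0 \<Longrightarrow> 1 \<le> s * exp (lam * t)"
  using lam s mult_mono[of 1 s 1 "exp (lam * t)"] by auto

lemma L2T_eq_0: "L2T g \<Longrightarrow> snd z \<notin> {0<..<T} \<Longrightarrow> g z = 0"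
  by (cases z) (simp add: L2T_def)

text \<open>The hypothesis \<open>s \<ge> 1\<close> makes \<open>s \<phi> \<ge> 1\<close>, so raising the power of \<open>s \<phi>\<close> only increases a weighted norm.\<close>

lemma J_Suc_ge:
  assumes "L2T g"
  shows "J n g g \<le> s * J (Suc n) g g"
proof -
  have "(\<integral>z. carl lam s n (snd z) * (g z * g z) \<partial>N) \<le> (\<integral>z. s * (carl lam s (Suc n) (snd z) * (g z * g z)) \<partial>N)"
  proof (rule integral_mono)
    fix z :: "'a \<times> real"
    show "carl lam s n (snd z) * (g z * g z) \<le> s * (carl lam s (Suc n) (snd z) * (g z * g z))"
    proof (cases "snd z \<in> {0<..<T}")
      case True
      then have "1 * (carl lam s n (snd z) * (g z * g z)) \<le> (s * exp (lam * snd z)) * (carl lam s n (snd z) * (g z * g z))"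
        using s_exp_ge_1[of "snd z"] by (intro mult_right_mono) (auto simp: less_imp_le[OF carl_pos])
      then show ?thesis by (simp add: carl_Suc mult_ac)
    next
      case False
      then show ?thesis using L2T_eq_0[OF assms] by simp
    qed
  qed (use int_J[OF assms assms] in auto)
  then show ?thesis using int_J[OF assms assms] by (simp add: J_def form_def)
qed

text \<open>With c = s lam phi and w = ut + c u one has f^2 = (w + (p - c u))^2 >= w^2 + 2 w (p - c
  u). This is integrated against s phi e^(2 s phi). The products p ut and u ut are handled by the
  energy inequalities and u p by Green's identity. The contributions of the derivative of e^(2 s
  phi) cancel; what survives comes from differentiating the factors phi and phi^2, namely s lam J 1
  q q and 2 s^2 lam^2 J 2 u u.\<close>

lemma carleman_backward:
  assumes good: "L2T u" "L2T ut" "L2T p" "L2T q" "L2T f"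
    and eq: "AE z in N. f z = ut z + p z"
    and en_\<beta>: "\<And>\<eta> \<eta>'. is_weight \<eta> \<eta>' \<Longrightarrow> - 2 * form \<eta> p ut + form \<eta>' q q \<le> \<eta> T * \<beta>\<^sub>T"
    and en_\<alpha>: "\<And>\<eta> \<eta>'. is_weight \<eta> \<eta>' \<Longrightarrow> 2 * form \<eta> u ut + form \<eta>' u u \<le> \<eta> T * \<alpha>\<^sub>T"
    and form: "\<And>\<eta>. continuous_on UNIV \<eta> \<Longrightarrow> form \<eta> u p = - form \<eta> q q"
  shows "J 0 ut ut + J 0 p p + s * lam * J 1 q q + s\<^sup>2 * lam\<^sup>2 * J 2 u u \<le>
    8 * (s * J 1 f f) + 6 * (s * carl lam s 1 T * \<beta>\<^sub>T + s\<^sup>2 * lam * carl lam s 2 T * \<alpha>\<^sub>T)"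
proof -
  define w where "w z = ut z + (s * lam * exp (lam * snd z)) * u z" for z
  have w: "L2T w"
    unfolding w_def by (intro L2T_add good L2T_mult_cont[where \<eta> = "\<lambda>t. s * lam * exp (lam * t)"] continuous_intros)
  have f_int: "J n f f = (\<integral>z. carl lam s n (snd z) * ((ut z + p z) * (ut z + p z)) \<partial>N)" for n
  proof -
    have "AE z in N. carl lam s n (snd z) * (f z * f z) = carl lam s n (snd z) * ((ut z + p z) * (ut z + p z))"
      using eq by eventually_elim simp
    then show ?thesis
      unfolding J_def form_def
      using int_J[OF good(5) good(5)] int_J[OF L2T_add[OF good(2,3)] L2T_add[OF good(2,3)]]
      by (intro integral_cong_AE borel_measurable_integrable) auto
  qed
  note ints = int_J[OF good(2,2)] int_J[OF good(3,3)] int_J[OF good(4,4)] int_J[OF good(1,1)] int_J[OF w w]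
    int_J[OF good(2,3)] int_J[OF good(1,3)] int_J[OF good(1,2)] int_J[OF L2T_add[OF good(2,3)] L2T_add[OF good(2,3)]]
  have main: "s * J 1 w w + 2 * s * J 1 ut p + 2 * s\<^sup>2 * lam * J 2 u p - 2 * s\<^sup>2 * lam * J 2 u ut - 2 * s^3 * lam\<^sup>2 * J 3 u u \<le> s * J 1 f f"
  proof -
    have "(\<integral>z. s * (carl lam s 1 (snd z) * (w z * w z)) + 2 * s * (carl lam s 1 (snd z) * (ut z * p z))
        + 2 * s\<^sup>2 * lam * (carl lam s 2 (snd z) * (u z * p z)) - 2 * s\<^sup>2 * lam * (carl lam s 2 (snd z) * (u z * ut z))
        - 2 * s^3 * lam\<^sup>2 * (carl lam s 3 (snd z) * (u z * u z)) \<partial>N)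
       \<le> (\<integral>z. s * (carl lam s 1 (snd z) * ((ut z + p z) * (ut z + p z))) \<partial>N)"
    proof (rule integral_mono)
      fix z :: "'a \<times> real"
      define \<phi> where "\<phi> = exp (lam * snd z)"
      define E where "E = exp (2 * s * \<phi>)"
      have c: "carl lam s 1 (snd z) = \<phi> * E" "carl lam s 2 (snd z) = \<phi>\<^sup>2 * E" "carl lam s 3 (snd z) = \<phi>^3 * E"
        by (simp_all add: carl_def \<phi>_def E_def)
      have "0 \<le> s * (\<phi> * E) * (p z - s * lam * \<phi> * u z)\<^sup>2" using s by (simp add: \<phi>_def E_def)
      then show "s * (carl lam s 1 (snd z) * (w z * w z)) + 2 * s * (carl lam s 1 (snd z) * (ut z * p z))
        + 2 * s\<^sup>2 * lam * (carl lam s 2 (snd z) * (u z * p z)) - 2 * s\<^sup>2 * lam * (carl lam s 2 (snd z) * (u z * ut z))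
        - 2 * s^3 * lam\<^sup>2 * (carl lam s 3 (snd z) * (u z * u z)) \<le> s * (carl lam s 1 (snd z) * ((ut z + p z) * (ut z + p z)))"
        unfolding c w_def \<phi>_def[symmetric] by (simp add: algebra_simps power2_eq_square power3_eq_cube)
    qed (use ints in auto)
    then show ?thesis using ints by (simp add: f_int) (simp add: J_def form_def)
  qed
  have b: "- 2 * (s * J 1 p ut) + s * (lam * J 1 q q + 2 * s * lam * J 2 q q) \<le> s * carl lam s 1 T * \<beta>\<^sub>T"
    using en_\<beta>[OF is_weight_carl[of s lam s 1]] s
    by (simp only: form_scaled_carl form_carl_deriv[OF good(4) good(4)]) (simp add: numeral_2_eq_2)
  have c: "2 * (s\<^sup>2 * lam * J 2 u ut) + s\<^sup>2 * lam * (2 * lam * J 2 u u + 2 * s * lam * J 3 u u) \<le> s\<^sup>2 * lam * carl lam s 2 T * \<alpha>\<^sub>T"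
    using en_\<alpha>[OF is_weight_carl[of "s\<^sup>2 * lam" lam s 2]] s lam
    by (simp only: form_scaled_carl form_carl_deriv[OF good(1) good(1)]) (simp add: numeral_3_eq_3 numeral_2_eq_2)
  have d: "J 2 u p = - J 2 q q" unfolding J_def by (rule form[OF carl_cont])
  have C1: "s * J 1 w w + s * lam * J 1 q q + 2 * (s\<^sup>2 * lam\<^sup>2 * J 2 u u) - (s * carl lam s 1 T * \<beta>\<^sub>T + s\<^sup>2 * lam * carl lam s 2 T * \<alpha>\<^sub>T) \<le> s * J 1 f f"
    using main b c unfolding d J_sym[of 1 ut p] by (simp add: algebra_simps power2_eq_square power3_eq_cube)
  have ut: "J 0 ut ut \<le> 2 * (s * J 1 w w) + 2 * (s\<^sup>2 * lam\<^sup>2 * J 2 u u)"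
  proof -
    have "(\<integral>z. carl lam s 0 (snd z) * (ut z * ut z) \<partial>N) \<le> (\<integral>z. 2 * (carl lam s 0 (snd z) * (w z * w z)) + 2 * (s\<^sup>2 * lam\<^sup>2) * (carl lam s 2 (snd z) * (u z * u z)) \<partial>N)"
    proof (rule integral_mono)
      fix z :: "'a \<times> real"
      define c where "c = s * lam * exp (lam * snd z)"
      have "0 \<le> carl lam s 0 (snd z) * (ut z + 2 * c * u z)\<^sup>2" by (simp add: less_imp_le[OF carl_pos])
      then show "carl lam s 0 (snd z) * (ut z * ut z) \<le> 2 * (carl lam s 0 (snd z) * (w z * w z)) + 2 * (s\<^sup>2 * lam\<^sup>2) * (carl lam s 2 (snd z) * (u z * u z))"
        unfolding w_def c_def by (simp add: carl_Suc numeral_2_eq_2 algebra_simps)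
    qed (use ints in auto)
    then have "J 0 ut ut \<le> 2 * J 0 w w + 2 * (s\<^sup>2 * lam\<^sup>2) * J 2 u u"
      using ints by (simp add: J_def form_def)
    then show ?thesis using J_Suc_ge[OF w, of 0] by simp
  qed
  have p: "J 0 p p \<le> 2 * (s * J 1 f f) + 2 * J 0 ut ut"
  proof -
    have "(\<integral>z. carl lam s 0 (snd z) * (p z * p z) \<partial>N) \<le> (\<integral>z. 2 * (carl lam s 0 (snd z) * ((ut z + p z) * (ut z + p z))) + 2 * (carl lam s 0 (snd z) * (ut z * ut z)) \<partial>N)"
    proof (rule integral_mono)
      fix z :: "'a \<times> real"
      have "0 \<le> carl lam s 0 (snd z) * (p z + 2 * ut z)\<^sup>2" by (simp add: less_imp_le[OF carl_pos])
      then show "carl lam s 0 (snd z) * (p z * p z) \<le> 2 * (carl lam s 0 (snd z) * ((ut z + p z) * (ut z + p z))) + 2 * (carl lam s 0 (snd z) * (ut z * ut z))"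
        by (simp add: power2_eq_square algebra_simps)
    qed (use ints in auto)
    then have "J 0 p p \<le> 2 * J 0 f f + 2 * J 0 ut ut"
      using ints by (simp add: f_int) (simp add: J_def form_def)
    then show ?thesis using J_Suc_ge[OF good(5), of 0] by simp
  qed
  \<comment> \<open>By \<open>p\<close> and then \<open>ut\<close>, the left side is at most 2 s J 1
    f f plus six times the positive part of \<open>C1\<close>. This gives the constants 2 + 6 = 8
    and 6.\<close>
  have "0 \<le> s * lam * J 1 q q" "0 \<le> s\<^sup>2 * lam\<^sup>2 * J 2 u u"
    using J_nonneg s lam by simp_all
  then show ?thesis using C1 ut p by argo
qed

text \<open>Now g^2 = (w - (p + c z))^2 >= w^2 - 2 w (p + c z) with c = s lam phi, integrated
  against e^(2 s phi). An additional factor phi would leave a gradient term of the wrong sign. The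
  gradient terms cancel altogether and only s lam^2 J 1 z z and the square of w remain; the term lam
  J 0 q q is recovered separately by testing the equation with z.\<close>

lemma carleman_forward:
  assumes good: "L2T z" "L2T zt" "L2T p" "L2T q" "L2T g"
    and eq: "AE y in N. g y = zt y - p y"
    and en_\<beta>: "\<And>\<eta> \<eta>'. is_weight \<eta> \<eta>' \<Longrightarrow> 2 * form \<eta> p zt - form \<eta>' q q \<le> \<eta> 0 * \<beta>\<^sub>0"
    and en_\<alpha>: "\<And>\<eta> \<eta>'. is_weight \<eta> \<eta>' \<Longrightarrow> 2 * form \<eta> z zt + form \<eta>' z z \<le> \<eta> T * \<alpha>\<^sub>T"
    and en_\<alpha>0: "\<And>\<eta> \<eta>'. is_weight \<eta> \<eta>' \<Longrightarrow> - 2 * form \<eta> z zt - form \<eta>' z z \<le> \<eta> 0 * \<alpha>\<^sub>0"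
    and \<alpha>\<^sub>0: "\<alpha>\<^sub>0 \<ge> 0"
    and form: "\<And>\<eta>. continuous_on UNIV \<eta> \<Longrightarrow> form \<eta> z p = - form \<eta> q q"
  shows "(Jm p + Jm zt) / s + lam * J 0 q q + s * lam\<^sup>2 * J 1 z z \<le>
    12 * J 0 g g + 9 * (carl lam s 0 0 * \<beta>\<^sub>0 + s * lam * carl lam s 1 T * \<alpha>\<^sub>T) + lam * carl lam s 0 0 * \<alpha>\<^sub>0"
proof -
  define w where "w y = zt y + (s * lam * exp (lam * snd y)) * z y" for y
  have w: "L2T w"
    unfolding w_def by (intro L2T_add good L2T_mult_cont[where \<eta> = "\<lambda>t. s * lam * exp (lam * t)"] continuous_intros)
  have g_int: "J n g g = (\<integral>y. carl lam s n (snd y) * ((zt y - p y) * (zt y - p y)) \<partial>N)" for n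
  proof -
    have "AE y in N. carl lam s n (snd y) * (g y * g y) = carl lam s n (snd y) * ((zt y - p y) * (zt y - p y))"
      using eq by eventually_elim simp
    then show ?thesis
      unfolding J_def form_def
      using int_J[OF good(5) good(5)] int_J[OF L2T_diff[OF good(2,3)] L2T_diff[OF good(2,3)]]
      by (intro integral_cong_AE borel_measurable_integrable) auto
  qed
  have zg_int: "J n z g = J n z zt - J n z p" for n
  proof -
    have "AE y in N. carl lam s n (snd y) * (z y * g y) = carl lam s n (snd y) * (z y * zt y) - carl lam s n (snd y) * (z y * p y)"
      using eq by eventually_elim (simp add: right_diff_distrib)
    then have "J n z g = (\<integral>y. carl lam s n (snd y) * (z y * zt y) - carl lam s n (snd y) * (z y * p y) \<partial>N)"
      unfolding J_def form_def
      using int_J[OF good(1) good(5)] int_J[OF good(1) good(2)] int_J[OF good(1) good(3)]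
      by (intro integral_cong_AE borel_measurable_integrable) auto
    then show ?thesis
      using int_J[OF good(1) good(2)] int_J[OF good(1) good(3)] by (simp add: J_def form_def)
  qed
  note ints = int_J[OF good(2,2)] int_J[OF good(3,3)] int_J[OF good(4,4)] int_J[OF good(1,1)] int_J[OF w w]
    int_J[OF good(2,3)] int_J[OF good(1,3)] int_J[OF good(1,2)] int_J[OF good(1,5)] int_J[OF good(5,5)]
    int_J[OF L2T_diff[OF good(2,3)] L2T_diff[OF good(2,3)]]
  have main: "J 0 w w - 2 * J 0 zt p - 2 * s * lam * J 1 z p - 2 * s * lam * J 1 z zt - 2 * s\<^sup>2 * lam\<^sup>2 * J 2 z z \<le> J 0 g g"
  proof -
    have "(\<integral>y. carl lam s 0 (snd y) * (w y * w y) - 2 * (carl lam s 0 (snd y) * (zt y * p y))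
        - 2 * s * lam * (carl lam s 1 (snd y) * (z y * p y)) - 2 * s * lam * (carl lam s 1 (snd y) * (z y * zt y))
        - 2 * s\<^sup>2 * lam\<^sup>2 * (carl lam s 2 (snd y) * (z y * z y)) \<partial>N)
       \<le> (\<integral>y. carl lam s 0 (snd y) * ((zt y - p y) * (zt y - p y)) \<partial>N)"
    proof (rule integral_mono)
      fix y :: "'a \<times> real"
      define \<phi> where "\<phi> = exp (lam * snd y)"
      define E where "E = exp (2 * s * \<phi>)"
      have c: "carl lam s 0 (snd y) = E" "carl lam s 1 (snd y) = \<phi> * E" "carl lam s 2 (snd y) = \<phi>\<^sup>2 * E"
        by (simp_all add: carl_def \<phi>_def E_def)
      have "0 \<le> E * (p y + s * lam * \<phi> * z y)\<^sup>2" by (simp add: \<phi>_def E_def)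
      then show "carl lam s 0 (snd y) * (w y * w y) - 2 * (carl lam s 0 (snd y) * (zt y * p y))
        - 2 * s * lam * (carl lam s 1 (snd y) * (z y * p y)) - 2 * s * lam * (carl lam s 1 (snd y) * (z y * zt y))
        - 2 * s\<^sup>2 * lam\<^sup>2 * (carl lam s 2 (snd y) * (z y * z y)) \<le> carl lam s 0 (snd y) * ((zt y - p y) * (zt y - p y))"
        unfolding c w_def \<phi>_def[symmetric] by (simp add: algebra_simps power2_eq_square)
    qed (use ints in auto)
    then show ?thesis using ints by (simp add: g_int) (simp add: J_def form_def)
  qed
  have b: "2 * J 0 p zt - 2 * s * lam * J 1 q q \<le> carl lam s 0 0 * \<beta>\<^sub>0"
    using en_\<beta>[OF is_weight_carl[of 1 lam s 0]]
    by (simp only: form_scaled_carl form_carl_deriv[OF good(4) good(4)]) simp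
  have c: "2 * (s * lam * J 1 z zt) + s * lam * (lam * J 1 z z + 2 * s * lam * J 2 z z) \<le> s * lam * carl lam s 1 T * \<alpha>\<^sub>T"
    using en_\<alpha>[OF is_weight_carl[of "s * lam" lam s 1]] s lam
    by (simp only: form_scaled_carl form_carl_deriv[OF good(1) good(1)]) (simp add: numeral_2_eq_2)
  have c0: "- 2 * J 0 z zt - 2 * s * lam * J 1 z z \<le> carl lam s 0 0 * \<alpha>\<^sub>0"
    using en_\<alpha>0[OF is_weight_carl[of 1 lam s 0]]
    by (simp only: form_scaled_carl form_carl_deriv[OF good(1) good(1)]) simp
  have d: "J n z p = - J n q q" for n unfolding J_def by (rule form[OF carl_cont])
  have C2: "J 0 w w + s * lam\<^sup>2 * J 1 z z - (carl lam s 0 0 * \<beta>\<^sub>0 + s * lam * carl lam s 1 T * \<alpha>\<^sub>T) \<le> J 0 g g"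
    using main b c unfolding d J_sym[of 0 zt p] by (simp add: algebra_simps power2_eq_square)
  \<comment> \<open>By Green's identity J 0 q q = J 0 z g - J 0 z zt. Multiplied by lam, the first
    product is split by Young's inequality; the second uses the energy inequality at time 0 and is
    the only source of \<open>\<alpha>\<^sub>0\<close>.\<close>
  have C3: "lam * J 0 q q \<le> J 0 g g / 2 + 3 / 2 * (s * lam\<^sup>2 * J 1 z z) + lam * carl lam s 0 0 * \<alpha>\<^sub>0 / 2"
  proof -
    have "(\<integral>y. lam * (carl lam s 0 (snd y) * (z y * g y)) \<partial>N) \<le> (\<integral>y. (carl lam s 0 (snd y) * (g y * g y)) / 2 + lam\<^sup>2 * (carl lam s 0 (snd y) * (z y * z y)) / 2 \<partial>N)"
    proof (rule integral_mono)
      fix y :: "'a \<times> real"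
      have "0 \<le> carl lam s 0 (snd y) * (g y - lam * z y)\<^sup>2" by (simp add: less_imp_le[OF carl_pos])
      then show "lam * (carl lam s 0 (snd y) * (z y * g y)) \<le> (carl lam s 0 (snd y) * (g y * g y)) / 2 + lam\<^sup>2 * (carl lam s 0 (snd y) * (z y * z y)) / 2"
        by (simp add: power2_eq_square algebra_simps)
    qed (use ints in auto)
    then have 1: "lam * J 0 z g \<le> J 0 g g / 2 + lam\<^sup>2 * J 0 z z / 2"
      using ints by (simp add: J_def form_def)
    have 2: "lam\<^sup>2 * J 0 z z \<le> lam\<^sup>2 * (s * J 1 z z)"
      using J_Suc_ge[OF good(1), of 0] by (intro mult_left_mono) auto
    have 3: "lam * (- 2 * J 0 z zt - 2 * s * lam * J 1 z z) \<le> lam * (carl lam s 0 0 * \<alpha>\<^sub>0)"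
      using c0 lam by (intro mult_left_mono) auto
    have "J 0 q q = J 0 z g - J 0 z zt" using zg_int[of 0] d[of 0] by simp
    then have "lam * J 0 q q = lam * J 0 z g - lam * J 0 z zt" by (simp only: right_diff_distrib)
    then show ?thesis using 1 2 3 by (simp add: algebra_simps power2_eq_square)
  qed
  have jm: "Jm h / s \<le> J 0 h h" if h: "L2T h" for h
  proof -
    have "(\<integral>y. (exp (- lam * snd y) * carl lam s 0 (snd y) * (h y * h y)) / s \<partial>N) \<le> (\<integral>y. carl lam s 0 (snd y) * (h y * h y) \<partial>N)"
    proof (rule integral_mono)
      fix y :: "'a \<times> real"
      show "(exp (- lam * snd y) * carl lam s 0 (snd y) * (h y * h y)) / s \<le> carl lam s 0 (snd y) * (h y * h y)"
      proof (cases "snd y \<in> {0<..<T}")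
        case True
        define c where "c = carl lam s 0 (snd y) * (h y * h y)"
        have c: "c \<ge> 0" by (simp add: c_def less_imp_le[OF carl_pos])
        have "0 \<le> lam * snd y" using True lam by simp
        then have "exp (- lam * snd y) \<le> 1" by simp
        then have "exp (- lam * snd y) * c \<le> 1 * c" using c by (rule mult_right_mono)
        also have "1 * c \<le> s * c" using s c by (rule mult_right_mono)
        finally have "exp (- lam * snd y) * c / s \<le> c" using s by (simp add: pos_divide_le_eq mult.commute)
        then show ?thesis by (simp add: c_def mult.assoc)
      next
        case False
        then show ?thesis using L2T_eq_0[OF h] by simp
      qed
    qed (use int_J[OF h h] int_J_minus[OF h] in auto)
    then show ?thesis using int_J[OF h h] int_J_minus[OF h] by (simp add: J_def Jm_def form_def)
  qed
  have zt: "Jm zt / s \<le> 2 * J 0 w w + 2 * (s * lam\<^sup>2 * J 1 z z)"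
  proof -
    have "(\<integral>y. (exp (- lam * snd y) * carl lam s 0 (snd y) * (zt y * zt y)) / s \<partial>N) \<le>
      (\<integral>y. 2 * (exp (- lam * snd y) * carl lam s 0 (snd y) * (w y * w y) / s) + 2 * (s * lam\<^sup>2) * (carl lam s 1 (snd y) * (z y * z y)) \<partial>N)"
    proof (rule integral_mono)
      fix y :: "'a \<times> real"
      define \<phi> where "\<phi> = exp (lam * snd y)"
      define E where "E = exp (2 * s * \<phi>)"
      have e: "exp (- lam * snd y) = 1 / \<phi>" "carl lam s 0 (snd y) = E" "carl lam s 1 (snd y) = \<phi> * E"
        by (simp_all add: carl_def \<phi>_def E_def exp_minus inverse_eq_divide)
      have \<phi>: "\<phi> > 0" by (simp add: \<phi>_def)
      \<comment> \<open>Multiplication by \<open>r\<close> turns the weight e^(2 s phi) into that of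
        \<open>Jm\<close> divided by s. On the z-term it lowers (s lam phi)^2 to s lam^2
        phi.\<close>
      define r where "r = 1 / (\<phi> * s)"
      have r: "r > 0" using \<phi> s by (simp add: r_def)
      have "0 \<le> E * (zt y + 2 * (s * lam * \<phi>) * z y)\<^sup>2" by (simp add: E_def)
      then have "E * (zt y * zt y) \<le> 2 * (E * (w y * w y)) + 2 * ((s * lam * \<phi>)\<^sup>2 * (E * (z y * z y)))"
        unfolding w_def \<phi>_def[symmetric] by (simp add: power2_eq_square algebra_simps)
      then have "r * (E * (zt y * zt y)) \<le> r * (2 * (E * (w y * w y)) + 2 * ((s * lam * \<phi>)\<^sup>2 * (E * (z y * z y))))"
        using r by (intro mult_left_mono) auto
      also have "\<dots> = 2 * (1 / \<phi> * E * (w y * w y) / s) + 2 * (r * (s * lam * \<phi>)\<^sup>2) * (E * (z y * z y))"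
        by (simp add: r_def distrib_left)
      also have "r * (s * lam * \<phi>)\<^sup>2 = s * lam\<^sup>2 * \<phi>"
        using \<phi> s by (simp add: r_def power2_eq_square)
      finally show "(exp (- lam * snd y) * carl lam s 0 (snd y) * (zt y * zt y)) / s \<le>
         2 * (exp (- lam * snd y) * carl lam s 0 (snd y) * (w y * w y) / s) + 2 * (s * lam\<^sup>2) * (carl lam s 1 (snd y) * (z y * z y))"
        unfolding e by (simp add: r_def mult.assoc)
    qed (use ints int_J_minus[OF w] int_J_minus[OF good(2)] in auto)
    then have "Jm zt / s \<le> 2 * (Jm w / s) + 2 * (s * lam\<^sup>2) * J 1 z z"
      using ints int_J_minus[OF w] int_J_minus[OF good(2)] by (simp add: J_def Jm_def form_def)
    then show ?thesis using jm[OF w] by simp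
  qed
  have p: "Jm p / s \<le> 2 * J 0 g g + 2 * (Jm zt / s)"
  proof -
    have "(\<integral>y. exp (- lam * snd y) * carl lam s 0 (snd y) * (p y * p y) \<partial>N) \<le>
      (\<integral>y. 2 * (exp (- lam * snd y) * carl lam s 0 (snd y) * (g y * g y)) + 2 * (exp (- lam * snd y) * carl lam s 0 (snd y) * (zt y * zt y)) \<partial>N)"
    proof (rule integral_mono_AE)
      show "AE y in N. exp (- lam * snd y) * carl lam s 0 (snd y) * (p y * p y) \<le>
         2 * (exp (- lam * snd y) * carl lam s 0 (snd y) * (g y * g y)) + 2 * (exp (- lam * snd y) * carl lam s 0 (snd y) * (zt y * zt y))"
        using eq
      proof eventually_elim
        case (elim y)
        have "0 \<le> (exp (- lam * snd y) * carl lam s 0 (snd y)) * (p y - 2 * zt y)\<^sup>2" by (simp add: less_imp_le[OF carl_pos])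
        then show ?case unfolding elim by (simp add: power2_eq_square algebra_simps)
      qed
    qed (use int_J_minus[OF good(2)] int_J_minus[OF good(3)] int_J_minus[OF good(5)] in auto)
    then have "Jm p \<le> 2 * Jm g + 2 * Jm zt"
      using int_J_minus[OF good(2)] int_J_minus[OF good(3)] int_J_minus[OF good(5)] by (simp add: Jm_def form_def)
    then have "Jm p / s \<le> 2 * (Jm g / s) + 2 * (Jm zt / s)" using s by (simp add: divide_right_mono field_simps)
    then show ?thesis using jm[OF good(5)] by simp
  qed
  have nn: "0 \<le> s * lam\<^sup>2 * J 1 z z" "0 \<le> J 0 w w" "0 \<le> J 0 g g"
    using J_nonneg s lam by simp_all
  have nn\<alpha>: "0 \<le> lam * carl lam s 0 0 * \<alpha>\<^sub>0"
    using lam \<alpha>\<^sub>0 carl_pos[of lam s 0 0] by (intro mult_nonneg_nonneg) auto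
  \<comment> \<open>P costs 2 G + 2 Z, so Z is counted three times and gives 6 W + 6 X. With L and X
    the total is at most 9 (W + X) plus 5/2 G plus a/2, and W + X <= G + b.\<close>
  have arith: "P + Z + L + X \<le> 12 * G + 9 * b + a"
    if "0 \<le> X" "0 \<le> W" "0 \<le> G" "0 \<le> a" "W + X - b \<le> G"
      "L \<le> G / 2 + 3 / 2 * X + a / 2" "Z \<le> 2 * W + 2 * X" "P \<le> 2 * G + 2 * Z" for P Z L X G b a W :: real
    using that by linarith
  show ?thesis unfolding add_divide_distrib by (rule arith[OF nn nn\<alpha> C2 C3 zt p])
qed

end

text \<open>
  The couplings are absorbed in two steps: \<open>q\<close> and \<open>R\<close> because their weights carry a factor
  \<open>lam\<close>; then the \<open>z\<close>-term on the right of the first estimate, whose weight \<open>s lam\<^sup>2 \<phi>\<close> beats the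
  product of the two constants.
\<close>

lemma coupled_absorption:
  fixes lam s k L1 L2 Jq Jz Jpp JR JF JG JGG Jff Jzz Jqq b1 b2 :: real
  assumes k: "k \<ge> 1" and lam: "lam \<ge> 6000 * k^4"
    and nn: "Jq \<ge> 0" "Jz \<ge> 0" "Jzz \<ge> 0" "Jqq \<ge> 0" "Jpp \<ge> 0" "JR \<ge> 0" "JF \<ge> 0" "JG \<ge> 0"
    and b: "b1 \<ge> 0" "b2 \<ge> 0"
    and L1: "L1 \<le> 8 * Jff + 6 * b1" "lam * Jq + Jpp \<le> L1"
    and ff: "Jff \<le> 3 * k\<^sup>2 * Jq + 3 * k\<^sup>2 * Jz + 3 * JF"
    and L2: "L2 \<le> 12 * JGG + b2" "lam * JR + lam\<^sup>2 * Jz \<le> L2"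
    and gg: "JGG \<le> 5 * k\<^sup>2 * (JR + Jzz + Jqq + Jpp) + 5 * JG"
    and low: "Jzz \<le> Jz" "Jqq \<le> Jq"
  shows "L1 + L2 \<le> 200000 * k^4 * (JF + JG + b1 + b2)"
proof -
  have k2: "1 \<le> k\<^sup>2" "k\<^sup>2 \<le> k^4" "k\<^sup>2 * k\<^sup>2 = k^4"
    using k power_increasing[of 2 4 k] by (simp_all flip: power_add)
  have lam1: "lam \<ge> 6000" "lam \<ge> 6000 * k\<^sup>2" using lam k2 by linarith+
  have L1nn: "L1 \<ge> 0" "Jpp + Jq \<le> L1"
  proof -
    have "1 * Jq \<le> lam * Jq" using lam1 nn by (intro mult_right_mono) auto
    then show "Jpp + Jq \<le> L1" using L1 by linarith
    then show "L1 \<ge> 0" using nn by linarith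
  qed
  \<comment> \<open>Eight times the Jq-part of \<open>ff\<close> is 24 k^2 Jq, at most half of L1.
    Absorbing it doubles the remaining constants to 48, 48 and 12.\<close>
  have "48 * k\<^sup>2 * Jq \<le> lam * Jq" using lam1 nn k2 by (intro mult_right_mono) linarith+
  then have A: "L1 \<le> 48 * (k\<^sup>2 * Jz) + 48 * JF + 12 * b1"
    using L1 ff nn(5) by linarith
  have lamsq: "lam * Jz \<le> lam\<^sup>2 * Jz"
  proof -
    have "1 * lam \<le> lam * lam" using lam1 by (intro mult_right_mono) auto
    then show ?thesis using nn(2) by (intro mult_right_mono) (auto simp: power2_eq_square)
  qed
  have "JR + Jzz + Jqq + Jpp \<le> JR + Jz + L1" using low L1nn by linarith
  then have "k\<^sup>2 * (JR + Jzz + Jqq + Jpp) \<le> k\<^sup>2 * (JR + Jz + L1)" by (intro mult_left_mono) auto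
  then have B: "L2 \<le> 60 * (k\<^sup>2 * JR) + 60 * (k\<^sup>2 * Jz) + 60 * (k\<^sup>2 * L1) + 60 * JG + b2"
    using L2(1) gg by (simp add: distrib_left)
  have "k\<^sup>2 * L1 \<le> k\<^sup>2 * (48 * (k\<^sup>2 * Jz) + 48 * JF + 12 * b1)" using A by (intro mult_left_mono) auto
  also have "\<dots> = 48 * (k^4 * Jz) + 48 * (k\<^sup>2 * JF) + 12 * (k\<^sup>2 * b1)" unfolding k2(3)[symmetric] by (simp add: algebra_simps)
  finally have C: "k\<^sup>2 * L1 \<le> 48 * (k^4 * Jz) + 48 * (k\<^sup>2 * JF) + 12 * (k\<^sup>2 * b1)" .
  have kJ: "k\<^sup>2 * Jz \<le> k^4 * Jz" "k\<^sup>2 * JF \<le> k^4 * JF" "k\<^sup>2 * b1 \<le> k^4 * b1" "JG \<le> k^4 * JG" "b2 \<le> k^4 * b2" "JF \<le> k^4 * JF" "b1 \<le> k^4 * b1"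
    using k2 nn b mult_right_mono[of 1 "k^4" JG] mult_right_mono[of 1 "k^4" b2] mult_right_mono[of 1 "k^4" JF] mult_right_mono[of 1 "k^4" b1]
    by (auto intro!: mult_right_mono)
  \<comment> \<open>The coefficient to be absorbed is 60 + 60 * 48 = 2940, where 48 enters through
    the bound for L1. Absorption into half of L2 needs twice this, which explains the threshold 6000
    k^4 for \<open>lam\<close>.\<close>
  have "6000 * k^4 * Jz \<le> lam * Jz" using lam nn by (intro mult_right_mono) auto
  moreover have "6000 * k\<^sup>2 * JR \<le> lam * JR" using lam1 nn by (intro mult_right_mono) auto
  moreover have "0 \<le> k\<^sup>2 * JR" "0 \<le> k^4 * Jz" using nn by auto
  ultimately have D: "60 * (k\<^sup>2 * JR) + 60 * (k\<^sup>2 * Jz) + 60 * (48 * (k^4 * Jz)) \<le> L2 / 2"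
    using L2(2) lamsq kJ(1) by linarith
  have E: "L2 \<le> 2 * (2880 * (k\<^sup>2 * JF) + 720 * (k\<^sup>2 * b1) + 60 * JG + b2)"
    using B C D by argo
  have "48 * (k\<^sup>2 * Jz) \<le> L2"
    using \<open>6000 * k^4 * Jz \<le> lam * Jz\<close> lamsq L2(2) kJ(1) nn \<open>0 \<le> k^4 * Jz\<close> \<open>6000 * k\<^sup>2 * JR \<le> lam * JR\<close> \<open>0 \<le> k\<^sup>2 * JR\<close> by linarith
  then have "L1 + L2 \<le> 2 * L2 + 48 * JF + 12 * b1" using A by linarith
  also have "\<dots> \<le> 200000 * (k^4 * JF) + 200000 * (k^4 * JG) + 200000 * (k^4 * b1) + 200000 * (k^4 * b2)"
  proof -
    have "0 \<le> k^4 * JF" "0 \<le> k^4 * JG" "0 \<le> k^4 * b1" "0 \<le> k^4 * b2" using nn b by auto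
    then show ?thesis using E kJ by argo
  qed
  finally show ?thesis by (simp add: algebra_simps)
qed

context carleman
begin

lemma J_le_pointwise:
  assumes f: "L2T f" and g: "L2T g\<^sub>1" "L2T g\<^sub>2" "L2T g\<^sub>3" "L2T g\<^sub>4" "L2T g\<^sub>5"
    and le: "AE z in N. (f z)\<^sup>2 \<le> c * ((g\<^sub>1 z)\<^sup>2 + (g\<^sub>2 z)\<^sup>2 + (g\<^sub>3 z)\<^sup>2 + (g\<^sub>4 z)\<^sup>2) + d * (g\<^sub>5 z)\<^sup>2"
  shows "J n f f \<le> c * (J n g\<^sub>1 g\<^sub>1 + J n g\<^sub>2 g\<^sub>2 + J n g\<^sub>3 g\<^sub>3 + J n g\<^sub>4 g\<^sub>4) + d * J n g\<^sub>5 g\<^sub>5"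
proof -
  let ?w = "\<lambda>z. carl lam s n (snd z)"
  note ints = int_J[OF f f] int_J[OF g(1) g(1)] int_J[OF g(2) g(2)] int_J[OF g(3) g(3)] int_J[OF g(4) g(4)] int_J[OF g(5) g(5)]
  have "(\<integral>z. ?w z * (f z * f z) \<partial>N) \<le> (\<integral>z. c * (?w z * (g\<^sub>1 z * g\<^sub>1 z) + ?w z * (g\<^sub>2 z * g\<^sub>2 z) + ?w z * (g\<^sub>3 z * g\<^sub>3 z) + ?w z * (g\<^sub>4 z * g\<^sub>4 z)) + d * (?w z * (g\<^sub>5 z * g\<^sub>5 z)) \<partial>N)"
  proof (rule integral_mono_AE)
    show "AE z in N. ?w z * (f z * f z) \<le> c * (?w z * (g\<^sub>1 z * g\<^sub>1 z) + ?w z * (g\<^sub>2 z * g\<^sub>2 z) + ?w z * (g\<^sub>3 z * g\<^sub>3 z) + ?w z * (g\<^sub>4 z * g\<^sub>4 z)) + d * (?w z * (g\<^sub>5 z * g\<^sub>5 z))"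
      using le
    proof eventually_elim
      case (elim z)
      have "?w z * (f z)\<^sup>2 \<le> ?w z * (c * ((g\<^sub>1 z)\<^sup>2 + (g\<^sub>2 z)\<^sup>2 + (g\<^sub>3 z)\<^sup>2 + (g\<^sub>4 z)\<^sup>2) + d * (g\<^sub>5 z)\<^sup>2)"
        by (intro mult_left_mono elim less_imp_le[OF carl_pos])
      then show ?case by (simp add: power2_eq_square algebra_simps)
    qed
  qed (use ints in auto)
  then show ?thesis using ints by (simp add: J_def form_def)
qed

text \<open>In the application p = a u_xx, q = sqrt(a) u_x, z = a m, P = a (a m)_xx and R = sqrt(a)
  (a m)_x. The equations enter only as pointwise inequalities, and evolution and boundary conditions
  only through the energy inequalities and the two Green identities.\<close>

lemma carleman_system:
  assumes k: "k \<ge> 1" and lam_large: "lam \<ge> 6000 * k^4"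
    and good: "L2T u" "L2T ut" "L2T p" "L2T q" "L2T z" "L2T zt" "L2T P" "L2T R" "L2T F" "L2T G"
    and eq_u: "AE y in N. \<bar>ut y + p y\<bar> \<le> k * (\<bar>q y\<bar> + \<bar>z y\<bar>) + \<bar>F y\<bar>"
    and eq_z: "AE y in N. \<bar>zt y - P y\<bar> \<le> k * (\<bar>R y\<bar> + \<bar>z y\<bar> + \<bar>q y\<bar> + \<bar>p y\<bar>) + \<bar>G y\<bar>"
    and u_\<beta>: "\<And>\<eta> \<eta>'. is_weight \<eta> \<eta>' \<Longrightarrow> - 2 * form \<eta> p ut + form \<eta>' q q \<le> \<eta> T * \<beta>\<^sub>T"
    and u_\<alpha>: "\<And>\<eta> \<eta>'. is_weight \<eta> \<eta>' \<Longrightarrow> 2 * form \<eta> u ut + form \<eta>' u u \<le> \<eta> T * \<alpha>\<^sub>T"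
    and u_form: "\<And>\<eta>. continuous_on UNIV \<eta> \<Longrightarrow> form \<eta> u p = - form \<eta> q q"
    and z_\<beta>: "\<And>\<eta> \<eta>'. is_weight \<eta> \<eta>' \<Longrightarrow> 2 * form \<eta> P zt - form \<eta>' R R \<le> \<eta> 0 * b\<^sub>0"
    and z_\<alpha>: "\<And>\<eta> \<eta>'. is_weight \<eta> \<eta>' \<Longrightarrow> 2 * form \<eta> z zt + form \<eta>' z z \<le> \<eta> T * a\<^sub>T"
    and z_\<alpha>0: "\<And>\<eta> \<eta>'. is_weight \<eta> \<eta>' \<Longrightarrow> - 2 * form \<eta> z zt - form \<eta>' z z \<le> \<eta> 0 * a\<^sub>0"
    and z_form: "\<And>\<eta>. continuous_on UNIV \<eta> \<Longrightarrow> form \<eta> z P = - form \<eta> R R"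
    and nn: "\<alpha>\<^sub>T \<ge> 0" "\<beta>\<^sub>T \<ge> 0" "a\<^sub>T \<ge> 0" "a\<^sub>0 \<ge> 0" "b\<^sub>0 \<ge> 0"
  shows "(J 0 ut ut + J 0 p p + s * lam * J 1 q q + s\<^sup>2 * lam\<^sup>2 * J 2 u u) +
      ((Jm P + Jm zt) / s + lam * J 0 R R + s * lam\<^sup>2 * J 1 z z)
    \<le> 2000000 * k^4 * (s * J 1 F F + J 0 G G
      + exp (lam * T) * (s * (s * lam * exp (lam * T) * \<alpha>\<^sub>T + \<beta>\<^sub>T)) * exp (2 * s * exp (lam * T))
      + s * lam * exp (lam * T) * a\<^sub>T * exp (2 * s * exp (lam * T))
      + (s * lam * a\<^sub>0 + b\<^sub>0) * exp (2 * s))"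
proof -
  define f where "f y = ut y + p y" for y
  define g where "g y = zt y - P y" for y
  have f: "L2T f" and g: "L2T g" unfolding f_def g_def using good by (auto intro: L2T_add L2T_diff)
  define b1 where "b1 = 6 * (s * carl lam s 1 T * \<beta>\<^sub>T + s\<^sup>2 * lam * carl lam s 2 T * \<alpha>\<^sub>T)"
  define b2 where "b2 = 9 * (carl lam s 0 0 * b\<^sub>0 + s * lam * carl lam s 1 T * a\<^sub>T) + lam * carl lam s 0 0 * a\<^sub>0"
  have b: "b1 \<ge> 0" "b2 \<ge> 0"
    unfolding b1_def b2_def using s lam nn less_imp_le[OF carl_pos] by (auto intro!: add_nonneg_nonneg mult_nonneg_nonneg)
  let ?L1 = "J 0 ut ut + J 0 p p + s * lam * J 1 q q + s\<^sup>2 * lam\<^sup>2 * J 2 u u"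
  let ?L2 = "(Jm P + Jm zt) / s + lam * J 0 R R + s * lam\<^sup>2 * J 1 z z"
  have Jm_nonneg: "Jm h \<ge> 0" for h
    unfolding Jm_def form_def by (intro integral_nonneg_AE always_eventually allI) (simp add: less_imp_le[OF carl_pos])
  have 1: "?L1 \<le> 8 * (s * J 1 f f) + 6 * (b1 / 6)"
  proof -
    have "?L1 \<le> 8 * (s * J 1 f f) + b1"
      unfolding b1_def by (rule carleman_backward[OF good(1-4) f _ u_\<beta> u_\<alpha> u_form]) (simp_all add: f_def)
    then show ?thesis by simp
  qed
  have 2: "?L2 \<le> 12 * J 0 g g + b2"
    unfolding b2_def using carleman_forward[OF good(5-8) g _ z_\<beta> z_\<alpha> z_\<alpha>0 nn(4) z_form] by (simp add: g_def)
  have L1_low: "lam * (s * J 1 q q) + J 0 p p \<le> ?L1"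
    using J_nonneg[of 0 ut] J_nonneg[of 2 u] s lam by (simp add: mult.left_commute mult.assoc)
  have L2_low: "lam * J 0 R R + lam\<^sup>2 * (s * J 1 z z) \<le> ?L2"
    using Jm_nonneg[of P] Jm_nonneg[of zt] s by (simp add: mult.left_commute)
  have three: "(k * (a + b) + c)\<^sup>2 \<le> 3 * k\<^sup>2 * (a\<^sup>2 + b\<^sup>2 + 0 + 0) + 3 * c\<^sup>2" for a b c :: real
  proof -
    have "0 \<le> (k * a - k * b)\<^sup>2 + (k * a - c)\<^sup>2 + (k * b - c)\<^sup>2" by simp
    then show ?thesis by (simp add: power2_eq_square algebra_simps)
  qed
  have five: "(k * (a + b + d + e) + c)\<^sup>2 \<le> 5 * k\<^sup>2 * (a\<^sup>2 + b\<^sup>2 + d\<^sup>2 + e\<^sup>2) + 5 * c\<^sup>2" for a b c d e :: real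
  proof -
    have "0 \<le> (k * a - k * b)\<^sup>2 + (k * a - k * d)\<^sup>2 + (k * a - k * e)\<^sup>2 + (k * b - k * d)\<^sup>2 + (k * b - k * e)\<^sup>2
      + (k * d - k * e)\<^sup>2 + (k * a - c)\<^sup>2 + (k * b - c)\<^sup>2 + (k * d - c)\<^sup>2 + (k * e - c)\<^sup>2" by simp
    then show ?thesis by (simp add: power2_eq_square algebra_simps)
  qed
  \<comment> \<open>The pointwise comparison has four slots for coupling terms. The first equation
    has two couplings and fills the rest with 0.\<close>
  have zero: "L2T (\<lambda>_. 0)" by (simp add: L2T_def)
  have ff: "J 1 f f \<le> 3 * k\<^sup>2 * (J 1 q q + J 1 z z + J 1 (\<lambda>_. 0) (\<lambda>_. 0) + J 1 (\<lambda>_. 0) (\<lambda>_. 0)) + 3 * J 1 F F"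
  proof (rule J_le_pointwise[OF f good(4,5) zero zero good(9)])
    show "AE y in N. (f y)\<^sup>2 \<le> 3 * k\<^sup>2 * ((q y)\<^sup>2 + (z y)\<^sup>2 + 0\<^sup>2 + 0\<^sup>2) + 3 * (F y)\<^sup>2"
      using eq_u
    proof eventually_elim
      case (elim y)
      then have "\<bar>f y\<bar>\<^sup>2 \<le> (k * (\<bar>q y\<bar> + \<bar>z y\<bar>) + \<bar>F y\<bar>)\<^sup>2" unfolding f_def by (rule power_mono) simp
      also note three
      finally show ?case by simp
    qed
  qed
  have gg: "J 0 g g \<le> 5 * k\<^sup>2 * (J 0 R R + J 0 z z + J 0 q q + J 0 p p) + 5 * J 0 G G"
  proof (rule J_le_pointwise[OF g good(8,5,4,3,10)])
    show "AE y in N. (g y)\<^sup>2 \<le> 5 * k\<^sup>2 * ((R y)\<^sup>2 + (z y)\<^sup>2 + (q y)\<^sup>2 + (p y)\<^sup>2) + 5 * (G y)\<^sup>2"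
      using eq_z
    proof eventually_elim
      case (elim y)
      then have "\<bar>g y\<bar>\<^sup>2 \<le> (k * (\<bar>R y\<bar> + \<bar>z y\<bar> + \<bar>q y\<bar> + \<bar>p y\<bar>) + \<bar>G y\<bar>)\<^sup>2" unfolding g_def by (rule power_mono) simp
      also note five
      finally show ?case by simp
    qed
  qed
  have J0: "J 1 (\<lambda>_. 0) (\<lambda>_. 0) = 0" by (simp add: J_def form_def)
  have "s * J 1 f f \<le> s * (3 * k\<^sup>2 * (J 1 q q + J 1 z z) + 3 * J 1 F F)"
    using ff s unfolding J0 by (intro mult_left_mono) auto
  also have "\<dots> = 3 * k\<^sup>2 * (s * J 1 q q) + 3 * k\<^sup>2 * (s * J 1 z z) + 3 * (s * J 1 F F)" by (simp add: algebra_simps)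
  finally have ff': "s * J 1 f f \<le> 3 * k\<^sup>2 * (s * J 1 q q) + 3 * k\<^sup>2 * (s * J 1 z z) + 3 * (s * J 1 F F)" .
  have "?L1 + ?L2 \<le> 200000 * k^4 * (s * J 1 F F + J 0 G G + b1 / 6 + b2)"
    by (rule coupled_absorption[OF k lam_large _ _ _ _ _ _ _ _ _ b(2) 1 L1_low ff' 2 L2_low gg])
      (use J_nonneg s b J_Suc_ge[OF good(5), of 0] J_Suc_ge[OF good(4), of 0] in auto)
  \<comment> \<open>The factor 10 covers the coefficients 9 in \<open>b2\<close>; its last term, lam
    times \<open>a\<^sub>0\<close>, is raised to s lam times \<open>a\<^sub>0\<close> by s >=
    1.\<close>
  also have "\<dots> \<le> 200000 * k^4 * (10 * (s * J 1 F F + J 0 G G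
      + exp (lam * T) * (s * (s * lam * exp (lam * T) * \<alpha>\<^sub>T + \<beta>\<^sub>T)) * exp (2 * s * exp (lam * T))
      + s * lam * exp (lam * T) * a\<^sub>T * exp (2 * s * exp (lam * T))
      + (s * lam * a\<^sub>0 + b\<^sub>0) * exp (2 * s)))"
  proof (rule mult_left_mono)
    have c: "carl lam s 1 T = exp (lam * T) * exp (2 * s * exp (lam * T))" "carl lam s 0 0 = exp (2 * s)"
      "carl lam s 2 T = exp (lam * T) * exp (lam * T) * exp (2 * s * exp (lam * T))"
      by (simp_all add: carl_def power2_eq_square)
    define e where "e = exp (lam * T)"
    define E where "E = exp (2 * s * e)"
    define E0 where "E0 = exp (2 * s)"
    have pos: "e > 0" "E > 0" "E0 > 0" by (simp_all add: e_def E_def E0_def)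
    have 1: "b1 / 6 = e * (s * (s * lam * e * \<alpha>\<^sub>T + \<beta>\<^sub>T)) * E"
      unfolding b1_def c e_def[symmetric] E_def[symmetric] by (simp add: algebra_simps power2_eq_square)
    have 2: "b2 = 9 * (E0 * b\<^sub>0) + 9 * (s * lam * e * a\<^sub>T * E) + lam * E0 * a\<^sub>0"
      unfolding b2_def c e_def[symmetric] E_def[symmetric] E0_def[symmetric] by (simp add: algebra_simps)
    have 3: "lam * E0 * a\<^sub>0 \<le> s * lam * a\<^sub>0 * E0"
    proof -
      have "1 * (lam * E0 * a\<^sub>0) \<le> s * (lam * E0 * a\<^sub>0)" using s lam pos nn by (intro mult_right_mono) auto
      then show ?thesis by (simp add: mult_ac)
    qed
    have nn': "0 \<le> s * J 1 F F" "0 \<le> J 0 G G" "0 \<le> E0 * b\<^sub>0" "0 \<le> s * lam * e * a\<^sub>T * E" "0 \<le> s * lam * a\<^sub>0 * E0" "0 \<le> b1 / 6"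
      using s lam pos nn b J_nonneg by simp_all
    have "x + y + v + w \<le> 10 * (x + y + v + c + (d + a))"
      if "0 \<le> x" "0 \<le> y" "0 \<le> a" "0 \<le> c" "0 \<le> d" "0 \<le> v" "w = 9 * a + 9 * c + h" "h \<le> d" for x y v w c d h a :: real
      using that by argo
    from this[OF nn' 2 3]
    show "s * J 1 F F + J 0 G G + b1 / 6 + b2 \<le> 10 * (s * J 1 F F + J 0 G G
      + exp (lam * T) * (s * (s * lam * exp (lam * T) * \<alpha>\<^sub>T + \<beta>\<^sub>T)) * exp (2 * s * exp (lam * T))
      + s * lam * exp (lam * T) * a\<^sub>T * exp (2 * s * exp (lam * T))
      + (s * lam * a\<^sub>0 + b\<^sub>0) * exp (2 * s))"
      unfolding e_def[symmetric] E_def[symmetric] E0_def[symmetric] 1[symmetric] by (simp add: distrib_right distrib_left mult.commute)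
  qed (use k in simp)
  also have "200000 * k^4 * (10 * X) = 2000000 * k^4 * X" for X :: real by simp
  finally show ?thesis .
qed

end

section \<open>The space-time cylinder with the degenerate weight\<close>

text \<open>P itself may fail to be measurable. Before the variables are exchanged, its exceptional
  set is enclosed in a measurable null set.\<close>

lemma AE_lborel_slices:
  fixes P :: "real \<times> real \<Rightarrow> bool"
  assumes "AE z in lborel. P z"
  shows "AE x in lborel. AE t in lborel. P (x, t)" "AE t in lborel. AE x in lborel. P (x, t)"
proof -
  have P: "AE z in lborel \<Otimes>\<^sub>M lborel. P z" using assms unfolding lborel_prod .
  then show "AE x in lborel. AE t in lborel. P (x, t)" by (rule lborel_pair.AE_pair)
  obtain N where N: "N \<in> null_sets (lborel \<Otimes>\<^sub>M lborel)" "{z \<in> space (lborel \<Otimes>\<^sub>M lborel). \<not> P z} \<subseteq> N"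
    using P by (auto simp: eventually_ae_filter)
  have "AE z in lborel \<Otimes>\<^sub>M lborel. z \<notin> N" using N(1) by (rule AE_not_in)
  then have "AE x in lborel. AE t in lborel. (x, t) \<notin> N" by (rule lborel_pair.AE_pair)
  moreover have "{z \<in> space (lborel \<Otimes>\<^sub>M lborel). (fst z, snd z) \<notin> N} \<in> sets (lborel \<Otimes>\<^sub>M lborel)"
  proof -
    have "{z \<in> space (lborel \<Otimes>\<^sub>M lborel). (fst z, snd z) \<notin> N} = space (lborel \<Otimes>\<^sub>M lborel) - N" by auto
    then show ?thesis by (simp only: sets.compl_sets[OF null_setsD2[OF N(1)]])
  qed
  ultimately have "AE t in lborel. AE x in lborel. (x, t) \<notin> N"
    by (subst (asm) lborel_pair.AE_commute) auto
  then show "AE t in lborel. AE x in lborel. P (x, t)"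
  proof eventually_elim
    case (elim t)
    then show ?case by eventually_elim (use N(2) in \<open>auto simp: space_pair_measure\<close>)
  qed
qed

lemma fst_snd_borel [measurable]:
  "(fst :: real \<times> real \<Rightarrow> real) \<in> borel_measurable borel" "(snd :: real \<times> real \<Rightarrow> real) \<in> borel_measurable borel"
  by (intro borel_measurable_continuous_onI continuous_intros)+

lemma Q_borel [measurable]: "Q T \<in> sets borel"
  by (intro borel_open open_Times) auto

lemma Q_lebesgue: "Q T \<in> sets lebesgue"
  using Q_borel[of T] by auto

lemma AE_lebesgue_on_iff:
  fixes P :: "'a :: euclidean_space \<Rightarrow> bool"
  assumes "S \<in> sets lebesgue"
  shows "(AE x in lebesgue_on S. P x) \<longleftrightarrow> (AE x in lborel. x \<in> S \<longrightarrow> P x)"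
  using assms by (simp add: AE_restrict_space_iff AE_completion_iff)

lemma borel_version:
  assumes "f \<in> borel_measurable (lebesgue_on (Q T))"
  obtains f' :: "real \<times> real \<Rightarrow> real" where "f' \<in> borel_measurable borel" "\<And>z. z \<notin> Q T \<Longrightarrow> f' z = 0"
    "AE z in lborel. z \<in> Q T \<longrightarrow> f' z = f z"
proof -
  have "(\<lambda>z. indicator (Q T) z *\<^sub>R f z) \<in> borel_measurable lebesgue"
    using assms borel_measurable_restrict_space_iff[of "Q T" lebesgue f] Q_lebesgue by simp
  then obtain g where g: "g \<in> borel_measurable lborel" "AE z in lborel. indicator (Q T) z *\<^sub>R f z = g z"
    using completion_ex_borel_measurable_real by blast
  show thesis
  proof (rule that[of "\<lambda>z. indicator (Q T) z * g z"])
    show "(\<lambda>z. indicator (Q T) z * g z) \<in> borel_measurable borel"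
      using g(1) by (intro borel_measurable_times borel_measurable_indicator) auto
    show "AE z in lborel. z \<in> Q T \<longrightarrow> indicator (Q T) z * g z = f z"
      using g(2) by eventually_elim auto
  qed simp
qed

lemma nn_integral_lebesgue_on_Q:
  assumes "AE z in lborel. z \<in> Q T \<longrightarrow> f z = g z"
  shows "(\<integral>\<^sup>+z. f z \<partial>lebesgue_on (Q T)) = (\<integral>\<^sup>+z. g z * indicator (Q T) z \<partial>lborel)"
proof -
  have "(\<integral>\<^sup>+z. f z \<partial>lebesgue_on (Q T)) = (\<integral>\<^sup>+z. f z * indicator (Q T) z \<partial>lborel)"
    using Q_lebesgue by (simp add: nn_integral_restrict_space nn_integral_completion)
  also have "\<dots> = (\<integral>\<^sup>+z. g z * indicator (Q T) z \<partial>lborel)"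
  proof (rule nn_integral_cong_AE)
    show "AE z in lborel. f z * indicator (Q T) z = g z * indicator (Q T) z"
      using assms by eventually_elim (auto simp: indicator_def)
  qed
  finally show ?thesis .
qed

text \<open>The iterated integral sees f only on almost every slice, where the Borel function g may
  replace it. Tonelli's theorem is then applied to g.\<close>

lemma nn_integral_iterated:
  fixes f g :: "real \<times> real \<Rightarrow> ennreal"
  assumes ae: "AE z in lborel. z \<in> Q T \<longrightarrow> f z = g z" and [measurable]: "g \<in> borel_measurable borel"
  shows "(\<integral>\<^sup>+t. (\<integral>\<^sup>+x. f (x, t) \<partial>lebesgue_on Omega) \<partial>lebesgue_on {0<..<T}) = (\<integral>\<^sup>+z. g z * indicator (Q T) z \<partial>lborel)"
proof -
  have "(\<integral>\<^sup>+t. (\<integral>\<^sup>+x. f (x, t) \<partial>lebesgue_on Omega) \<partial>lebesgue_on {0<..<T})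
     = (\<integral>\<^sup>+t. (\<integral>\<^sup>+x. f (x, t) * indicator Omega x \<partial>lborel) * indicator {0<..<T} t \<partial>lborel)"
    by (simp add: nn_integral_restrict_space nn_integral_completion)
  also have "\<dots> = (\<integral>\<^sup>+t. (\<integral>\<^sup>+x. g (x, t) * indicator (Q T) (x, t) \<partial>lborel) \<partial>lborel)"
  proof (rule nn_integral_cong_AE)
    show "AE t in lborel. (\<integral>\<^sup>+x. f (x, t) * indicator Omega x \<partial>lborel) * indicator {0<..<T} t = (\<integral>\<^sup>+x. g (x, t) * indicator (Q T) (x, t) \<partial>lborel)"
      using AE_lborel_slices(2)[OF ae]
    proof eventually_elim
    case (elim t)
    have "(\<integral>\<^sup>+x. f (x, t) * indicator Omega x \<partial>lborel) * indicator {0<..<T} t = (\<integral>\<^sup>+x. f (x, t) * indicator (Q T) (x, t) \<partial>lborel)"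
      by (cases "t \<in> {0<..<T}") (auto simp: indicator_def intro!: nn_integral_cong)
    also have "\<dots> = (\<integral>\<^sup>+x. g (x, t) * indicator (Q T) (x, t) \<partial>lborel)"
    proof (rule nn_integral_cong_AE)
      show "AE x in lborel. f (x, t) * indicator (Q T) (x, t) = g (x, t) * indicator (Q T) (x, t)"
        using elim by eventually_elim (auto simp: indicator_def)
    qed
    finally show ?case .
    qed
  qed
  also have "\<dots> = (\<integral>\<^sup>+z. g z * indicator (Q T) z \<partial>(lborel \<Otimes>\<^sub>M lborel))"
  proof (rule lborel_pair.nn_integral_snd)
    show "(\<lambda>z. g z * indicator (Q T) z) \<in> borel_measurable (lborel \<Otimes>\<^sub>M lborel)"
      unfolding lborel_prod by measurable
  qed
  finally show ?thesis unfolding lborel_prod .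
qed

lemma L2_Icc_integrable:
  fixes g :: "real \<Rightarrow> real"
  assumes [measurable]: "g \<in> borel_measurable lborel" and fin: "(\<integral>\<^sup>+r. ennreal ((g r)\<^sup>2) \<partial>lborel) < \<infinity>"
  shows "set_integrable lborel {p..q} g" "set_integrable lebesgue {p..q} g"
proof -
  have sq: "integrable lborel (\<lambda>r. (g r)\<^sup>2)"
    using fin by (intro integrableI_bounded) auto
  have "integrable lborel (indicat_real {p..q})"
    by (intro integrable_real_indicator) (auto simp: emeasure_lborel_Icc_eq)
  moreover have "(\<lambda>r. (indicat_real {p..q} r)\<^sup>2) = indicat_real {p..q}"
    by (auto simp: indicator_def)
  ultimately show i: "set_integrable lborel {p..q} g"
    unfolding set_integrable_def using sq by (simp add: integrable_mult_L2)
  then show "set_integrable lebesgue {p..q} g"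
    unfolding set_integrable_def by (subst integrable_completion) (auto simp: set_integrable_def)
qed

locale degenerate =
  fixes a :: "real \<Rightarrow> real" and T :: real
  assumes T: "T > 0" and a_cont: "continuous_on {0..1} a" and a_pos: "\<And>x. x \<in> Omega \<Longrightarrow> a x > 0"
begin

text \<open>Extension by 0 makes the weights a and 1/a Borel functions on the whole line, whatever
  values \<open>a\<close> has outside the unit interval.\<close>

definition "ab x = indicator Omega x * a x"
definition "wt x = indicator Omega x / a x"

lemma ab_borel [measurable]: "ab \<in> borel_measurable borel"
proof -
  have "(\<lambda>x. indicator Omega x *\<^sub>R a x) \<in> borel_measurable borel"
    by (intro borel_measurable_continuous_on_indicator continuous_on_subset[OF a_cont]) auto
  then show ?thesis by (simp add: ab_def[abs_def])
qed

lemma wt_eq: "wt x = (if ab x = 0 then 0 else 1 / ab x)"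
  using a_pos[of x] by (cases "x \<in> Omega") (auto simp: wt_def ab_def)

lemma wt_borel [measurable]: "wt \<in> borel_measurable borel"
  unfolding wt_eq[abs_def] by measurable

lemma wt_pos: "wt x \<ge> 0" "x \<in> Omega \<Longrightarrow> wt x > 0" "x \<notin> Omega \<Longrightarrow> wt x = 0" "x \<in> Omega \<Longrightarrow> wt x = 1 / a x"
  using a_pos[of x] by (auto simp: wt_def indicator_def)

lemma ab_simps: "x \<in> Omega \<Longrightarrow> ab x = a x" "x \<notin> Omega \<Longrightarrow> ab x = 0" "ab x \<ge> 0"
  using a_pos[of x] by (auto simp: ab_def indicator_def)

text \<open>The measure dx/a on the unit interval. It may be infinite since 1/a can fail to be
  integrable at the end points; sigma-finiteness is what the product measure requires.\<close>

definition "M = density lborel (\<lambda>x. ennreal (wt x))"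

lemma sets_M [measurable_cong, simp]: "sets M = sets borel" and space_M [simp]: "space M = UNIV"
  by (simp_all add: M_def)

lemma sigma_finite_M: "sigma_finite_measure M"
  unfolding M_def by (subst sigma_finite_measure.sigma_finite_iff_density_finite[OF lborel.sigma_finite_measure_axioms]) auto

sublocale time_cylinder M T
  by (rule time_cylinder.intro[OF sigma_finite_M T])

lemma sets_N [measurable_cong]: "sets N = sets (borel :: (real \<times> real) measure)"
proof -
  have "sets N = sets ((borel :: real measure) \<Otimes>\<^sub>M (borel :: real measure))"
    unfolding N_def by (intro sets_pair_measure_cong) auto
  then show ?thesis unfolding borel_prod .
qed

lemma space_N [simp]: "space N = UNIV"
  by (simp add: N_def space_pair_measure)

lemma borel_measurable_N: "f \<in> borel_measurable N \<longleftrightarrow> f \<in> borel_measurable borel"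
  by (simp add: measurable_def sets_N)

lemma AE_M_iff: "(AE x in M. P x) \<longleftrightarrow> (AE x in lborel. x \<in> Omega \<longrightarrow> P x)"
proof -
  have "(AE x in M. P x) \<longleftrightarrow> (AE x in lborel. 0 < ennreal (wt x) \<longrightarrow> P x)"
    unfolding M_def by (rule AE_density) simp
  also have "\<dots> \<longleftrightarrow> (AE x in lborel. x \<in> Omega \<longrightarrow> P x)"
  proof -
    have "0 < ennreal (wt x) \<longleftrightarrow> x \<in> Omega" for x
      using wt_pos[of x] by (cases "x \<in> Omega") auto
    then show ?thesis by simp
  qed
  finally show ?thesis .
qed

lemma nn_integral_N:
  fixes h :: "real \<times> real \<Rightarrow> ennreal"
  assumes [measurable]: "h \<in> borel_measurable borel"
  shows "(\<integral>\<^sup>+z. h z \<partial>N) = (\<integral>\<^sup>+z. ennreal (wt (fst z)) * h z \<partial>lborel)"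
proof -
  have [measurable]: "h \<in> borel_measurable (lborel \<Otimes>\<^sub>M lborel)"
    unfolding lborel_prod using assms by simp
  have [measurable]: "h \<in> borel_measurable (M \<Otimes>\<^sub>M lborel)"
    using assms borel_measurable_N unfolding N_def by simp
  have "(\<integral>\<^sup>+z. h z \<partial>N) = (\<integral>\<^sup>+x. \<integral>\<^sup>+t. h (x, t) \<partial>lborel \<partial>M)"
    unfolding N_def by (subst lborel.nn_integral_fst[symmetric]) auto
  also have "\<dots> = (\<integral>\<^sup>+x. ennreal (wt x) * (\<integral>\<^sup>+t. h (x, t) \<partial>lborel) \<partial>lborel)"
    unfolding M_def by (rule nn_integral_density) measurable
  also have "\<dots> = (\<integral>\<^sup>+x. \<integral>\<^sup>+t. ennreal (wt x) * h (x, t) \<partial>lborel \<partial>lborel)"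
    by (intro nn_integral_cong nn_integral_cmult[symmetric]) measurable
  also have "\<dots> = (\<integral>\<^sup>+z. ennreal (wt (fst z)) * h z \<partial>(lborel \<Otimes>\<^sub>M lborel))"
    by (subst lborel.nn_integral_fst[symmetric]) auto
  finally show ?thesis unfolding lborel_prod .
qed

lemma AE_N_I:
  assumes "AE z in lborel. P z"
  shows "AE z in N. P z"
proof -
  obtain A where A: "A \<in> null_sets (lborel :: (real \<times> real) measure)" "{z \<in> space lborel. \<not> P z} \<subseteq> A"
    using assms by (auto simp: eventually_ae_filter)
  have [measurable]: "A \<in> sets borel" using A(1) by auto
  have "emeasure N A = (\<integral>\<^sup>+z. indicator A z \<partial>N)"
    by (subst nn_integral_indicator) (simp_all add: sets_N)
  also have "\<dots> = (\<integral>\<^sup>+z. ennreal (wt (fst z)) * indicator A z \<partial>lborel)"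
    by (rule nn_integral_N) measurable
  also have "\<dots> = 0"
  proof (rule nn_integral_0_iff_AE[THEN iffD2])
    show "AE z in lborel. ennreal (wt (fst z)) * indicator A z = 0"
      using AE_not_in[OF A(1)] by eventually_elim auto
  qed measurable
  finally have "A \<in> null_sets N" by (auto simp: null_sets_def sets_N)
  then show ?thesis using A(2) by (intro AE_I'[of A]) auto
qed

lemma integral_M:
  assumes [measurable]: "f \<in> borel_measurable borel"
  shows "(\<integral>x. f x \<partial>M) = (LINT x:Omega|lebesgue. f x / a x)"
    and "integrable M f \<longleftrightarrow> set_integrable lebesgue Omega (\<lambda>x. f x / a x)"
proof -
  have eq: "indicator Omega x *\<^sub>R (f x / a x) = wt x *\<^sub>R f x" for x by (simp add: wt_def)
  have m: "(\<lambda>x. wt x *\<^sub>R f x) \<in> borel_measurable lborel" by measurable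
  have "(\<integral>x. f x \<partial>M) = (\<integral>x. wt x *\<^sub>R f x \<partial>lborel)"
    unfolding M_def by (rule integral_density) (auto simp: wt_pos)
  also have "\<dots> = (LINT x:Omega|lebesgue. f x / a x)"
    unfolding set_lebesgue_integral_def eq using m by (rule integral_completion[symmetric])
  finally show "(\<integral>x. f x \<partial>M) = (LINT x:Omega|lebesgue. f x / a x)" .
  have "integrable M f \<longleftrightarrow> integrable lborel (\<lambda>x. wt x *\<^sub>R f x)"
    unfolding M_def by (rule integrable_density) (auto simp: wt_pos)
  also have "\<dots> \<longleftrightarrow> set_integrable lebesgue Omega (\<lambda>x. f x / a x)"
    unfolding set_integrable_def eq using m by (rule integrable_completion[symmetric])
  finally show "integrable M f \<longleftrightarrow> set_integrable lebesgue Omega (\<lambda>x. f x / a x)" .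
qed

lemma L2T_I:
  assumes "g \<in> borel_measurable borel" "\<And>z. z \<notin> Q T \<Longrightarrow> g z = 0"
    and "(\<integral>\<^sup>+z. ennreal (wt (fst z) * (g z)\<^sup>2) \<partial>lborel) < \<infinity>"
  shows "L2T g"
proof -
  have [measurable]: "g \<in> borel_measurable borel" by fact
  have "(\<integral>\<^sup>+z. ennreal ((g z)\<^sup>2) \<partial>N) = (\<integral>\<^sup>+z. ennreal (wt (fst z)) * ennreal ((g z)\<^sup>2) \<partial>lborel)"
    by (rule nn_integral_N) measurable
  also have "\<dots> = (\<integral>\<^sup>+z. ennreal (wt (fst z) * (g z)\<^sup>2) \<partial>lborel)"
    by (simp add: ennreal_mult' wt_pos)
  finally have "(\<integral>\<^sup>+z. ennreal ((g z)\<^sup>2) \<partial>N) < \<infinity>" using assms(3) by simp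
  moreover have "g \<in> borel_measurable N" by (simp add: borel_measurable_N)
  ultimately have "integrable N (\<lambda>z. (g z)\<^sup>2)"
    by (intro integrableI_bounded) auto
  then show ?thesis
    unfolding L2T_def using assms by (auto simp: borel_measurable_N)
qed

lemma L2T_slice:
  assumes "L2T g"
  shows "AE t in lborel. integrable M (\<lambda>x. (g (x, t))\<^sup>2)" "AE x in M. (\<integral>\<^sup>+t. ennreal ((g (x, t))\<^sup>2) \<partial>lborel) < \<infinity>"
proof -
  interpret sigma_finite_measure M by (rule sigma_finite_M)
  interpret P: pair_sigma_finite M "lborel :: real measure" ..
  have i: "integrable (M \<Otimes>\<^sub>M lborel) (\<lambda>z. (g z)\<^sup>2)" and [measurable]: "g \<in> borel_measurable (M \<Otimes>\<^sub>M lborel)"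
    using assms by (auto simp: L2T_def N_def)
  have [measurable]: "g \<in> borel_measurable borel" using assms by (simp add: L2T_def borel_measurable_N)
  show "AE t in lborel. integrable M (\<lambda>x. (g (x, t))\<^sup>2)"
  proof -
    have "AE t in lborel. integrable M (\<lambda>x. h (x, t))" if "integrable (M \<Otimes>\<^sub>M lborel) h" for h :: "real \<times> real \<Rightarrow> real"
      using P.AE_integrable_snd[of "\<lambda>x t. h (x, t)"] that by simp
    from this[OF i] show ?thesis .
  qed
  have "(\<integral>\<^sup>+x. \<integral>\<^sup>+r. ennreal ((g (x, r))\<^sup>2) \<partial>lborel \<partial>M) < \<infinity>"
    using i by (subst lborel.nn_integral_fst) (auto simp: integrable_iff_bounded)
  then have "AE x in M. (\<integral>\<^sup>+r. ennreal ((g (x, r))\<^sup>2) \<partial>lborel) \<noteq> \<infinity>"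
    by (intro nn_integral_PInf_AE lborel.borel_measurable_nn_integral) auto
  then show "AE x in M. (\<integral>\<^sup>+t. ennreal ((g (x, t))\<^sup>2) \<partial>lborel) < \<infinity>"
    by eventually_elim (simp add: less_top)
qed

end

section \<open>Values in time and energy inequalities\<close>

lemma AE_lborel_shift:
  fixes P :: "real \<Rightarrow> bool"
  assumes "AE t in lborel. P t"
  shows "AE t in lborel. P (t + c)"
proof -
  have "AE t in distr lborel borel ((+) c). P t" using assms unfolding lborel_distr_plus .
  then have "AE t in lborel. P (c + t)" by (rule AE_distrD[rotated]) simp
  then show ?thesis by (simp add: add.commute)
qed

locale slab = degenerate +
  fixes z zt :: "real \<times> real \<Rightarrow> real"
  assumes z: "L2T z" and zt: "L2T zt" and time: "has_time_deriv T z zt"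
begin

lemma z_borel [measurable]: "z \<in> borel_measurable borel" "zt \<in> borel_measurable borel"
  using z zt by (auto simp: L2T_def borel_measurable_N)

lemma z_borel_M [measurable]: "z \<in> borel_measurable (M \<Otimes>\<^sub>M lborel)" "zt \<in> borel_measurable (M \<Otimes>\<^sub>M lborel)"
  using z zt by (auto simp: L2T_def N_def)

lemma slice_borel [measurable]:
  "f \<in> borel_measurable borel \<Longrightarrow> (\<lambda>t::real. f (x::real, t)) \<in> borel_measurable borel"
  "f \<in> borel_measurable borel \<Longrightarrow> (\<lambda>x::real. f (x, t::real)) \<in> borel_measurable borel" for f :: "real \<times> real \<Rightarrow> real"
proof -
  assume f: "f \<in> borel_measurable borel"
  have "(\<lambda>t. (x, t)) \<in> borel_measurable borel" "(\<lambda>x. (x, t)) \<in> borel_measurable borel"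
    by (intro borel_measurable_continuous_onI continuous_intros)+
  then show "(\<lambda>t. f (x, t)) \<in> borel_measurable borel" "(\<lambda>x. f (x, t)) \<in> borel_measurable borel"
    using measurable_compose[OF _ f] by auto
qed

text \<open>Its negative is the primitive of zt in time that vanishes from T on. As a parameter
  integral it is jointly measurable, so a representative of z can be written as a function of x
  minus \<open>tail\<close>.\<close>

definition tail :: "real \<Rightarrow> real \<Rightarrow> real" where
  "tail x t = (\<integral>r. indicator {t<..} r * zt (x, r) \<partial>lborel)"

lemma zt_slice: "AE x in M. integrable lborel (\<lambda>r. zt (x, r))"
  using L2T_slice(2)[OF zt]
proof eventually_elim
  case (elim x)
  have i: "set_integrable lborel {0..T} (\<lambda>r. zt (x, r))"
    by (rule L2_Icc_integrable(1)) (use elim in auto)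
  have eq: "indicator {0..T} r *\<^sub>R zt (x, r) = zt (x, r)" for r
    using zt by (cases "r \<in> {0<..<T}") (auto simp: L2T_def indicator_def)
  show ?case using i unfolding set_integrable_def eq .
qed

lemma tail_measurable [measurable]: "(\<lambda>w. tail (fst w) (snd w)) \<in> borel_measurable (M \<Otimes>\<^sub>M lborel)"
proof -
  have [measurable]: "Measurable.pred ((M \<Otimes>\<^sub>M lborel) \<Otimes>\<^sub>M lborel) (\<lambda>w::(real \<times> real) \<times> real. snd w \<in> {snd (fst w)<..})"
    unfolding greaterThan_iff by measurable
  have "(\<lambda>(w, r). indicator {snd w<..} r * zt (fst w, r)) \<in> borel_measurable ((M \<Otimes>\<^sub>M lborel) \<Otimes>\<^sub>M lborel)"
    unfolding split_beta' indicator_def by measurable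
  from lborel.borel_measurable_lebesgue_integral[OF this] show ?thesis
    unfolding tail_def by simp
qed

lemma tail_borel [measurable]: "(\<lambda>x. tail x t) \<in> borel_measurable borel"
proof -
  have "(\<lambda>x. (x, t)) \<in> measurable M (M \<Otimes>\<^sub>M lborel)" by simp
  from measurable_compose[OF this tail_measurable] show ?thesis by (simp add: measurable_def)
qed

lemma tail_diff:
  assumes "integrable lborel (\<lambda>r. zt (x, r))" "s \<le> t"
  shows "tail x s - tail x t = (\<integral>r. indicator {s..t} r * zt (x, r) \<partial>lborel)"
proof -
  have i: "integrable lborel (\<lambda>r. indicator {u<..} r * zt (x, r))" for u
    using integrable_mult_indicator[OF _ assms(1), of "{u<..}"] by simp
  have "tail x s - tail x t = (\<integral>r. indicator {s<..} r * zt (x, r) - indicator {t<..} r * zt (x, r) \<partial>lborel)"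
    unfolding tail_def using i by simp
  also have "\<dots> = (\<integral>r. indicator {s..t} r * zt (x, r) \<partial>lborel)"
  proof (rule integral_cong_AE)
    show "AE r in lborel. indicator {s<..} r * zt (x, r) - indicator {t<..} r * zt (x, r) = indicator {s..t} r * zt (x, r)"
      using AE_lborel_singleton[of s] by eventually_elim (use assms(2) in \<open>auto simp: indicator_def\<close>)
  qed measurable
  finally show ?thesis .
qed

lemma tail_T: "t \<ge> T \<Longrightarrow> tail x t = 0"
proof -
  assume t: "t \<ge> T"
  have eq: "indicator {t<..} r * zt (x, r) = 0" for r
    using zt t by (cases "r \<in> {0<..<T}") (auto simp: L2T_def)
  show ?thesis unfolding tail_def eq by simp
qed

lemma tail_0: "t \<le> 0 \<Longrightarrow> tail x t = tail x 0"
proof -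
  assume t: "t \<le> 0"
  have eq: "indicator {t<..} r * zt (x, r) = indicator {0<..} r * zt (x, r)" for r
    using zt t by (cases "r \<in> {0<..<T}") (auto simp: L2T_def indicator_def)
  show ?thesis unfolding tail_def eq ..
qed

lemma tail_continuous:
  assumes "integrable lborel (\<lambda>r. zt (x, r))" "X \<longlonglongrightarrow> \<tau>"
  shows "(\<lambda>n. tail x (X n)) \<longlonglongrightarrow> tail x \<tau>"
  unfolding tail_def
proof (rule integral_dominated_convergence[where w = "\<lambda>r. \<bar>zt (x, r)\<bar>"])
  show "AE r in lborel. (\<lambda>n. indicator {X n<..} r * zt (x, r)) \<longlonglongrightarrow> indicator {\<tau><..} r * zt (x, r)"
    using AE_lborel_singleton[of \<tau>]
  proof eventually_elim
    case (elim r)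
    have "\<forall>\<^sub>F n in sequentially. indicator {\<tau><..} r * zt (x, r) = indicator {X n<..} r * zt (x, r)"
    proof (cases "\<tau> < r")
      case True
      then have "\<forall>\<^sub>F n in sequentially. X n < r" using order_tendstoD(2)[OF assms(2)] by auto
      then show ?thesis by eventually_elim (use True in auto)
    next
      case False
      then have "r < \<tau>" using elim by simp
      then have "\<forall>\<^sub>F n in sequentially. r < X n" using order_tendstoD(1)[OF assms(2)] by auto
      then show ?thesis by eventually_elim (use False in auto)
    qed
    then show ?case by (rule Lim_transform_eventually[OF tendsto_const])
  qed
  show "AE r in lborel. norm (indicator {X n<..} r * zt (x, r)) \<le> \<bar>zt (x, r)\<bar>" for n
    by (intro always_eventually allI) (auto simp: indicator_def)
next
  show "integrable lborel (\<lambda>r. \<bar>zt (x, r)\<bar>)" using assms(1) by (rule integrable_abs)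
next
  have [measurable]: "(\<lambda>r. zt (x, r)) \<in> borel_measurable lborel" using assms(1) by (rule borel_measurable_integrable)
  show "(\<lambda>r. indicator {\<tau><..} r * zt (x, r)) \<in> borel_measurable lborel" by measurable
  show "(\<lambda>r. indicator {X n<..} r * zt (x, r)) \<in> borel_measurable lborel" for n by measurable
qed

text \<open>The identities for all humps with rational parameters hold off one null set of x. For
  each remaining x the lemma of du Bois-Reymond shows that z + \<open>tail\<close> is constant in
  time almost everywhere.\<close>

lemma time_representation:
  obtains c where "c \<in> borel_measurable borel"
    "AE t in lborel. t \<in> {0<..<T} \<longrightarrow> (AE x in M. z (x, t) = c x - tail x t)"
proof -
  let ?h = "\<lambda>p d n j. hump (real (Suc n)) p d (1 / real (Suc j))"
  \<comment> \<open>A countable index set, so that the exceptional sets of x belonging to the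
    individual test functions may be united.\<close>
  define I where "I = {(p, d, n::nat, j::nat). p \<in> \<rat> \<and> d \<in> \<rat> \<and> 0 < p \<and> 0 < d \<and> p + d + 1 / real (Suc j) < T}"
  have "I \<subseteq> \<rat> \<times> \<rat> \<times> UNIV \<times> UNIV" by (auto simp: I_def)
  then have "countable I" by (rule countable_subset) (intro countable_SIGMA countable_rat countableI_type)
  have "AE x in lborel. x \<in> Omega \<longrightarrow> (\<forall>(p, d, n, j) \<in> I.
      (LINT t|lebesgue_on {0<..<T}. z (x, t) * deriv (?h p d n j) t) = - (LINT t|lebesgue_on {0<..<T}. zt (x, t) * ?h p d n j t))"
  proof -
    have "AE x in lebesgue_on Omega. \<forall>i \<in> I. case i of (p, d, n, j) \<Rightarrow>
        (LINT t|lebesgue_on {0<..<T}. z (x, t) * deriv (?h p d n j) t) = - (LINT t|lebesgue_on {0<..<T}. zt (x, t) * ?h p d n j t)"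
      unfolding AE_ball_countable[OF \<open>countable I\<close>]
    proof
      fix i assume i: "i \<in> I"
      obtain p d n j where [simp]: "i = (p, d, n, j)" by (cases i) auto
      have "test_fun {0<..<T} (?h p d n j)"
        by (rule test_fun_hump) (use i in \<open>auto simp: I_def\<close>)
      then show "AE x in lebesgue_on Omega. case i of (p, d, n, j) \<Rightarrow>
        (LINT t|lebesgue_on {0<..<T}. z (x, t) * deriv (?h p d n j) t) = - (LINT t|lebesgue_on {0<..<T}. zt (x, t) * ?h p d n j t)"
        using time by (simp add: has_time_deriv_def)
    qed
    then show ?thesis by (simp only: AE_lebesgue_on_iff[OF Omega_lebesgue(1)])
  qed
  then have tests: "AE x in M. \<forall>(p, d, n, j) \<in> I.
      (LINT t|lebesgue_on {0<..<T}. z (x, t) * deriv (?h p d n j) t) = - (LINT t|lebesgue_on {0<..<T}. zt (x, t) * ?h p d n j t)"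
    by (simp only: AE_M_iff)
  \<comment> \<open>The constant is written as a mean over (0, T), and not as a value at a chosen
    time depending on x, to make it measurable in x.\<close>
  define c where "c x = (\<integral>t. indicator {0<..<T} t * (z (x, t) + tail x t) \<partial>lborel) / T" for x
  have c_m: "c \<in> borel_measurable M"
  proof -
    have "(\<lambda>(x, t). indicator {0<..<T} t * (z (x, t) + tail x t)) \<in> borel_measurable (M \<Otimes>\<^sub>M lborel)"
      using tail_measurable unfolding split_beta' by measurable
    from lborel.borel_measurable_lebesgue_integral[OF this] show ?thesis
      unfolding c_def by measurable
  qed
  have rep: "AE x in M. AE t in lborel. t \<in> {0<..<T} \<longrightarrow> z (x, t) = c x - tail x t"
    using tests L2T_slice(2)[OF z] L2T_slice(2)[OF zt] zt_slice
  proof eventually_elim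
    case (elim x)
    have f: "set_integrable lebesgue {p..q} (\<lambda>t. z (x, t))" and g: "set_integrable lebesgue {p..q} (\<lambda>t. zt (x, t))" for p q
      by (rule L2_Icc_integrable(2), simp, use elim in simp)+
    obtain Nx where Nx: "negligible Nx"
      "\<And>s t. s \<notin> Nx \<Longrightarrow> t \<notin> Nx \<Longrightarrow> 0 < s \<Longrightarrow> s < t \<Longrightarrow> t < T \<Longrightarrow> z (x, t) - z (x, s) = (LINT r:{s..t}|lebesgue. zt (x, r))"
    proof (rule du_bois_reymond[where f = "\<lambda>t. z (x, t)" and g = "\<lambda>t. zt (x, t)" and \<alpha> = 0 and \<beta> = T, OF f g])
      fix n p d j assume "p \<in> \<rat>" "d \<in> \<rat>" "0 < p" "0 < d" "p + d + 1 / real (Suc j) < T"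
      then have "(p, d, n, j) \<in> I" by (simp add: I_def)
      then show "(LINT t|lebesgue_on {0<..<T}. z (x, t) * deriv (?h p d n j) t) = - (LINT t|lebesgue_on {0<..<T}. zt (x, t) * ?h p d n j t)"
        using elim(1) by blast
    qed blast
    have const: "z (x, s) + tail x s = z (x, t) + tail x t" if "s \<notin> Nx" "t \<notin> Nx" "0 < s" "s < t" "t < T" for s t
    proof -
      have "(LINT r:{s..t}|lebesgue. zt (x, r)) = (\<integral>r. indicator {s..t} r * zt (x, r) \<partial>lborel)"
        by (simp add: set_lebesgue_integral_def integral_completion)
      then show ?thesis using Nx(2)[OF that] tail_diff[OF elim(4), of s t] that by simp
    qed
    have "\<not> {0<..<T} \<subseteq> Nx"
      using Nx(1) negligible_subset[of Nx "{0<..<T}"] open_not_negligible[of "{0<..<T}"] T by auto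
    then obtain s0 where s0: "s0 \<notin> Nx" "0 < s0" "s0 < T" by (meson greaterThanLessThan_iff subsetI)
    define \<kappa> where "\<kappa> = z (x, s0) + tail x s0"
    have \<kappa>: "z (x, t) + tail x t = \<kappa>" if "t \<notin> Nx" "t \<in> {0<..<T}" for t
      using const[of s0 t] const[of t s0] s0 that by (cases t s0 rule: linorder_cases) (auto simp: \<kappa>_def)
    have "AE t in lebesgue. t \<notin> Nx" using Nx(1) by (intro AE_not_in) (simp add: negligible_iff_null_sets)
    then have "AE t in lebesgue. t \<in> {0<..<T} \<longrightarrow> z (x, t) + tail x t = \<kappa>"
      by eventually_elim (use \<kappa> in auto)
    then have ae: "AE t in lborel. t \<in> {0<..<T} \<longrightarrow> z (x, t) + tail x t = \<kappa>" by (simp only: AE_completion_iff)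
    have tail_m: "tail x \<in> borel_measurable lborel"
    proof -
      have "(\<lambda>t. (x, t)) \<in> measurable lborel (M \<Otimes>\<^sub>M lborel)" by simp
      from measurable_compose[OF this tail_measurable] show ?thesis by simp
    qed
    have "(\<integral>t. indicator {0<..<T} t * (z (x, t) + tail x t) \<partial>lborel) = (\<integral>t. indicator {0<..<T} t * \<kappa> \<partial>lborel)"
    proof (rule integral_cong_AE)
      show "AE t in lborel. indicator {0<..<T} t * (z (x, t) + tail x t) = indicator {0<..<T} t * \<kappa>"
        using ae by eventually_elim (auto simp: indicator_def)
    qed (use tail_m in measurable)
    also have "\<dots> = T * \<kappa>" using T by simp
    finally have c\<kappa>: "c x = \<kappa>" using T by (simp add: c_def)
    show ?case unfolding c\<kappa> using ae by eventually_elim (simp add: algebra_simps)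
  qed
  interpret sigma_finite_measure M by (rule sigma_finite_M)
  interpret P: pair_sigma_finite M "lborel :: real measure" ..
  \<comment> \<open>The representation was found for almost every x; the energy argument works on
    time slices. Joint measurability permits the exchange.\<close>
  have "AE t in lborel. AE x in M. t \<in> {0<..<T} \<longrightarrow> z (x, t) = c x - tail x t"
  proof (rule P.AE_commute[THEN iffD1, OF _ rep])
    have [measurable]: "(\<lambda>w. c (fst w)) \<in> borel_measurable (M \<Otimes>\<^sub>M lborel)" "(\<lambda>w. z (fst w, snd w)) \<in> borel_measurable (M \<Otimes>\<^sub>M lborel)"
      using c_m by auto
    show "{w \<in> space (M \<Otimes>\<^sub>M lborel). snd w \<in> {0<..<T} \<longrightarrow> z (fst w, snd w) = c (fst w) - tail (fst w) (snd w)} \<in> sets (M \<Otimes>\<^sub>M lborel)"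
      using tail_measurable by measurable
  qed
  then have "AE t in lborel. t \<in> {0<..<T} \<longrightarrow> (AE x in M. z (x, t) = c x - tail x t)"
    by eventually_elim auto
  moreover have "c \<in> borel_measurable borel" using c_m by (simp add: measurable_def)
  ultimately show thesis using that by blast
qed

definition c where
  "c = (SOME c. c \<in> borel_measurable borel \<and> (AE t in lborel. t \<in> {0<..<T} \<longrightarrow> (AE x in M. z (x, t) = c x - tail x t)))"

lemma c_borel [measurable]: "c \<in> borel_measurable borel"
  and c_rep: "AE t in lborel. t \<in> {0<..<T} \<longrightarrow> (AE x in M. z (x, t) = c x - tail x t)"
  using someI_ex[of "\<lambda>c. c \<in> borel_measurable borel \<and> (AE t in lborel. t \<in> {0<..<T} \<longrightarrow> (AE x in M. z (x, t) = c x - tail x t))"]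
    time_representation unfolding c_def by blast+

text \<open>The value at time \<open>\<tau>\<close>, with 0 and T included, of the representative
  that is absolutely continuous in time for almost every x.\<close>

definition val :: "real \<Rightarrow> real \<Rightarrow> real" where
  "val \<tau> x = c x - tail x \<tau>"

lemma val_borel [measurable]: "val \<tau> \<in> borel_measurable borel"
  unfolding val_def by measurable

lemma val_diff: "AE x in M. \<forall>s t. s \<le> t \<longrightarrow> val t x - val s x = (\<integral>r. indicator {s..t} r * zt (x, r) \<partial>lborel)"
  using zt_slice
proof eventually_elim
  case (elim x)
  show ?case
  proof (intro allI impI)
    fix s t :: real assume "s \<le> t"
    from tail_diff[OF elim this] show "val t x - val s x = (\<integral>r. indicator {s..t} r * zt (x, r) \<partial>lborel)"
      by (simp add: val_def)
  qed
qed

text \<open>Convexity is available only between times whose slices are regular, collected in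
  \<open>g\<close>. The functional is continued beyond T by the constant \<open>bT\<close>, so that
  a step leaving the interval is compared with the final value.\<close>

lemma energy_final:
  assumes L: "L2T L" and b [measurable]: "b \<in> borel_measurable borel" and b_nonneg: "\<And>t. b t \<ge> 0"
    and b_int: "integrable lborel (\<lambda>t. indicator {0<..<T} t * b t)" and bT: "bT \<ge> 0"
    and g: "AE t in lborel. t \<in> {0<..<T} \<longrightarrow> g t"
    and cvx: "\<And>t t'. g t \<Longrightarrow> g t' \<Longrightarrow> t \<in> {0<..<T} \<Longrightarrow> t' \<in> {0<..<T} \<Longrightarrow>
      2 * (\<integral>x. L (x, t) * (z (x, t') - z (x, t)) \<partial>M) \<le> b t' - b t"
    and cvxT: "\<And>t. g t \<Longrightarrow> t \<in> {0<..<T} \<Longrightarrow> 2 * (\<integral>x. L (x, t) * (val T x - z (x, t)) \<partial>M) \<le> bT - b t"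
    and w: "is_weight \<eta> \<eta>'"
  shows "2 * form \<eta> L zt + (\<integral>t. indicator {0<..<T} t * (\<eta>' t * b t) \<partial>lborel) \<le> \<eta> T * bT"
proof -
  define \<beta> where "\<beta> t = (if t \<ge> T then bT else b t)" for t
  have [measurable]: "L \<in> borel_measurable borel" using L by (simp add: L2T_def borel_measurable_N)
  have L_m: "L \<in> borel_measurable (M \<Otimes>\<^sub>M lborel)" using L by (simp add: L2T_def N_def)
  have \<beta>_eq: "indicator {0<..<T} t * \<beta> t = indicator {0<..<T} t * b t" for t by (auto simp: \<beta>_def)
  have \<beta>_eq': "indicator {0<..<T} t * (\<eta>' t * \<beta> t) = indicator {0<..<T} t * (\<eta>' t * b t)" for t by (auto simp: \<beta>_def)
  have "2 * (\<integral>w. \<eta> (snd w) * L w * zt w \<partial>(M \<Otimes>\<^sub>M lborel)) + (\<integral>t. indicator {0<..<T} t * (\<eta>' t * \<beta> t) \<partial>lborel) \<le> \<eta> T * bT"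
  proof (rule energy_forward[OF sigma_finite_M T z_borel_M(2) L_m])
    show "integrable (M \<Otimes>\<^sub>M lborel) (\<lambda>z. (zt z)\<^sup>2)" "integrable (M \<Otimes>\<^sub>M lborel) (\<lambda>z. (L z)\<^sup>2)"
      using zt L by (simp_all add: L2T_def N_def)
    show "L (x, t) = 0" if "t \<notin> {0<..<T}" for x t using L that by (simp add: L2T_def)
    show "\<beta> \<in> borel_measurable borel" unfolding \<beta>_def by measurable
    show "\<beta> t \<ge> 0" for t using b_nonneg bT by (simp add: \<beta>_def)
    show "integrable lborel (\<lambda>t. indicator {0<..<T} t * \<beta> t)" unfolding \<beta>_eq by (rule b_int)
    show "\<beta> t = bT" if "t \<ge> T" for t using that by (simp add: \<beta>_def)
    show "(\<eta> has_real_derivative \<eta>' t) (at t)" "continuous_on UNIV \<eta>'" "\<eta> t \<ge> 0" for t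
      using w by (auto simp: is_weight_def)
    fix k :: real assume k: "k > 0"
    have "AE t in lborel. t \<in> {0<..<T} \<longrightarrow> (g t \<and> (AE x in M. z (x, t) = val t x))"
      using g c_rep by eventually_elim (auto simp: val_def)
    \<comment> \<open>For almost every t both t and t + k are regular times, since translation
      preserves null sets.\<close>
    note this AE_lborel_shift[OF this, of k]
    then show "AE t in lborel. t \<in> {0<..<T} \<longrightarrow>
      2 * (\<integral>x. L (x, t) * (\<integral>r. indicator {t..t+k} r * zt (x, r) \<partial>lborel) \<partial>M) \<le> \<beta> (t + k) - \<beta> t"
    proof eventually_elim
      case (elim t)
      show ?case
      proof
        assume t: "t \<in> {0<..<T}"
        have [measurable]: "(\<lambda>x. \<integral>r. indicator {t..t+k} r * zt (x, r) \<partial>lborel) \<in> borel_measurable M"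
        proof -
          have "(\<lambda>(x, r). indicator {t..t+k} r * zt (x, r)) \<in> borel_measurable (M \<Otimes>\<^sub>M lborel)" by measurable
          from lborel.borel_measurable_lebesgue_integral[OF this] show ?thesis .
        qed
        have [measurable]: "(\<lambda>x. L (x, t)) \<in> borel_measurable M" "(\<lambda>x. z (x, t')) \<in> borel_measurable M" "val t' \<in> borel_measurable M" for t'
          by (simp_all add: M_def)
        have gt: "g t" "AE x in M. z (x, t) = val t x" using elim t by auto
        show "2 * (\<integral>x. L (x, t) * (\<integral>r. indicator {t..t+k} r * zt (x, r) \<partial>lborel) \<partial>M) \<le> \<beta> (t + k) - \<beta> t"
        proof (cases "t + k < T")
          case True
          then have tk: "t + k \<in> {0<..<T}" using t k by auto
          then have gtk: "g (t + k)" "AE x in M. z (x, t + k) = val (t + k) x" using elim by auto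
          have "(\<integral>x. L (x, t) * (\<integral>r. indicator {t..t+k} r * zt (x, r) \<partial>lborel) \<partial>M) = (\<integral>x. L (x, t) * (z (x, t + k) - z (x, t)) \<partial>M)"
          proof (rule integral_cong_AE)
            show "AE x in M. L (x, t) * (\<integral>r. indicator {t..t+k} r * zt (x, r) \<partial>lborel) = L (x, t) * (z (x, t + k) - z (x, t))"
              using gt(2) gtk(2) val_diff
            proof eventually_elim
              case (elim x)
              then have "val (t + k) x - val t x = (\<integral>r. indicator {t..t+k} r * zt (x, r) \<partial>lborel)" using k by simp
              then show ?case using elim(1,2) by simp
            qed
          qed measurable
          then show ?thesis using cvx[OF gt(1) gtk(1) t tk] t tk by (simp add: \<beta>_def)
        next
          case False
          have "(\<integral>x. L (x, t) * (\<integral>r. indicator {t..t+k} r * zt (x, r) \<partial>lborel) \<partial>M) = (\<integral>x. L (x, t) * (val T x - z (x, t)) \<partial>M)"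
          proof (rule integral_cong_AE)
            show "AE x in M. L (x, t) * (\<integral>r. indicator {t..t+k} r * zt (x, r) \<partial>lborel) = L (x, t) * (val T x - z (x, t))"
              using gt(2) val_diff
            proof eventually_elim
              case (elim x)
              then have "val (t + k) x - val t x = (\<integral>r. indicator {t..t+k} r * zt (x, r) \<partial>lborel)" using k by simp
              moreover have "val (t + k) x = val T x" using tail_T[of "t + k" x] tail_T[of T x] False by (simp add: val_def)
              ultimately show ?case using elim(1) by simp
            qed
          qed measurable
          then show ?thesis using cvxT[OF gt(1) t] t False by (simp add: \<beta>_def)
        qed
      qed
    qed
  qed
  then show ?thesis unfolding \<beta>_eq' form_def N_def by (simp add: mult.assoc)
qed

text \<open>The mirror image of \<open>energy_final\<close>: steps go to the left, and before time 0
  the functional is continued by the constant \<open>b0\<close>.\<close>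

lemma energy_initial:
  assumes L: "L2T L" and b [measurable]: "b \<in> borel_measurable borel" and b_nonneg: "\<And>t. b t \<ge> 0"
    and b_int: "integrable lborel (\<lambda>t. indicator {0<..<T} t * b t)" and b0: "b0 \<ge> 0"
    and g: "AE t in lborel. t \<in> {0<..<T} \<longrightarrow> g t"
    and cvx: "\<And>t t'. g t \<Longrightarrow> g t' \<Longrightarrow> t \<in> {0<..<T} \<Longrightarrow> t' \<in> {0<..<T} \<Longrightarrow>
      2 * (\<integral>x. L (x, t) * (z (x, t') - z (x, t)) \<partial>M) \<le> b t' - b t"
    and cvx0: "\<And>t. g t \<Longrightarrow> t \<in> {0<..<T} \<Longrightarrow> 2 * (\<integral>x. L (x, t) * (val 0 x - z (x, t)) \<partial>M) \<le> b0 - b t"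
    and w: "is_weight \<eta> \<eta>'"
  shows "- 2 * form \<eta> L zt - (\<integral>t. indicator {0<..<T} t * (\<eta>' t * b t) \<partial>lborel) \<le> \<eta> 0 * b0"
proof -
  define \<beta> where "\<beta> t = (if t \<le> 0 then b0 else b t)" for t
  have [measurable]: "L \<in> borel_measurable borel" using L by (simp add: L2T_def borel_measurable_N)
  have L_m: "L \<in> borel_measurable (M \<Otimes>\<^sub>M lborel)" using L by (simp add: L2T_def N_def)
  have \<beta>_eq: "indicator {0<..<T} t * \<beta> t = indicator {0<..<T} t * b t" for t by (auto simp: \<beta>_def)
  have \<beta>_eq': "indicator {0<..<T} t * (\<eta>' t * \<beta> t) = indicator {0<..<T} t * (\<eta>' t * b t)" for t by (auto simp: \<beta>_def)
  have "- 2 * (\<integral>w. \<eta> (snd w) * L w * zt w \<partial>(M \<Otimes>\<^sub>M lborel)) - (\<integral>t. indicator {0<..<T} t * (\<eta>' t * \<beta> t) \<partial>lborel) \<le> \<eta> 0 * b0"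
  proof (rule energy_backward[OF sigma_finite_M T z_borel_M(2) L_m])
    show "integrable (M \<Otimes>\<^sub>M lborel) (\<lambda>z. (zt z)\<^sup>2)" "integrable (M \<Otimes>\<^sub>M lborel) (\<lambda>z. (L z)\<^sup>2)"
      using zt L by (simp_all add: L2T_def N_def)
    show "L (x, t) = 0" if "t \<notin> {0<..<T}" for x t using L that by (simp add: L2T_def)
    show "\<beta> \<in> borel_measurable borel" unfolding \<beta>_def by measurable
    show "\<beta> t \<ge> 0" for t using b_nonneg b0 by (simp add: \<beta>_def)
    show "integrable lborel (\<lambda>t. indicator {0<..<T} t * \<beta> t)" unfolding \<beta>_eq by (rule b_int)
    show "\<beta> t = b0" if "t \<le> 0" for t using that by (simp add: \<beta>_def)
    show "(\<eta> has_real_derivative \<eta>' t) (at t)" "continuous_on UNIV \<eta>'" "\<eta> t \<ge> 0" for t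
      using w by (auto simp: is_weight_def)
    fix k :: real assume k: "k > 0"
    have "AE t in lborel. t \<in> {0<..<T} \<longrightarrow> (g t \<and> (AE x in M. z (x, t) = val t x))"
      using g c_rep by eventually_elim (auto simp: val_def)
    note this AE_lborel_shift[OF this, of "- k"]
    then show "AE t in lborel. t \<in> {0<..<T} \<longrightarrow>
      - 2 * (\<integral>x. L (x, t) * (\<integral>r. indicator {t-k..t} r * zt (x, r) \<partial>lborel) \<partial>M) \<le> \<beta> (t - k) - \<beta> t"
    proof eventually_elim
      case (elim t)
      show ?case
      proof
        assume t: "t \<in> {0<..<T}"
        have [measurable]: "(\<lambda>x. \<integral>r. indicator {t-k..t} r * zt (x, r) \<partial>lborel) \<in> borel_measurable M"
        proof -
          have "(\<lambda>(x, r). indicator {t-k..t} r * zt (x, r)) \<in> borel_measurable (M \<Otimes>\<^sub>M lborel)" by measurable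
          from lborel.borel_measurable_lebesgue_integral[OF this] show ?thesis .
        qed
        have [measurable]: "(\<lambda>x. L (x, t)) \<in> borel_measurable M" "(\<lambda>x. z (x, t')) \<in> borel_measurable M" "val t' \<in> borel_measurable M" for t'
          by (simp_all add: M_def)
        have gt: "g t" "AE x in M. z (x, t) = val t x" using elim t by auto
        have neg: "- 2 * (\<integral>x. L (x, t) * (\<integral>r. indicator {t-k..t} r * zt (x, r) \<partial>lborel) \<partial>M)
          = 2 * (\<integral>x. L (x, t) * (- (\<integral>r. indicator {t-k..t} r * zt (x, r) \<partial>lborel)) \<partial>M)" by simp
        show "- 2 * (\<integral>x. L (x, t) * (\<integral>r. indicator {t-k..t} r * zt (x, r) \<partial>lborel) \<partial>M) \<le> \<beta> (t - k) - \<beta> t"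
        proof (cases "0 < t - k")
          case True
          then have tk: "t - k \<in> {0<..<T}" using t k by auto
          then have gtk: "g (t - k)" "AE x in M. z (x, t - k) = val (t - k) x" using elim by auto
          have "(\<integral>x. L (x, t) * (- (\<integral>r. indicator {t-k..t} r * zt (x, r) \<partial>lborel)) \<partial>M) = (\<integral>x. L (x, t) * (z (x, t - k) - z (x, t)) \<partial>M)"
          proof (rule integral_cong_AE)
            show "AE x in M. L (x, t) * (- (\<integral>r. indicator {t-k..t} r * zt (x, r) \<partial>lborel)) = L (x, t) * (z (x, t - k) - z (x, t))"
              using gt(2) gtk(2) val_diff
            proof eventually_elim
              case (elim x)
              then have I: "(\<integral>r. indicator {t-k..t} r * zt (x, r) \<partial>lborel) = val t x - val (t - k) x" using k by simp
              show ?case unfolding I elim(1,2) by (simp add: algebra_simps)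
            qed
          qed measurable
          then show ?thesis unfolding neg using cvx[OF gt(1) gtk(1) t tk] t tk by (simp add: \<beta>_def)
        next
          case False
          have "(\<integral>x. L (x, t) * (- (\<integral>r. indicator {t-k..t} r * zt (x, r) \<partial>lborel)) \<partial>M) = (\<integral>x. L (x, t) * (val 0 x - z (x, t)) \<partial>M)"
          proof (rule integral_cong_AE)
            show "AE x in M. L (x, t) * (- (\<integral>r. indicator {t-k..t} r * zt (x, r) \<partial>lborel)) = L (x, t) * (val 0 x - z (x, t))"
              using gt(2) val_diff
            proof eventually_elim
              case (elim x)
              then have I: "(\<integral>r. indicator {t-k..t} r * zt (x, r) \<partial>lborel) = val t x - val (t - k) x" using k by simp
              have v0: "val (t - k) x = val 0 x" using tail_0[of "t - k" x] False by (simp add: val_def)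
              show ?case unfolding I v0 elim(1) by (simp add: algebra_simps)
            qed
          qed measurable
          then show ?thesis unfolding neg using cvx0[OF gt(1) t] t False by (simp add: \<beta>_def)
        qed
      qed
    qed
  qed
  then show ?thesis unfolding \<beta>_eq' form_def N_def by (simp add: mult.assoc)
qed

text \<open>
  The value at \<open>\<tau>\<close> of the representative that is continuous in time agrees with the pointwise
  primitive: both are limits along times at which they coincide with the slice of \<open>z\<close>.
\<close>

lemma val_eq_time_value:
  assumes \<tau>: "\<tau> \<in> {0..T}"
    and Um: "\<And>t. t \<in> {0..T} \<Longrightarrow> U t \<in> borel_measurable (lebesgue_on Omega)"
    and lim: "((\<lambda>t. nsq_inv a (\<lambda>x. U t x - U \<tau> x)) \<longlongrightarrow> 0) (at \<tau> within {0..T})"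
    and eq: "AE t in lborel. t \<in> {0<..<T} \<longrightarrow> (AE x in M. U t x = z (x, t))"
  shows "AE x in M. U \<tau> x = val \<tau> x"
proof -
  have am: "a \<in> borel_measurable (lebesgue_on Omega)"
    by (rule continuous_imp_measurable_on_sets_lebesgue) (auto intro: continuous_on_subset[OF a_cont])
  have good: "AE t in lborel. t \<in> {0<..<T} \<longrightarrow> (AE x in M. U t x = val t x)"
    using eq c_rep
  proof eventually_elim
    case (elim t)
    show ?case
    proof
      assume "t \<in> {0<..<T}"
      with elim have "AE x in M. U t x = z (x, t)" "AE x in M. z (x, t) = c x - tail x t" by auto
      then show "AE x in M. U t x = val t x" by eventually_elim (simp add: val_def)
    qed
  qed
  \<comment> \<open>Times at which U agrees with \<open>val\<close> have full measure and hence meet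
    every neighbourhood of \<open>\<tau>\<close>, also at an end point. The time
    \<open>\<tau>\<close> itself is avoided because the limit \<open>lim\<close> excludes
    it.\<close>
  have "\<exists>t. t \<in> {0<..<T} \<and> \<bar>t - \<tau>\<bar> < 1 / real (Suc n) \<and> t \<noteq> \<tau> \<and> (AE x in M. U t x = val t x)" for n
  proof (rule ccontr)
    assume neg: "\<not> ?thesis"
    let ?I = "{0<..<T} \<inter> {\<tau> - 1 / real (Suc n)<..<\<tau> + 1 / real (Suc n)}"
    have pos: "1 / real (Suc n) > 0" by simp
    have "AE t in lborel. t \<notin> ?I"
      using good AE_lborel_singleton[of \<tau>]
    proof eventually_elim
      case (elim t)
      show ?case
      proof
        assume "t \<in> ?I"
        then have "t \<in> {0<..<T}" "\<bar>t - \<tau>\<bar> < 1 / real (Suc n)" by (auto simp: abs_less_iff)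
        with neg elim show False by blast
      qed
    qed
    then have "AE t in lebesgue. t \<notin> ?I" by (rule AE_completion)
    then obtain Z where Z: "Z \<in> null_sets lebesgue" "{t \<in> space lebesgue. \<not> t \<notin> ?I} \<subseteq> Z"
      unfolding eventually_ae_filter by blast
    have "?I \<subseteq> Z" using Z(2) by auto
    with Z(1) have "negligible ?I"
      using negligible_subset negligible_iff_null_sets by blast
    moreover have "open ?I" "?I \<noteq> {}"
    proof -
      have "0 \<le> \<tau>" "\<tau> \<le> T" using \<tau> by auto
      then have "0 < \<tau> + 1 / real (Suc n)" "\<tau> - 1 / real (Suc n) < T" using pos by linarith+
      then have "max 0 (\<tau> - 1 / real (Suc n)) < min T (\<tau> + 1 / real (Suc n))"
        using T pos unfolding max_less_iff_conj min_less_iff_conj by (auto simp del: of_nat_Suc)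
      then obtain t where "max 0 (\<tau> - 1 / real (Suc n)) < t" "t < min T (\<tau> + 1 / real (Suc n))" using dense by blast
      then show "?I \<noteq> {}" by auto
    qed auto
    ultimately show False using open_not_negligible by blast
  qed
  then obtain X where X: "\<And>n. X n \<in> {0<..<T}" "\<And>n. \<bar>X n - \<tau>\<bar> < 1 / real (Suc n)" "\<And>n. X n \<noteq> \<tau>"
    "\<And>n. AE x in M. U (X n) x = val (X n) x" by metis
  have Xlim: "X \<longlonglongrightarrow> \<tau>"
  proof (rule LIM_zero_cancel, rule Lim_null_comparison)
    show "\<forall>\<^sub>F n in sequentially. norm (X n - \<tau>) \<le> 1 / real (Suc n)" using X(2) by (simp add: less_imp_le)
    show "(\<lambda>n. 1 / real (Suc n)) \<longlonglongrightarrow> 0" using LIMSEQ_inverse_real_of_nat by (simp add: inverse_eq_divide)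
  qed
  have "X n \<in> {0..T}" for n using X(1)[of n] by auto
  then have "filterlim X (at \<tau> within {0..T}) sequentially"
    using Xlim X(3) by (auto simp: filterlim_at)
  with lim have nlim: "(\<lambda>n. nsq_inv a (\<lambda>x. U (X n) x - U \<tau> x)) \<longlonglongrightarrow> 0" by (rule filterlim_compose)
  have ae: "AE x in M. (\<lambda>n. U (X n) x) \<longlonglongrightarrow> val \<tau> x"
  proof -
    have "AE x in M. \<forall>n. U (X n) x = val (X n) x" using X(4) by (simp add: AE_all_countable)
    then show ?thesis using zt_slice
    proof eventually_elim
      case (elim x)
      have "(\<lambda>n. c x - tail x (X n)) \<longlonglongrightarrow> c x - tail x \<tau>"
        by (intro tendsto_intros tail_continuous[OF elim(2) Xlim])
      then show ?case using elim(1) by (simp add: val_def)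
    qed
  qed
  have AE_conv: "(AE x in M. P x) \<longleftrightarrow> (AE x in lebesgue_on Omega. P x)" for P
    by (simp only: AE_M_iff AE_lebesgue_on_iff[OF Omega_lebesgue(1)])
  have vm: "val \<tau> \<in> borel_measurable (lebesgue_on Omega)"
    by (intro measurable_restrict_space1 measurable_completion) simp
  \<comment> \<open>Fatou's lemma: along the chosen times U tends to \<open>val\<close> pointwise
    almost everywhere and to \<open>U \<tau>\<close> in the weighted norm.\<close>
  have "(\<integral>\<^sup>+x. ennreal ((val \<tau> x - U \<tau> x)\<^sup>2 / a x) \<partial>lebesgue_on Omega)
     = (\<integral>\<^sup>+x. liminf (\<lambda>n. ennreal ((U (X n) x - U \<tau> x)\<^sup>2 / a x)) \<partial>lebesgue_on Omega)"
  proof (rule nn_integral_cong_AE)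
    show "AE x in lebesgue_on Omega. ennreal ((val \<tau> x - U \<tau> x)\<^sup>2 / a x) = liminf (\<lambda>n. ennreal ((U (X n) x - U \<tau> x)\<^sup>2 / a x))"
      using ae[unfolded AE_conv]
    proof eventually_elim
      case (elim x)
      have "(\<lambda>n. ennreal ((U (X n) x - U \<tau> x)\<^sup>2 / a x)) \<longlonglongrightarrow> ennreal ((val \<tau> x - U \<tau> x)\<^sup>2 / a x)"
        unfolding divide_inverse by (intro tendsto_ennrealI tendsto_intros elim)
      then show ?case by (simp add: lim_imp_Liminf)
    qed
  qed
  also have "\<dots> \<le> liminf (\<lambda>n. \<integral>\<^sup>+x. ennreal ((U (X n) x - U \<tau> x)\<^sup>2 / a x) \<partial>lebesgue_on Omega)"
  proof (rule nn_integral_liminf)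
    have "U (X n) \<in> borel_measurable (lebesgue_on Omega)" for n using X(1)[of n] by (intro Um) auto
    then show "(\<lambda>x. ennreal ((U (X n) x - U \<tau> x)\<^sup>2 / a x)) \<in> borel_measurable (lebesgue_on Omega)" for n
      using Um[OF \<tau>] am by measurable
  qed
  also have "\<dots> = 0" using nlim by (simp add: lim_imp_Liminf nsq_inv_def)
  finally have "(\<integral>\<^sup>+x. ennreal ((val \<tau> x - U \<tau> x)\<^sup>2 / a x) \<partial>lebesgue_on Omega) = 0" by simp
  then have "AE x in lebesgue_on Omega. ennreal ((val \<tau> x - U \<tau> x)\<^sup>2 / a x) = 0"
    using vm Um[OF \<tau>] am by (subst (asm) nn_integral_0_iff_AE) auto
  moreover have "AE x in lebesgue_on Omega. x \<in> Omega" by (rule AE_I2) simp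
  ultimately have "AE x in lebesgue_on Omega. U \<tau> x = val \<tau> x"
  proof eventually_elim
    case (elim x)
    have "0 \<le> (val \<tau> x - U \<tau> x)\<^sup>2 / a x" "(val \<tau> x - U \<tau> x)\<^sup>2 / a x \<le> 0"
      using elim a_pos[of x] by (auto simp: ennreal_eq_0_iff)
    then show ?case using elim(2) a_pos[of x] by (simp add: divide_le_0_iff)
  qed
  then show ?thesis by (simp only: AE_conv)
qed

end

section \<open>Energy inequalities for functions with two spatial derivatives\<close>

locale regular_slab = slab +
  fixes zx zxx :: "real \<times> real \<Rightarrow> real"
  assumes zx_borel [measurable]: "zx \<in> borel_measurable borel" and zxx_borel [measurable]: "zxx \<in> borel_measurable borel"
    and zx_0: "\<And>w. w \<notin> Q T \<Longrightarrow> zx w = 0" and zxx_0: "\<And>w. w \<notin> Q T \<Longrightarrow> zxx w = 0"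
    and zx_fin: "(\<integral>\<^sup>+w. ennreal ((zx w)\<^sup>2) \<partial>lborel) < \<infinity>"
    and zxx_fin: "(\<integral>\<^sup>+w. ennreal (ab (fst w) * (zxx w)\<^sup>2) \<partial>lborel) < \<infinity>"
    and space: "AE t in lborel. t \<in> {0<..<T} \<longrightarrow> has_weak_deriv Omega (\<lambda>x. z (x, t)) (\<lambda>x. zx (x, t)) \<and>
      has_weak_deriv Omega (\<lambda>x. zx (x, t)) (\<lambda>x. zxx (x, t)) \<and> vanishes_at_ends (\<lambda>x. z (x, t))"
begin

text \<open>The factors a and sqrt(a) are chosen for the measure dx/a: the squared norms of p and q
  become the integrals of a z_xx^2 and z_x^2.\<close>

definition "p w = ab (fst w) * zxx w"
definition "q w = sqrt (ab (fst w)) * zx w"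

lemma p_borel [measurable]: "p \<in> borel_measurable borel" and q_borel [measurable]: "q \<in> borel_measurable borel"
  unfolding p_def[abs_def] q_def[abs_def] by measurable

lemma wt_ab: "x \<in> Omega \<Longrightarrow> wt x * ab x = 1"
  using wt_pos(4)[of x] ab_simps(1)[of x] a_pos[of x] by simp

lemma p: "L2T p"
proof (rule L2T_I)
  show "p w = 0" if "w \<notin> Q T" for w using zxx_0[OF that] by (simp add: p_def)
  have "wt (fst w) * (p w)\<^sup>2 = ab (fst w) * (zxx w)\<^sup>2" for w
    using wt_ab[of "fst w"] zxx_0[of w] by (cases "w \<in> Q T") (auto simp: p_def power2_eq_square)
  then show "(\<integral>\<^sup>+w. ennreal (wt (fst w) * (p w)\<^sup>2) \<partial>lborel) < \<infinity>" using zxx_fin by simp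
qed measurable

lemma q: "L2T q"
proof (rule L2T_I)
  show "q w = 0" if "w \<notin> Q T" for w using zx_0[OF that] by (simp add: q_def)
  have "wt (fst w) * (q w)\<^sup>2 = (zx w)\<^sup>2" for w
    using wt_ab[of "fst w"] zx_0[of w] ab_simps(3)[of "fst w"]
    by (cases "w \<in> Q T") (auto simp: q_def power_mult_distrib)
  then show "(\<integral>\<^sup>+w. ennreal (wt (fst w) * (q w)\<^sup>2) \<partial>lborel) < \<infinity>" using zx_fin by simp
qed measurable

text \<open>The times at which Green's identity and both convexity inequalities hold for the slice
  of z; almost every time is of this kind.\<close>

definition good :: "real \<Rightarrow> bool" where
  "good t \<longleftrightarrow> integrable M (\<lambda>x. (z (x, t))\<^sup>2) \<and> integrable M (\<lambda>x. (p (x, t))\<^sup>2) \<and>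
    H10 (\<lambda>x. z (x, t)) (\<lambda>x. zx (x, t)) \<and> has_weak_deriv Omega (\<lambda>x. zx (x, t)) (\<lambda>x. zxx (x, t))"

lemma set_integrable_Omega_cong:
  assumes "\<And>x. x \<in> Omega \<Longrightarrow> f x = g x"
  shows "set_integrable lebesgue Omega f \<longleftrightarrow> set_integrable lebesgue Omega g"
    and "(LINT x:Omega|lebesgue. f x) = (LINT x:Omega|lebesgue. (g x :: real))"
proof -
  have eq: "indicator Omega x *\<^sub>R f x = indicator Omega x *\<^sub>R g x" for x
    using assms by (cases "x \<in> Omega") auto
  show "set_integrable lebesgue Omega f \<longleftrightarrow> set_integrable lebesgue Omega g" "(LINT x:Omega|lebesgue. f x) = (LINT x:Omega|lebesgue. (g x :: real))"
    unfolding set_integrable_def set_lebesgue_integral_def eq by auto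
qed

lemma sq_q: "integrable M (\<lambda>x. (q (x, t))\<^sup>2) \<longleftrightarrow> set_integrable lebesgue Omega (\<lambda>x. (zx (x, t))\<^sup>2)"
  "(\<integral>x. (q (x, t))\<^sup>2 \<partial>M) = (LINT x:Omega|lebesgue. (zx (x, t))\<^sup>2)"
proof -
  have eq: "(q (x, t))\<^sup>2 / a x = (zx (x, t))\<^sup>2" if "x \<in> Omega" for x
    using a_pos[OF that] ab_simps(1)[OF that] by (simp add: q_def power_mult_distrib)
  have m: "(\<lambda>x. (q (x, t))\<^sup>2) \<in> borel_measurable borel" by measurable
  show "integrable M (\<lambda>x. (q (x, t))\<^sup>2) \<longleftrightarrow> set_integrable lebesgue Omega (\<lambda>x. (zx (x, t))\<^sup>2)"
    unfolding integral_M(2)[OF m] by (rule set_integrable_Omega_cong(1)[OF eq])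
  show "(\<integral>x. (q (x, t))\<^sup>2 \<partial>M) = (LINT x:Omega|lebesgue. (zx (x, t))\<^sup>2)"
    unfolding integral_M(1)[OF m] by (rule set_integrable_Omega_cong(2)[OF eq])
qed

lemma sq_p: "integrable M (\<lambda>x. (p (x, t))\<^sup>2) \<longleftrightarrow> set_integrable lebesgue Omega (\<lambda>x. a x * (zxx (x, t))\<^sup>2)"
proof -
  have eq: "(p (x, t))\<^sup>2 / a x = a x * (zxx (x, t))\<^sup>2" if "x \<in> Omega" for x
    using a_pos[OF that] ab_simps(1)[OF that] by (simp add: p_def power2_eq_square)
  have m: "(\<lambda>x. (p (x, t))\<^sup>2) \<in> borel_measurable borel" by measurable
  show ?thesis unfolding integral_M(2)[OF m] by (rule set_integrable_Omega_cong(1)[OF eq])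
qed

lemma AE_good: "AE t in lborel. t \<in> {0<..<T} \<longrightarrow> good t"
  using space L2T_slice(1)[OF z] L2T_slice(1)[OF p] L2T_slice(1)[OF q]
proof eventually_elim
  case (elim t)
  then show ?case using H10I[of "\<lambda>x. z (x, t)" "\<lambda>x. zx (x, t)"] by (auto simp: good_def sq_q)
qed

lemma good_convex:
  assumes g: "good t" and v: "H10 v vx" and [measurable]: "v \<in> borel_measurable borel" and v2: "integrable M (\<lambda>x. (v x)\<^sup>2)"
  shows "2 * (\<integral>x. - p (x, t) * (v x - z (x, t)) \<partial>M) \<le> (LINT x:Omega|lebesgue. (vx x)\<^sup>2) - (\<integral>x. (q (x, t))\<^sup>2 \<partial>M)"
proof -
  have [measurable]: "v \<in> borel_measurable M" "(\<lambda>x. z (x, t)) \<in> borel_measurable M" by (simp_all add: M_def)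
  have "integrable M (\<lambda>x. (v x - z (x, t))\<^sup>2)"
    using v2 g by (intro integrable_add_sq) (auto simp: good_def)
  then have vz: "set_integrable lebesgue Omega (\<lambda>x. (v x - z (x, t))\<^sup>2 / a x)"
    by (subst (asm) integral_M(2)) measurable
  have m: "(\<lambda>x. - p (x, t) * (v x - z (x, t))) \<in> borel_measurable borel" by measurable
  have "(\<integral>x. - p (x, t) * (v x - z (x, t)) \<partial>M) = (LINT x:Omega|lebesgue. (v x - z (x, t)) * (- zxx (x, t)))"
    unfolding integral_M(1)[OF m]
  proof (rule set_integrable_Omega_cong(2))
    fix x assume x: "x \<in> Omega"
    then show "- p (x, t) * (v x - z (x, t)) / a x = (v x - z (x, t)) * - zxx (x, t)"
      using a_pos[OF x] ab_simps(1)[OF x] by (simp add: p_def)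
  qed
  then show ?thesis unfolding sq_q(2)
    using H10_convexity[OF a_pos v _ _ vz, of "\<lambda>x. zx (x, t)" "\<lambda>x. zxx (x, t)"] g by (auto simp: good_def sq_p)
qed

lemma good_green:
  assumes g: "good t"
  shows "(\<integral>x. z (x, t) * p (x, t) \<partial>M) = - (\<integral>x. (q (x, t))\<^sup>2 \<partial>M)"
proof -
  have m: "(\<lambda>x. z (x, t) * p (x, t)) \<in> borel_measurable borel" by measurable
  have "(\<integral>x. z (x, t) * p (x, t) \<partial>M) = (LINT x:Omega|lebesgue. z (x, t) * zxx (x, t))"
    unfolding integral_M(1)[OF m]
  proof (rule set_integrable_Omega_cong(2))
    fix x assume x: "x \<in> Omega"
    then show "z (x, t) * p (x, t) / a x = z (x, t) * zxx (x, t)"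
      using a_pos[OF x] ab_simps(1)[OF x] by (simp add: p_def)
  qed
  moreover have "set_integrable lebesgue Omega (\<lambda>x. (z (x, t))\<^sup>2 / a x)"
    using g by (subst integral_M(2)[symmetric]) (auto simp: good_def)
  then have "(LINT x:Omega|lebesgue. zx (x, t) * zx (x, t)) = - (LINT x:Omega|lebesgue. z (x, t) * zxx (x, t))"
    by (rule H10_green(2)[of a, rotated 3]) (use g a_pos in \<open>auto simp: good_def sq_p H10_def\<close>)
  ultimately show ?thesis unfolding sq_q(2) by (simp add: power2_eq_square)
qed

lemma form_slices:
  assumes g: "L2T g" and h: "L2T h" and \<eta>: "continuous_on UNIV \<eta>"
  shows "form \<eta> g h = (\<integral>t. indicator {0<..<T} t * (\<eta> t * (\<integral>x. g (x, t) * h (x, t) \<partial>M)) \<partial>lborel)"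
proof -
  interpret sigma_finite_measure M by (rule sigma_finite_M)
  interpret P: pair_sigma_finite M "lborel :: real measure" ..
  have "integrable (M \<Otimes>\<^sub>M lborel) (\<lambda>(x, t). \<eta> t * (g (x, t) * h (x, t)))"
    using L2T_integrable[OF g h \<eta>] by (simp add: N_def split_beta')
  from P.integral_snd[OF this]
  have "form \<eta> g h = (\<integral>t. (\<integral>x. \<eta> t * (g (x, t) * h (x, t)) \<partial>M) \<partial>lborel)"
    by (simp add: form_def N_def split_beta')
  also have "\<dots> = (\<integral>t. indicator {0<..<T} t * (\<eta> t * (\<integral>x. g (x, t) * h (x, t) \<partial>M)) \<partial>lborel)"
  proof (rule Bochner_Integration.integral_cong[OF refl])
    fix t show "(\<integral>x. \<eta> t * (g (x, t) * h (x, t)) \<partial>M) = indicator {0<..<T} t * (\<eta> t * (\<integral>x. g (x, t) * h (x, t) \<partial>M))"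
      using g by (cases "t \<in> {0<..<T}") (auto simp: L2T_def)
  qed
  finally show ?thesis .
qed

lemma green:
  assumes "continuous_on UNIV \<eta>"
  shows "form \<eta> z p = - form \<eta> q q"
proof -
  have "(\<integral>t. indicator {0<..<T} t * (\<eta> t * (\<integral>x. z (x, t) * p (x, t) \<partial>M)) \<partial>lborel)
      = (\<integral>t. - (indicator {0<..<T} t * (\<eta> t * (\<integral>x. q (x, t) * q (x, t) \<partial>M))) \<partial>lborel)"
  proof (rule integral_cong_AE)
    show "AE t in lborel. indicator {0<..<T} t * (\<eta> t * (\<integral>x. z (x, t) * p (x, t) \<partial>M))
        = - (indicator {0<..<T} t * (\<eta> t * (\<integral>x. q (x, t) * q (x, t) \<partial>M)))"
      using AE_good
    proof eventually_elim
      case (elim t)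
      then show ?case using good_green[of t] by (cases "t \<in> {0<..<T}") (auto simp: power2_eq_square)
    qed
    have [measurable]: "\<eta> \<in> borel_measurable borel" using assms by (rule borel_measurable_continuous_onI)
    interpret sigma_finite_measure M by (rule sigma_finite_M)
    have [measurable]: "(\<lambda>t. \<integral>x. g (x, t) * h (x, t) \<partial>M) \<in> borel_measurable borel" if "L2T g" "L2T h" for g h
    proof -
      have [measurable]: "g \<in> borel_measurable (M \<Otimes>\<^sub>M borel)" "h \<in> borel_measurable (M \<Otimes>\<^sub>M borel)"
        using that by (auto simp: L2T_def N_def cong: measurable_cong_sets)
      have "(\<lambda>(t, x). g (x, t) * h (x, t)) \<in> borel_measurable (borel \<Otimes>\<^sub>M M)" by measurable
      from borel_measurable_lebesgue_integral[OF this] show ?thesis .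
    qed
    show "(\<lambda>t. indicator {0<..<T} t * (\<eta> t * (\<integral>x. z (x, t) * p (x, t) \<partial>M))) \<in> borel_measurable lborel"
      "(\<lambda>t. - (indicator {0<..<T} t * (\<eta> t * (\<integral>x. q (x, t) * q (x, t) \<partial>M)))) \<in> borel_measurable lborel"
      using z p q by measurable
  qed
  then show ?thesis by (simp add: form_slices[OF z p assms] form_slices[OF q q assms])
qed

lemma sq_slice:
  assumes "L2T g"
  shows "(\<lambda>t. \<integral>x. (g (x, t))\<^sup>2 \<partial>M) \<in> borel_measurable borel"
    and "integrable lborel (\<lambda>t. indicator {0<..<T} t * (\<integral>x. (g (x, t))\<^sup>2 \<partial>M))"
proof -
  interpret sigma_finite_measure M by (rule sigma_finite_M)
  interpret P: pair_sigma_finite M "lborel :: real measure" ..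
  have "integrable (M \<Otimes>\<^sub>M lborel) (\<lambda>(x, t). (g (x, t))\<^sup>2)"
    using assms by (simp add: L2T_def N_def split_beta')
  from P.integrable_snd[OF this] have i: "integrable lborel (\<lambda>t. \<integral>x. (g (x, t))\<^sup>2 \<partial>M)" .
  then show "(\<lambda>t. \<integral>x. (g (x, t))\<^sup>2 \<partial>M) \<in> borel_measurable borel" by auto
  show "integrable lborel (\<lambda>t. indicator {0<..<T} t * (\<integral>x. (g (x, t))\<^sup>2 \<partial>M))"
    using integrable_mult_indicator[OF _ i, of "{0<..<T}"] by simp
qed

lemma form_sq:
  assumes "L2T g" "is_weight \<eta> \<eta>'"
  shows "form \<eta>' g g = (\<integral>t. indicator {0<..<T} t * (\<eta>' t * (\<integral>x. (g (x, t))\<^sup>2 \<partial>M)) \<partial>lborel)"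
  using form_slices[OF assms(1,1), of \<eta>'] assms(2) by (simp add: is_weight_def power2_eq_square)

lemma sq_convex:
  fixes u v :: "real \<Rightarrow> real"
  assumes u: "integrable M (\<lambda>x. (u x)\<^sup>2)" and v: "integrable M (\<lambda>x. (v x)\<^sup>2)"
    and [measurable]: "u \<in> borel_measurable borel" "v \<in> borel_measurable borel"
  shows "2 * (\<integral>x. u x * (v x - u x) \<partial>M) \<le> (\<integral>x. (v x)\<^sup>2 \<partial>M) - (\<integral>x. (u x)\<^sup>2 \<partial>M)"
proof -
  have [measurable]: "u \<in> borel_measurable M" "v \<in> borel_measurable M" by (simp_all add: M_def)
  have i: "integrable M (\<lambda>x. u x * v x)" using integrable_mult_L2[of u M v] u v by simp
  have "2 * (\<integral>x. u x * (v x - u x) \<partial>M) = (\<integral>x. 2 * (u x * v x - (u x)\<^sup>2) \<partial>M)"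
    unfolding integral_mult_right_zero by (simp add: right_diff_distrib power2_eq_square)
  also have "\<dots> \<le> (\<integral>x. (v x)\<^sup>2 - (u x)\<^sup>2 \<partial>M)"
  proof (rule integral_mono)
    fix x show "2 * (u x * v x - (u x)\<^sup>2) \<le> (v x)\<^sup>2 - (u x)\<^sup>2"
      using zero_le_power2[of "v x - u x"] by (simp add: power2_diff algebra_simps)
  qed (use i u v in auto)
  finally show ?thesis using u v by simp
qed

lemma final_sq:
  assumes "integrable M (\<lambda>x. (val T x)\<^sup>2)" "is_weight \<eta> \<eta>'"
  shows "2 * form \<eta> z zt + form \<eta>' z z \<le> \<eta> T * (\<integral>x. (val T x)\<^sup>2 \<partial>M)"
  unfolding form_sq[OF z assms(2)]
proof (rule energy_final[OF z sq_slice(1)[OF z] _ sq_slice(2)[OF z] _ AE_good _ _ assms(2)])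
  show "2 * (\<integral>x. z (x, t) * (z (x, t') - z (x, t)) \<partial>M) \<le> (\<integral>x. (z (x, t'))\<^sup>2 \<partial>M) - (\<integral>x. (z (x, t))\<^sup>2 \<partial>M)"
    if "good t" "good t'" for t t' by (rule sq_convex) (use that in \<open>auto simp: good_def\<close>)
  show "2 * (\<integral>x. z (x, t) * (val T x - z (x, t)) \<partial>M) \<le> (\<integral>x. (val T x)\<^sup>2 \<partial>M) - (\<integral>x. (z (x, t))\<^sup>2 \<partial>M)"
    if "good t" for t by (rule sq_convex) (use that assms(1) in \<open>auto simp: good_def\<close>)
qed auto

lemma initial_sq:
  assumes "integrable M (\<lambda>x. (val 0 x)\<^sup>2)" "is_weight \<eta> \<eta>'"
  shows "- 2 * form \<eta> z zt - form \<eta>' z z \<le> \<eta> 0 * (\<integral>x. (val 0 x)\<^sup>2 \<partial>M)"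
  unfolding form_sq[OF z assms(2)]
proof (rule energy_initial[OF z sq_slice(1)[OF z] _ sq_slice(2)[OF z] _ AE_good _ _ assms(2)])
  show "2 * (\<integral>x. z (x, t) * (z (x, t') - z (x, t)) \<partial>M) \<le> (\<integral>x. (z (x, t'))\<^sup>2 \<partial>M) - (\<integral>x. (z (x, t))\<^sup>2 \<partial>M)"
    if "good t" "good t'" for t t' by (rule sq_convex) (use that in \<open>auto simp: good_def\<close>)
  show "2 * (\<integral>x. z (x, t) * (val 0 x - z (x, t)) \<partial>M) \<le> (\<integral>x. (val 0 x)\<^sup>2 \<partial>M) - (\<integral>x. (z (x, t))\<^sup>2 \<partial>M)"
    if "good t" for t by (rule sq_convex) (use that assms(1) in \<open>auto simp: good_def\<close>)
qed auto

lemma good_convex_slices: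
  assumes "good t" "good t'"
  shows "2 * (\<integral>x. - p (x, t) * (z (x, t') - z (x, t)) \<partial>M) \<le> (\<integral>x. (q (x, t'))\<^sup>2 \<partial>M) - (\<integral>x. (q (x, t))\<^sup>2 \<partial>M)"
  unfolding sq_q(2)[of t'] by (rule good_convex[OF assms(1)]) (use assms(2) in \<open>auto simp: good_def\<close>)

lemma L2T_uminus: "L2T g \<Longrightarrow> L2T (\<lambda>w. - g w)"
  unfolding L2T_def by auto

lemma form_uminus: "form \<eta> (\<lambda>w. - g w) h = - form \<eta> g h"
  by (simp add: form_def)

text \<open>In L^2(dx/a) the gradient of the Dirichlet integral at z is -2 a z_xx. Hence
  \<open>energy_final\<close> is applied with -p as half gradient and with the squared norm of q as
  functional.\<close>

lemma final_deriv:
  assumes "integrable M (\<lambda>x. (val T x)\<^sup>2)" "H10 (val T) e" "is_weight \<eta> \<eta>'"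
  shows "- 2 * form \<eta> p zt + form \<eta>' q q \<le> \<eta> T * (LINT x:Omega|lebesgue. (e x)\<^sup>2)"
proof -
  have "2 * form \<eta> (\<lambda>w. - p w) zt + (\<integral>t. indicator {0<..<T} t * (\<eta>' t * (\<integral>x. (q (x, t))\<^sup>2 \<partial>M)) \<partial>lborel)
      \<le> \<eta> T * (LINT x:Omega|lebesgue. (e x)\<^sup>2)"
  proof (rule energy_final[OF L2T_uminus[OF p] sq_slice(1)[OF q] _ sq_slice(2)[OF q] _ AE_good _ _ assms(3)])
    show "0 \<le> (LINT x:Omega|lebesgue. (e x)\<^sup>2)" by (simp add: set_lebesgue_integral_def)
    show "2 * (\<integral>x. - p (x, t) * (val T x - z (x, t)) \<partial>M) \<le> (LINT x:Omega|lebesgue. (e x)\<^sup>2) - (\<integral>x. (q (x, t))\<^sup>2 \<partial>M)"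
      if "good t" for t by (rule good_convex[OF that assms(2) _ assms(1)]) measurable
  qed (rule good_convex_slices | simp)+
  then show ?thesis by (simp add: form_uminus form_sq[OF q assms(3)])
qed

lemma initial_deriv:
  assumes "integrable M (\<lambda>x. (val 0 x)\<^sup>2)" "H10 (val 0) e" "is_weight \<eta> \<eta>'"
  shows "2 * form \<eta> p zt - form \<eta>' q q \<le> \<eta> 0 * (LINT x:Omega|lebesgue. (e x)\<^sup>2)"
proof -
  have "- 2 * form \<eta> (\<lambda>w. - p w) zt - (\<integral>t. indicator {0<..<T} t * (\<eta>' t * (\<integral>x. (q (x, t))\<^sup>2 \<partial>M)) \<partial>lborel)
      \<le> \<eta> 0 * (LINT x:Omega|lebesgue. (e x)\<^sup>2)"
  proof (rule energy_initial[OF L2T_uminus[OF p] sq_slice(1)[OF q] _ sq_slice(2)[OF q] _ AE_good _ _ assms(3)])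
    show "0 \<le> (LINT x:Omega|lebesgue. (e x)\<^sup>2)" by (simp add: set_lebesgue_integral_def)
    show "2 * (\<integral>x. - p (x, t) * (val 0 x - z (x, t)) \<partial>M) \<le> (LINT x:Omega|lebesgue. (e x)\<^sup>2) - (\<integral>x. (q (x, t))\<^sup>2 \<partial>M)"
      if "good t" for t by (rule good_convex[OF that assms(2) _ assms(1)]) measurable
  qed (rule good_convex_slices | simp)+
  then show ?thesis by (simp add: form_uminus form_sq[OF q assms(3)])
qed

end

section \<open>Passing from representatives to Borel versions\<close>

text \<open>No measurability is assumed. By completeness of Lebesgue measure f and g are measurable
  on S together, and otherwise both Bochner integrals are 0 by convention.\<close>

lemma integral_cong_AE_lebesgue:
  fixes f g :: "real \<Rightarrow> real"
  assumes "AE x in lebesgue. x \<in> S \<longrightarrow> f x = g x" "S \<in> sets lebesgue"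
  shows "(LINT x|lebesgue_on S. f x) = (LINT x|lebesgue_on S. g x)"
proof -
  have ae: "AE x in lebesgue. indicator S x *\<^sub>R f x = indicator S x *\<^sub>R g x"
    using assms(1) by eventually_elim (simp add: indicator_def)
  then have ae': "AE x in lebesgue. indicator S x *\<^sub>R g x = indicator S x *\<^sub>R f x"
    by eventually_elim (rule sym)
  have "(\<integral>x. indicator S x *\<^sub>R f x \<partial>lebesgue) = (\<integral>x. indicator S x *\<^sub>R g x \<partial>lebesgue)"
  proof (cases "(\<lambda>x. indicator S x *\<^sub>R f x) \<in> borel_measurable lebesgue")
    case True
    then show ?thesis using borel_measurable_AE[OF True ae] ae by (intro integral_cong_AE)
  next
    case False
    then have "(\<lambda>x. indicator S x *\<^sub>R g x) \<notin> borel_measurable lebesgue" using borel_measurable_AE[OF _ ae'] by blast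
    with False show ?thesis by (metis borel_measurable_integrable not_integrable_integral_eq)
  qed
  then show ?thesis using assms(2) by (simp add: integral_restrict_space)
qed

lemma locally_integrable_cong_AE:
  assumes "locally_integrable S f" "AE x in lebesgue. x \<in> S \<longrightarrow> f x = g x"
  shows "locally_integrable S g"
  unfolding locally_integrable_def
proof (intro allI impI)
  fix C assume C: "compact C \<and> C \<subseteq> S"
  then have i: "integrable lebesgue (\<lambda>x. indicator C x *\<^sub>R f x)"
    using assms(1) unfolding locally_integrable_def set_integrable_def by blast
  have ae: "AE x in lebesgue. indicator C x *\<^sub>R f x = indicator C x *\<^sub>R g x"
    using assms(2) by eventually_elim (use C in \<open>auto simp: indicator_def\<close>)
  show "g absolutely_integrable_on C"
    unfolding set_integrable_def
    by (rule integrable_cong_AE_imp[OF i borel_measurable_AE[OF borel_measurable_integrable[OF i] ae] ae])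
qed

lemma has_weak_deriv_cong_AE:
  assumes "has_weak_deriv Omega f g"
    and f: "AE x in lebesgue. x \<in> Omega \<longrightarrow> f x = f' x" and g: "AE x in lebesgue. x \<in> Omega \<longrightarrow> g x = g' x"
  shows "has_weak_deriv Omega f' g'"
  unfolding has_weak_deriv_def
proof (intro conjI allI impI)
  show "locally_integrable Omega f'" "locally_integrable Omega g'"
    using assms locally_integrable_cong_AE by (auto simp: has_weak_deriv_def)
  fix \<phi> assume "test_fun Omega \<phi>"
  then have "(LINT x|lebesgue_on Omega. f x * deriv \<phi> x) = - (LINT x|lebesgue_on Omega. g x * \<phi> x)"
    using assms(1) by (simp add: has_weak_deriv_def)
  moreover have "(LINT x|lebesgue_on Omega. f x * deriv \<phi> x) = (LINT x|lebesgue_on Omega. f' x * deriv \<phi> x)"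
    by (rule integral_cong_AE_lebesgue) (use f in \<open>auto elim: eventually_mono\<close>)
  moreover have "(LINT x|lebesgue_on Omega. g x * \<phi> x) = (LINT x|lebesgue_on Omega. g' x * \<phi> x)"
    by (rule integral_cong_AE_lebesgue) (use g in \<open>auto elim: eventually_mono\<close>)
  ultimately show "(LINT x|lebesgue_on Omega. f' x * deriv \<phi> x) = - (LINT x|lebesgue_on Omega. g' x * \<phi> x)" by simp
qed

lemma vanishes_at_ends_cong_AE:
  assumes "vanishes_at_ends f" "AE x in lebesgue. x \<in> Omega \<longrightarrow> f x = g x"
  shows "vanishes_at_ends g"
proof -
  obtain v where v: "continuous_on {0..1} v" "AE x in lebesgue_on Omega. v x = f x" "v 0 = 0" "v 1 = 0"
    using assms(1) by (auto simp: vanishes_at_ends_def)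
  have "AE x in lebesgue_on Omega. f x = g x" using assms(2) by (simp add: AE_restrict_space_iff)
  with v(2) have "AE x in lebesgue_on Omega. v x = g x" by eventually_elim simp
  with v show ?thesis by (auto simp: vanishes_at_ends_def)
qed

lemma has_time_deriv_cong_AE:
  assumes "has_time_deriv T f g"
    and f: "AE w in lborel. w \<in> Q T \<longrightarrow> f w = f' w" and g: "AE w in lborel. w \<in> Q T \<longrightarrow> g w = g' w"
  shows "has_time_deriv T f' g'"
  unfolding has_time_deriv_def
proof (intro allI impI)
  fix \<phi> assume "test_fun {0<..<T} \<phi>"
  then have "AE x in lebesgue_on Omega. (LINT t|lebesgue_on {0<..<T}. f (x, t) * deriv \<phi> t) = - (LINT t|lebesgue_on {0<..<T}. g (x, t) * \<phi> t)"
    using assms(1) by (simp add: has_time_deriv_def)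
  then have "AE x in lborel. x \<in> Omega \<longrightarrow> (LINT t|lebesgue_on {0<..<T}. f (x, t) * deriv \<phi> t) = - (LINT t|lebesgue_on {0<..<T}. g (x, t) * \<phi> t)"
    by (simp only: AE_lebesgue_on_iff[OF Omega_lebesgue(1)])
  then have "AE x in lborel. x \<in> Omega \<longrightarrow> (LINT t|lebesgue_on {0<..<T}. f' (x, t) * deriv \<phi> t) = - (LINT t|lebesgue_on {0<..<T}. g' (x, t) * \<phi> t)"
    using AE_lborel_slices(1)[OF f] AE_lborel_slices(1)[OF g]
  proof eventually_elim
    case (elim x)
    show ?case
    proof
      assume x: "x \<in> Omega"
      have "AE t in lebesgue. t \<in> {0<..<T} \<longrightarrow> f (x, t) = f' (x, t)" "AE t in lebesgue. t \<in> {0<..<T} \<longrightarrow> g (x, t) = g' (x, t)"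
        using elim(2,3) x by (auto intro!: AE_completion)
      then have "(LINT t|lebesgue_on {0<..<T}. f (x, t) * deriv \<phi> t) = (LINT t|lebesgue_on {0<..<T}. f' (x, t) * deriv \<phi> t)"
        "(LINT t|lebesgue_on {0<..<T}. g (x, t) * \<phi> t) = (LINT t|lebesgue_on {0<..<T}. g' (x, t) * \<phi> t)"
        by (auto intro!: integral_cong_AE_lebesgue elim: eventually_mono)
      then show "(LINT t|lebesgue_on {0<..<T}. f' (x, t) * deriv \<phi> t) = - (LINT t|lebesgue_on {0<..<T}. g' (x, t) * \<phi> t)"
        using elim(1) x by simp
    qed
  qed
  then show "AE x in lebesgue_on Omega. (LINT t|lebesgue_on {0<..<T}. f' (x, t) * deriv \<phi> t) = - (LINT t|lebesgue_on {0<..<T}. g' (x, t) * \<phi> t)"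
    by (simp only: AE_lebesgue_on_iff[OF Omega_lebesgue(1)])
qed

lemma has_time_deriv_scale:
  assumes "has_time_deriv T f g"
  shows "has_time_deriv T (\<lambda>(x, t). a x * f (x, t)) (\<lambda>(x, t). a x * g (x, t))"
  unfolding has_time_deriv_def
proof (intro allI impI)
  fix \<phi> assume "test_fun {0<..<T} \<phi>"
  then have "AE x in lebesgue_on Omega. (LINT t|lebesgue_on {0<..<T}. f (x, t) * deriv \<phi> t) = - (LINT t|lebesgue_on {0<..<T}. g (x, t) * \<phi> t)"
    using assms by (simp add: has_time_deriv_def)
  then show "AE x in lebesgue_on Omega. (LINT t|lebesgue_on {0<..<T}. (case (x, t) of (x, t) \<Rightarrow> a x * f (x, t)) * deriv \<phi> t)
      = - (LINT t|lebesgue_on {0<..<T}. (case (x, t) of (x, t) \<Rightarrow> a x * g (x, t)) * \<phi> t)"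
    by eventually_elim (simp add: mult.assoc)
qed

lemma weak_deriv_AE:
  assumes "has_weak_deriv Omega f g"
  shows "AE x in lebesgue. x \<in> Omega \<longrightarrow> g x = weak_deriv f x" "has_weak_deriv Omega f (weak_deriv f)"
proof -
  show w: "has_weak_deriv Omega f (weak_deriv f)"
    unfolding weak_deriv_def by (rule someI[of "has_weak_deriv Omega f", OF assms])
  show "AE x in lebesgue. x \<in> Omega \<longrightarrow> g x = weak_deriv f x"
    by (rule has_weak_deriv_unique[OF assms w]) simp
qed

lemma nn_integral_Omega_cong:
  fixes f g :: "real \<Rightarrow> real" and h :: "real \<Rightarrow> real \<Rightarrow> ennreal"
  assumes "AE x in lebesgue. x \<in> Omega \<longrightarrow> f x = g x"
  shows "(\<integral>\<^sup>+x. h x (f x) \<partial>lebesgue_on Omega) = (\<integral>\<^sup>+x. h x (g x) \<partial>lebesgue_on Omega)"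
proof (rule nn_integral_cong_AE)
  have "AE x in lebesgue_on Omega. f x = g x" using assms by (simp add: AE_restrict_space_iff)
  then show "AE x in lebesgue_on Omega. h x (f x) = h x (g x)" by eventually_elim simp
qed

lemma nn_integral_weak_deriv:
  assumes f: "has_weak_deriv Omega f fx" and fx: "has_weak_deriv Omega fx fxx"
  shows "(\<integral>\<^sup>+x. ennreal ((weak_deriv f x)\<^sup>2) \<partial>lebesgue_on Omega) = (\<integral>\<^sup>+x. ennreal ((fx x)\<^sup>2) \<partial>lebesgue_on Omega)"
    and "(\<integral>\<^sup>+x. ennreal (a x * (weak_deriv (weak_deriv f) x)\<^sup>2) \<partial>lebesgue_on Omega) = (\<integral>\<^sup>+x. ennreal (a x * (fxx x)\<^sup>2) \<partial>lebesgue_on Omega)"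
proof -
  show "(\<integral>\<^sup>+x. ennreal ((weak_deriv f x)\<^sup>2) \<partial>lebesgue_on Omega) = (\<integral>\<^sup>+x. ennreal ((fx x)\<^sup>2) \<partial>lebesgue_on Omega)"
    by (rule nn_integral_Omega_cong[OF weak_deriv_AE(1)[OF f], of "\<lambda>x y. ennreal (y\<^sup>2)", symmetric])
  have "has_weak_deriv Omega (weak_deriv f) fxx"
    by (rule has_weak_deriv_cong_AE[OF fx weak_deriv_AE(1)[OF f]]) simp
  from nn_integral_Omega_cong[OF weak_deriv_AE(1)[OF this], of "\<lambda>x y. ennreal (a x * y\<^sup>2)"]
  show "(\<integral>\<^sup>+x. ennreal (a x * (weak_deriv (weak_deriv f) x)\<^sup>2) \<partial>lebesgue_on Omega) = (\<integral>\<^sup>+x. ennreal (a x * (fxx x)\<^sup>2) \<partial>lebesgue_on Omega)"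
    by simp
qed

lemma H10_weak_deriv:
  assumes h: "has_weak_deriv Omega h g" and g: "g \<in> L2" and v: "vanishes_at_ends h"
  shows "H10 h (weak_deriv h)"
    and "ennreal (LINT x:Omega|lebesgue. (weak_deriv h x)\<^sup>2) = (\<integral>\<^sup>+x. ennreal ((weak_deriv h x)\<^sup>2) \<partial>lebesgue_on Omega)"
proof -
  note w = weak_deriv_AE[OF h]
  have [measurable]: "weak_deriv h \<in> borel_measurable (lebesgue_on Omega)"
    using w(2) by (intro locally_integrable_measurable) (simp add: has_weak_deriv_def)
  have "(\<integral>\<^sup>+x. ennreal ((weak_deriv h x)\<^sup>2) \<partial>lebesgue_on Omega) < \<infinity>"
    using nn_integral_Omega_cong[OF w(1), of "\<lambda>x y. ennreal (y\<^sup>2)"] g by (simp add: L2_def)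
  then have i: "integrable (lebesgue_on Omega) (\<lambda>x. (weak_deriv h x)\<^sup>2)"
    by (intro integrableI_bounded) auto
  then show "H10 h (weak_deriv h)"
    using w(2) v by (intro H10I) (simp_all add: set_integrable_iff_lebesgue_on)
  show "ennreal (LINT x:Omega|lebesgue. (weak_deriv h x)\<^sup>2) = (\<integral>\<^sup>+x. ennreal ((weak_deriv h x)\<^sup>2) \<partial>lebesgue_on Omega)"
    using nn_integral_eq_integral[OF i] by (simp add: set_integral_iff_lebesgue_on)
qed

lemma H10_cong_AE:
  assumes "H10 v w" "AE x in lebesgue. x \<in> Omega \<longrightarrow> v x = v' x"
  shows "H10 v' w"
proof -
  obtain W where W: "primitive_on {0..1} W w" "W 0 = 0" "W 1 = 0" "AE x in lebesgue. x \<in> Omega \<longrightarrow> W x = v x"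
    and w: "set_integrable lebesgue Omega (\<lambda>x. (w x)\<^sup>2)" using assms(1) by (auto simp: H10_def)
  have "AE x in lebesgue. x \<in> Omega \<longrightarrow> W x = v' x" using W(4) assms(2) by eventually_elim auto
  then show ?thesis unfolding H10_def using W w by blast
qed

text \<open>The data are only Lebesgue measurable on Q and arbitrary outside. The product measure
  arguments need Borel functions on the whole plane that vanish off Q.\<close>

definition version :: "real \<Rightarrow> (real \<times> real \<Rightarrow> real) \<Rightarrow> (real \<times> real \<Rightarrow> real) \<Rightarrow> bool" where
  "version T f f' \<longleftrightarrow> f' \<in> borel_measurable borel \<and> (\<forall>w. w \<notin> Q T \<longrightarrow> f' w = 0) \<and> (AE w in lborel. w \<in> Q T \<longrightarrow> f w = f' w)"

lemma versionD:
  assumes "version T f f'"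
  shows "f' \<in> borel_measurable borel" "w \<notin> Q T \<Longrightarrow> f' w = 0" "AE w in lborel. w \<in> Q T \<longrightarrow> f w = f' w"
  using assms unfolding version_def by blast+

lemma version_exists:
  assumes "f \<in> borel_measurable (lebesgue_on (Q T))"
  obtains f' where "version T f f'"
proof -
  obtain f' :: "real \<times> real \<Rightarrow> real" where f': "f' \<in> borel_measurable borel" "\<And>z. z \<notin> Q T \<Longrightarrow> f' z = 0"
    "AE z in lborel. z \<in> Q T \<longrightarrow> f' z = f z"
    using borel_version[OF assms] by blast
  have "AE z in lborel. z \<in> Q T \<longrightarrow> f z = f' z" using f'(3) by eventually_elim simp
  with f' show thesis by (intro that[of f']) (simp add: version_def)
qed

lemma version_slices:
  assumes "version T f f'"
  shows "AE t in lborel. t \<in> {0<..<T} \<longrightarrow> (AE x in lebesgue. x \<in> Omega \<longrightarrow> f (x, t) = f' (x, t))"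
proof -
  have "AE w in lborel. w \<in> Q T \<longrightarrow> f w = f' w" using assms by (simp add: version_def)
  from AE_lborel_slices(2)[OF this] show ?thesis
    by eventually_elim (auto intro!: AE_completion)
qed

context degenerate
begin

lemma nsq_inv_iterated:
  assumes "version T f f'"
  shows "(\<integral>\<^sup>+t. nsq_inv a (\<lambda>x. f (x, t)) \<partial>lebesgue_on {0<..<T}) = (\<integral>\<^sup>+w. ennreal (wt (fst w) * (f' w)\<^sup>2) \<partial>lborel)"
proof -
  have [measurable]: "f' \<in> borel_measurable borel" and z: "\<And>w. w \<notin> Q T \<Longrightarrow> f' w = 0"
    and ae: "AE w in lborel. w \<in> Q T \<longrightarrow> f w = f' w" using versionD[OF assms] by blast+
  have "(\<integral>\<^sup>+t. nsq_inv a (\<lambda>x. f (x, t)) \<partial>lebesgue_on {0<..<T})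
      = (\<integral>\<^sup>+t. (\<integral>\<^sup>+x. (\<lambda>w. ennreal ((f w)\<^sup>2 / a (fst w))) (x, t) \<partial>lebesgue_on Omega) \<partial>lebesgue_on {0<..<T})"
    by (simp add: nsq_inv_def)
  also have "\<dots> = (\<integral>\<^sup>+w. ennreal (wt (fst w) * (f' w)\<^sup>2) * indicator (Q T) w \<partial>lborel)"
  proof (rule nn_integral_iterated)
    show "AE w in lborel. w \<in> Q T \<longrightarrow> ennreal ((f w)\<^sup>2 / a (fst w)) = ennreal (wt (fst w) * (f' w)\<^sup>2)"
      using ae by eventually_elim (auto simp: wt_pos)
  qed measurable
  also have "\<dots> = (\<integral>\<^sup>+w. ennreal (wt (fst w) * (f' w)\<^sup>2) \<partial>lborel)"
    by (rule nn_integral_cong) (use z in \<open>auto simp: indicator_def\<close>)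
  finally show ?thesis .
qed

lemma L2T_version:
  assumes v: "version T f f'" and fin: "(\<integral>\<^sup>+t. nsq_inv a (\<lambda>x. f (x, t)) \<partial>lebesgue_on {0<..<T}) < \<infinity>"
  shows "L2T f'"
proof (rule L2T_I)
  show "f' \<in> borel_measurable borel" by (rule versionD(1)[OF v])
  show "f' w = 0" if "w \<notin> Q T" for w by (rule versionD(2)[OF v that])
  show "(\<integral>\<^sup>+w. ennreal (wt (fst w) * (f' w)\<^sup>2) \<partial>lborel) < \<infinity>" using fin unfolding nsq_inv_iterated[OF v] .
qed

lemma regular_slab_version:
  assumes v: "version T z z'" "version T zt zt'" "version T zx zx'" "version T zxx zxx'"
    and time: "has_time_deriv T z zt"
    and space: "AE t in lebesgue_on {0<..<T}. has_weak_deriv Omega (\<lambda>x. z (x, t)) (\<lambda>x. zx (x, t)) \<and>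
      has_weak_deriv Omega (\<lambda>x. zx (x, t)) (\<lambda>x. zxx (x, t)) \<and> vanishes_at_ends (\<lambda>x. z (x, t))"
    and fin: "(\<integral>\<^sup>+t. nsq_inv a (\<lambda>x. z (x, t)) \<partial>lebesgue_on {0<..<T}) < \<infinity>"
      "(\<integral>\<^sup>+t. nsq_inv a (\<lambda>x. zt (x, t)) \<partial>lebesgue_on {0<..<T}) < \<infinity>"
      "(\<integral>\<^sup>+t. (\<integral>\<^sup>+x. ennreal ((zx (x, t))\<^sup>2) \<partial>lebesgue_on Omega) \<partial>lebesgue_on {0<..<T}) < \<infinity>"
      "(\<integral>\<^sup>+t. (\<integral>\<^sup>+x. ennreal (a x * (zxx (x, t))\<^sup>2) \<partial>lebesgue_on Omega) \<partial>lebesgue_on {0<..<T}) < \<infinity>"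
  shows "regular_slab a T z' zt' zx' zxx'"
proof
  show "L2T z'" "L2T zt'" using v fin by (auto intro: L2T_version)
  have ae: "AE w in lborel. w \<in> Q T \<longrightarrow> z w = z' w" "AE w in lborel. w \<in> Q T \<longrightarrow> zt w = zt' w"
    "AE w in lborel. w \<in> Q T \<longrightarrow> zx w = zx' w" "AE w in lborel. w \<in> Q T \<longrightarrow> zxx w = zxx' w"
    using v by (auto simp: version_def)
  show "has_time_deriv T z' zt'" by (rule has_time_deriv_cong_AE[OF time ae(1,2)])
  show m [measurable]: "zx' \<in> borel_measurable borel" "zxx' \<in> borel_measurable borel" using v by (auto simp: version_def)
  show off: "zx' w = 0" "zxx' w = 0" if "w \<notin> Q T" for w using versionD(2)[OF v(3) that] versionD(2)[OF v(4) that] by auto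
  have "(\<integral>\<^sup>+w. ennreal ((zx' w)\<^sup>2) \<partial>lborel) = (\<integral>\<^sup>+w. ennreal ((zx' w)\<^sup>2) * indicator (Q T) w \<partial>lborel)"
    by (rule nn_integral_cong) (use off in \<open>auto simp: indicator_def\<close>)
  also have "\<dots> = (\<integral>\<^sup>+t. (\<integral>\<^sup>+x. (\<lambda>w. ennreal ((zx w)\<^sup>2)) (x, t) \<partial>lebesgue_on Omega) \<partial>lebesgue_on {0<..<T})"
    by (rule nn_integral_iterated[symmetric]) (use ae(3) in \<open>auto elim: eventually_mono\<close>)
  finally show "(\<integral>\<^sup>+w. ennreal ((zx' w)\<^sup>2) \<partial>lborel) < \<infinity>" using fin(3) by simp
  have "(\<integral>\<^sup>+w. ennreal (ab (fst w) * (zxx' w)\<^sup>2) \<partial>lborel) = (\<integral>\<^sup>+w. ennreal (ab (fst w) * (zxx' w)\<^sup>2) * indicator (Q T) w \<partial>lborel)"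
    by (rule nn_integral_cong) (use off in \<open>auto simp: indicator_def\<close>)
  also have "\<dots> = (\<integral>\<^sup>+t. (\<integral>\<^sup>+x. (\<lambda>w. ennreal (a (fst w) * (zxx w)\<^sup>2)) (x, t) \<partial>lebesgue_on Omega) \<partial>lebesgue_on {0<..<T})"
  proof (rule nn_integral_iterated[symmetric])
    show "AE w in lborel. w \<in> Q T \<longrightarrow> ennreal (a (fst w) * (zxx w)\<^sup>2) = ennreal (ab (fst w) * (zxx' w)\<^sup>2)"
      using ae(4) by eventually_elim (auto simp: ab_simps)
  qed measurable
  finally show "(\<integral>\<^sup>+w. ennreal (ab (fst w) * (zxx' w)\<^sup>2) \<partial>lborel) < \<infinity>" using fin(4) by simp
  have "AE t in lborel. t \<in> {0<..<T} \<longrightarrow> has_weak_deriv Omega (\<lambda>x. z (x, t)) (\<lambda>x. zx (x, t)) \<and>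
      has_weak_deriv Omega (\<lambda>x. zx (x, t)) (\<lambda>x. zxx (x, t)) \<and> vanishes_at_ends (\<lambda>x. z (x, t))"
    using space by (subst (asm) AE_lebesgue_on_iff) auto
  then show "AE t in lborel. t \<in> {0<..<T} \<longrightarrow> has_weak_deriv Omega (\<lambda>x. z' (x, t)) (\<lambda>x. zx' (x, t)) \<and>
      has_weak_deriv Omega (\<lambda>x. zx' (x, t)) (\<lambda>x. zxx' (x, t)) \<and> vanishes_at_ends (\<lambda>x. z' (x, t))"
    using version_slices[OF v(1)] version_slices[OF v(3)] version_slices[OF v(4)]
  proof eventually_elim
    case (elim t)
    then show ?case
      using has_weak_deriv_cong_AE[of "\<lambda>x. z (x, t)" "\<lambda>x. zx (x, t)" "\<lambda>x. z' (x, t)" "\<lambda>x. zx' (x, t)"]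
        has_weak_deriv_cong_AE[of "\<lambda>x. zx (x, t)" "\<lambda>x. zxx (x, t)" "\<lambda>x. zx' (x, t)" "\<lambda>x. zxx' (x, t)"]
        vanishes_at_ends_cong_AE[of "\<lambda>x. z (x, t)" "\<lambda>x. z' (x, t)"] by blast
  qed
qed

lemma nsq_inv_integral_M:
  assumes [measurable]: "v \<in> borel_measurable borel" and ae: "AE x in M. h x = v x" and fin: "nsq_inv a h < \<infinity>"
  shows "integrable M (\<lambda>x. (v x)\<^sup>2)" "ennreal (\<integral>x. (v x)\<^sup>2 \<partial>M) = nsq_inv a h"
proof -
  have [measurable]: "v \<in> borel_measurable M" by (simp add: M_def)
  have "AE x in lborel. x \<in> Omega \<longrightarrow> h x = v x" using ae by (simp only: AE_M_iff)
  then have ae': "AE x in lebesgue. x \<in> Omega \<longrightarrow> h x = v x" by (rule AE_completion)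
  have "(\<integral>\<^sup>+x. ennreal ((v x)\<^sup>2) \<partial>M) = (\<integral>\<^sup>+x. ennreal (wt x) * ennreal ((v x)\<^sup>2) \<partial>lborel)"
    unfolding M_def by (rule nn_integral_density) measurable
  also have "\<dots> = (\<integral>\<^sup>+x. ennreal ((v x)\<^sup>2 / a x) * indicator Omega x \<partial>lborel)"
  proof (rule nn_integral_cong)
    fix x show "ennreal (wt x) * ennreal ((v x)\<^sup>2) = ennreal ((v x)\<^sup>2 / a x) * indicator Omega x"
      by (cases "x \<in> Omega") (simp_all add: wt_pos ennreal_mult'[symmetric] less_imp_le[OF a_pos])
  qed
  also have "\<dots> = (\<integral>\<^sup>+x. ennreal ((v x)\<^sup>2 / a x) \<partial>lebesgue_on Omega)"
    by (simp add: nn_integral_restrict_space nn_integral_completion)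
  also have "\<dots> = nsq_inv a h"
    unfolding nsq_inv_def by (rule nn_integral_Omega_cong[OF ae', of "\<lambda>x y. ennreal (y\<^sup>2 / a x)", symmetric])
  finally have eq: "(\<integral>\<^sup>+x. ennreal ((v x)\<^sup>2) \<partial>M) = nsq_inv a h" .
  then show i: "integrable M (\<lambda>x. (v x)\<^sup>2)" using fin by (intro integrableI_bounded) auto
  show "ennreal (\<integral>x. (v x)\<^sup>2 \<partial>M) = nsq_inv a h" using nn_integral_eq_integral[OF i] eq by simp
qed

text \<open>Since a f^2 = (a f)^2 / a, multiplication by a is an isometry from the norm with weight
  a to the norm with weight 1/a. Through it the forward equation for m becomes one for z = a m in
  the same space as u.\<close>

lemma nsq_wt_scale: "nsq_wt a f = nsq_inv a (\<lambda>x. a x * f x)"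
  unfolding nsq_wt_def nsq_inv_def
proof (rule nn_integral_cong)
  fix x assume "x \<in> space (lebesgue_on Omega)"
  then have "a x > 0" using a_pos by auto
  then show "ennreal (a x * (f x)\<^sup>2) = ennreal ((a x * f x)\<^sup>2 / a x)" by (simp add: power2_eq_square mult_ac)
qed

end

text \<open>The space X enters only through measurability, so that the lemma serves both u and the
  scaled function a m.\<close>

lemma (in slab) time_value_val:
  assumes "has_time_value T X (nsq_inv a) f \<tau> v" "X \<subseteq> borel_measurable (lebesgue_on Omega)"
    and \<tau>: "\<tau> \<in> {0..T}" and f: "version T f z"
  shows "AE x in M. v x = val \<tau> x"
proof -
  obtain U where U: "\<And>t. t \<in> {0..T} \<Longrightarrow> U t \<in> X"
    "\<And>t0. t0 \<in> {0..T} \<Longrightarrow> ((\<lambda>t. nsq_inv a (\<lambda>x. U t x - U t0 x)) \<longlongrightarrow> 0) (at t0 within {0..T})"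
    "AE t in lebesgue_on {0<..<T}. AE x in lebesgue_on Omega. U t x = f (x, t)"
    "AE x in lebesgue_on Omega. v x = U \<tau> x"
    using assms(1) unfolding has_time_value_def by blast
  have AE_conv: "(AE x in M. P x) \<longleftrightarrow> (AE x in lebesgue_on Omega. P x)" for P
    by (simp only: AE_M_iff AE_lebesgue_on_iff[OF Omega_lebesgue(1)])
  have "AE t in lborel. t \<in> {0<..<T} \<longrightarrow> (AE x in lebesgue_on Omega. U t x = f (x, t))"
    using U(3) by (subst (asm) AE_lebesgue_on_iff) auto
  then have "AE t in lborel. t \<in> {0<..<T} \<longrightarrow> (AE x in M. U t x = z (x, t))"
    using version_slices[OF f]
  proof eventually_elim
    case (elim t)
    show ?case
    proof
      assume "t \<in> {0<..<T}"
      with elim have "AE x in lebesgue_on Omega. U t x = f (x, t)" "AE x in lebesgue_on Omega. f (x, t) = z (x, t)"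
        by (auto simp: AE_restrict_space_iff)
      then have "AE x in lebesgue_on Omega. U t x = z (x, t)" by eventually_elim simp
      then show "AE x in M. U t x = z (x, t)" by (simp only: AE_conv)
    qed
  qed
  from val_eq_time_value[OF \<tau> _ U(2)[OF \<tau>] this] have "AE x in M. U \<tau> x = val \<tau> x" using U(1) assms(2) by blast
  moreover have "AE x in M. v x = U \<tau> x" using U(4) by (simp only: AE_conv)
  ultimately show ?thesis by eventually_elim simp
qed

lemma (in degenerate) has_time_value_scale:
  assumes "has_time_value T (L2_wt a) (nsq_wt a) f \<tau> v"
  shows "has_time_value T (borel_measurable (lebesgue_on Omega)) (nsq_inv a) (\<lambda>(x, t). a x * f (x, t)) \<tau> (\<lambda>x. a x * v x)"
proof -
  have am [measurable]: "a \<in> borel_measurable (lebesgue_on Omega)"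
    by (rule continuous_imp_measurable_on_sets_lebesgue) (auto intro: continuous_on_subset[OF a_cont])
  obtain U where U: "\<And>t. t \<in> {0..T} \<Longrightarrow> U t \<in> L2_wt a"
    "\<And>t0. t0 \<in> {0..T} \<Longrightarrow> ((\<lambda>t. nsq_wt a (\<lambda>x. U t x - U t0 x)) \<longlongrightarrow> 0) (at t0 within {0..T})"
    "AE t in lebesgue_on {0<..<T}. AE x in lebesgue_on Omega. U t x = f (x, t)"
    "AE x in lebesgue_on Omega. v x = U \<tau> x"
    using assms(1) unfolding has_time_value_def by blast
  show ?thesis
    unfolding has_time_value_def
  proof (intro exI[of _ "\<lambda>t x. a x * U t x"] conjI ballI)
    show "(\<lambda>x. a x * U t x) \<in> borel_measurable (lebesgue_on Omega)" if "t \<in> {0..T}" for t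
      using U(1)[OF that] by (auto simp: L2_wt_def)
    show "((\<lambda>t. nsq_inv a (\<lambda>x. a x * U t x - a x * U t0 x)) \<longlongrightarrow> 0) (at t0 within {0..T})" if "t0 \<in> {0..T}" for t0
      using U(2)[OF that] unfolding nsq_wt_scale right_diff_distrib .
    show "AE t in lebesgue_on {0<..<T}. AE x in lebesgue_on Omega. a x * U t x = (case (x, t) of (x, t) \<Rightarrow> a x * f (x, t))"
      using U(3)
    proof eventually_elim
      case (elim t)
      then show ?case by eventually_elim simp
    qed
    show "AE x in lebesgue_on Omega. a x * v x = a x * U \<tau> x" using U(4) by eventually_elim simp
  qed
qed

text \<open>On continuous representatives the identity W = a R holds everywhere. Since a is
  classically differentiable, the product rule for right difference quotients then identifies w
  almost everywhere.\<close>

lemma weak_product_rule: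
  assumes a: "a C1_differentiable_on Omega" and m: "has_weak_deriv Omega m mx" and w: "has_weak_deriv Omega (\<lambda>x. a x * m x) w"
  shows "AE x in lebesgue. x \<in> Omega \<longrightarrow> a x * mx x = w x - deriv a x * m x"
proof -
  have D: "DERIV a x :> deriv a x" if "x \<in> Omega" for x
    using a that by (simp add: C1_differentiable_on_eq DERIV_deriv_iff_real_differentiable)
  have ca: "continuous_on Omega a"
    using D by (intro continuous_at_imp_continuous_on ballI) (rule DERIV_isCont)
  obtain R where R: "primitive_on Omega R mx" "AE x in lebesgue. x \<in> Omega \<longrightarrow> R x = m x"
    using has_weak_deriv_primitive[OF m] by auto
  obtain W where W: "primitive_on Omega W w" "AE x in lebesgue. x \<in> Omega \<longrightarrow> W x = a x * m x"
    using has_weak_deriv_primitive[OF w] by auto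
  have eq: "W x = a x * R x" if x: "x \<in> Omega" for x
  proof -
    let ?D = "Omega \<inter> (\<lambda>x. W x - a x * R x) -` (- {0})"
    have "open ?D"
      by (rule continuous_open_preimage)
        (auto intro!: continuous_intros ca primitive_on_open_continuous[OF R(1)] primitive_on_open_continuous[OF W(1)])
    moreover have "negligible ?D"
    proof -
      have "AE x in lebesgue. x \<notin> ?D" using R(2) W(2) by eventually_elim auto
      then obtain Z where Z: "Z \<in> null_sets lebesgue" "{x \<in> space lebesgue. \<not> x \<notin> ?D} \<subseteq> Z"
        unfolding eventually_ae_filter by blast
      have "?D \<subseteq> Z" using Z(2) by auto
      with Z(1) show ?thesis using negligible_subset negligible_iff_null_sets by blast
    qed
    ultimately have "?D = {}" using open_not_negligible by blast
    with x show ?thesis by auto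
  qed
  show ?thesis
    using primitive_on_AE_right_deriv[OF R(1)] primitive_on_AE_right_deriv[OF W(1)] R(2)
  proof eventually_elim
    case (elim x)
    show ?case
    proof
      assume x: "x \<in> Omega"
      have r: "((\<lambda>h. (R (x + h) - R x) / h) \<longlongrightarrow> mx x) (at_right 0)" "((\<lambda>h. (W (x + h) - W x) / h) \<longlongrightarrow> w x) (at_right 0)"
        and Rm: "R x = m x" using elim x by auto
      have d: "((\<lambda>h. (a (x + h) - a x) / h) \<longlongrightarrow> deriv a x) (at_right 0)"
        using D[OF x] unfolding DERIV_def by (rule tendsto_mono[OF at_le, rotated]) simp
      have c: "((\<lambda>h. a (x + h)) \<longlongrightarrow> a x) (at_right 0)"
        using DERIV_isCont[OF D[OF x]] unfolding isCont_iff by (rule tendsto_mono[OF at_le, rotated]) simp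
      have "((\<lambda>h. a (x + h) * ((R (x + h) - R x) / h) + (a (x + h) - a x) / h * R x) \<longlongrightarrow> a x * mx x + deriv a x * R x) (at_right 0)"
        by (intro tendsto_intros c r d)
      moreover have "\<forall>\<^sub>F h in at_right 0. a (x + h) * ((R (x + h) - R x) / h) + (a (x + h) - a x) / h * R x = (W (x + h) - W x) / h"
      proof -
        have "\<forall>\<^sub>F h in at_right 0. h < 1 - x" using x by (intro eventually_at_rightI[of 0 "1 - x"]) auto
        then show ?thesis using eventually_at_right_less[of 0]
        proof eventually_elim
          case (elim h)
          then have "x + h \<in> Omega" using x by auto
          then show ?case using elim eq[of "x + h"] eq[OF x] by (simp add: field_simps)
        qed
      qed
      ultimately have "((\<lambda>h. (W (x + h) - W x) / h) \<longlongrightarrow> a x * mx x + deriv a x * R x) (at_right 0)"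
        by (rule Lim_transform_eventually)
      from tendsto_unique[OF _ this r(2)] Rm show "a x * mx x = w x - deriv a x * m x" by simp
    qed
  qed
qed

lemma AE_lborel_slicesI:
  fixes P :: "real \<times> real \<Rightarrow> bool"
  assumes "{w. P w} \<in> sets borel" "AE t in lborel. AE x in lborel. P (x, t)"
  shows "AE w in lborel. P w"
proof -
  have "{w. P w} \<in> sets ((lborel :: real measure) \<Otimes>\<^sub>M (lborel :: real measure))"
    using assms(1) unfolding lborel_prod by simp
  then have s: "{w \<in> space ((lborel :: real measure) \<Otimes>\<^sub>M (lborel :: real measure)). P w} \<in> sets ((lborel :: real measure) \<Otimes>\<^sub>M (lborel :: real measure))"
    by (simp add: space_pair_measure)
  have "AE x in lborel. AE t in lborel. P (x, t)"
    using assms(2) lborel_pair.AE_commute[of "\<lambda>x t. P (x, t)"] s by simp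
  from lborel_pair.AE_pair_measure[OF s this] show ?thesis unfolding lborel_prod .
qed

lemma measurable_cong_AE_lebesgue_on:
  fixes f g :: "'a :: euclidean_space \<Rightarrow> real"
  assumes f: "f \<in> borel_measurable (lebesgue_on S)" and ae: "AE x in lborel. x \<in> S \<longrightarrow> f x = g x" and S: "S \<in> sets lebesgue"
  shows "g \<in> borel_measurable (lebesgue_on S)"
proof -
  have "AE x in lebesgue. indicator S x *\<^sub>R f x = indicator S x *\<^sub>R g x"
    by (rule AE_completion) (use ae in \<open>eventually_elim, auto simp: indicator_def\<close>)
  from borel_measurable_AE[OF _ this] show ?thesis
    using f S by (simp add: borel_measurable_restrict_space_iff)
qed

text \<open>The norms are defined with the version chosen by \<open>weak_deriv\<close> on each slice
  separately. On almost every slice it may be exchanged for the jointly measurable derivatives fx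
  and fxx.\<close>

lemma space_deriv_finite:
  assumes f: "has_space_deriv T f fx" and fx: "has_space_deriv T fx fxx"
    and B: "AE t in lebesgue_on {0<..<T}. (\<integral>\<^sup>+x. ennreal ((weak_deriv (\<lambda>x. f (x, t)) x)\<^sup>2) \<partial>lebesgue_on Omega) +
      (\<integral>\<^sup>+x. ennreal (a x * (weak_deriv (weak_deriv (\<lambda>x. f (x, t))) x)\<^sup>2) \<partial>lebesgue_on Omega) \<le> B t"
    and fin: "(\<integral>\<^sup>+t. B t \<partial>lebesgue_on {0<..<T}) < \<infinity>"
  shows "(\<integral>\<^sup>+t. (\<integral>\<^sup>+x. ennreal ((fx (x, t))\<^sup>2) \<partial>lebesgue_on Omega) \<partial>lebesgue_on {0<..<T}) < \<infinity>"
    and "(\<integral>\<^sup>+t. (\<integral>\<^sup>+x. ennreal (a x * (fxx (x, t))\<^sup>2) \<partial>lebesgue_on Omega) \<partial>lebesgue_on {0<..<T}) < \<infinity>"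
proof -
  have ae: "AE t in lebesgue_on {0<..<T}. (\<integral>\<^sup>+x. ennreal ((fx (x, t))\<^sup>2) \<partial>lebesgue_on Omega) +
      (\<integral>\<^sup>+x. ennreal (a x * (fxx (x, t))\<^sup>2) \<partial>lebesgue_on Omega) \<le> B t"
    using B f[unfolded has_space_deriv_def, THEN conjunct2] fx[unfolded has_space_deriv_def, THEN conjunct2]
  proof eventually_elim
    case (elim t)
    then show ?case
      by (simp only: nn_integral_weak_deriv[OF elim(2) elim(3)])
  qed
  have "(\<integral>\<^sup>+t. (\<integral>\<^sup>+x. ennreal ((fx (x, t))\<^sup>2) \<partial>lebesgue_on Omega) \<partial>lebesgue_on {0<..<T}) \<le> (\<integral>\<^sup>+t. B t \<partial>lebesgue_on {0<..<T})"
    using ae by (intro nn_integral_mono_AE) (auto elim!: eventually_mono intro: order_trans[rotated])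
  moreover have "(\<integral>\<^sup>+t. (\<integral>\<^sup>+x. ennreal (a x * (fxx (x, t))\<^sup>2) \<partial>lebesgue_on Omega) \<partial>lebesgue_on {0<..<T}) \<le> (\<integral>\<^sup>+t. B t \<partial>lebesgue_on {0<..<T})"
    using ae by (intro nn_integral_mono_AE) (auto elim!: eventually_mono intro: order_trans[rotated])
  ultimately show "(\<integral>\<^sup>+t. (\<integral>\<^sup>+x. ennreal ((fx (x, t))\<^sup>2) \<partial>lebesgue_on Omega) \<partial>lebesgue_on {0<..<T}) < \<infinity>"
    "(\<integral>\<^sup>+t. (\<integral>\<^sup>+x. ennreal (a x * (fxx (x, t))\<^sup>2) \<partial>lebesgue_on Omega) \<partial>lebesgue_on {0<..<T}) < \<infinity>"
    using fin by (auto intro: le_less_trans)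
qed

context degenerate
begin

text \<open>Serves to read off the integrability of F and a G from the equations, whose other terms
  are square integrable.\<close>

lemma L2T_le:
  assumes [measurable]: "f \<in> borel_measurable borel" and off: "\<And>w. w \<notin> Q T \<Longrightarrow> f w = 0" and h: "L2T h"
    and le: "AE w in lborel. w \<in> Q T \<longrightarrow> \<bar>f w\<bar> \<le> h w"
  shows "L2T f"
  unfolding L2T_def
proof (intro conjI allI impI)
  show m [measurable]: "f \<in> borel_measurable N" by (simp add: borel_measurable_N)
  show "f (x, t) = 0" if "t \<notin> {0<..<T}" for x t using that by (intro off) auto
  show "integrable N (\<lambda>w. (f w)\<^sup>2)"
  proof (rule Bochner_Integration.integrable_bound)
    show "integrable N (\<lambda>w. (h w)\<^sup>2)" using h by (simp add: L2T_def)
    show "AE w in N. norm ((f w)\<^sup>2) \<le> norm ((h w)\<^sup>2)"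
    proof (rule AE_N_I)
      show "AE w in lborel. norm ((f w)\<^sup>2) \<le> norm ((h w)\<^sup>2)"
        using le
      proof eventually_elim
        case (elim w)
        show ?case
        proof (cases "w \<in> Q T")
          case True
          then show ?thesis using elim power_mono[of "\<bar>f w\<bar>" "h w" 2] by simp
        qed (simp add: off)
      qed
    qed
  qed measurable
qed

lemma L2T_abs: "L2T g \<Longrightarrow> L2T (\<lambda>w. \<bar>g w\<bar>)"
  unfolding L2T_def by auto

lemma L2T_scale: "L2T g \<Longrightarrow> L2T (\<lambda>w. k * g w)"
  using L2T_mult_cont[of g "\<lambda>_. k"] by simp

lemma version_scale:
  assumes "version T f f'"
  shows "version T (\<lambda>(x, t). a x * f (x, t)) (\<lambda>w. ab (fst w) * f' w)"
  unfolding version_def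
proof (intro conjI allI impI)
  have [measurable]: "f' \<in> borel_measurable borel" by (rule versionD(1)[OF assms])
  show "(\<lambda>w. ab (fst w) * f' w) \<in> borel_measurable borel" by measurable
  show "ab (fst w) * f' w = 0" if "w \<notin> Q T" for w using versionD(2)[OF assms that] by simp
  show "AE w in lborel. w \<in> Q T \<longrightarrow> (case w of (x, t) \<Rightarrow> a x * f (x, t)) = ab (fst w) * f' w"
    using versionD(3)[OF assms] by eventually_elim (auto simp: ab_simps)
qed

text \<open>The integral over Q with respect to dx dt is rewritten for the measure dx/a dt. There
  are four slots because the first integral of the estimate has four terms; the other integrals fill
  up with coefficient 0.\<close>

lemma nn_integral_Q_forms:
  assumes g: "L2T g1" "L2T g2" "L2T g3" "L2T g4"
    and \<eta>: "continuous_on UNIV \<eta>1" "continuous_on UNIV \<eta>2" "continuous_on UNIV \<eta>3" "continuous_on UNIV \<eta>4"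
    and nn: "\<And>t. \<eta>1 t \<ge> 0" "\<And>t. \<eta>2 t \<ge> 0" "\<And>t. \<eta>3 t \<ge> 0" "\<And>t. \<eta>4 t \<ge> 0" "c1 \<ge> 0" "c2 \<ge> 0" "c3 \<ge> 0" "c4 \<ge> 0"
    and f: "AE w in lborel. w \<in> Q T \<longrightarrow> f w = ennreal (wt (fst w) * (c1 * \<eta>1 (snd w) * (g1 w)\<^sup>2 + c2 * \<eta>2 (snd w) * (g2 w)\<^sup>2
      + c3 * \<eta>3 (snd w) * (g3 w)\<^sup>2 + c4 * \<eta>4 (snd w) * (g4 w)\<^sup>2))"
  shows "(\<integral>\<^sup>+w. f w \<partial>lebesgue_on (Q T)) = ennreal (c1 * form \<eta>1 g1 g1 + c2 * form \<eta>2 g2 g2 + c3 * form \<eta>3 g3 g3 + c4 * form \<eta>4 g4 g4)"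
proof -
  define H where "H w = c1 * (\<eta>1 (snd w) * (g1 w * g1 w)) + c2 * (\<eta>2 (snd w) * (g2 w * g2 w))
      + c3 * (\<eta>3 (snd w) * (g3 w * g3 w)) + c4 * (\<eta>4 (snd w) * (g4 w * g4 w))" for w
  note i = L2T_integrable[OF g(1,1) \<eta>(1)] L2T_integrable[OF g(2,2) \<eta>(2)] L2T_integrable[OF g(3,3) \<eta>(3)] L2T_integrable[OF g(4,4) \<eta>(4)]
  have Hi: "integrable N H" unfolding H_def using i by simp
  have H0: "H w \<ge> 0" for w unfolding H_def by (intro add_nonneg_nonneg mult_nonneg_nonneg nn zero_le_square)
  have Hb [measurable]: "H \<in> borel_measurable borel" using Hi borel_measurable_N by auto
  have "(\<integral>\<^sup>+w. f w \<partial>lebesgue_on (Q T)) = (\<integral>\<^sup>+w. ennreal (wt (fst w)) * ennreal (H w) * indicator (Q T) w \<partial>lborel)"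
  proof (rule nn_integral_lebesgue_on_Q)
    show "AE w in lborel. w \<in> Q T \<longrightarrow> f w = ennreal (wt (fst w)) * ennreal (H w)"
      using f
    proof eventually_elim
      case (elim w)
      then show ?case using H0[of w] wt_pos(1)[of "fst w"]
        by (simp add: H_def power2_eq_square mult.assoc ennreal_mult[symmetric])
    qed
  qed
  also have "\<dots> = (\<integral>\<^sup>+w. ennreal (wt (fst w)) * ennreal (H w) \<partial>lborel)"
  proof (rule nn_integral_cong)
    fix w
    show "ennreal (wt (fst w)) * ennreal (H w) * indicator (Q T) w = ennreal (wt (fst w)) * ennreal (H w)"
    proof (cases "w \<in> Q T")
      case False
      obtain x t where [simp]: "w = (x, t)" by (cases w)
      have "x \<notin> Omega \<or> t \<notin> {0<..<T}" using False by auto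
      then have "wt x = 0 \<or> H w = 0"
        using wt_pos(3)[of x] g by (auto simp: H_def L2T_def simp del: greaterThanLessThan_iff)
      then show ?thesis using False by auto
    qed simp
  qed
  also have "\<dots> = (\<integral>\<^sup>+w. ennreal (H w) \<partial>N)" by (rule nn_integral_N[symmetric]) measurable
  also have "\<dots> = ennreal (\<integral>w. H w \<partial>N)" using Hi H0 by (intro nn_integral_eq_integral) auto
  also have "(\<integral>w. H w \<partial>N) = c1 * form \<eta>1 g1 g1 + c2 * form \<eta>2 g2 g2 + c3 * form \<eta>3 g3 g3 + c4 * form \<eta>4 g4 g4"
    unfolding H_def form_def using i by simp
  finally show ?thesis .
qed

end

lemma continuous_carl [continuous_intros]: "continuous_on S (carl lam s n)"
  unfolding carl_def[abs_def] by (intro continuous_intros)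

text \<open>On the right the full first-order norms replace the derivative parts alone, and
  \<open>X\<close> and \<open>Y\<close> are added. All of this only enlarges the right side, since
  the terms are extended nonnegative.\<close>

lemma combine_terms:
  assumes nn: "f \<ge> 0" "g \<ge> 0" "\<alpha> \<ge> 0" "\<beta> \<ge> 0" "aT \<ge> 0" "a0 \<ge> 0" "b0 \<ge> 0" "C \<ge> 0" "s \<ge> 0" "l \<ge> 0" "\<phi> \<ge> 0" "E \<ge> 0" "E0 \<ge> 0"
    and L: "L \<le> C * f + C * g + C * s * (s * l * \<phi> * \<alpha> + \<beta>) * E + C * (s * l * \<phi> * aT) * E + C * (s * l * a0 + b0) * E0"
  shows "ennreal L \<le> ennreal C * ennreal f + ennreal C * ennreal g + ennreal (C * s) * (ennreal (s * l * \<phi>) * ennreal \<alpha> + (ennreal \<alpha> + ennreal \<beta>)) * ennreal E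
    + X + ennreal C * (ennreal (s * l * \<phi>) * ennreal aT + Y) * ennreal E + ennreal C * (ennreal (s * l) * ennreal a0 + (ennreal a0 + ennreal b0)) * ennreal E0"
proof -
  have "ennreal L \<le> ennreal (C * f + C * g + C * s * (s * l * \<phi> * \<alpha> + \<beta>) * E + C * (s * l * \<phi> * aT) * E + C * (s * l * a0 + b0) * E0)"
    using L by (rule ennreal_leI)
  also have "\<dots> = ennreal C * ennreal f + ennreal C * ennreal g + ennreal (C * s) * (ennreal (s * l * \<phi>) * ennreal \<alpha> + ennreal \<beta>) * ennreal E
    + 0 + ennreal C * (ennreal (s * l * \<phi>) * ennreal aT + 0) * ennreal E + ennreal C * (ennreal (s * l) * ennreal a0 + ennreal b0) * ennreal E0"
    using nn by (simp add: ennreal_plus ennreal_mult)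
  also have "\<dots> \<le> ennreal C * ennreal f + ennreal C * ennreal g + ennreal (C * s) * (ennreal (s * l * \<phi>) * ennreal \<alpha> + (ennreal \<alpha> + ennreal \<beta>)) * ennreal E
    + X + ennreal C * (ennreal (s * l * \<phi>) * ennreal aT + Y) * ennreal E + ennreal C * (ennreal (s * l) * ennreal a0 + (ennreal a0 + ennreal b0)) * ennreal E0"
    by (intro add_mono mult_mono order_refl zero_le) (simp_all add: add_increasing)
  finally show ?thesis .
qed

section \<open>The linearized mean-field game system\<close>

lemma Bochner_L2D:
  assumes "f \<in> Bochner_L2 T X N"
  shows "f \<in> borel_measurable (lebesgue_on (Q T))" "AE t in lebesgue_on {0<..<T}. (\<lambda>x. f (x, t)) \<in> X"
    "(\<integral>\<^sup>+t. N (\<lambda>x. f (x, t)) \<partial>lebesgue_on {0<..<T}) < \<infinity>"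
  using assms by (auto simp: Bochner_L2_def)

lemma L2_inv_measurable: "L2_inv a \<subseteq> borel_measurable (lebesgue_on Omega)"
  by (auto simp: L2_inv_def L2_def)

lemma H2_inv_space_deriv_finite:
  assumes u: "u \<in> Bochner_L2 T (H2_inv a) (nsq2_inv a)" and d: "has_space_deriv T u ux" "has_space_deriv T ux uxx"
  shows "(\<integral>\<^sup>+t. (\<integral>\<^sup>+x. ennreal ((ux (x, t))\<^sup>2) \<partial>lebesgue_on Omega) \<partial>lebesgue_on {0<..<T}) < \<infinity>"
    and "(\<integral>\<^sup>+t. (\<integral>\<^sup>+x. ennreal (a x * (uxx (x, t))\<^sup>2) \<partial>lebesgue_on Omega) \<partial>lebesgue_on {0<..<T}) < \<infinity>"
proof -
  have "AE t in lebesgue_on {0<..<T}. (\<integral>\<^sup>+x. ennreal ((weak_deriv (\<lambda>x. u (x, t)) x)\<^sup>2) \<partial>lebesgue_on Omega) +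
      (\<integral>\<^sup>+x. ennreal (a x * (weak_deriv (weak_deriv (\<lambda>x. u (x, t))) x)\<^sup>2) \<partial>lebesgue_on Omega) \<le> nsq2_inv a (\<lambda>x. u (x, t))"
    using Bochner_L2D(2)[OF u]
  proof eventually_elim
    case (elim t)
    then have "(\<lambda>x. u (x, t)) \<in> H1_inv a" by (simp add: H2_inv_def)
    with elim show ?case by (simp add: nsq2_inv_def nsq1_inv_def add_right_mono)
  qed
  from space_deriv_finite[OF d this Bochner_L2D(3)[OF u]]
  show "(\<integral>\<^sup>+t. (\<integral>\<^sup>+x. ennreal ((ux (x, t))\<^sup>2) \<partial>lebesgue_on Omega) \<partial>lebesgue_on {0<..<T}) < \<infinity>"
    and "(\<integral>\<^sup>+t. (\<integral>\<^sup>+x. ennreal (a x * (uxx (x, t))\<^sup>2) \<partial>lebesgue_on Omega) \<partial>lebesgue_on {0<..<T}) < \<infinity>" by auto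
qed

lemma H2_wt_space_deriv_finite:
  assumes m: "m \<in> Bochner_L2 T (H2_wt a) (nsq2_wt a)"
    and d: "has_space_deriv T (\<lambda>(x, t). a x * m (x, t)) w" "has_space_deriv T w wx"
  shows "(\<integral>\<^sup>+t. (\<integral>\<^sup>+x. ennreal ((w (x, t))\<^sup>2) \<partial>lebesgue_on Omega) \<partial>lebesgue_on {0<..<T}) < \<infinity>"
    and "(\<integral>\<^sup>+t. (\<integral>\<^sup>+x. ennreal (a x * (wx (x, t))\<^sup>2) \<partial>lebesgue_on Omega) \<partial>lebesgue_on {0<..<T}) < \<infinity>"
proof -
  have "AE t in lebesgue_on {0<..<T}. (\<integral>\<^sup>+x. ennreal ((weak_deriv (\<lambda>x. case (x, t) of (x, t) \<Rightarrow> a x * m (x, t)) x)\<^sup>2) \<partial>lebesgue_on Omega) +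
      (\<integral>\<^sup>+x. ennreal (a x * (weak_deriv (weak_deriv (\<lambda>x. case (x, t) of (x, t) \<Rightarrow> a x * m (x, t))) x)\<^sup>2) \<partial>lebesgue_on Omega) \<le> nsq2_wt a (\<lambda>x. m (x, t))"
    using Bochner_L2D(2)[OF m]
  proof eventually_elim
    case (elim t)
    then have "(\<lambda>x. m (x, t)) \<in> H1_wt a" by (simp add: H2_wt_def)
    with elim show ?case by (simp add: nsq2_wt_def nsq1_wt_def add_right_mono)
  qed
  from space_deriv_finite[OF d this Bochner_L2D(3)[OF m]]
  show "(\<integral>\<^sup>+t. (\<integral>\<^sup>+x. ennreal ((w (x, t))\<^sup>2) \<partial>lebesgue_on Omega) \<partial>lebesgue_on {0<..<T}) < \<infinity>"
    and "(\<integral>\<^sup>+t. (\<integral>\<^sup>+x. ennreal (a x * (wx (x, t))\<^sup>2) \<partial>lebesgue_on Omega) \<partial>lebesgue_on {0<..<T}) < \<infinity>" by auto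
qed

lemma (in time_cylinder) form_nonneg: "(\<And>t. \<eta> t \<ge> 0) \<Longrightarrow> form \<eta> g g \<ge> 0"
  unfolding form_def by (intro integral_nonneg_AE always_eventually allI) simp

context degenerate
begin

text \<open>\<open>X\<close> and \<open>Y\<close> are arbitrary and stand for the contributions of
  u(., 0) and of the norm of first order of m at T. The energy inequalities do not produce these
  terms: the boundary contributions at the corresponding times have the favourable sign.\<close>

lemma estimate:
  assumes k: "k \<ge> 1" and lam_large: "lam \<ge> 6000 * k^4" and s: "s \<ge> 1"
    and u: "u \<in> Bochner_L2 T (L2_inv a) (nsq_inv a)" "u \<in> Bochner_L2 T (H2_inv a) (nsq2_inv a)"
    and ut: "ut \<in> Bochner_L2 T (L2_inv a) (nsq_inv a)" "has_time_deriv T u ut"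
    and ux: "has_space_deriv T u ux" "has_space_deriv T ux uxx"
    and m: "m \<in> Bochner_L2 T (L2_wt a) (nsq_wt a)" "m \<in> Bochner_L2 T (H2_wt a) (nsq2_wt a)"
    and mt: "mt \<in> Bochner_L2 T (L2_wt a) (nsq_wt a)" "has_time_deriv T m mt"
    and amx: "has_space_deriv T (\<lambda>(x, t). a x * m (x, t)) amx" "has_space_deriv T amx amxx"
    and F: "F \<in> borel_measurable (lebesgue_on (Q T))" and G: "G \<in> borel_measurable (lebesgue_on (Q T))"
    and eq_u: "AE w in lborel. w \<in> Q T \<longrightarrow> \<bar>ut w + a (fst w) * uxx w - F w\<bar> \<le>
      k * (sqrt (a (fst w)) * \<bar>ux w\<bar> + a (fst w) * \<bar>m w\<bar>)"
    and eq_m: "AE w in lborel. w \<in> Q T \<longrightarrow> \<bar>a (fst w) * mt w - a (fst w) * amxx w - a (fst w) * G w\<bar> \<le>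
      k * (sqrt (a (fst w)) * \<bar>amx w\<bar> + a (fst w) * \<bar>m w\<bar> + sqrt (a (fst w)) * \<bar>ux w\<bar> + a (fst w) * \<bar>uxx w\<bar>)"
    and van: "AE t in lebesgue_on {0<..<T}. vanishes_at_ends (\<lambda>x. u (x, t)) \<and> vanishes_at_ends (\<lambda>x. a x * m (x, t))"
    and m0: "has_time_value T (L2_wt a) (nsq_wt a) m 0 m0"
    and h: "has_time_value T (L2_inv a) (nsq_inv a) u T h"
    and mT: "has_time_value T (L2_wt a) (nsq_wt a) m T mT"
    and C: "C = 2000000 * k^4 * exp (lam * T)"
  shows "(\<integral>\<^sup>+(x, t). ennreal (
           ((ut (x, t))\<^sup>2 / a x + a x * (uxx (x, t))\<^sup>2 + s * lam * exp (lam * t) * (ux (x, t))\<^sup>2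
            + s\<^sup>2 * lam\<^sup>2 * (exp (lam * t))\<^sup>2 / a x * (u (x, t))\<^sup>2) * exp (2 * s * exp (lam * t))) \<partial>lebesgue_on (Q T))
      + (\<integral>\<^sup>+(x, t). ennreal (
           1 / (s * exp (lam * t)) * (a x * (amxx (x, t))\<^sup>2 + a x * (mt (x, t))\<^sup>2) * exp (2 * s * exp (lam * t)))
           \<partial>lebesgue_on (Q T))
      + (\<integral>\<^sup>+(x, t). ennreal (lam * (amx (x, t))\<^sup>2 * exp (2 * s * exp (lam * t))) \<partial>lebesgue_on (Q T))
      + (\<integral>\<^sup>+(x, t). ennreal (s * lam\<^sup>2 * exp (lam * t) * a x * (m (x, t))\<^sup>2 * exp (2 * s * exp (lam * t)))
           \<partial>lebesgue_on (Q T))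
      \<le> ennreal C * (\<integral>\<^sup>+(x, t). ennreal (s * exp (lam * t) * (1 / a x) * (F (x, t))\<^sup>2 * exp (2 * s * exp (lam * t)))
                        \<partial>lebesgue_on (Q T))
      + ennreal C * (\<integral>\<^sup>+(x, t). ennreal (a x * (G (x, t))\<^sup>2 * exp (2 * s * exp (lam * t))) \<partial>lebesgue_on (Q T))
      + ennreal (C * s) * (ennreal (s * lam * exp (lam * T)) * nsq_inv a h + nsq1_inv a h)
          * ennreal (exp (2 * s * exp (lam * T)))
      + X
      + ennreal C * (ennreal (s * lam * exp (lam * T)) * nsq_wt a mT + Y)
          * ennreal (exp (2 * s * exp (lam * T)))
      + ennreal C * (ennreal (s * lam) * nsq_wt a m0 + nsq1_wt a m0) * ennreal (exp (2 * s))"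
    (is "?LHS \<le> ?RHS")
proof -
  have "k^4 \<ge> 1" using k by (rule one_le_power)
  then have lam: "lam \<ge> 1" using lam_large by simp
  have Cpos: "C > 0" using k by (simp add: C)
  obtain u' where u': "version T u u'" using version_exists[OF Bochner_L2D(1)[OF u(1)]] .
  obtain ut' where ut': "version T ut ut'" using version_exists[OF Bochner_L2D(1)[OF ut(1)]] .
  obtain m' where m': "version T m m'" using version_exists[OF Bochner_L2D(1)[OF m(1)]] .
  obtain mt' where mt': "version T mt mt'" using version_exists[OF Bochner_L2D(1)[OF mt(1)]] .
  obtain ux' where ux': "version T ux ux'" using version_exists ux(1) unfolding has_space_deriv_def by blast
  obtain uxx' where uxx': "version T uxx uxx'" using version_exists ux(2) unfolding has_space_deriv_def by blast
  obtain amx' where amx': "version T amx amx'" using version_exists amx(1) unfolding has_space_deriv_def by blast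
  obtain amxx' where amxx': "version T amxx amxx'" using version_exists amx(2) unfolding has_space_deriv_def by blast
  obtain F' where F': "version T F F'" using version_exists[OF F] .
  obtain G1 where G1: "version T G G1" using version_exists[OF G] .
  define G' where "G' w = ab (fst w) * G1 w" for w
  define z' zt' where "z' w = ab (fst w) * m' w" and "zt' w = ab (fst w) * mt' w" for w
  have z': "version T (\<lambda>(x, t). a x * m (x, t)) z'" "version T (\<lambda>(x, t). a x * mt (x, t)) zt'"
    "version T (\<lambda>(x, t). a x * G (x, t)) G'"
    using version_scale[OF m'] version_scale[OF mt'] version_scale[OF G1] by (simp_all add: z'_def[abs_def] zt'_def[abs_def] G'_def[abs_def])
  have "regular_slab a T u' ut' ux' uxx'"
  proof (rule regular_slab_version[OF u' ut' ux' uxx' ut(2) _ Bochner_L2D(3)[OF u(1)] Bochner_L2D(3)[OF ut(1)] H2_inv_space_deriv_finite[OF u(2) ux]])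
    show "AE t in lebesgue_on {0<..<T}. has_weak_deriv Omega (\<lambda>x. u (x, t)) (\<lambda>x. ux (x, t)) \<and>
      has_weak_deriv Omega (\<lambda>x. ux (x, t)) (\<lambda>x. uxx (x, t)) \<and> vanishes_at_ends (\<lambda>x. u (x, t))"
      using ux[unfolded has_space_deriv_def] van by (auto elim: eventually_elim2)
  qed
  then interpret U: regular_slab a T u' ut' ux' uxx' .
  have "regular_slab a T z' zt' amx' amxx'"
  proof (rule regular_slab_version[OF z'(1,2) amx' amxx' has_time_deriv_scale[OF mt(2)] _ _ _ H2_wt_space_deriv_finite[OF m(2) amx]])
    show "AE t in lebesgue_on {0<..<T}. has_weak_deriv Omega (\<lambda>x. case (x, t) of (x, t) \<Rightarrow> a x * m (x, t)) (\<lambda>x. amx (x, t)) \<and>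
      has_weak_deriv Omega (\<lambda>x. amx (x, t)) (\<lambda>x. amxx (x, t)) \<and> vanishes_at_ends (\<lambda>x. case (x, t) of (x, t) \<Rightarrow> a x * m (x, t))"
      using amx[unfolded has_space_deriv_def] van by (auto elim: eventually_elim2)
    show "(\<integral>\<^sup>+t. nsq_inv a (\<lambda>x. case (x, t) of (x, t) \<Rightarrow> a x * m (x, t)) \<partial>lebesgue_on {0<..<T}) < \<infinity>"
      using Bochner_L2D(3)[OF m(1)] by (simp add: nsq_wt_scale)
    show "(\<integral>\<^sup>+t. nsq_inv a (\<lambda>x. case (x, t) of (x, t) \<Rightarrow> a x * mt (x, t)) \<partial>lebesgue_on {0<..<T}) < \<infinity>"
      using Bochner_L2D(3)[OF mt(1)] by (simp add: nsq_wt_scale)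
  qed
  then interpret Z: regular_slab a T z' zt' amx' amxx' .
  interpret C: carleman M T lam s
    by (intro carleman.intro carleman_axioms.intro time_cylinder_axioms lam s)
  note vs = versionD(3)[OF u'] versionD(3)[OF ut'] versionD(3)[OF ux'] versionD(3)[OF uxx'] versionD(3)[OF m']
    versionD(3)[OF mt'] versionD(3)[OF amx'] versionD(3)[OF amxx'] versionD(3)[OF F'] versionD(3)[OF G1]
  have ineq_u: "AE w in lborel. w \<in> Q T \<longrightarrow> \<bar>ut' w + U.p w - F' w\<bar> \<le> k * (\<bar>U.q w\<bar> + \<bar>z' w\<bar>)"
    using eq_u vs
  proof eventually_elim
    case (elim w)
    show ?case
    proof
      assume w: "w \<in> Q T"
      then have "fst w \<in> Omega" by auto
      then show "\<bar>ut' w + U.p w - F' w\<bar> \<le> k * (\<bar>U.q w\<bar> + \<bar>z' w\<bar>)"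
        using elim w a_pos[of "fst w"] by (simp add: U.p_def U.q_def z'_def ab_simps abs_mult)
    qed
  qed
  have ineq_m: "AE w in lborel. w \<in> Q T \<longrightarrow> \<bar>zt' w - Z.p w - G' w\<bar> \<le> k * (\<bar>Z.q w\<bar> + \<bar>z' w\<bar> + \<bar>U.q w\<bar> + \<bar>U.p w\<bar>)"
    using eq_m vs
  proof eventually_elim
    case (elim w)
    show ?case
    proof
      assume w: "w \<in> Q T"
      then have "fst w \<in> Omega" by auto
      then show "\<bar>zt' w - Z.p w - G' w\<bar> \<le> k * (\<bar>Z.q w\<bar> + \<bar>z' w\<bar> + \<bar>U.q w\<bar> + \<bar>U.p w\<bar>)"
        using elim w a_pos[of "fst w"] by (simp add: U.p_def U.q_def Z.p_def Z.q_def z'_def zt'_def G'_def ab_simps abs_mult)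
    qed
  qed
  \<comment> \<open>Square integrability of F in the weight 1/a is a consequence of the first
    equation, because all other terms of it have this property.\<close>
  have F'_L2: "L2T F'"
  proof (rule L2T_le[OF versionD(1,2)[OF F']])
    show "L2T (\<lambda>w. (\<bar>ut' w\<bar> + \<bar>U.p w\<bar>) + k * (\<bar>U.q w\<bar> + \<bar>z' w\<bar>))"
      by (intro L2T_add L2T_scale L2T_abs U.zt U.p U.q Z.z)
    show "AE w in lborel. w \<in> Q T \<longrightarrow> \<bar>F' w\<bar> \<le> (\<bar>ut' w\<bar> + \<bar>U.p w\<bar>) + k * (\<bar>U.q w\<bar> + \<bar>z' w\<bar>)"
      using ineq_u by eventually_elim linarith
  qed
  have G'_L2: "L2T G'"
  proof (rule L2T_le[OF versionD(1,2)[OF z'(3)]])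
    show "L2T (\<lambda>w. (\<bar>zt' w\<bar> + \<bar>Z.p w\<bar>) + k * (\<bar>Z.q w\<bar> + \<bar>z' w\<bar> + \<bar>U.q w\<bar> + \<bar>U.p w\<bar>))"
      by (intro L2T_add L2T_scale L2T_abs U.p U.q Z.z Z.zt Z.p Z.q)
    show "AE w in lborel. w \<in> Q T \<longrightarrow> \<bar>G' w\<bar> \<le> (\<bar>zt' w\<bar> + \<bar>Z.p w\<bar>) + k * (\<bar>Z.q w\<bar> + \<bar>z' w\<bar> + \<bar>U.q w\<bar> + \<bar>U.p w\<bar>)"
      using ineq_m by eventually_elim linarith
  qed
  have off: "w \<notin> Q T \<Longrightarrow> ut' w = 0 \<and> U.p w = 0 \<and> F' w = 0 \<and> zt' w = 0 \<and> Z.p w = 0 \<and> G' w = 0" for w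
    using versionD(2)[OF ut'] versionD(2)[OF uxx'] versionD(2)[OF F'] versionD(2)[OF mt'] versionD(2)[OF amxx'] versionD(2)[OF G1]
    by (simp add: U.p_def Z.p_def zt'_def G'_def)
  have N_u: "AE w in N. \<bar>ut' w + U.p w\<bar> \<le> k * (\<bar>U.q w\<bar> + \<bar>z' w\<bar>) + \<bar>F' w\<bar>"
  proof (rule AE_N_I)
    show "AE w in lborel. \<bar>ut' w + U.p w\<bar> \<le> k * (\<bar>U.q w\<bar> + \<bar>z' w\<bar>) + \<bar>F' w\<bar>"
      using ineq_u
    proof eventually_elim
      case (elim w)
      then show ?case using off[of w] k by (cases "w \<in> Q T") (linarith, simp)
    qed
  qed
  have N_m: "AE w in N. \<bar>zt' w - Z.p w\<bar> \<le> k * (\<bar>Z.q w\<bar> + \<bar>z' w\<bar> + \<bar>U.q w\<bar> + \<bar>U.p w\<bar>) + \<bar>G' w\<bar>"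
  proof (rule AE_N_I)
    show "AE w in lborel. \<bar>zt' w - Z.p w\<bar> \<le> k * (\<bar>Z.q w\<bar> + \<bar>z' w\<bar> + \<bar>U.q w\<bar> + \<bar>U.p w\<bar>) + \<bar>G' w\<bar>"
      using ineq_m
    proof eventually_elim
      case (elim w)
      then show ?case using off[of w] k by (cases "w \<in> Q T") (linarith, simp)
    qed
  qed
  have T0: "0 \<in> {0..T}" "T \<in> {0..T}" using T by auto
  have h_val: "AE x in M. h x = U.val T x"
    by (rule U.time_value_val[OF h L2_inv_measurable T0(2) u'])
  have m0_val: "AE x in M. a x * m0 x = Z.val 0 x"
    by (rule Z.time_value_val[OF has_time_value_scale[OF m0] subset_refl T0(1) z'(1)])
  have mT_val: "AE x in M. a x * mT x = Z.val T x"
    by (rule Z.time_value_val[OF has_time_value_scale[OF mT] subset_refl T0(2) z'(1)])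
  have AE_leb: "AE x in lebesgue. x \<in> Omega \<longrightarrow> P x" if "AE x in M. P x" for P
    by (rule AE_completion) (use that in \<open>simp only: AE_M_iff\<close>)
  show ?thesis
  \<comment> \<open>If one of these norms is infinite, the right side is infinite. Otherwise the
    time values have the regularity that the final and initial energy inequalities ask for.\<close>
  proof (cases "nsq1_inv a h = \<infinity> \<or> nsq1_wt a m0 = \<infinity> \<or> nsq_wt a mT = \<infinity>")
    case True
    have R: "?RHS = top"
      using True Cpos s lam by (auto simp: ennreal_mult_eq_top_iff)
    show ?thesis unfolding R by (rule top_greatest)
  next
    case False
    have hH: "h \<in> H1_inv a" and m0H: "m0 \<in> H1_wt a" and mTf: "nsq_inv a (\<lambda>x. a x * mT x) < \<infinity>"
      using False by (auto simp: nsq1_inv_def nsq1_wt_def nsq_wt_scale less_top split: if_splits)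
    have hf: "nsq_inv a h < \<infinity>" and m0f: "nsq_inv a (\<lambda>x. a x * m0 x) < \<infinity>"
      using hH m0H by (auto simp: H1_inv_def L2_inv_def H1_wt_def L2_wt_def nsq_wt_scale)
    note hv = nsq_inv_integral_M[OF U.val_borel h_val hf]
    note m0v = nsq_inv_integral_M[OF Z.val_borel m0_val m0f]
    note mTv = nsq_inv_integral_M[OF Z.val_borel mT_val mTf]
    obtain g where g: "g \<in> L2" "has_weak_deriv Omega h g" using hH by (auto simp: H1_inv_def H1_0_def)
    have hvan: "vanishes_at_ends h" using hH by (intro H1_0_vanishes) (simp add: H1_inv_def)
    note hd = H10_weak_deriv[OF g(2,1) hvan]
    obtain g0 where g0: "g0 \<in> L2" "has_weak_deriv Omega (\<lambda>x. a x * m0 x) g0" and m0van: "vanishes_at_ends (\<lambda>x. a x * m0 x)"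
      using m0H by (auto simp: H1_wt_def)
    note m0d = H10_weak_deriv[OF g0(2,1) m0van]
    define \<alpha> where "\<alpha> = (\<integral>x. (U.val T x)\<^sup>2 \<partial>M)"
    define \<beta> where "\<beta> = (LINT x:Omega|lebesgue. (weak_deriv h x)\<^sup>2)"
    define aT where "aT = (\<integral>x. (Z.val T x)\<^sup>2 \<partial>M)"
    define a0 where "a0 = (\<integral>x. (Z.val 0 x)\<^sup>2 \<partial>M)"
    define b0 where "b0 = (LINT x:Omega|lebesgue. (weak_deriv (\<lambda>x. a x * m0 x) x)\<^sup>2)"
    have nn: "\<alpha> \<ge> 0" "\<beta> \<ge> 0" "aT \<ge> 0" "a0 \<ge> 0" "b0 \<ge> 0"
      by (simp_all add: \<alpha>_def \<beta>_def aT_def a0_def b0_def set_lebesgue_integral_def)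
    have norms: "nsq_inv a h = ennreal \<alpha>" "nsq1_inv a h = ennreal \<alpha> + ennreal \<beta>"
      "nsq_wt a mT = ennreal aT" "nsq_wt a m0 = ennreal a0" "nsq1_wt a m0 = ennreal a0 + ennreal b0"
      using hv(2) hd(2) m0v(2) m0d(2) mTv(2) hH m0H
      by (simp_all add: \<alpha>_def \<beta>_def aT_def a0_def b0_def nsq1_inv_def nsq1_wt_def nsq_wt_scale)
    have car: "C.J 0 ut' ut' + C.J 0 U.p U.p + s * lam * C.J 1 U.q U.q + s\<^sup>2 * lam\<^sup>2 * C.J 2 u' u' +
        ((C.Jm Z.p + C.Jm zt') / s + lam * C.J 0 Z.q Z.q + s * lam\<^sup>2 * C.J 1 z' z')
      \<le> 2000000 * k ^ 4 * (s * C.J 1 F' F' + C.J 0 G' G'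
        + exp (lam * T) * (s * (s * lam * exp (lam * T) * \<alpha> + \<beta>)) * exp (2 * s * exp (lam * T))
        + s * lam * exp (lam * T) * aT * exp (2 * s * exp (lam * T)) + (s * lam * a0 + b0) * exp (2 * s))"
      by (rule C.carleman_system[OF k lam_large U.z U.zt U.p U.q Z.z Z.zt Z.p Z.q F'_L2 G'_L2 N_u N_m
      U.final_deriv[OF hv(1) H10_cong_AE[OF hd(1) AE_leb[OF h_val]]] U.final_sq[OF hv(1)] U.green
      Z.initial_deriv[OF m0v(1) H10_cong_AE[OF m0d(1) AE_leb[OF m0_val]]] Z.final_sq[OF mTv(1)] Z.initial_sq[OF m0v(1)] Z.green,
      folded \<alpha>_def \<beta>_def aT_def a0_def b0_def, OF _ _ _ _ _ _ _ nn])
    let ?c = "carl lam s" and ?e = "\<lambda>t. exp (- lam * t) * carl lam s 0 t"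
    have cc: "continuous_on UNIV (?c n)" "continuous_on UNIV ?e" "?c n t \<ge> 0" "?e t \<ge> 0" for n t
      by (auto intro!: continuous_intros mult_nonneg_nonneg less_imp_le[OF carl_pos])
    have QO: "w \<in> Q T \<Longrightarrow> wt (fst w) = 1 / a (fst w) \<and> ab (fst w) = a (fst w) \<and> a (fst w) > 0 \<and> (sqrt (a (fst w)))\<^sup>2 = a (fst w)" for w
      using wt_pos(4)[of "fst w"] ab_simps(1)[of "fst w"] a_pos[of "fst w"] by auto
    have sqrt_twice: "sqrt A * (sqrt A * y) = A * y" if "A > 0" for A y :: real
      using that by (simp flip: mult.assoc)
    have I1: "(\<integral>\<^sup>+(x, t). ennreal (
           ((ut (x, t))\<^sup>2 / a x + a x * (uxx (x, t))\<^sup>2 + s * lam * exp (lam * t) * (ux (x, t))\<^sup>2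
            + s\<^sup>2 * lam\<^sup>2 * (exp (lam * t))\<^sup>2 / a x * (u (x, t))\<^sup>2) * exp (2 * s * exp (lam * t))) \<partial>lebesgue_on (Q T))
       = ennreal (1 * form (?c 0) ut' ut' + 1 * form (?c 0) U.p U.p + s * lam * form (?c 1) U.q U.q + s\<^sup>2 * lam\<^sup>2 * form (?c 2) u' u')"
    proof (rule nn_integral_Q_forms[OF U.zt U.p U.q U.z cc(1,1,1,1) cc(3,3,3,3)], goal_cases)
      case 5
      show ?case using vs
      proof eventually_elim
        case (elim w)
        show ?case
        proof
          assume w: "w \<in> Q T"
          show "(case w of (x, t) \<Rightarrow> ennreal (
           ((ut (x, t))\<^sup>2 / a x + a x * (uxx (x, t))\<^sup>2 + s * lam * exp (lam * t) * (ux (x, t))\<^sup>2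
            + s\<^sup>2 * lam\<^sup>2 * (exp (lam * t))\<^sup>2 / a x * (u (x, t))\<^sup>2) * exp (2 * s * exp (lam * t))))
            = ennreal (wt (fst w) * (1 * ?c 0 (snd w) * (ut' w)\<^sup>2 + 1 * ?c 0 (snd w) * (U.p w)\<^sup>2
              + s * lam * ?c 1 (snd w) * (U.q w)\<^sup>2 + s\<^sup>2 * lam\<^sup>2 * ?c 2 (snd w) * (u' w)\<^sup>2))"
            using elim w QO[OF w] by (cases w) (simp add: U.p_def U.q_def carl_def power_mult_distrib field_simps power2_eq_square sqrt_twice)
        qed
      qed
    qed (use s lam in auto)
    have I2: "(\<integral>\<^sup>+(x, t). ennreal (
           1 / (s * exp (lam * t)) * (a x * (amxx (x, t))\<^sup>2 + a x * (mt (x, t))\<^sup>2) * exp (2 * s * exp (lam * t)))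
           \<partial>lebesgue_on (Q T))
       = ennreal (1 / s * form ?e Z.p Z.p + 1 / s * form ?e zt' zt' + 0 * form ?e zt' zt' + 0 * form ?e zt' zt')"
    proof (rule nn_integral_Q_forms[OF Z.p Z.zt Z.zt Z.zt cc(2,2,2,2) cc(4,4,4,4)], goal_cases)
      case 5
      show ?case using vs
      proof eventually_elim
        case (elim w)
        show ?case
        proof
          assume w: "w \<in> Q T"
          show "(case w of (x, t) \<Rightarrow> ennreal (
           1 / (s * exp (lam * t)) * (a x * (amxx (x, t))\<^sup>2 + a x * (mt (x, t))\<^sup>2) * exp (2 * s * exp (lam * t))))
            = ennreal (wt (fst w) * (1 / s * ?e (snd w) * (Z.p w)\<^sup>2 + 1 / s * ?e (snd w) * (zt' w)\<^sup>2
              + 0 * ?e (snd w) * (zt' w)\<^sup>2 + 0 * ?e (snd w) * (zt' w)\<^sup>2))"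
            using elim w QO[OF w] s by (cases w, simp only: prod.case fst_conv snd_conv, intro arg_cong[where f = ennreal])
                (simp add: Z.p_def zt'_def carl_def power_mult_distrib exp_minus field_simps power2_eq_square)
        qed
      qed
    qed (use s lam in auto)
    have I3: "(\<integral>\<^sup>+(x, t). ennreal (lam * (amx (x, t))\<^sup>2 * exp (2 * s * exp (lam * t))) \<partial>lebesgue_on (Q T))
       = ennreal (lam * form (?c 0) Z.q Z.q + 0 * form (?c 0) Z.q Z.q + 0 * form (?c 0) Z.q Z.q + 0 * form (?c 0) Z.q Z.q)"
    proof (rule nn_integral_Q_forms[OF Z.q Z.q Z.q Z.q cc(1,1,1,1) cc(3,3,3,3)], goal_cases)
      case 5
      show ?case using vs
      proof eventually_elim
        case (elim w)
        show ?case
        proof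
          assume w: "w \<in> Q T"
          show "(case w of (x, t) \<Rightarrow> ennreal (lam * (amx (x, t))\<^sup>2 * exp (2 * s * exp (lam * t))))
            = ennreal (wt (fst w) * (lam * ?c 0 (snd w) * (Z.q w)\<^sup>2 + 0 * ?c 0 (snd w) * (Z.q w)\<^sup>2
              + 0 * ?c 0 (snd w) * (Z.q w)\<^sup>2 + 0 * ?c 0 (snd w) * (Z.q w)\<^sup>2))"
            using elim w QO[OF w] by (cases w) (simp add: Z.q_def carl_def power_mult_distrib mult_ac)
        qed
      qed
    qed (use s lam in auto)
    have I4: "(\<integral>\<^sup>+(x, t). ennreal (s * lam\<^sup>2 * exp (lam * t) * a x * (m (x, t))\<^sup>2 * exp (2 * s * exp (lam * t))) \<partial>lebesgue_on (Q T))
       = ennreal (s * lam\<^sup>2 * form (?c 1) z' z' + 0 * form (?c 1) z' z' + 0 * form (?c 1) z' z' + 0 * form (?c 1) z' z')"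
    proof (rule nn_integral_Q_forms[OF Z.z Z.z Z.z Z.z cc(1,1,1,1) cc(3,3,3,3)], goal_cases)
      case 5
      show ?case using vs
      proof eventually_elim
        case (elim w)
        show ?case
        proof
          assume w: "w \<in> Q T"
          show "(case w of (x, t) \<Rightarrow> ennreal (s * lam\<^sup>2 * exp (lam * t) * a x * (m (x, t))\<^sup>2 * exp (2 * s * exp (lam * t))))
            = ennreal (wt (fst w) * (s * lam\<^sup>2 * ?c 1 (snd w) * (z' w)\<^sup>2 + 0 * ?c 1 (snd w) * (z' w)\<^sup>2
              + 0 * ?c 1 (snd w) * (z' w)\<^sup>2 + 0 * ?c 1 (snd w) * (z' w)\<^sup>2))"
            using elim w QO[OF w] by (cases w) (simp add: z'_def carl_def power2_eq_square mult_ac)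
        qed
      qed
    qed (use s lam in auto)
    have I5: "(\<integral>\<^sup>+(x, t). ennreal (s * exp (lam * t) * (1 / a x) * (F (x, t))\<^sup>2 * exp (2 * s * exp (lam * t))) \<partial>lebesgue_on (Q T))
       = ennreal (s * form (?c 1) F' F' + 0 * form (?c 1) F' F' + 0 * form (?c 1) F' F' + 0 * form (?c 1) F' F')"
    proof (rule nn_integral_Q_forms[OF F'_L2 F'_L2 F'_L2 F'_L2 cc(1,1,1,1) cc(3,3,3,3)], goal_cases)
      case 5
      show ?case using vs
      proof eventually_elim
        case (elim w)
        show ?case
        proof
          assume w: "w \<in> Q T"
          show "(case w of (x, t) \<Rightarrow> ennreal (s * exp (lam * t) * (1 / a x) * (F (x, t))\<^sup>2 * exp (2 * s * exp (lam * t))))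
            = ennreal (wt (fst w) * (s * ?c 1 (snd w) * (F' w)\<^sup>2 + 0 * ?c 1 (snd w) * (F' w)\<^sup>2
              + 0 * ?c 1 (snd w) * (F' w)\<^sup>2 + 0 * ?c 1 (snd w) * (F' w)\<^sup>2))"
            using elim w QO[OF w] by (cases w) (simp add: carl_def mult_ac)
        qed
      qed
    qed (use s lam in auto)
    have I6: "(\<integral>\<^sup>+(x, t). ennreal (a x * (G (x, t))\<^sup>2 * exp (2 * s * exp (lam * t))) \<partial>lebesgue_on (Q T))
       = ennreal (1 * form (?c 0) G' G' + 0 * form (?c 0) G' G' + 0 * form (?c 0) G' G' + 0 * form (?c 0) G' G')"
    proof (rule nn_integral_Q_forms[OF G'_L2 G'_L2 G'_L2 G'_L2 cc(1,1,1,1) cc(3,3,3,3)], goal_cases)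
      case 5
      show ?case using vs
      proof eventually_elim
        case (elim w)
        show ?case
        proof
          assume w: "w \<in> Q T"
          show "(case w of (x, t) \<Rightarrow> ennreal (a x * (G (x, t))\<^sup>2 * exp (2 * s * exp (lam * t))))
            = ennreal (wt (fst w) * (1 * ?c 0 (snd w) * (G' w)\<^sup>2 + 0 * ?c 0 (snd w) * (G' w)\<^sup>2
              + 0 * ?c 0 (snd w) * (G' w)\<^sup>2 + 0 * ?c 0 (snd w) * (G' w)\<^sup>2))"
            using elim w QO[OF w] by (cases w) (simp add: G'_def carl_def power2_eq_square mult_ac)
        qed
      qed
    qed (use s lam in auto)
    note I = I1 I2 I3 I4 I5 I6
    define L where "L = (1 * form (?c 0) ut' ut' + 1 * form (?c 0) U.p U.p + s * lam * form (?c 1) U.q U.q + s\<^sup>2 * lam\<^sup>2 * form (?c 2) u' u')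
      + (1 / s * form ?e Z.p Z.p + 1 / s * form ?e zt' zt') + lam * form (?c 0) Z.q Z.q + s * lam\<^sup>2 * form (?c 1) z' z'"
    define f1 where "f1 = s * form (?c 1) F' F'"
    define g1 where "g1 = form (?c 0) G' G'"
    have fn: "form (?c n) g g \<ge> 0" "form ?e g g \<ge> 0" for n g by (rule form_nonneg[OF cc(3)] form_nonneg[OF cc(4)])+
    have lhs: "?LHS = ennreal L"
      unfolding I L_def using fn s lam by (simp add: ennreal_plus)
    have fg: "f1 \<ge> 0" "g1 \<ge> 0" using fn s by (simp_all add: f1_def g1_def)
    \<comment> \<open>The weight s phi e^(2 s phi) at time T produces an additional factor phi(T) =
      e^(lam T) in front of the norms of u(., T). It is moved into C, which therefore depends on lam
      but not on s.\<close>
    define c0 E0 where "c0 = 2000000 * k^4" and "E0 = exp (lam * T)"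
    have c0: "c0 \<ge> 0" and E0: "E0 \<ge> 1" using k lam T by (auto simp: c0_def E0_def)
    have C_eq: "C = c0 * E0" by (simp add: C c0_def E0_def)
    have "L \<le> c0 * (f1 + g1 + E0 * (s * (s * lam * E0 * \<alpha> + \<beta>)) * exp (2 * s * E0) + s * lam * E0 * aT * exp (2 * s * E0) + (s * lam * a0 + b0) * exp (2 * s))"
      using car by (simp add: L_def f1_def g1_def c0_def E0_def C.J_def C.Jm_def add_divide_distrib)
    also have "\<dots> = c0 * f1 + c0 * g1 + C * s * (s * lam * E0 * \<alpha> + \<beta>) * exp (2 * s * E0) + c0 * (s * lam * E0 * aT * exp (2 * s * E0)) + c0 * ((s * lam * a0 + b0) * exp (2 * s))"
      unfolding C_eq by (simp add: algebra_simps)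
    also have "\<dots> \<le> C * f1 + C * g1 + C * s * (s * lam * E0 * \<alpha> + \<beta>) * exp (2 * s * E0) + C * (s * lam * E0 * aT * exp (2 * s * E0)) + C * ((s * lam * a0 + b0) * exp (2 * s))"
    proof -
      have "c0 \<le> C" unfolding C_eq using c0 E0 by (simp add: mult_le_cancel_left1)
      then show ?thesis using fg nn s lam E0 by (intro add_mono mult_right_mono order_refl) auto
    qed
    finally have bound: "L \<le> C * f1 + C * g1 + C * s * (s * lam * E0 * \<alpha> + \<beta>) * exp (2 * s * E0) + C * (s * lam * E0 * aT) * exp (2 * s * E0) + C * (s * lam * a0 + b0) * exp (2 * s)"
      by (simp add: mult.assoc)
    have "ennreal L \<le> ennreal C * ennreal f1 + ennreal C * ennreal g1 + ennreal (C * s) * (ennreal (s * lam * E0) * ennreal \<alpha> + (ennreal \<alpha> + ennreal \<beta>)) * ennreal (exp (2 * s * E0))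
      + X + ennreal C * (ennreal (s * lam * E0) * ennreal aT + Y) * ennreal (exp (2 * s * E0)) + ennreal C * (ennreal (s * lam) * ennreal a0 + (ennreal a0 + ennreal b0)) * ennreal (exp (2 * s))"
      by (rule combine_terms[OF fg nn(1,2,3,4,5) _ _ _ _ _ _ bound]) (use Cpos s lam E0 in auto)
    then show ?thesis
      unfolding lhs norms using I5 I6 by (simp add: f1_def g1_def E0_def)
  qed
qed

text \<open>The weak product rule holds slice by slice. Borel versions make its exceptional set in Q
  measurable, so that Fubini's theorem passes from slices to Q.\<close>

lemma product_rule_Q:
  assumes a: "a C1_differentiable_on Omega" and m: "m \<in> borel_measurable (lebesgue_on (Q T))"
    and mx: "has_space_deriv T m mx" and amx: "has_space_deriv T (\<lambda>(x, t). a x * m (x, t)) amx"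
  shows "AE w in lborel. w \<in> Q T \<longrightarrow> a (fst w) * mx w = amx w - deriv a (fst w) * m w"
proof -
  obtain m' where m': "version T m m'" using version_exists[OF m] .
  obtain mx' where mx': "version T mx mx'" using version_exists mx unfolding has_space_deriv_def by blast
  obtain amx' where amx': "version T amx amx'" using version_exists amx unfolding has_space_deriv_def by blast
  have [measurable]: "m' \<in> borel_measurable borel" "mx' \<in> borel_measurable borel" "amx' \<in> borel_measurable borel"
    using versionD(1) m' mx' amx' by blast+
  define d where "d x = indicator Omega x * deriv a x" for x
  have [measurable]: "d \<in> borel_measurable borel"
  proof -
    have "continuous_on Omega (deriv a)"
      using a by (auto simp: C1_differentiable_on_eq field_derivative_eq_vector_derivative[abs_def])
    then have "(\<lambda>x. indicator Omega x *\<^sub>R deriv a x) \<in> borel_measurable borel"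
      by (intro borel_measurable_continuous_on_indicator) auto
    then show ?thesis by (simp add: d_def[abs_def])
  qed
  have "AE w in lborel. w \<in> Q T \<longrightarrow> ab (fst w) * mx' w = amx' w - d (fst w) * m' w"
  proof (rule AE_lborel_slicesI)
    have "{w \<in> space borel. w \<in> Q T \<longrightarrow> ab (fst w) * mx' w = amx' w - d (fst w) * m' w} \<in> sets borel"
      by measurable
    then show "{w. w \<in> Q T \<longrightarrow> ab (fst w) * mx' w = amx' w - d (fst w) * m' w} \<in> sets borel" by simp
    have "AE t in lborel. t \<in> {0<..<T} \<longrightarrow> has_weak_deriv Omega (\<lambda>x. m (x, t)) (\<lambda>x. mx (x, t))"
      "AE t in lborel. t \<in> {0<..<T} \<longrightarrow> has_weak_deriv Omega (\<lambda>x. case (x, t) of (x, t) \<Rightarrow> a x * m (x, t)) (\<lambda>x. amx (x, t))"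
      using mx[unfolded has_space_deriv_def, THEN conjunct2] amx[unfolded has_space_deriv_def, THEN conjunct2]
      by (simp_all add: AE_lebesgue_on_iff)
    then show "AE t in lborel. AE x in lborel. (x, t) \<in> Q T \<longrightarrow> ab (fst (x, t)) * mx' (x, t) = amx' (x, t) - d (fst (x, t)) * m' (x, t)"
      using version_slices[OF m'] version_slices[OF mx'] version_slices[OF amx']
    proof eventually_elim
      case (elim t)
      show ?case
      proof (cases "t \<in> {0<..<T}")
        case True
        have "AE x in lebesgue. x \<in> Omega \<longrightarrow> a x * mx (x, t) = amx (x, t) - deriv a x * m (x, t)"
          using elim(1,2) True by (intro weak_product_rule[OF a]) auto
        moreover have "AE x in lebesgue. x \<in> Omega \<longrightarrow> m (x, t) = m' (x, t)" "AE x in lebesgue. x \<in> Omega \<longrightarrow> mx (x, t) = mx' (x, t)"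
          "AE x in lebesgue. x \<in> Omega \<longrightarrow> amx (x, t) = amx' (x, t)" using elim(3-5) True by auto
        ultimately have "AE x in lebesgue. (x, t) \<in> Q T \<longrightarrow> ab (fst (x, t)) * mx' (x, t) = amx' (x, t) - d (fst (x, t)) * m' (x, t)"
          by eventually_elim (auto simp: ab_simps d_def)
        then show ?thesis by (simp only: AE_completion_iff)
      next
        case False
        then have "(x, t) \<notin> Q T" for x by auto
        then show ?thesis by (intro always_eventually) blast
      qed
    qed
  qed
  then show ?thesis
    using versionD(3)[OF m'] versionD(3)[OF mx'] versionD(3)[OF amx']
  proof eventually_elim
    case (elim w)
    show ?case
    proof
      assume w: "w \<in> Q T"
      then have "fst w \<in> Omega" by auto
      then show "a (fst w) * mx w = amx w - deriv a (fst w) * m w"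
        using elim w by (simp add: ab_simps d_def)
    qed
  qed
qed

end

section \<open>The couplings in terms of a m, and the choice of the constants\<close>

theorem lemma2p7:
  fixes T K :: real
    and a :: "real \<Rightarrow> real"
    and b c\<^sub>1 c\<^sub>2 d\<^sub>1 d\<^sub>2 \<rho> :: "real \<times> real \<Rightarrow> real"
  assumes T: "T > 0"
    and a_cont: "continuous_on {0..1} a"
    and a_C1: "a C1_differentiable_on {0<..<1}"
    and a_pos: "\<And>x. x \<in> {0<..<1} \<Longrightarrow> a x > 0"
    and a_ends: "a 0 = 0" "a 1 = 0"
    and Linf: "b \<in> L_infty T" "c\<^sub>2 \<in> L_infty T" "\<rho> \<in> L_infty T"
    and meas: "d\<^sub>1 \<in> borel_measurable (lebesgue_on (Q T))"
      "d\<^sub>2 \<in> borel_measurable (lebesgue_on (Q T))"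
      "c\<^sub>1 \<in> borel_measurable (lebesgue_on (Q T))"
    and K: "K > 0"
    and d1_bound: "\<And>x t. (x, t) \<in> Q T \<Longrightarrow> \<bar>d\<^sub>1 (x, t)\<bar> \<le> K * sqrt (a x)"
    and c1_bound: "\<And>x t. (x, t) \<in> Q T \<Longrightarrow> \<bar>c\<^sub>1 (x, t)\<bar> \<le> K * sqrt (a x)"
    and a_deriv_bound: "\<And>x. x \<in> {0<..<1} \<Longrightarrow> \<bar>deriv a x\<bar> \<le> K * sqrt (a x)"
    and d2_bound: "\<And>x t. (x, t) \<in> Q T \<Longrightarrow> \<bar>d\<^sub>2 (x, t)\<bar> \<le> K * a x"
  shows "\<exists>lam\<^sub>0>0. \<forall>lam>lam\<^sub>0. \<exists>s\<^sub>0>0. \<exists>C>0. \<forall>s\<ge>s\<^sub>0.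
    \<forall>u u\<^sub>t u\<^sub>x u\<^sub>x\<^sub>x m m\<^sub>t m\<^sub>x am\<^sub>x am\<^sub>x\<^sub>x F G :: real \<times> real \<Rightarrow> real.
    \<forall>u\<^sub>0 h m\<^sub>0 m\<^sub>T :: real \<Rightarrow> real.
    let \<phi> = (\<lambda>t::real. exp (lam * t)) in
      u \<in> Bochner_H1 T (L2_inv a) (nsq_inv a) \<inter> Bochner_L2 T (H2_inv a) (nsq2_inv a) \<longrightarrow>
      m \<in> Bochner_H1 T (L2_wt a) (nsq_wt a) \<inter> Bochner_L2 T (H2_wt a) (nsq2_wt a) \<longrightarrow>
      u\<^sub>t \<in> Bochner_L2 T (L2_inv a) (nsq_inv a) \<and> has_time_deriv T u u\<^sub>t \<longrightarrow>
      has_space_deriv T u u\<^sub>x \<and> has_space_deriv T u\<^sub>x u\<^sub>x\<^sub>x \<longrightarrow>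
      m\<^sub>t \<in> Bochner_L2 T (L2_wt a) (nsq_wt a) \<and> has_time_deriv T m m\<^sub>t \<longrightarrow>
      has_space_deriv T m m\<^sub>x \<longrightarrow>
      has_space_deriv T (\<lambda>(x, t). a x * m (x, t)) am\<^sub>x \<and> has_space_deriv T am\<^sub>x am\<^sub>x\<^sub>x \<longrightarrow>
      (AE (x, t) in lebesgue_on (Q T).
         u\<^sub>t (x, t) + a x * u\<^sub>x\<^sub>x (x, t) + d\<^sub>1 (x, t) * u\<^sub>x (x, t) = d\<^sub>2 (x, t) * m (x, t) + F (x, t)) \<longrightarrow>
      (AE (x, t) in lebesgue_on (Q T).
         m\<^sub>t (x, t) - am\<^sub>x\<^sub>x (x, t) + c\<^sub>1 (x, t) * m\<^sub>x (x, t) =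
         b (x, t) * m (x, t) + c\<^sub>2 (x, t) * u\<^sub>x (x, t) + \<rho> (x, t) * u\<^sub>x\<^sub>x (x, t) + G (x, t)) \<longrightarrow>
      (AE t in lebesgue_on {0<..<T}.
         vanishes_at_ends (\<lambda>x. u (x, t)) \<and> vanishes_at_ends (\<lambda>x. a x * m (x, t))) \<longrightarrow>
      has_time_value T (L2_wt a) (nsq_wt a) m 0 m\<^sub>0 \<longrightarrow>
      has_time_value T (L2_inv a) (nsq_inv a) u T h \<longrightarrow>
      has_time_value T (L2_inv a) (nsq_inv a) u 0 u\<^sub>0 \<longrightarrow>
      has_time_value T (L2_wt a) (nsq_wt a) m T m\<^sub>T \<longrightarrow>
      (\<integral>\<^sup>+(x, t). ennreal (
           ((u\<^sub>t (x, t))\<^sup>2 / a x + a x * (u\<^sub>x\<^sub>x (x, t))\<^sup>2 + s * lam * \<phi> t * (u\<^sub>x (x, t))\<^sup>2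
            + s\<^sup>2 * lam\<^sup>2 * (\<phi> t)\<^sup>2 / a x * (u (x, t))\<^sup>2) * exp (2 * s * \<phi> t)) \<partial>lebesgue_on (Q T))
      + (\<integral>\<^sup>+(x, t). ennreal (
           1 / (s * \<phi> t) * (a x * (am\<^sub>x\<^sub>x (x, t))\<^sup>2 + a x * (m\<^sub>t (x, t))\<^sup>2) * exp (2 * s * \<phi> t))
           \<partial>lebesgue_on (Q T))
      + (\<integral>\<^sup>+(x, t). ennreal (lam * (am\<^sub>x (x, t))\<^sup>2 * exp (2 * s * \<phi> t)) \<partial>lebesgue_on (Q T))
      + (\<integral>\<^sup>+(x, t). ennreal (s * lam\<^sup>2 * \<phi> t * a x * (m (x, t))\<^sup>2 * exp (2 * s * \<phi> t))
           \<partial>lebesgue_on (Q T))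
      \<le> ennreal C * (\<integral>\<^sup>+(x, t). ennreal (s * \<phi> t * (1 / a x) * (F (x, t))\<^sup>2 * exp (2 * s * \<phi> t))
                        \<partial>lebesgue_on (Q T))
      + ennreal C * (\<integral>\<^sup>+(x, t). ennreal (a x * (G (x, t))\<^sup>2 * exp (2 * s * \<phi> t)) \<partial>lebesgue_on (Q T))
      + ennreal (C * s) * (ennreal (s * lam * \<phi> T) * nsq_inv a h + nsq1_inv a h)
          * ennreal (exp (2 * s * \<phi> T))
      + ennreal (C * s) * (ennreal (s * lam) * nsq_inv a u\<^sub>0 + nsq1_inv a u\<^sub>0) * ennreal (exp (2 * s))
      + ennreal C * (ennreal (s * lam * \<phi> T) * nsq_wt a m\<^sub>T + nsq1_wt a m\<^sub>T)
          * ennreal (exp (2 * s * \<phi> T))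
      + ennreal C * (ennreal (s * lam) * nsq_wt a m\<^sub>0 + nsq1_wt a m\<^sub>0) * ennreal (exp (2 * s))"
proof -
  interpret degenerate a T by (rule degenerate.intro[OF T a_cont a_pos])
  obtain A where A: "\<And>x. x \<in> Omega \<Longrightarrow> a x \<le> A"
  proof -
    have "compact (a ` {0..1})" by (rule compact_continuous_image[OF a_cont]) simp
    then have "bounded (a ` {0..1})" by (rule compact_imp_bounded)
    then obtain B where B: "\<forall>y\<in>a ` {0..1}. norm y \<le> B" unfolding bounded_iff by blast
    have "a x \<le> B" if "x \<in> Omega" for x
      using B that by (auto simp: abs_le_iff dest!: bspec[of _ _ x])
    then show thesis by (rule that)
  qed
  have A0: "A \<ge> 0" using A[of "1/2"] a_pos[of "1/2"] by simp
  obtain Bb Bc Br where ae: "AE w in lebesgue_on (Q T). \<bar>b w\<bar> \<le> Bb" "AE w in lebesgue_on (Q T). \<bar>c\<^sub>2 w\<bar> \<le> Bc"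
      "AE w in lebesgue_on (Q T). \<bar>\<rho> w\<bar> \<le> Br"
    and cm [measurable]: "b \<in> borel_measurable (lebesgue_on (Q T))" "c\<^sub>2 \<in> borel_measurable (lebesgue_on (Q T))"
      "\<rho> \<in> borel_measurable (lebesgue_on (Q T))"
    using Linf unfolding L_infty_def by blast
  note [measurable] = meas
  have coef: "AE w in lborel. w \<in> Q T \<longrightarrow> \<bar>b w\<bar> \<le> \<bar>Bb\<bar> \<and> \<bar>c\<^sub>2 w\<bar> \<le> \<bar>Bc\<bar> \<and> \<bar>\<rho> w\<bar> \<le> \<bar>Br\<bar>"
    using ae[unfolded AE_lebesgue_on_iff[OF Q_lebesgue]] by eventually_elim auto
  \<comment> \<open>One constant for all couplings: K serves \<open>d\<^sub>1\<close>,
    \<open>d\<^sub>2\<close> and \<open>c\<^sub>1\<close>; K^2 is the product of the bounds for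
    \<open>c\<^sub>1\<close> and a_x, which meet through the product rule; sqrt A appears because a
    = sqrt(a) sqrt(a) is bounded by sqrt(A) sqrt(a) in the term with \<open>c\<^sub>2\<close>. The
    summand 1 ensures k >= 1.\<close>
  define k where "k = 1 + K + K\<^sup>2 + \<bar>Bb\<bar> + \<bar>Bc\<bar> * sqrt A + \<bar>Br\<bar>"
  have k: "k \<ge> 1" "K \<le> k" "\<bar>Bb\<bar> + K\<^sup>2 \<le> k" "\<bar>Bc\<bar> * sqrt A \<le> k" "\<bar>Br\<bar> \<le> k"
    using K A0 by (auto simp: k_def)
  have a_meas [measurable]: "(\<lambda>w. a (fst w)) \<in> borel_measurable (lebesgue_on (Q T))"
  proof (rule measurable_cong_AE_lebesgue_on[OF _ _ Q_lebesgue])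
    have "(\<lambda>w::real \<times> real. ab (fst w)) \<in> borel_measurable borel" by measurable
    then show "(\<lambda>w. ab (fst w)) \<in> borel_measurable (lebesgue_on (Q T))"
      by (intro measurable_restrict_space1 measurable_completion) simp
    show "AE w in lborel. w \<in> Q T \<longrightarrow> ab (fst w) = a (fst w)"
      by (intro always_eventually) (auto simp: ab_simps)
  qed
  show ?thesis
    unfolding Let_def
  proof (rule exI[of _ "6000 * k^4"], intro conjI allI impI)
    show "6000 * k^4 > 0" using k(1) by simp
    fix lam :: real assume lam: "lam > 6000 * k^4"
    show "\<exists>s\<^sub>0>0. \<exists>C>0. \<forall>s\<ge>s\<^sub>0.
    \<forall>u u\<^sub>t u\<^sub>x u\<^sub>x\<^sub>x m m\<^sub>t m\<^sub>x am\<^sub>x am\<^sub>x\<^sub>x F G :: real \<times> real \<Rightarrow> real.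
    \<forall>u\<^sub>0 h m\<^sub>0 m\<^sub>T :: real \<Rightarrow> real.
      u \<in> Bochner_H1 T (L2_inv a) (nsq_inv a) \<inter> Bochner_L2 T (H2_inv a) (nsq2_inv a) \<longrightarrow>
      m \<in> Bochner_H1 T (L2_wt a) (nsq_wt a) \<inter> Bochner_L2 T (H2_wt a) (nsq2_wt a) \<longrightarrow>
      u\<^sub>t \<in> Bochner_L2 T (L2_inv a) (nsq_inv a) \<and> has_time_deriv T u u\<^sub>t \<longrightarrow>
      has_space_deriv T u u\<^sub>x \<and> has_space_deriv T u\<^sub>x u\<^sub>x\<^sub>x \<longrightarrow>
      m\<^sub>t \<in> Bochner_L2 T (L2_wt a) (nsq_wt a) \<and> has_time_deriv T m m\<^sub>t \<longrightarrow>
      has_space_deriv T m m\<^sub>x \<longrightarrow>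
      has_space_deriv T (\<lambda>(x, t). a x * m (x, t)) am\<^sub>x \<and> has_space_deriv T am\<^sub>x am\<^sub>x\<^sub>x \<longrightarrow>
      (AE (x, t) in lebesgue_on (Q T).
         u\<^sub>t (x, t) + a x * u\<^sub>x\<^sub>x (x, t) + d\<^sub>1 (x, t) * u\<^sub>x (x, t) = d\<^sub>2 (x, t) * m (x, t) + F (x, t)) \<longrightarrow>
      (AE (x, t) in lebesgue_on (Q T).
         m\<^sub>t (x, t) - am\<^sub>x\<^sub>x (x, t) + c\<^sub>1 (x, t) * m\<^sub>x (x, t) =
         b (x, t) * m (x, t) + c\<^sub>2 (x, t) * u\<^sub>x (x, t) + \<rho> (x, t) * u\<^sub>x\<^sub>x (x, t) + G (x, t)) \<longrightarrow>
      (AE t in lebesgue_on {0<..<T}.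
         vanishes_at_ends (\<lambda>x. u (x, t)) \<and> vanishes_at_ends (\<lambda>x. a x * m (x, t))) \<longrightarrow>
      has_time_value T (L2_wt a) (nsq_wt a) m 0 m\<^sub>0 \<longrightarrow>
      has_time_value T (L2_inv a) (nsq_inv a) u T h \<longrightarrow>
      has_time_value T (L2_inv a) (nsq_inv a) u 0 u\<^sub>0 \<longrightarrow>
      has_time_value T (L2_wt a) (nsq_wt a) m T m\<^sub>T \<longrightarrow>
      (\<integral>\<^sup>+(x, t). ennreal (
           ((u\<^sub>t (x, t))\<^sup>2 / a x + a x * (u\<^sub>x\<^sub>x (x, t))\<^sup>2 + s * lam * exp (lam * t) * (u\<^sub>x (x, t))\<^sup>2
            + s\<^sup>2 * lam\<^sup>2 * (exp (lam * t))\<^sup>2 / a x * (u (x, t))\<^sup>2) * exp (2 * s * exp (lam * t))) \<partial>lebesgue_on (Q T))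
      + (\<integral>\<^sup>+(x, t). ennreal (
           1 / (s * exp (lam * t)) * (a x * (am\<^sub>x\<^sub>x (x, t))\<^sup>2 + a x * (m\<^sub>t (x, t))\<^sup>2) * exp (2 * s * exp (lam * t)))
           \<partial>lebesgue_on (Q T))
      + (\<integral>\<^sup>+(x, t). ennreal (lam * (am\<^sub>x (x, t))\<^sup>2 * exp (2 * s * exp (lam * t))) \<partial>lebesgue_on (Q T))
      + (\<integral>\<^sup>+(x, t). ennreal (s * lam\<^sup>2 * exp (lam * t) * a x * (m (x, t))\<^sup>2 * exp (2 * s * exp (lam * t)))
           \<partial>lebesgue_on (Q T))
      \<le> ennreal C * (\<integral>\<^sup>+(x, t). ennreal (s * exp (lam * t) * (1 / a x) * (F (x, t))\<^sup>2 * exp (2 * s * exp (lam * t)))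
                        \<partial>lebesgue_on (Q T))
      + ennreal C * (\<integral>\<^sup>+(x, t). ennreal (a x * (G (x, t))\<^sup>2 * exp (2 * s * exp (lam * t))) \<partial>lebesgue_on (Q T))
      + ennreal (C * s) * (ennreal (s * lam * exp (lam * T)) * nsq_inv a h + nsq1_inv a h)
          * ennreal (exp (2 * s * exp (lam * T)))
      + ennreal (C * s) * (ennreal (s * lam) * nsq_inv a u\<^sub>0 + nsq1_inv a u\<^sub>0) * ennreal (exp (2 * s))
      + ennreal C * (ennreal (s * lam * exp (lam * T)) * nsq_wt a m\<^sub>T + nsq1_wt a m\<^sub>T)
          * ennreal (exp (2 * s * exp (lam * T)))
      + ennreal C * (ennreal (s * lam) * nsq_wt a m\<^sub>0 + nsq1_wt a m\<^sub>0) * ennreal (exp (2 * s))"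
    \<comment> \<open>The threshold s >= 1 works for every lam, and only C depends on lam.\<close>
    proof (rule exI[of _ 1], rule conjI, simp, rule exI[of _ "2000000 * k^4 * exp (lam * T)"], intro conjI allI impI, goal_cases)
      case (2 s u u\<^sub>t u\<^sub>x u\<^sub>x\<^sub>x m m\<^sub>t m\<^sub>x am\<^sub>x am\<^sub>x\<^sub>x F G u\<^sub>0 h m\<^sub>0 m\<^sub>T)
      have u_m [measurable]: "u \<in> borel_measurable (lebesgue_on (Q T))" "u\<^sub>t \<in> borel_measurable (lebesgue_on (Q T))"
        "m \<in> borel_measurable (lebesgue_on (Q T))" "m\<^sub>t \<in> borel_measurable (lebesgue_on (Q T))"
        "u\<^sub>x \<in> borel_measurable (lebesgue_on (Q T))" "u\<^sub>x\<^sub>x \<in> borel_measurable (lebesgue_on (Q T))"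
        "m\<^sub>x \<in> borel_measurable (lebesgue_on (Q T))" "am\<^sub>x \<in> borel_measurable (lebesgue_on (Q T))"
        "am\<^sub>x\<^sub>x \<in> borel_measurable (lebesgue_on (Q T))"
        using 2 by (auto simp: has_space_deriv_def Bochner_H1_def Bochner_L2_def)
      have uB: "u \<in> Bochner_L2 T (L2_inv a) (nsq_inv a)" "u \<in> Bochner_L2 T (H2_inv a) (nsq2_inv a)"
        "m \<in> Bochner_L2 T (L2_wt a) (nsq_wt a)" "m \<in> Bochner_L2 T (H2_wt a) (nsq2_wt a)"
        using 2(2,3) by (auto simp: Bochner_H1_def)
      have eq_u: "AE w in lborel. w \<in> Q T \<longrightarrow> u\<^sub>t w + a (fst w) * u\<^sub>x\<^sub>x w + d\<^sub>1 w * u\<^sub>x w = d\<^sub>2 w * m w + F w"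
        using 2(9)[unfolded AE_lebesgue_on_iff[OF Q_lebesgue]] by eventually_elim auto
      have eq_m: "AE w in lborel. w \<in> Q T \<longrightarrow> m\<^sub>t w - am\<^sub>x\<^sub>x w + c\<^sub>1 w * m\<^sub>x w = b w * m w + c\<^sub>2 w * u\<^sub>x w + \<rho> w * u\<^sub>x\<^sub>x w + G w"
        using 2(10)[unfolded AE_lebesgue_on_iff[OF Q_lebesgue]] by eventually_elim auto
      have prod: "AE w in lborel. w \<in> Q T \<longrightarrow> a (fst w) * m\<^sub>x w = am\<^sub>x w - deriv a (fst w) * m w"
        by (rule product_rule_Q[OF a_C1 u_m(3) 2(7) 2(8)[THEN conjunct1]])
      \<comment> \<open>Measurability of F is read off the equation, and likewise for G.\<close>
      have F: "F \<in> borel_measurable (lebesgue_on (Q T))"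
      proof (rule measurable_cong_AE_lebesgue_on[OF _ _ Q_lebesgue])
        show "(\<lambda>w. u\<^sub>t w + a (fst w) * u\<^sub>x\<^sub>x w + d\<^sub>1 w * u\<^sub>x w - d\<^sub>2 w * m w) \<in> borel_measurable (lebesgue_on (Q T))"
          by measurable
        show "AE w in lborel. w \<in> Q T \<longrightarrow> u\<^sub>t w + a (fst w) * u\<^sub>x\<^sub>x w + d\<^sub>1 w * u\<^sub>x w - d\<^sub>2 w * m w = F w"
          using eq_u by eventually_elim linarith
      qed
      have G: "G \<in> borel_measurable (lebesgue_on (Q T))"
      proof (rule measurable_cong_AE_lebesgue_on[OF _ _ Q_lebesgue])
        show "(\<lambda>w. m\<^sub>t w - am\<^sub>x\<^sub>x w + c\<^sub>1 w * m\<^sub>x w - b w * m w - c\<^sub>2 w * u\<^sub>x w - \<rho> w * u\<^sub>x\<^sub>x w) \<in> borel_measurable (lebesgue_on (Q T))"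
          by measurable
        show "AE w in lborel. w \<in> Q T \<longrightarrow> m\<^sub>t w - am\<^sub>x\<^sub>x w + c\<^sub>1 w * m\<^sub>x w - b w * m w - c\<^sub>2 w * u\<^sub>x w - \<rho> w * u\<^sub>x\<^sub>x w = G w"
          using eq_m by eventually_elim linarith
      qed
      have le_u: "AE w in lborel. w \<in> Q T \<longrightarrow> \<bar>u\<^sub>t w + a (fst w) * u\<^sub>x\<^sub>x w - F w\<bar> \<le>
          k * (sqrt (a (fst w)) * \<bar>u\<^sub>x w\<bar> + a (fst w) * \<bar>m w\<bar>)"
        using eq_u
      proof eventually_elim
        case (elim w)
        show ?case
        proof
          assume w: "w \<in> Q T"
          obtain x t where xt: "w = (x, t)" by (cases w)
          have x: "x \<in> Omega" using w xt by auto
          have "u\<^sub>t w + a x * u\<^sub>x\<^sub>x w - F w = d\<^sub>2 w * m w - d\<^sub>1 w * u\<^sub>x w" using elim w xt by simp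
          then have "\<bar>u\<^sub>t w + a x * u\<^sub>x\<^sub>x w - F w\<bar> \<le> \<bar>d\<^sub>2 w\<bar> * \<bar>m w\<bar> + \<bar>d\<^sub>1 w\<bar> * \<bar>u\<^sub>x w\<bar>"
            using abs_triangle_ineq4[of "d\<^sub>2 w * m w" "d\<^sub>1 w * u\<^sub>x w"] by (simp add: abs_mult)
          also have "\<dots> \<le> (k * a x) * \<bar>m w\<bar> + (k * sqrt (a x)) * \<bar>u\<^sub>x w\<bar>"
          proof (intro add_mono mult_right_mono abs_ge_zero)
            show "\<bar>d\<^sub>2 w\<bar> \<le> k * a x"
              using order_trans[OF d2_bound mult_right_mono[OF k(2) less_imp_le[OF a_pos[OF x]]], of t] w xt by simp
            show "\<bar>d\<^sub>1 w\<bar> \<le> k * sqrt (a x)"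
              using order_trans[OF d1_bound mult_right_mono[OF k(2) real_sqrt_ge_zero[OF less_imp_le[OF a_pos[OF x]]]], of t] w xt by simp
          qed
          finally show "\<bar>u\<^sub>t w + a (fst w) * u\<^sub>x\<^sub>x w - F w\<bar> \<le> k * (sqrt (a (fst w)) * \<bar>u\<^sub>x w\<bar> + a (fst w) * \<bar>m w\<bar>)"
            by (simp add: xt algebra_simps)
        qed
      qed
      have le_m: "AE w in lborel. w \<in> Q T \<longrightarrow> \<bar>a (fst w) * m\<^sub>t w - a (fst w) * am\<^sub>x\<^sub>x w - a (fst w) * G w\<bar> \<le>
          k * (sqrt (a (fst w)) * \<bar>am\<^sub>x w\<bar> + a (fst w) * \<bar>m w\<bar> + sqrt (a (fst w)) * \<bar>u\<^sub>x w\<bar> + a (fst w) * \<bar>u\<^sub>x\<^sub>x w\<bar>)"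
        using eq_m prod coef
      proof eventually_elim
        case (elim w)
        show ?case
        proof
          assume w: "w \<in> Q T"
          obtain x t where xt: "w = (x, t)" by (cases w)
          have x: "x \<in> Omega" using w xt by auto
          have ax: "a x > 0" "sqrt (a x) \<ge> 0" "sqrt (a x) * sqrt (a x) = a x" "sqrt (a x) \<le> sqrt A" using a_pos[OF x] A[OF x] by auto
          have co: "\<bar>b w\<bar> \<le> \<bar>Bb\<bar>" "\<bar>c\<^sub>2 w\<bar> \<le> \<bar>Bc\<bar>" "\<bar>\<rho> w\<bar> \<le> \<bar>Br\<bar>" using elim w by auto
          have c1: "\<bar>c\<^sub>1 w\<bar> \<le> K * sqrt (a x)" using c1_bound[of x t] w xt by simp
          have G_eq: "G w = m\<^sub>t w - am\<^sub>x\<^sub>x w + c\<^sub>1 w * m\<^sub>x w - b w * m w - c\<^sub>2 w * u\<^sub>x w - \<rho> w * u\<^sub>x\<^sub>x w" using elim w by simp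
          have "a x * m\<^sub>t w - a x * am\<^sub>x\<^sub>x w - a x * G w = a x * (b w * m w) + a x * (c\<^sub>2 w * u\<^sub>x w) + a x * (\<rho> w * u\<^sub>x\<^sub>x w) - c\<^sub>1 w * (a x * m\<^sub>x w)"
            unfolding G_eq by (simp add: algebra_simps)
          \<comment> \<open>The drift term contains \<open>m\<^sub>x\<close>, which the estimate
            does not control. Multiplied by a it becomes (a m)_x - a_x m, and the bound for a_x
            supplies the second sqrt(a) that the m-term needs.\<close>
          also have "a x * m\<^sub>x w = am\<^sub>x w - deriv a x * m w" using elim w xt by simp
          finally have "\<bar>a x * m\<^sub>t w - a x * am\<^sub>x\<^sub>x w - a x * G w\<bar>
              = \<bar>a x * (b w * m w) + a x * (c\<^sub>2 w * u\<^sub>x w) + a x * (\<rho> w * u\<^sub>x\<^sub>x w) - c\<^sub>1 w * am\<^sub>x w + (c\<^sub>1 w * deriv a x) * m w\<bar>"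
            by (simp add: algebra_simps)
          also have "\<dots> \<le> \<bar>a x * (b w * m w)\<bar> + \<bar>a x * (c\<^sub>2 w * u\<^sub>x w)\<bar> + \<bar>a x * (\<rho> w * u\<^sub>x\<^sub>x w)\<bar> + \<bar>c\<^sub>1 w * am\<^sub>x w\<bar> + \<bar>(c\<^sub>1 w * deriv a x) * m w\<bar>"
            by linarith
          also have "\<dots> \<le> (\<bar>Bb\<bar> * a x) * \<bar>m w\<bar> + (k * sqrt (a x)) * \<bar>u\<^sub>x w\<bar> + (k * a x) * \<bar>u\<^sub>x\<^sub>x w\<bar> + (k * sqrt (a x)) * \<bar>am\<^sub>x w\<bar> + (K\<^sup>2 * a x) * \<bar>m w\<bar>"
          proof (intro add_mono)
            show "\<bar>a x * (b w * m w)\<bar> \<le> (\<bar>Bb\<bar> * a x) * \<bar>m w\<bar>"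
            proof -
              have "\<bar>a x * (b w * m w)\<bar> = (\<bar>b w\<bar> * a x) * \<bar>m w\<bar>" using ax by (simp add: abs_mult mult_ac)
              also have "\<dots> \<le> (\<bar>Bb\<bar> * a x) * \<bar>m w\<bar>" using ax by (intro mult_right_mono co) auto
              finally show ?thesis .
            qed
            have "\<bar>c\<^sub>2 w\<bar> * a x \<le> \<bar>Bc\<bar> * (sqrt A * sqrt (a x))"
              using mult_mono[OF co(2) mult_right_mono[OF ax(4,2)] abs_ge_zero mult_nonneg_nonneg[OF ax(2,2)]] unfolding ax(3) .
            also have "\<dots> \<le> k * sqrt (a x)" using mult_right_mono[OF k(4) ax(2)] by (simp only: mult.assoc)
            finally show "\<bar>a x * (c\<^sub>2 w * u\<^sub>x w)\<bar> \<le> (k * sqrt (a x)) * \<bar>u\<^sub>x w\<bar>"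
            proof -
              assume le: "\<bar>c\<^sub>2 w\<bar> * a x \<le> k * sqrt (a x)"
              have "\<bar>a x * (c\<^sub>2 w * u\<^sub>x w)\<bar> = (\<bar>c\<^sub>2 w\<bar> * a x) * \<bar>u\<^sub>x w\<bar>" using ax by (simp add: abs_mult mult_ac)
              also have "\<dots> \<le> (k * sqrt (a x)) * \<bar>u\<^sub>x w\<bar>" by (rule mult_right_mono[OF le]) simp
              finally show ?thesis .
            qed
            have "\<bar>\<rho> w\<bar> * a x \<le> k * a x" using co(3) k(5) ax by (intro mult_right_mono) auto
            then show "\<bar>a x * (\<rho> w * u\<^sub>x\<^sub>x w)\<bar> \<le> (k * a x) * \<bar>u\<^sub>x\<^sub>x w\<bar>"
            proof -
              assume le: "\<bar>\<rho> w\<bar> * a x \<le> k * a x"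
              have "\<bar>a x * (\<rho> w * u\<^sub>x\<^sub>x w)\<bar> = (\<bar>\<rho> w\<bar> * a x) * \<bar>u\<^sub>x\<^sub>x w\<bar>" using ax by (simp add: abs_mult mult_ac)
              also have "\<dots> \<le> (k * a x) * \<bar>u\<^sub>x\<^sub>x w\<bar>" by (rule mult_right_mono[OF le]) simp
              finally show ?thesis .
            qed
            have "\<bar>c\<^sub>1 w\<bar> \<le> k * sqrt (a x)" using order_trans[OF c1 mult_right_mono[OF k(2) ax(2)]] .
            then show "\<bar>c\<^sub>1 w * am\<^sub>x w\<bar> \<le> (k * sqrt (a x)) * \<bar>am\<^sub>x w\<bar>"
              unfolding abs_mult by (rule mult_right_mono) simp
            have "\<bar>c\<^sub>1 w\<bar> * \<bar>deriv a x\<bar> \<le> (K * sqrt (a x)) * (K * sqrt (a x))"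
              using c1 a_deriv_bound[OF x] K ax by (intro mult_mono) auto
            also have "\<dots> = K\<^sup>2 * (sqrt (a x) * sqrt (a x))" by (simp only: power2_eq_square mult_ac)
            finally have "\<bar>c\<^sub>1 w\<bar> * \<bar>deriv a x\<bar> \<le> K\<^sup>2 * a x" unfolding ax(3) .
            then show "\<bar>(c\<^sub>1 w * deriv a x) * m w\<bar> \<le> (K\<^sup>2 * a x) * \<bar>m w\<bar>"
              unfolding abs_mult by (rule mult_right_mono) simp
          qed
          also have "\<dots> = ((\<bar>Bb\<bar> + K\<^sup>2) * (a x * \<bar>m w\<bar>)) + k * (sqrt (a x) * \<bar>am\<^sub>x w\<bar> + sqrt (a x) * \<bar>u\<^sub>x w\<bar> + a x * \<bar>u\<^sub>x\<^sub>x w\<bar>)"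
            by (simp only: distrib_left distrib_right mult_ac add_ac)
          also have "\<dots> \<le> k * (a x * \<bar>m w\<bar>) + k * (sqrt (a x) * \<bar>am\<^sub>x w\<bar> + sqrt (a x) * \<bar>u\<^sub>x w\<bar> + a x * \<bar>u\<^sub>x\<^sub>x w\<bar>)"
            by (intro add_right_mono mult_right_mono k(3)) (use ax in auto)
          finally show "\<bar>a (fst w) * m\<^sub>t w - a (fst w) * am\<^sub>x\<^sub>x w - a (fst w) * G w\<bar> \<le>
              k * (sqrt (a (fst w)) * \<bar>am\<^sub>x w\<bar> + a (fst w) * \<bar>m w\<bar> + sqrt (a (fst w)) * \<bar>u\<^sub>x w\<bar> + a (fst w) * \<bar>u\<^sub>x\<^sub>x w\<bar>)"
            by (simp add: xt distrib_left add_ac)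
        qed
      qed
      show ?case
        by (rule estimate[OF k(1) less_imp_le[OF lam] 2(1) uB(1,2) 2(4)[THEN conjunct1] 2(4)[THEN conjunct2]
          2(5)[THEN conjunct1] 2(5)[THEN conjunct2] uB(3,4) 2(6)[THEN conjunct1] 2(6)[THEN conjunct2]
          2(8)[THEN conjunct1] 2(8)[THEN conjunct2] F G le_u le_m 2(11) 2(12) 2(13) 2(15) refl])
    qed (use k(1) in auto)
  qed
qed

end
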